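(* Let $\mathcal{A}$ be a length category. Then $\mathcal{A}$ is equivalent to the category of pointwise finite dimensional $\mathbb{K}$-linear representations of some poset $P$ together with some family of division rings $\mathbb{K}=(K_x,\kappa_{xy})_{x,y\in P}$ if and only if there is an object $M\in\mathcal{A}$ satisfying the following conditions: (M1) The ext-quiver of $\mathcal{A}$ has no oriented cycle. (M2) The lattice of subobjects of $M$ is distributive and each object of $\mathcal{A}$ is a subquotient of a finite direct sum of copies of $M$. (M3) For each join-irreducible subobject $N\subseteq M$ the canonical map $\operatorname{End}(N)\to\operatorname{End}(N/\operatorname{rad}N)$ is surjective. In this case the poset is given by the set $(M_x)_{x\in\Omega}$ of join-irreducible subobjects of $M$, where $x\le y$ if there is an inclusion $i_{xy}\colon M_x\to M_y$ (of subobjects of $M$). For $x\in\Omega$ the division ring is $K_x=\operatorname{End}(M_x)$, and for $x\le y$ the homomorphism $\kappa_{xy}\colon K_y\to K_x$ is given by $i_{xy}\,\kappa_{xy}(\alpha)=\alpha\, i_{xy}$ for $\alpha\in K_y$.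
   Context: A length category is an abelian category such that any chain of subobjects of a given object is finite and the isomorphism classes of objects form a set. The ext-quiver of $\mathcal{A}$ has as vertices the isomorphism classes $[S]$ of simple objects, and there is an arrow $[S]\to[T]$ if $\operatorname{Ext}^1(T,S)\neq 0$. Loops count as oriented cycles. A subobject $N\subseteq M$ is join-irreducible if $N\neq 0$ and $N=N_1+N_2$ implies $N=N_1$ or $N=N_2$. The radical $\operatorname{rad}N$ is the intersection of all maximal subobjects of $N$; each endomorphism of $N$ preserves it, which gives the canonical map $\operatorname{End}(N)\to\operatorname{End}(N/\operatorname{rad}N)$. Let $P$ be a poset. A family of division rings on $P$ is $\mathbb{K}=(K_x,\kappa_{xy})_{x,y\in P}$ consisting of division rings $K_x$ ($x\in P$) with ring homomorphisms $\kappa_{xy}\colon K_y\to K_x$ for $x\le y$ such that $\kappa_{xy}\kappa_{yz}=\kappa_{xz}$ for all $x\le y\le z$. A $\mathbb{K}$-linear representation of $P$ is given by (right) vector spaces $M(x)$ over $K_x$ for $x\in P$ and $K_y$-linear maps $M(y)\to\kappa_{xy}^*M(x)$ for $x\le y$, where $\kappa_{xy}^*$ denotes restriction of scalars along $\kappa_{xy}$, that are compatible: for $x\le y\le z$ the map $M(z)\to M(x)$ equals the composite $M(z)\to M(y)\to M(x)$, and the map for $x=y$ is the identity. It is pointwise finite dimensional if each $M(x)$ is finite dimensional over $K_x$. Morphisms of representations are families of $K_x$-linear maps commuting with the structure maps. *)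

theory Defs
  imports "HOL-Algebra.Lattice" "HOL-Algebra.Ring" "HOL-Library.FuncSet"
begin

section \<open>Categories and equivalences\<close>

record ('o, 'a) category =
  Ob :: "'o set"
  Ar :: "'a set"
  src :: "'a \<Rightarrow> 'o"
  tgt :: "'a \<Rightarrow> 'o"
  ident :: "'o \<Rightarrow> 'a"
  cmp :: "'a \<Rightarrow> 'a \<Rightarrow> 'a"  (infixr "\<bullet>\<index>" 70)

definition Hom :: "('o, 'a, 'm) category_scheme \<Rightarrow> 'o \<Rightarrow> 'o \<Rightarrow> 'a set" where
  "Hom C X Y = {f \<in> Ar C. src C f = X \<and> tgt C f = Y}"

locale category =
  fixes C :: "('o, 'a, 'm) category_scheme" (structure)
  assumes src_Ob: "f \<in> Ar C \<Longrightarrow> src C f \<in> Ob C"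
    and tgt_Ob: "f \<in> Ar C \<Longrightarrow> tgt C f \<in> Ob C"
    and ident_Hom: "X \<in> Ob C \<Longrightarrow> ident C X \<in> Hom C X X"
    and cmp_Hom: "\<lbrakk>f \<in> Hom C X Y; g \<in> Hom C Y Z\<rbrakk> \<Longrightarrow> g \<bullet> f \<in> Hom C X Z"
    and cmp_ident: "f \<in> Hom C X Y \<Longrightarrow> f \<bullet> ident C X = f"
    and ident_cmp: "f \<in> Hom C X Y \<Longrightarrow> ident C Y \<bullet> f = f"
    and cmp_assoc: "\<lbrakk>f \<in> Hom C W X; g \<in> Hom C X Y; h \<in> Hom C Y Z\<rbrakk>
      \<Longrightarrow> (h \<bullet> g) \<bullet> f = h \<bullet> (g \<bullet> f)"

definition iso_arrow :: "('o, 'a, 'm) category_scheme \<Rightarrow> 'a \<Rightarrow> bool" where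
  "iso_arrow C f \<longleftrightarrow> f \<in> Ar C \<and>
     (\<exists>g \<in> Hom C (tgt C f) (src C f).
        g \<bullet>\<^bsub>C\<^esub> f = ident C (src C f) \<and> f \<bullet>\<^bsub>C\<^esub> g = ident C (tgt C f))"

definition iso_class :: "('o, 'a, 'm) category_scheme \<Rightarrow> 'o \<Rightarrow> 'o set" where
  "iso_class C X = {Y \<in> Ob C. \<exists>f \<in> Hom C X Y. iso_arrow C f}"

definition monic :: "('o, 'a, 'm) category_scheme \<Rightarrow> 'a \<Rightarrow> bool" where
  "monic C f \<longleftrightarrow> f \<in> Ar C \<and>
     (\<forall>W \<in> Ob C. \<forall>g \<in> Hom C W (src C f). \<forall>h \<in> Hom C W (src C f).
        f \<bullet>\<^bsub>C\<^esub> g = f \<bullet>\<^bsub>C\<^esub> h \<longrightarrow> g = h)"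

definition epic :: "('o, 'a, 'm) category_scheme \<Rightarrow> 'a \<Rightarrow> bool" where
  "epic C f \<longleftrightarrow> f \<in> Ar C \<and>
     (\<forall>W \<in> Ob C. \<forall>g \<in> Hom C (tgt C f) W. \<forall>h \<in> Hom C (tgt C f) W.
        g \<bullet>\<^bsub>C\<^esub> f = h \<bullet>\<^bsub>C\<^esub> f \<longrightarrow> g = h)"

locale cat_functor = C: category C + D: category D
  for C :: "('o, 'a, 'm) category_scheme" and D :: "('p, 'b, 'n) category_scheme" +
  fixes Fo :: "'o \<Rightarrow> 'p" and Fa :: "'a \<Rightarrow> 'b"
  assumes Fo_Ob: "X \<in> Ob C \<Longrightarrow> Fo X \<in> Ob D"
    and Fa_Hom: "f \<in> Hom C X Y \<Longrightarrow> Fa f \<in> Hom D (Fo X) (Fo Y)"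
    and Fa_ident: "X \<in> Ob C \<Longrightarrow> Fa (ident C X) = ident D (Fo X)"
    and Fa_cmp: "\<lbrakk>f \<in> Hom C X Y; g \<in> Hom C Y Z\<rbrakk>
      \<Longrightarrow> Fa (g \<bullet>\<^bsub>C\<^esub> f) = Fa g \<bullet>\<^bsub>D\<^esub> Fa f"

definition natural_iso ::
    "('o, 'a, 'm) category_scheme \<Rightarrow> ('p, 'b, 'n) category_scheme \<Rightarrow>
     ('o \<Rightarrow> 'p) \<Rightarrow> ('a \<Rightarrow> 'b) \<Rightarrow> ('o \<Rightarrow> 'p) \<Rightarrow> ('a \<Rightarrow> 'b) \<Rightarrow> ('o \<Rightarrow> 'b) \<Rightarrow> bool" where
  "natural_iso C D Fo Fa Go Ga \<eta> \<longleftrightarrow>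
     (\<forall>X \<in> Ob C. \<eta> X \<in> Hom D (Fo X) (Go X) \<and> iso_arrow D (\<eta> X)) \<and>
     (\<forall>X \<in> Ob C. \<forall>Y \<in> Ob C. \<forall>f \<in> Hom C X Y. \<eta> Y \<bullet>\<^bsub>D\<^esub> Fa f = Ga f \<bullet>\<^bsub>D\<^esub> \<eta> X)"

definition equivalent_categories ::
    "('o, 'a, 'm) category_scheme \<Rightarrow> ('p, 'b, 'n) category_scheme \<Rightarrow> bool" where
  "equivalent_categories C D \<longleftrightarrow>
     (\<exists>Fo Fa Go Ga \<eta> \<epsilon>. cat_functor C D Fo Fa \<and> cat_functor D C Go Ga \<and>
        natural_iso C C id id (Go \<circ> Fo) (Ga \<circ> Fa) \<eta> \<and>
        natural_iso D D (Fo \<circ> Go) (Fa \<circ> Ga) id id \<epsilon>)"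


section \<open>Abelian categories\<close>

record ('o, 'a) preadditive = "('o, 'a) category" +
  hzero :: "'o \<Rightarrow> 'o \<Rightarrow> 'a"
  hadd :: "'a \<Rightarrow> 'a \<Rightarrow> 'a"  (infixl "\<boxplus>\<index>" 65)

text \<open>The group of morphisms from \<open>X\<close> to \<open>Y\<close>, in the record type that HOL-Algebra uses for
  abelian groups; the fields \<open>mult\<close> and \<open>one\<close> are meaningful only for \<open>X = Y\<close>.\<close>

definition hom_group :: "('o, 'a, 'm) preadditive_scheme \<Rightarrow> 'o \<Rightarrow> 'o \<Rightarrow> 'a ring" where
  "hom_group C X Y = \<lparr>carrier = Hom C X Y, mult = cmp C, one = ident C X,
     zero = hzero C X Y, add = hadd C\<rparr>"

definition End_ring :: "('o, 'a, 'm) preadditive_scheme \<Rightarrow> 'o \<Rightarrow> 'a ring" where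
  "End_ring C X = hom_group C X X"

locale preadditive_category = category C
  for C :: "('o, 'a, 'm) preadditive_scheme" (structure) +
  assumes hom_abelian_group: "\<lbrakk>X \<in> Ob C; Y \<in> Ob C\<rbrakk> \<Longrightarrow> abelian_group (hom_group C X Y)"
    and cmp_hadd: "\<lbrakk>f \<in> Hom C X Y; g \<in> Hom C X Y; h \<in> Hom C Y Z\<rbrakk>
      \<Longrightarrow> h \<bullet> (f \<boxplus> g) = (h \<bullet> f) \<boxplus> (h \<bullet> g)"
    and hadd_cmp: "\<lbrakk>f \<in> Hom C X Y; g \<in> Hom C Y Z; h \<in> Hom C Y Z\<rbrakk>
      \<Longrightarrow> (g \<boxplus> h) \<bullet> f = (g \<bullet> f) \<boxplus> (h \<bullet> f)"

definition zero_object :: "('o, 'a, 'm) category_scheme \<Rightarrow> 'o \<Rightarrow> bool" where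
  "zero_object C Z \<longleftrightarrow> Z \<in> Ob C \<and>
     (\<forall>X \<in> Ob C. (\<exists>!f. f \<in> Hom C X Z) \<and> (\<exists>!f. f \<in> Hom C Z X))"

definition is_biproduct ::
    "('o, 'a, 'm) preadditive_scheme \<Rightarrow> 'o \<Rightarrow> 'o \<Rightarrow> 'o \<Rightarrow> 'a \<Rightarrow> 'a \<Rightarrow> 'a \<Rightarrow> 'a \<Rightarrow> bool" where
  "is_biproduct C X Y B i1 i2 p1 p2 \<longleftrightarrow> B \<in> Ob C \<and>
     i1 \<in> Hom C X B \<and> i2 \<in> Hom C Y B \<and> p1 \<in> Hom C B X \<and> p2 \<in> Hom C B Y \<and>
     p1 \<bullet>\<^bsub>C\<^esub> i1 = ident C X \<and> p2 \<bullet>\<^bsub>C\<^esub> i2 = ident C Y \<and>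
     p1 \<bullet>\<^bsub>C\<^esub> i2 = hzero C Y X \<and> p2 \<bullet>\<^bsub>C\<^esub> i1 = hzero C X Y \<and>
     (i1 \<bullet>\<^bsub>C\<^esub> p1) \<boxplus>\<^bsub>C\<^esub> (i2 \<bullet>\<^bsub>C\<^esub> p2) = ident C B"

text \<open>\<open>B\<close> is a direct sum of \<open>n\<close> copies of \<open>M\<close>.\<close>

definition is_power :: "('o, 'a, 'm) preadditive_scheme \<Rightarrow> 'o \<Rightarrow> nat \<Rightarrow> 'o \<Rightarrow> bool" where
  "is_power C M n B \<longleftrightarrow> B \<in> Ob C \<and>
     (\<exists>i p. (\<forall>k<n. i k \<in> Hom C M B \<and> p k \<in> Hom C B M) \<and>
        (\<forall>j<n. \<forall>k<n. p j \<bullet>\<^bsub>C\<^esub> i k = (if j = k then ident C M else hzero C M M)) \<and>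
        finsum (hom_group C B B) (\<lambda>k. i k \<bullet>\<^bsub>C\<^esub> p k) {..<n} = ident C B)"

definition is_kernel :: "('o, 'a, 'm) preadditive_scheme \<Rightarrow> 'a \<Rightarrow> 'a \<Rightarrow> bool" where
  "is_kernel C f k \<longleftrightarrow> f \<in> Ar C \<and> k \<in> Ar C \<and> tgt C k = src C f \<and>
     f \<bullet>\<^bsub>C\<^esub> k = hzero C (src C k) (tgt C f) \<and>
     (\<forall>W \<in> Ob C. \<forall>g \<in> Hom C W (src C f). f \<bullet>\<^bsub>C\<^esub> g = hzero C W (tgt C f) \<longrightarrow>
        (\<exists>!u. u \<in> Hom C W (src C k) \<and> k \<bullet>\<^bsub>C\<^esub> u = g))"

definition is_cokernel :: "('o, 'a, 'm) preadditive_scheme \<Rightarrow> 'a \<Rightarrow> 'a \<Rightarrow> bool" where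
  "is_cokernel C f q \<longleftrightarrow> f \<in> Ar C \<and> q \<in> Ar C \<and> src C q = tgt C f \<and>
     q \<bullet>\<^bsub>C\<^esub> f = hzero C (src C f) (tgt C q) \<and>
     (\<forall>W \<in> Ob C. \<forall>g \<in> Hom C (tgt C f) W. g \<bullet>\<^bsub>C\<^esub> f = hzero C (src C f) W \<longrightarrow>
        (\<exists>!u. u \<in> Hom C (tgt C q) W \<and> u \<bullet>\<^bsub>C\<^esub> q = g))"

locale abelian_category = preadditive_category C
  for C :: "('o, 'a, 'm) preadditive_scheme" (structure) +
  assumes zero_object_exists: "\<exists>Z. zero_object C Z"
    and biproduct_exists: "\<lbrakk>X \<in> Ob C; Y \<in> Ob C\<rbrakk>
      \<Longrightarrow> \<exists>B i1 i2 p1 p2. is_biproduct C X Y B i1 i2 p1 p2"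
    and kernel_exists: "f \<in> Ar C \<Longrightarrow> \<exists>k. is_kernel C f k"
    and cokernel_exists: "f \<in> Ar C \<Longrightarrow> \<exists>q. is_cokernel C f q"
    and monic_normal: "monic C f \<Longrightarrow> \<exists>g. is_kernel C g f"
    and epic_normal: "epic C f \<Longrightarrow> \<exists>g. is_cokernel C g f"


section \<open>Subobjects and length categories\<close>

definition factors_through :: "('o, 'a, 'm) category_scheme \<Rightarrow> 'a \<Rightarrow> 'a \<Rightarrow> bool" where
  "factors_through C m n \<longleftrightarrow> (\<exists>u \<in> Hom C (src C m) (src C n). n \<bullet>\<^bsub>C\<^esub> u = m)"

text \<open>A subobject of \<open>X\<close> is an equivalence class of monomorphisms into \<open>X\<close>.\<close>

definition subobject :: "('o, 'a, 'm) category_scheme \<Rightarrow> 'a \<Rightarrow> 'a set" where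
  "subobject C m = {n. monic C n \<and> tgt C n = tgt C m \<and>
     factors_through C m n \<and> factors_through C n m}"

definition Sub :: "('o, 'a, 'm) category_scheme \<Rightarrow> 'o \<Rightarrow> 'a set gorder" where
  "Sub C X = \<lparr>carrier = {subobject C m | m. monic C m \<and> tgt C m = X}, eq = (=),
     le = (\<lambda>A B. \<exists>m \<in> A. \<exists>n \<in> B. factors_through C m n)\<rparr>"

text \<open>There is no condition on the size of the set of isomorphism classes of objects, since
  the objects of a category in the present sense always form a set.\<close>

locale length_category = abelian_category C
  for C :: "('o, 'a, 'm) preadditive_scheme" (structure) +
  assumes finite_chains: "\<lbrakk>X \<in> Ob C; \<C> \<subseteq> carrier (Sub C X);
      \<And>A B. \<lbrakk>A \<in> \<C>; B \<in> \<C>\<rbrakk> \<Longrightarrow> A \<sqsubseteq>\<^bsub>Sub C X\<^esub> B \<or> B \<sqsubseteq>\<^bsub>Sub C X\<^esub> A\<rbrakk>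
    \<Longrightarrow> finite \<C>"

definition subquotient :: "('o, 'a, 'm) category_scheme \<Rightarrow> 'o \<Rightarrow> 'o \<Rightarrow> bool" where
  "subquotient C X Y \<longleftrightarrow>
     (\<exists>m e. monic C m \<and> epic C e \<and> tgt C m = Y \<and> src C e = src C m \<and> tgt C e = X)"

locale distributive_lattice = lattice +
  assumes meet_join_distrib: "\<lbrakk>x \<in> carrier L; y \<in> carrier L; z \<in> carrier L\<rbrakk>
    \<Longrightarrow> x \<sqinter> (y \<squnion> z) = (x \<sqinter> y) \<squnion> (x \<sqinter> z)"

definition join_irreducible :: "('x, 'm) gorder_scheme \<Rightarrow> 'x \<Rightarrow> bool" where
  "join_irreducible L x \<longleftrightarrow> x \<in> carrier L \<and> x \<noteq> \<bottom>\<^bsub>L\<^esub> \<and>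
     (\<forall>y \<in> carrier L. \<forall>z \<in> carrier L. x = y \<squnion>\<^bsub>L\<^esub> z \<longrightarrow> x = y \<or> x = z)"

definition maximal_proper :: "('x, 'm) gorder_scheme \<Rightarrow> 'x \<Rightarrow> bool" where
  "maximal_proper L x \<longleftrightarrow> x \<in> carrier L \<and> x \<noteq> \<top>\<^bsub>L\<^esub> \<and>
     (\<forall>y \<in> carrier L. x \<sqsubseteq>\<^bsub>L\<^esub> y \<longrightarrow> y = x \<or> y = \<top>\<^bsub>L\<^esub>)"

definition radical :: "('o, 'a, 'm) category_scheme \<Rightarrow> 'o \<Rightarrow> 'a set" where
  "radical C X = \<Sqinter>\<^bsub>Sub C X\<^esub> {A. maximal_proper (Sub C X) A}"

text \<open>For an epimorphism \<open>q\<close> with domain \<open>X\<close> and an endomorphism \<open>\<alpha>\<close> of \<open>X\<close> preserving the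
  kernel of \<open>q\<close>, the endomorphism induced on the codomain of \<open>q\<close>.\<close>

definition induced_endo :: "('o, 'a, 'm) category_scheme \<Rightarrow> 'a \<Rightarrow> 'a \<Rightarrow> 'a" where
  "induced_endo C q \<alpha> =
     (THE \<beta>. \<beta> \<in> Hom C (tgt C q) (tgt C q) \<and> \<beta> \<bullet>\<^bsub>C\<^esub> q = q \<bullet>\<^bsub>C\<^esub> \<alpha>)"


section \<open>Extensions and the ext-quiver\<close>

definition simple_object :: "('o, 'a, 'm) category_scheme \<Rightarrow> 'o \<Rightarrow> bool" where
  "simple_object C S \<longleftrightarrow> S \<in> Ob C \<and> \<not> zero_object C S \<and>
     (\<forall>m. monic C m \<and> tgt C m = S \<longrightarrow> zero_object C (src C m) \<or> iso_arrow C m)"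

text \<open>\<open>Ext\<^sup>1(T, S)\<close> is Yoneda's: equivalence classes of short exact sequences
  \<open>0 \<rightarrow> S \<rightarrow> E \<rightarrow> T \<rightarrow> 0\<close>. Its zero element is the class of the sequence given by the direct
  sum of \<open>S\<close> and \<open>T\<close>. The Baer sum is not defined, since only vanishing is needed.\<close>

definition extensions :: "('o, 'a, 'm) preadditive_scheme \<Rightarrow> 'o \<Rightarrow> 'o \<Rightarrow> ('a \<times> 'a) set" where
  "extensions C T S = {(i, p). i \<in> Ar C \<and> p \<in> Ar C \<and> src C i = S \<and> tgt C p = T \<and>
     is_kernel C p i \<and> is_cokernel C i p}"

definition extension_rel ::
    "('o, 'a, 'm) preadditive_scheme \<Rightarrow> 'o \<Rightarrow> 'o \<Rightarrow> (('a \<times> 'a) \<times> ('a \<times> 'a)) set" where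
  "extension_rel C T S = {((i, p), (i', p')).
     (i, p) \<in> extensions C T S \<and> (i', p') \<in> extensions C T S \<and>
     (\<exists>h \<in> Hom C (tgt C i) (tgt C i'). iso_arrow C h \<and> h \<bullet>\<^bsub>C\<^esub> i = i' \<and> p' \<bullet>\<^bsub>C\<^esub> h = p)}"

definition Ext1 :: "('o, 'a, 'm) preadditive_scheme \<Rightarrow> 'o \<Rightarrow> 'o \<Rightarrow> ('a \<times> 'a) set set" where
  "Ext1 C T S = extensions C T S // extension_rel C T S"

definition Ext1_zero :: "('o, 'a, 'm) preadditive_scheme \<Rightarrow> 'o \<Rightarrow> 'o \<Rightarrow> ('a \<times> 'a) set" where
  "Ext1_zero C T S =
     {e. \<exists>B i1 i2 p1 p2. is_biproduct C S T B i1 i2 p1 p2 \<and> ((i1, p2), e) \<in> extension_rel C T S}"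

text \<open>The set of arrows of the ext-quiver, a relation on isomorphism classes of simple objects.\<close>

definition ext_quiver :: "('o, 'a, 'm) preadditive_scheme \<Rightarrow> ('o set \<times> 'o set) set" where
  "ext_quiver C = {(iso_class C S, iso_class C T) | S T.
     simple_object C S \<and> simple_object C T \<and> Ext1 C T S \<noteq> {Ext1_zero C T S}}"


section \<open>The conditions on an object of an abelian category\<close>

definition cond_M1 :: "('o, 'a, 'm) preadditive_scheme \<Rightarrow> bool" where
  "cond_M1 C \<longleftrightarrow> acyclic (ext_quiver C)"

definition cond_M2 :: "('o, 'a, 'm) preadditive_scheme \<Rightarrow> 'o \<Rightarrow> bool" where
  "cond_M2 C M \<longleftrightarrow> distributive_lattice (Sub C M) \<and>
     (\<forall>X \<in> Ob C. \<exists>n B. is_power C M n B \<and> subquotient C X B)"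

text \<open>Here \<open>m\<close> is any monomorphism representing a join-irreducible subobject \<open>N\<close>, \<open>r\<close> any
  monomorphism representing its radical and \<open>q\<close> any realisation of the quotient of \<open>N\<close> by its
  radical.\<close>

definition cond_M3 :: "('o, 'a, 'm) preadditive_scheme \<Rightarrow> 'o \<Rightarrow> bool" where
  "cond_M3 C M \<longleftrightarrow>
     (\<forall>N. join_irreducible (Sub C M) N \<longrightarrow>
        (\<forall>m \<in> N. \<forall>r \<in> radical C (src C m). \<forall>q. is_cokernel C r q \<longrightarrow>
           induced_endo C q ` carrier (End_ring C (src C m)) = carrier (End_ring C (tgt C q))))"


section \<open>Linear representations of posets\<close>

locale skew_field = ring +
  assumes skew_field_Units: "Units R = carrier R - {\<zero>}"

record ('k, 'v) rmodule = "'v ring" +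
  rsmult :: "'v \<Rightarrow> 'k \<Rightarrow> 'v"  (infixl "\<odot>\<index>" 70)

locale right_vector_space = K: skew_field K + V: abelian_group V
  for K :: "'k ring" and V :: "('k, 'v) rmodule" +
  assumes rsmult_closed: "\<lbrakk>v \<in> carrier V; a \<in> carrier K\<rbrakk> \<Longrightarrow> v \<odot>\<^bsub>V\<^esub> a \<in> carrier V"
    and rsmult_add_left: "\<lbrakk>v \<in> carrier V; w \<in> carrier V; a \<in> carrier K\<rbrakk>
      \<Longrightarrow> (v \<oplus>\<^bsub>V\<^esub> w) \<odot>\<^bsub>V\<^esub> a = (v \<odot>\<^bsub>V\<^esub> a) \<oplus>\<^bsub>V\<^esub> (w \<odot>\<^bsub>V\<^esub> a)"
    and rsmult_add_right: "\<lbrakk>v \<in> carrier V; a \<in> carrier K; b \<in> carrier K\<rbrakk>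
      \<Longrightarrow> v \<odot>\<^bsub>V\<^esub> (a \<oplus>\<^bsub>K\<^esub> b) = (v \<odot>\<^bsub>V\<^esub> a) \<oplus>\<^bsub>V\<^esub> (v \<odot>\<^bsub>V\<^esub> b)"
    and rsmult_assoc: "\<lbrakk>v \<in> carrier V; a \<in> carrier K; b \<in> carrier K\<rbrakk>
      \<Longrightarrow> v \<odot>\<^bsub>V\<^esub> (a \<otimes>\<^bsub>K\<^esub> b) = (v \<odot>\<^bsub>V\<^esub> a) \<odot>\<^bsub>V\<^esub> b"
    and rsmult_one: "v \<in> carrier V \<Longrightarrow> v \<odot>\<^bsub>V\<^esub> \<one>\<^bsub>K\<^esub> = v"

definition is_basis :: "'k ring \<Rightarrow> ('k, 'v) rmodule \<Rightarrow> 'v set \<Rightarrow> bool" where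
  "is_basis K V B \<longleftrightarrow> finite B \<and> B \<subseteq> carrier V \<and>
     (\<forall>v \<in> carrier V. \<exists>!c. c \<in> B \<rightarrow>\<^sub>E carrier K \<and> v = finsum V (\<lambda>b. b \<odot>\<^bsub>V\<^esub> c b) B)"

definition finite_dimensional :: "'k ring \<Rightarrow> ('k, 'v) rmodule \<Rightarrow> bool" where
  "finite_dimensional K V \<longleftrightarrow> (\<exists>B. is_basis K V B)"

definition linear_maps :: "'k ring \<Rightarrow> ('k, 'v) rmodule \<Rightarrow> ('k, 'w) rmodule \<Rightarrow> ('v \<Rightarrow> 'w) set" where
  "linear_maps K V W = {f \<in> carrier V \<rightarrow> carrier W.
     (\<forall>v \<in> carrier V. \<forall>w \<in> carrier V. f (v \<oplus>\<^bsub>V\<^esub> w) = f v \<oplus>\<^bsub>W\<^esub> f w) \<and>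
     (\<forall>v \<in> carrier V. \<forall>a \<in> carrier K. f (v \<odot>\<^bsub>V\<^esub> a) = f v \<odot>\<^bsub>W\<^esub> a)}"

definition restrict_scalars :: "('k \<Rightarrow> 'l) \<Rightarrow> ('l, 'v) rmodule \<Rightarrow> ('k, 'v) rmodule" where
  "restrict_scalars h V = \<lparr>carrier = carrier V, mult = mult V, one = one V, zero = zero V,
     add = add V, rsmult = (\<lambda>v a. v \<odot>\<^bsub>V\<^esub> h a)\<rparr>"

locale division_ring_family = P: partial_order P
  for P :: "'p gorder" +
  fixes K :: "'p \<Rightarrow> 'k ring" and \<kappa> :: "'p \<Rightarrow> 'p \<Rightarrow> 'k \<Rightarrow> 'k"
  assumes skew_field_K: "x \<in> carrier P \<Longrightarrow> skew_field (K x)"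
    and kappa_hom: "\<lbrakk>x \<in> carrier P; y \<in> carrier P; x \<sqsubseteq>\<^bsub>P\<^esub> y\<rbrakk>
      \<Longrightarrow> \<kappa> x y \<in> ring_hom (K y) (K x)"
    and kappa_cmp: "\<lbrakk>x \<in> carrier P; y \<in> carrier P; z \<in> carrier P; x \<sqsubseteq>\<^bsub>P\<^esub> y; y \<sqsubseteq>\<^bsub>P\<^esub> z;
        a \<in> carrier (K z)\<rbrakk> \<Longrightarrow> \<kappa> x y (\<kappa> y z a) = \<kappa> x z a"

text \<open>\<open>rmap M x y\<close> is the structure map from \<open>M(y)\<close> to \<open>M(x)\<close>, for \<open>x \<le> y\<close>.\<close>

record ('p, 'k, 'v) rep =
  rspace :: "'p \<Rightarrow> ('k, 'v) rmodule"
  rmap :: "'p \<Rightarrow> 'p \<Rightarrow> 'v \<Rightarrow> 'v"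

definition is_pfd_rep ::
    "'p gorder \<Rightarrow> ('p \<Rightarrow> 'k ring) \<Rightarrow> ('p \<Rightarrow> 'p \<Rightarrow> 'k \<Rightarrow> 'k) \<Rightarrow> ('p, 'k, 'v) rep \<Rightarrow> bool" where
  "is_pfd_rep P K \<kappa> M \<longleftrightarrow>
     (\<forall>x \<in> carrier P. right_vector_space (K x) (rspace M x) \<and>
        finite_dimensional (K x) (rspace M x)) \<and>
     (\<forall>x \<in> carrier P. \<forall>y \<in> carrier P. x \<sqsubseteq>\<^bsub>P\<^esub> y \<longrightarrow>
        rmap M x y \<in> linear_maps (K y) (rspace M y) (restrict_scalars (\<kappa> x y) (rspace M x))) \<and>
     (\<forall>x \<in> carrier P. \<forall>v \<in> carrier (rspace M x). rmap M x x v = v) \<and>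
     (\<forall>x \<in> carrier P. \<forall>y \<in> carrier P. \<forall>z \<in> carrier P. x \<sqsubseteq>\<^bsub>P\<^esub> y \<longrightarrow> y \<sqsubseteq>\<^bsub>P\<^esub> z \<longrightarrow>
        (\<forall>v \<in> carrier (rspace M z). rmap M x z v = rmap M x y (rmap M y z v)))"

text \<open>Morphisms are extensional, both in \<open>x\<close> and as maps on \<open>M(x)\<close>, so that equal morphisms
  are equal as functions.\<close>

definition rep_hom ::
    "'p gorder \<Rightarrow> ('p \<Rightarrow> 'k ring) \<Rightarrow> ('p, 'k, 'v) rep \<Rightarrow> ('p, 'k, 'v) rep \<Rightarrow> ('p \<Rightarrow> 'v \<Rightarrow> 'v) set" where
  "rep_hom P K M N =
     {f \<in> (\<Pi>\<^sub>E x \<in> carrier P.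
            linear_maps (K x) (rspace M x) (rspace N x) \<inter> extensional (carrier (rspace M x))).
        \<forall>x \<in> carrier P. \<forall>y \<in> carrier P. x \<sqsubseteq>\<^bsub>P\<^esub> y \<longrightarrow>
          (\<forall>v \<in> carrier (rspace M y). f x (rmap M x y v) = rmap N x y (f y v))}"

type_synonym ('p, 'k, 'v) rep_arrow = "('p, 'k, 'v) rep \<times> ('p \<Rightarrow> 'v \<Rightarrow> 'v) \<times> ('p, 'k, 'v) rep"

definition Rep_category ::
    "'p gorder \<Rightarrow> ('p \<Rightarrow> 'k ring) \<Rightarrow> ('p \<Rightarrow> 'p \<Rightarrow> 'k \<Rightarrow> 'k) \<Rightarrow>
     (('p, 'k, 'v) rep, ('p, 'k, 'v) rep_arrow) category" where
  "Rep_category P K \<kappa> = \<lparr>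
     Ob = {M. is_pfd_rep P K \<kappa> M},
     Ar = {(M, f, N). is_pfd_rep P K \<kappa> M \<and> is_pfd_rep P K \<kappa> N \<and> f \<in> rep_hom P K M N},
     src = (\<lambda>(M, f, N). M),
     tgt = (\<lambda>(M, f, N). N),
     ident = (\<lambda>M. (M, (\<lambda>x \<in> carrier P. \<lambda>v \<in> carrier (rspace M x). v), M)),
     cmp = (\<lambda>(M', g, N) (M, f, M'').
       (M, (\<lambda>x \<in> carrier P. compose (carrier (rspace M x)) (g x) (f x)), N))\<rparr>"

text \<open>In \<open>Rep_category\<close> all spaces have carriers in one type \<open>'v\<close>. Each finite dimensional
  space over a division ring with elements in \<open>'k\<close> is isomorphic to one with carrier in
  \<open>nat \<Rightarrow> 'k\<close> (a space of coordinate vectors), so \<open>pfd_Rep\<close> contains, up to isomorphism, all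
  pointwise finite dimensional representations, whatever the type of their elements.\<close>

definition pfd_Rep ::
    "'p gorder \<Rightarrow> ('p \<Rightarrow> 'k ring) \<Rightarrow> ('p \<Rightarrow> 'p \<Rightarrow> 'k \<Rightarrow> 'k) \<Rightarrow>
     (('p, 'k, nat \<Rightarrow> 'k) rep, ('p, 'k, nat \<Rightarrow> 'k) rep_arrow) category" where
  "pfd_Rep = Rep_category"

lemma rmap_closed:
  assumes "is_pfd_rep P K \<kappa> M" "x \<in> carrier P" "y \<in> carrier P" "x \<sqsubseteq>\<^bsub>P\<^esub> y"
    "v \<in> carrier (rspace M y)"
  shows "rmap M x y v \<in> carrier (rspace M x)"
proof -
  have "rmap M x y \<in> linear_maps (K y) (rspace M y) (restrict_scalars (\<kappa> x y) (rspace M x))"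
    using assms(1-4) unfolding is_pfd_rep_def by blast
  then show ?thesis
    using assms(5) by (auto simp: linear_maps_def restrict_scalars_def)
qed

lemma category_Rep:
  fixes P :: "'p gorder" and K :: "'p \<Rightarrow> 'k ring"
  shows "category (Rep_category P K \<kappa> :: (('p, 'k, 'v) rep, ('p, 'k, 'v) rep_arrow) category)"
    (is "category ?C")
proof -
  have Hom: "\<phi> \<in> Hom ?C M N \<longleftrightarrow> is_pfd_rep P K \<kappa> M \<and> is_pfd_rep P K \<kappa> N \<and>
      (\<exists>f \<in> rep_hom P K M N. \<phi> = (M, f, N))" for \<phi> M N
    by (auto simp: Hom_def Rep_category_def)
  have id_hom: "(\<lambda>x \<in> carrier P. \<lambda>v \<in> carrier (rspace M x). v) \<in> rep_hom P K M M"
    if "is_pfd_rep P K \<kappa> M" for M :: "('p, 'k, 'v) rep"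
  proof -
    have M: "rmap M x y v \<in> carrier (rspace M x)"
      if "x \<in> carrier P" "y \<in> carrier P" "x \<sqsubseteq>\<^bsub>P\<^esub> y" "v \<in> carrier (rspace M y)" for x y v
      by (rule rmap_closed[OF \<open>is_pfd_rep P K \<kappa> M\<close> that])
    have vs: "x \<in> carrier P \<Longrightarrow> right_vector_space (K x) (rspace M x)" for x
      using that by (simp add: is_pfd_rep_def)
    have ab: "x \<in> carrier P \<Longrightarrow> abelian_group (rspace M x)" for x
      using vs by (auto simp: right_vector_space_def)
    have lin: "(\<lambda>v \<in> carrier (rspace M x). v) \<in> linear_maps (K x) (rspace M x) (rspace M x)"
      if "x \<in> carrier P" for x
      using vs[OF that] ab[OF that]
      by (simp add: linear_maps_def abelian_group_def abelian_monoid.a_closed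
          right_vector_space.rsmult_closed)
    show ?thesis
      unfolding rep_hom_def using lin M by simp
  qed
  have comp_hom: "(\<lambda>x \<in> carrier P. compose (carrier (rspace M x)) (g x) (f x)) \<in> rep_hom P K M L"
    if M: "is_pfd_rep P K \<kappa> M" and f: "f \<in> rep_hom P K M N" and g: "g \<in> rep_hom P K N L"
    for M N L :: "('p, 'k, 'v) rep" and f g
  proof -
    have M1: "rmap M x y v \<in> carrier (rspace M x)"
      if "x \<in> carrier P" "y \<in> carrier P" "x \<sqsubseteq>\<^bsub>P\<^esub> y" "v \<in> carrier (rspace M y)" for x y v
      by (rule rmap_closed[OF \<open>is_pfd_rep P K \<kappa> M\<close> that])
    have vs: "x \<in> carrier P \<Longrightarrow> right_vector_space (K x) (rspace M x)" for x
      using M by (simp add: is_pfd_rep_def)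
    have ab: "x \<in> carrier P \<Longrightarrow> abelian_group (rspace M x)" for x
      using vs by (auto simp: right_vector_space_def)
    have fl: "f x \<in> linear_maps (K x) (rspace M x) (rspace N x)"
      and gl: "g x \<in> linear_maps (K x) (rspace N x) (rspace L x)" if "x \<in> carrier P" for x
      using f g that by (auto simp: rep_hom_def PiE_def Pi_def)
    have fc: "f x v \<in> carrier (rspace N x)" if "x \<in> carrier P" "v \<in> carrier (rspace M x)" for x v
      using fl[OF that(1)] that(2) by (auto simp: linear_maps_def)
    have lin: "compose (carrier (rspace M x)) (g x) (f x) \<in> linear_maps (K x) (rspace M x) (rspace L x)"
      if x: "x \<in> carrier P" for x
      using vs[OF x] ab[OF x] fl[OF x] gl[OF x]
      by (auto simp: linear_maps_def compose_def abelian_group_def abelian_monoid.a_closed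
          right_vector_space.rsmult_closed Pi_iff)
    have nat: "g x (f x (rmap M x y v)) = rmap L x y (g y (f y v))"
      if "x \<in> carrier P" "y \<in> carrier P" "x \<sqsubseteq>\<^bsub>P\<^esub> y" "v \<in> carrier (rspace M y)" for x y v
      using f g that fc by (simp add: rep_hom_def)
    show ?thesis
      unfolding rep_hom_def using lin M1 nat by (auto simp: compose_eq compose_def)
  qed
  have ext: "f = g" if "f \<in> rep_hom P K M N" "g \<in> rep_hom P K M N"
     "\<And>x v. x \<in> carrier P \<Longrightarrow> v \<in> carrier (rspace M x) \<Longrightarrow> f x v = g x v"
    for f g and M N :: "('p, 'k, 'v) rep"
  proof -
    have "f x = g x" if x: "x \<in> carrier P" for x
      using \<open>f \<in> rep_hom P K M N\<close> \<open>g \<in> rep_hom P K M N\<close> x that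
        \<open>\<And>x v. x \<in> carrier P \<Longrightarrow> v \<in> carrier (rspace M x) \<Longrightarrow> f x v = g x v\<close>
      by (intro extensionalityI[of _ "carrier (rspace M x)"]) (auto simp: rep_hom_def PiE_iff)
    then show ?thesis
      using that(1,2) by (intro extensionalityI[of _ "carrier P"]) (auto simp: rep_hom_def PiE_iff)
  qed
  have car: "f x v \<in> carrier (rspace N x)"
    if "f \<in> rep_hom P K M N" "x \<in> carrier P" "v \<in> carrier (rspace M x)" for f M N x v
    using that by (auto simp: rep_hom_def PiE_iff linear_maps_def)
  have cmp: "cmp ?C (N', g, L) (M, f, N) =
      (M, (\<lambda>x \<in> carrier P. compose (carrier (rspace M x)) (g x) (f x)), L)" for L M N N' f g
    by (simp add: Rep_category_def)
  have idn: "ident ?C M = (M, (\<lambda>x \<in> carrier P. \<lambda>v \<in> carrier (rspace M x). v), M)" for M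
    by (simp add: Rep_category_def)
  show ?thesis
  proof
    show "src ?C f \<in> Ob ?C" "tgt ?C f \<in> Ob ?C" if "f \<in> Ar ?C" for f
      using that by (auto simp: Rep_category_def)
    show "ident ?C X \<in> Hom ?C X X" if "X \<in> Ob ?C" for X
      using that id_hom by (auto simp: Hom idn) (auto simp: Rep_category_def)
    show "cmp ?C g f \<in> Hom ?C X Z" if "f \<in> Hom ?C X Y" "g \<in> Hom ?C Y Z" for f g X Y Z
      using that comp_hom by (auto simp: Hom cmp)
    show "cmp ?C \<phi> (ident ?C X) = \<phi>" if "\<phi> \<in> Hom ?C X Y" for \<phi> X Y
    proof -
      obtain f where f: "\<phi> = (X, f, Y)" "f \<in> rep_hom P K X Y" "is_pfd_rep P K \<kappa> X"
        using \<open>\<phi> \<in> Hom ?C X Y\<close> Hom by blast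
      have "(\<lambda>x \<in> carrier P. compose (carrier (rspace X x)) (f x)
          ((\<lambda>x \<in> carrier P. \<lambda>v \<in> carrier (rspace X x). v) x)) = f"
        by (rule ext[OF comp_hom[OF f(3) id_hom[OF f(3)] f(2)] f(2)]) (simp add: compose_def)
      then show ?thesis unfolding f(1) idn cmp by simp
    qed
    show "cmp ?C (ident ?C Y) \<phi> = \<phi>" if "\<phi> \<in> Hom ?C X Y" for \<phi> X Y
    proof -
      obtain f where f: "\<phi> = (X, f, Y)" "f \<in> rep_hom P K X Y"
          "is_pfd_rep P K \<kappa> X" "is_pfd_rep P K \<kappa> Y"
        using \<open>\<phi> \<in> Hom ?C X Y\<close> Hom by blast
      have "(\<lambda>x \<in> carrier P. compose (carrier (rspace X x))
          ((\<lambda>x \<in> carrier P. \<lambda>v \<in> carrier (rspace Y x). v) x) (f x)) = f"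
        by (rule ext[OF comp_hom[OF f(3) f(2) id_hom[OF f(4)]] f(2)])
           (simp add: compose_def car[OF f(2)])
      then show ?thesis unfolding f(1) idn cmp by simp
    qed
    show "cmp ?C (cmp ?C \<chi> \<psi>) \<phi> = cmp ?C \<chi> (cmp ?C \<psi> \<phi>)"
      if hyps: "\<phi> \<in> Hom ?C W X" "\<psi> \<in> Hom ?C X Y" "\<chi> \<in> Hom ?C Y Z" for \<phi> \<psi> \<chi> W X Y Z
    proof -
      obtain f g h where f: "\<phi> = (W, f, X)" "f \<in> rep_hom P K W X"
          and g: "\<psi> = (X, g, Y)" "g \<in> rep_hom P K X Y"
          and h: "\<chi> = (Y, h, Z)" "h \<in> rep_hom P K Y Z"
          and pfd: "is_pfd_rep P K \<kappa> W" "is_pfd_rep P K \<kappa> X"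
        using hyps[unfolded Hom] by blast
      show ?thesis unfolding f(1) g(1) h(1) cmp prod.inject
        by (intro conjI refl ext[OF comp_hom[OF pfd(1) f(2) comp_hom[OF pfd(2) g(2) h(2)]]
              comp_hom[OF pfd(1) comp_hom[OF pfd(1) f(2) g(2)] h(2)]])
           (simp add: compose_def car[OF f(2)])
    qed
  qed
qed


section \<open>The poset of join-irreducible subobjects\<close>

text \<open>The family of monomorphisms \<open>m x\<close>, for \<open>x \<in> \<Omega>\<close>, represents each join-irreducible
  subobject of \<open>M\<close> exactly once; \<open>M\<^sub>x\<close> is the domain of \<open>m x\<close>.\<close>

definition enumerates_ji ::
    "('o, 'a, 'm) category_scheme \<Rightarrow> 'o \<Rightarrow> 'x set \<Rightarrow> ('x \<Rightarrow> 'a) \<Rightarrow> bool" where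
  "enumerates_ji C M \<Omega> m \<longleftrightarrow>
     (\<forall>x \<in> \<Omega>. monic C (m x) \<and> tgt C (m x) = M) \<and>
     bij_betw (\<lambda>x. subobject C (m x)) \<Omega> {N. join_irreducible (Sub C M) N}"

definition ji_poset ::
    "('o, 'a, 'm) category_scheme \<Rightarrow> 'o \<Rightarrow> 'x set \<Rightarrow> ('x \<Rightarrow> 'a) \<Rightarrow> 'x gorder" where
  "ji_poset C M \<Omega> m = \<lparr>carrier = \<Omega>, eq = (=),
     le = (\<lambda>x y. subobject C (m x) \<sqsubseteq>\<^bsub>Sub C M\<^esub> subobject C (m y))\<rparr>"

definition ji_ring :: "('o, 'a, 'm) preadditive_scheme \<Rightarrow> ('x \<Rightarrow> 'a) \<Rightarrow> 'x \<Rightarrow> 'a ring" where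
  "ji_ring C m x = End_ring C (src C (m x))"

definition ji_incl :: "('o, 'a, 'm) category_scheme \<Rightarrow> ('x \<Rightarrow> 'a) \<Rightarrow> 'x \<Rightarrow> 'x \<Rightarrow> 'a" where
  "ji_incl C m x y = (THE i. i \<in> Hom C (src C (m x)) (src C (m y)) \<and> m y \<bullet>\<^bsub>C\<^esub> i = m x)"

definition ji_kappa ::
    "('o, 'a, 'm) preadditive_scheme \<Rightarrow> ('x \<Rightarrow> 'a) \<Rightarrow> 'x \<Rightarrow> 'x \<Rightarrow> 'a \<Rightarrow> 'a" where
  "ji_kappa C m x y \<alpha> = (THE \<beta>. \<beta> \<in> carrier (ji_ring C m x) \<and>
     ji_incl C m x y \<bullet>\<^bsub>C\<^esub> \<beta> = \<alpha> \<bullet>\<^bsub>C\<^esub> ji_incl C m x y)"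

end

theory Submission
 imports Defs
begin

text \<open>
 Both directions pass through a family of monomorphisms \<open>m\<^sub>x : N\<^sub>x \<rightarrow> M\<close>, pairwise inequivalent,
 with \<open>N\<^sub>x\<close> nonzero and projective, such that the \<open>N\<^sub>x\<close> generate, every arrow \<open>N\<^sub>x \<rightarrow> M\<close> factors
 through \<open>m\<^sub>x\<close> and every nonzero endomorphism of \<open>N\<^sub>x\<close> is invertible (locale
 \<open>poset_generators\<close>).

 Given (M1)--(M3), the join-irreducible subobjects of \<open>M\<close> are the local ones, those with a simple
 top. Distributivity makes two local subobjects with the same top comparable, and the absence of
 oriented cycles makes them equal; every local object is, by (M2) and (M3), a quotient of the local
 subobject of \<open>M\<close> with the same top, which is therefore projective. Conversely such a family gives
 (M1)--(M3): subobjects of \<open>M\<close> are determined by the down-set of the \<open>x\<close> with \<open>m\<^sub>x\<close> below them.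

 The functor \<open>X \<mapsto> Hom (N\<^sub>x, X)\<close> is then an equivalence. Given an equivalence with a category of
 representations, take for \<open>N\<^sub>x\<close> the representation that is one-dimensional on the principal
 down-set of \<open>x\<close> and for \<open>M\<close> the one that is one-dimensional everywhere; projectivity holds
 because an epimorphism that is not surjective at some \<open>x\<close>, maximal with this property, would be
 killed by a nonzero map to the simple representation at \<open>x\<close>.
\<close>

section \<open>Arrows of a category\<close>

text \<open>Representations of a poset appear for the following reason. An arrow from
  \<open>N\<^sub>x\<close> to \<open>N\<^sub>y\<close>, followed by \<open>m\<^sub>y\<close>, is an
  arrow into M and so factors through \<open>m\<^sub>x\<close>; hence a nonzero one exists only for
  x \<le> y, and it is then an endomorphism of \<open>N\<^sub>x\<close> followed by the inclusion.
  So a contravariant additive functor on the \<open>N\<^sub>x\<close> amounts to a right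
  \<open>K\<^sub>x\<close>-space for each x and a map for each inclusion, semilinear along \<kappa>,
  and projective generators recover the whole category from it. The obstacle is that the category is
  abstract. Elements are replaced by arrows lifted along an epimorphism after a pullback
  (\<open>pullback_epic\<close>). Finite generation is replaced by the chain condition: a property
  of arrows into X that survives the addition of one further arrow is carried to an arrow with
  maximal image (\<open>noetherian\<close>). Conversely, the category of representations is never
  shown to be abelian: kernels, images and chains are formed in the given category, whose arrows act
  on vectors.\<close>

definition null :: "('o, 'a, 'm) preadditive_scheme => 'a => bool" where
 "null C f \<longleftrightarrow> f = hzero C (src C f) (tgt C f)"

definition factors_over :: "('o, 'a, 'm) category_scheme => 'a => 'a => bool" where
 "factors_over C h c \<longleftrightarrow> (\<exists>u \<in> Hom C (tgt C c) (tgt C h). u \<bullet>\<^bsub>C\<^esub> c = h)"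

context category
begin

abbreviation arr where "arr f \<equiv> f \<in> Ar C"
abbreviation dom where "dom \<equiv> src C"
abbreviation cod where "cod \<equiv> tgt C"
abbreviation comp (infixr "**" 70) where "g ** f \<equiv> g \<bullet> f"
abbreviation below (infix "<~" 50) where "f <~ g \<equiv> factors_through C f g"

lemma cmp_closed [simp]:
  "[|arr f; arr g; dom g = cod f|] ==> g ** f \<in> Ar C"
 and src_cmp [simp]: "[|arr f; arr g; dom g = cod f|] ==> dom (g ** f) = dom f"
 and tgt_cmp [simp]: "[|arr f; arr g; dom g = cod f|] ==> cod (g ** f) = cod g"
 using cmp_Hom[of f "dom f" "cod f" g "cod g"] by (auto simp: Hom_def)

lemma cmp_assoc_Ar [simp]:
 "[|arr f; arr g; arr h; dom g = cod f; dom h = cod g|]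
  ==> (h ** g) ** f = h ** (g ** f)"
 using cmp_assoc[of f "dom f" "cod f" g "cod g" h "cod h"] by (auto simp: Hom_def)

lemma ident_simps [simp]:
 "X \<in> Ob C ==> ident C X \<in> Ar C"
 "X \<in> Ob C ==> dom (ident C X) = X"
 "X \<in> Ob C ==> cod (ident C X) = X"
 using ident_Hom[of X] by (auto simp: Hom_def)

lemma cmp_ident_Ar [simp]: "arr f ==> dom f = X ==> f ** ident C X = f"
 and ident_cmp_Ar [simp]: "arr f ==> cod f = X ==> ident C X ** f = f"
 using cmp_ident[of f "dom f" "cod f"] ident_cmp[of f "dom f" "cod f"]
 by (auto simp: Hom_def)

lemma Ob_simps [simp]: "arr f ==> dom f \<in> Ob C" "arr f ==> cod f \<in> Ob C"
 by (simp_all add: src_Ob tgt_Ob)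

text \<open>The simplifier associates composites to the right, which hides a known product
  \<open>g ** f\<close> inside \<open>g ** (f ** w)\<close>; this rule applies the known equation
  there.\<close>

lemma cmp_reduce:
 "[|g ** f = h; arr f; arr g; dom g = cod f; arr w; cod w = dom f|]
  ==> g ** (f ** w) = h ** w"
 by (metis cmp_assoc_Ar)

lemma iso_arrowI:
 "[|arr f; arr g; dom g = cod f; cod g = dom f;
  g ** f = ident C (dom f); f ** g = ident C (cod f)|] ==> iso_arrow C f"
 by (auto simp: iso_arrow_def Hom_def)

lemma iso_arrowE:
 assumes "iso_arrow C f"
 obtains g where "arr f" "arr g" "dom g = cod f" "cod g = dom f"
  "g ** f = ident C (dom f)" "f ** g = ident C (cod f)"
 using assms by (auto simp: iso_arrow_def Hom_def)

lemma factors_throughI: "[|arr u; dom u = dom m; cod u = dom n; n ** u = m|]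
  ==> m <~ n"
 by (auto simp: factors_through_def Hom_def)

lemma factors_throughE:
 assumes "m <~ n"
 obtains u where "arr u" "dom u = dom m" "cod u = dom n" "n ** u = m"
 using assms by (auto simp: factors_through_def Hom_def)

lemma factors_overE:
 assumes "factors_over C h c"
 obtains u where "arr u" "dom u = cod c" "cod u = cod h" "u ** c = h"
 using assms by (auto simp: factors_over_def Hom_def)

lemma factors_through_refl [simp]: "arr m ==> m <~ m"
 by (rule factors_throughI[of "ident C (dom m)"]) auto

lemma factors_through_trans:
 assumes "l <~ m" "m <~ n" "arr n"
 shows "l <~ n"
proof -
 obtain u where u: "arr u" "dom u = dom l" "cod u = dom m" "m ** u = l"
  using assms(1) by (rule factors_throughE)
 obtain v where v: "arr v" "dom v = dom m" "cod v = dom n" "n ** v = m"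
  using assms(2) by (rule factors_throughE)
 show ?thesis
  using u v assms(3) by (intro factors_throughI[of "v ** u"]) (simp_all flip: cmp_assoc_Ar)
qed

lemma factors_through_cmp:
 "[|arr m; arr u; cod u = dom m|] ==> m ** u <~ m"
 by (rule factors_throughI[of u]) auto

lemma monic_cmp_iff:
 assumes "monic C m" "arr f" "arr g" "cod f = dom m" "cod g = dom m"
  "dom f = dom g"
 shows "m ** f = m ** g \<longleftrightarrow> f = g"
 using assms unfolding monic_def Hom_def by (metis (mono_tags, lifting) Ob_simps(1) mem_Collect_eq)

lemma epic_cmp_iff:
 assumes "epic C e" "arr f" "arr g" "dom f = cod e" "dom g = cod e"
  "cod f = cod g"
 shows "f ** e = g ** e \<longleftrightarrow> f = g"
 using assms unfolding epic_def Hom_def by (metis (mono_tags, lifting) Ob_simps(2) mem_Collect_eq)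

lemma monic_Ar [simp]: "monic C m ==> arr m"
 and epic_Ar [simp]: "epic C m ==> arr m"
 and iso_Ar [simp]: "iso_arrow C m ==> arr m"
 by (simp_all add: monic_def epic_def iso_arrow_def)

lemma monic_cmp:
 assumes "monic C m" "monic C n" "cod n = dom m"
 shows "monic C (m ** n)"
 unfolding monic_def
proof (intro conjI ballI impI)
 fix W g h
 assume "W \<in> Ob C" "g \<in> Hom C W (dom (m ** n))" "h \<in> Hom C W (dom (m ** n))"
  "(m ** n) ** g = (m ** n) ** h"
 thus "g = h"
  using assms monic_cmp_iff[OF assms(1), of "n ** g" "n ** h"]
   monic_cmp_iff[OF assms(2), of g h] by (auto simp: Hom_def)
qed (use assms in auto)

lemma monic_right_factor:
 assumes "monic C (m ** n)" "arr n" "arr m" "dom m = cod n"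
 shows "monic C n"
 unfolding monic_def
proof (intro conjI ballI impI)
 fix W g h
 assume gh: "W \<in> Ob C" "g \<in> Hom C W (dom n)" "h \<in> Hom C W (dom n)" "n ** g = n ** h"
 hence "(m ** n) ** g = (m ** n) ** h"
  using assms by (auto simp: Hom_def)
 thus "g = h"
  using assms gh monic_cmp_iff[OF assms(1), of g h] by (auto simp: Hom_def)
qed (use assms in auto)

lemma epic_cmp:
 assumes "epic C m" "epic C n" "cod n = dom m"
 shows "epic C (m ** n)"
 unfolding epic_def
proof (intro conjI ballI impI)
 fix W g h
 assume "W \<in> Ob C" "g \<in> Hom C (cod (m ** n)) W" "h \<in> Hom C (cod (m ** n)) W"
  "g ** (m ** n) = h ** (m ** n)"
 thus "g = h"
  using assms epic_cmp_iff[OF assms(2), of "g ** m" "h ** m"]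
   epic_cmp_iff[OF assms(1), of g h] by (auto simp: Hom_def)
qed (use assms in auto)

lemma epic_left_factor:
 assumes "epic C (m ** n)" "arr n" "arr m" "dom m = cod n"
 shows "epic C m"
 unfolding epic_def
proof (intro conjI ballI impI)
 fix W g h
 assume gh: "W \<in> Ob C" "g \<in> Hom C (cod m) W" "h \<in> Hom C (cod m) W" "g ** m = h ** m"
 hence "g ** (m ** n) = h ** (m ** n)"
  using assms by (auto simp: Hom_def simp flip: cmp_assoc_Ar)
 thus "g = h"
  using assms gh epic_cmp_iff[OF assms(1), of g h] by (auto simp: Hom_def)
qed (use assms in auto)

lemma ident_monic [simp]: assumes "X \<in> Ob C" shows "monic C (ident C X)"
 unfolding monic_def using assms by (metis Hom_def ident_cmp ident_simps(1,2))

lemma ident_epic [simp]: assumes "X \<in> Ob C" shows "epic C (ident C X)"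
 unfolding epic_def using assms by (metis Hom_def cmp_ident ident_simps(1,3))

lemma ident_iso [simp]: "X \<in> Ob C ==> iso_arrow C (ident C X)"
 by (rule iso_arrowI[of _ "ident C X"]) auto

lemma iso_arrow_monic: "iso_arrow C f ==> monic C f"
 by (elim iso_arrowE) (metis Ob_simps(1) ident_monic monic_right_factor)

lemma iso_arrow_epic: "iso_arrow C f ==> epic C f"
 by (elim iso_arrowE) (metis Ob_simps(2) ident_epic epic_left_factor)

lemma iso_arrow_cmp:
 assumes "iso_arrow C f" "iso_arrow C g" "dom g = cod f"
 shows "iso_arrow C (g ** f)"
proof -
 obtain f' where f: "arr f" "arr f'" "dom f' = cod f" "cod f' = dom f"
  "f' ** f = ident C (dom f)" "f ** f' = ident C (cod f)"
  using assms(1) by (rule iso_arrowE)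
 obtain g' where g: "arr g" "arr g'" "dom g' = cod g" "cod g' = dom g"
  "g' ** g = ident C (dom g)" "g ** g' = ident C (cod g)"
  using assms(2) by (rule iso_arrowE)
 show ?thesis
  using f g assms(3) by (intro iso_arrowI[of _ "f' ** g'"])
   (simp_all add: cmp_reduce[OF g(5)] cmp_reduce[OF f(6)])
qed

end

section \<open>Additive and abelian categories\<close>

text \<open>The hom group is read off from the arrow itself, so no objects have to be
  passed.\<close>

definition hneg :: "('o, 'a, 'm) preadditive_scheme => 'a => 'a" where
 "hneg C f = a_inv (hom_group C (src C f) (tgt C f)) f"

context preadditive_category
begin

lemma hom_group_simps [simp]:
 "carrier (hom_group C X Y) = Hom C X Y" "zero (hom_group C X Y) = hzero C X Y"
 "add (hom_group C X Y) = hadd C" "mult (hom_group C X Y) = cmp C"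
 "one (hom_group C X Y) = ident C X"
 by (simp_all add: hom_group_def)

lemma hzero_simps [simp]:
 assumes "X \<in> Ob C" "Y \<in> Ob C"
 shows "arr (hzero C X Y)" "dom (hzero C X Y) = X" "cod (hzero C X Y) = Y"
 using abelian_group.axioms(1)[OF hom_abelian_group[OF assms]] abelian_monoid.zero_closed
 by (fastforce simp: Hom_def)+

lemma hadd_simps [simp]:
 assumes "arr f" "arr g" "dom f = dom g" "cod f = cod g"
 shows "arr (f \<boxplus> g)" "dom (f \<boxplus> g) = dom g" "cod (f \<boxplus> g) = cod g"
proof -
 interpret abelian_group "hom_group C (dom g) (cod g)"
  using assms by (simp add: hom_abelian_group)
 show "arr (f \<boxplus> g)" "dom (f \<boxplus> g) = dom g" "cod (f \<boxplus> g) = cod g"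
  using a_closed[of f g] assms by (auto simp: Hom_def)
qed

lemma hneg_simps [simp]:
 assumes "arr f"
 shows "arr (hneg C f)" "dom (hneg C f) = dom f" "cod (hneg C f) = cod f"
proof -
 interpret abelian_group "hom_group C (dom f) (cod f)"
  using assms by (simp add: hom_abelian_group)
 show "arr (hneg C f)" "dom (hneg C f) = dom f" "cod (hneg C f) = cod f"
  using a_inv_closed[of f] assms by (auto simp: Hom_def hneg_def)
qed

lemma hadd_assoc:
 assumes "arr f" "arr g" "arr h" "dom f = dom h" "dom g = dom h"
  "cod f = cod h" "cod g = cod h"
 shows "(f \<boxplus> g) \<boxplus> h = f \<boxplus> (g \<boxplus> h)"
proof -
 interpret abelian_group "hom_group C (dom h) (cod h)"
  using assms by (simp add: hom_abelian_group)
 show ?thesis using a_assoc[of f g h] assms by (simp add: Hom_def)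
qed

lemma hadd_comm:
 assumes "arr f" "arr g" "dom f = dom g" "cod f = cod g"
 shows "f \<boxplus> g = g \<boxplus> f"
proof -
 interpret abelian_group "hom_group C (dom g) (cod g)"
  using assms by (simp add: hom_abelian_group)
 show ?thesis using a_comm[of f g] assms by (simp add: Hom_def)
qed

lemma hadd_zero [simp]:
 assumes "arr f" "dom f = X" "cod f = Y"
 shows "f \<boxplus> hzero C X Y = f" "hzero C X Y \<boxplus> f = f"
proof -
 interpret abelian_group "hom_group C X Y"
  using assms by (auto intro!: hom_abelian_group)
 show "f \<boxplus> hzero C X Y = f" "hzero C X Y \<boxplus> f = f"
  using r_zero[of f] l_zero[of f] assms by (simp_all add: Hom_def)
qed

lemma hadd_hneg [simp]:
 assumes "arr f"
 shows "f \<boxplus> hneg C f = hzero C (dom f) (cod f)" "hneg C f \<boxplus> f = hzero C (dom f) (cod f)"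
proof -
 interpret abelian_group "hom_group C (dom f) (cod f)"
  using assms by (auto intro!: hom_abelian_group)
 show "f \<boxplus> hneg C f = hzero C (dom f) (cod f)" "hneg C f \<boxplus> f = hzero C (dom f) (cod f)"
  using r_neg[of f] l_neg[of f] assms by (simp_all add: Hom_def hneg_def)
qed

lemma hadd_left_cancel:
 assumes "arr f" "arr g" "arr h" "dom f = dom h" "dom g = dom h"
  "cod f = cod h" "cod g = cod h" "h \<boxplus> f = h \<boxplus> g"
 shows "f = g"
proof -
 have "(hneg C h \<boxplus> h) \<boxplus> f = (hneg C h \<boxplus> h) \<boxplus> g"
  using assms by (simp add: hadd_assoc del: hadd_hneg)
 thus ?thesis using assms by simp
qed

lemma hneg_unique:
 assumes "arr f" "arr g" "dom f = dom g" "cod f = cod g"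
  "f \<boxplus> g = hzero C (dom f) (cod f)"
 shows "g = hneg C f"
 using assms by (intro hadd_left_cancel[of g "hneg C f" f]) auto

lemma hneg_hzero [simp]: "X \<in> Ob C ==> Y \<in> Ob C ==> hneg C (hzero C X Y) = hzero C X Y"
 using hneg_unique[of "hzero C X Y" "hzero C X Y"] by simp

lemma cmp_hadd_Ar [simp]:
 "[|arr f; arr g; arr h; dom f = dom g; cod f = dom h; cod g = dom h|]
  ==> h ** (f \<boxplus> g) = (h ** f) \<boxplus> (h ** g)"
 using cmp_hadd[of f "dom g" "dom h" g h "cod h"] by (simp add: Hom_def)

lemma hadd_cmp_Ar [simp]:
 "[|arr f; arr g; arr h; dom g = cod f; dom h = cod f; cod g = cod h|]
  ==> (g \<boxplus> h) ** f = (g ** f) \<boxplus> (h ** f)"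
 using hadd_cmp[of f "dom f" "cod f" g "cod h" h] by (simp add: Hom_def)

text \<open>An idempotent of a group is its unit. In this form additivity alone gives that
  composition, and later every natural map, preserves zero.\<close>

lemma hadd_self_zero:
 assumes "arr f" "f \<boxplus> f = f" shows "f = hzero C (dom f) (cod f)"
 using assms by (intro hadd_left_cancel[of f "hzero C (dom f) (cod f)" f]) auto

lemma cmp_hzero [simp]:
 assumes "arr f" "X \<in> Ob C" "dom f = Y" shows "f ** hzero C X Y = hzero C X (cod f)"
proof -
 have "f ** (hzero C X Y \<boxplus> hzero C X Y) = (f ** hzero C X Y) \<boxplus> (f ** hzero C X Y)"
  using assms by (intro cmp_hadd_Ar) auto
 moreover have "hzero C X Y \<boxplus> hzero C X Y = hzero C X Y"
  using assms by auto
 ultimately show ?thesis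
  using hadd_self_zero[of "f ** hzero C X Y"] assms by auto
qed

lemma hzero_cmp [simp]:
 assumes "arr f" "Z \<in> Ob C" "cod f = Y" shows "hzero C Y Z ** f = hzero C (dom f) Z"
proof -
 have "(hzero C Y Z \<boxplus> hzero C Y Z) ** f = (hzero C Y Z ** f) \<boxplus> (hzero C Y Z ** f)"
  using assms by (intro hadd_cmp_Ar) auto
 moreover have "hzero C Y Z \<boxplus> hzero C Y Z = hzero C Y Z"
  using assms by auto
 ultimately show ?thesis
  using hadd_self_zero[of "hzero C Y Z ** f"] assms by auto
qed

lemma cmp_hneg [simp]:
 assumes "arr f" "arr g" "dom g = cod f"
 shows "g ** hneg C f = hneg C (g ** f)"
proof -
 have "g ** (f \<boxplus> hneg C f) = hzero C (dom f) (cod g)"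
  unfolding hadd_hneg[OF assms(1)] using assms by simp
 thus ?thesis using assms by (intro hneg_unique) (auto simp del: hadd_hneg)
qed

lemma hneg_cmp [simp]:
 assumes "arr f" "arr g" "dom g = cod f"
 shows "hneg C g ** f = hneg C (g ** f)"
proof -
 have "(g \<boxplus> hneg C g) ** f = hzero C (dom f) (cod g)"
  unfolding hadd_hneg[OF assms(2)] using assms by simp
 thus ?thesis using assms by (intro hneg_unique) (auto simp del: hadd_hneg)
qed

lemma hadd_hneg_cancel:
 assumes "arr f" "arr g" "dom f = dom g" "cod f = cod g"
 shows "(f \<boxplus> g) \<boxplus> hneg C g = f" "(f \<boxplus> hneg C g) \<boxplus> g = f"
 using assms by (auto simp: hadd_assoc)

lemma null_diff_iff:
 assumes "arr f" "arr g" "dom f = dom g" "cod f = cod g"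
 shows "null C (f \<boxplus> hneg C g) \<longleftrightarrow> f = g"
proof
 assume "null C (f \<boxplus> hneg C g)"
 hence "(f \<boxplus> hneg C g) \<boxplus> g = g" using assms by (auto simp: null_def)
 thus "f = g" using hadd_hneg_cancel(2)[OF assms] by simp
qed (use assms in \<open>simp add: null_def\<close>)

lemma null_hzero [simp]: "X \<in> Ob C ==> Y \<in> Ob C ==> null C (hzero C X Y)"
 by (simp add: null_def)

lemma null_cmp_left:
 assumes "null C g" "arr f" "arr g" "dom g = cod f" shows "null C (g ** f)"
proof -
 have "g ** f = hzero C (dom g) (cod g) ** f"
  using assms(1) unfolding null_def by (rule arg_cong[where f = "\<lambda>x. x ** f"])
 thus ?thesis using assms by (simp add: null_def[of C "g ** f"])
qed

lemma null_cmp_right: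
 assumes "null C f" "arr f" "arr g" "dom g = cod f" shows "null C (g ** f)"
proof -
 have "g ** f = g ** hzero C (dom f) (cod f)"
  using assms(1) unfolding null_def by (rule arg_cong)
 thus ?thesis using assms by (simp add: null_def[of C "g ** f"])
qed

lemma null_hadd:
 "[|null C f; null C g; arr f; arr g; dom f = dom g; cod f = cod g|]
  ==> null C (f \<boxplus> g)"
 by (metis hadd_zero(1) null_def)

lemma null_eqI:
 "[|null C f; null C g; dom f = dom g; cod f = cod g|] ==> f = g"
 by (simp add: null_def)

text \<open>Two arrows with the same composite differ by an arrow with zero composite, so
  cancellation need only be tested against zero.\<close>

lemma monicI:
 assumes f: "arr f"
  and z: "!!g. [|arr g; cod g = dom f; null C (f ** g)|] ==> null C g"
 shows "monic C f"
 unfolding monic_def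
proof (intro conjI ballI impI)
 fix W g h assume gh: "g \<in> Hom C W (dom f)" "h \<in> Hom C W (dom f)" "f ** g = f ** h"
 have t: "arr g" "arr h" "cod g = dom f" "cod h = dom f" "dom g = W" "dom h = W"
  using gh by (simp_all add: Hom_def)
 have "null C ((f ** g) \<boxplus> hneg C (f ** h))"
  using f t gh(3) by (subst null_diff_iff) simp_all
 hence "null C (g \<boxplus> hneg C h)" using f t z[of "g \<boxplus> hneg C h"] by simp
 thus "g = h" using t by (subst (asm) null_diff_iff) simp_all
qed (rule f)

lemma monicD:
 assumes "monic C f" "arr g" "cod g = dom f" "null C (f ** g)"
 shows "null C g"
proof -
 have "f ** g = f ** hzero C (dom g) (dom f)"
  using assms by (auto simp: null_def)
 thus ?thesis
  using assms by (subst (asm) monic_cmp_iff) (auto simp: null_def)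
qed

lemma epicI:
 assumes f: "arr f"
  and z: "!!g. [|arr g; dom g = cod f; null C (g ** f)|] ==> null C g"
 shows "epic C f"
 unfolding epic_def
proof (intro conjI ballI impI)
 fix W g h assume gh: "g \<in> Hom C (cod f) W" "h \<in> Hom C (cod f) W" "g ** f = h ** f"
 have t: "arr g" "arr h" "dom g = cod f" "dom h = cod f" "cod g = W" "cod h = W"
  using gh by (simp_all add: Hom_def)
 have "null C ((g ** f) \<boxplus> hneg C (h ** f))"
  using f t gh(3) by (subst null_diff_iff) simp_all
 hence "null C (g \<boxplus> hneg C h)" using f t z[of "g \<boxplus> hneg C h"] by simp
 thus "g = h" using t by (subst (asm) null_diff_iff) simp_all
qed (rule f)

lemma epicD:
 assumes "epic C f" "arr g" "dom g = cod f" "null C (g ** f)"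
 shows "null C g"
proof -
 have "g ** f = hzero C (cod f) (cod g) ** f"
  using assms by (auto simp: null_def)
 thus ?thesis
  using assms by (subst (asm) epic_cmp_iff) (auto simp: null_def)
qed

text \<open>Every arrow into or out of Z is a composite with the identity of Z, so all of them
  vanish with it.\<close>

lemma zero_object_iff: "zero_object C Z \<longleftrightarrow> Z \<in> Ob C & null C (ident C Z)"
proof
 assume z: "zero_object C Z"
 hence Z: "Z \<in> Ob C" and ex: "\<exists>!f. f \<in> Hom C Z Z"
  unfolding zero_object_def by blast+
 have "ident C Z = hzero C Z Z"
  using ex ident_Hom[OF Z] Z hzero_simps[OF Z Z] unfolding Hom_def by blast
 thus "Z \<in> Ob C & null C (ident C Z)" using Z by (simp add: null_def)
next
 assume z: "Z \<in> Ob C & null C (ident C Z)"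
 have 1: "f = hzero C X Z" if "f \<in> Hom C X Z" for f X
 proof -
  have "null C (ident C Z ** f)" by (rule null_cmp_left) (use z that in \<open>auto simp: Hom_def\<close>)
  thus ?thesis using that by (simp add: Hom_def null_def)
 qed
 have 2: "f = hzero C Z X" if "f \<in> Hom C Z X" for f X
 proof -
  have "null C (f ** ident C Z)" by (rule null_cmp_right) (use z that in \<open>auto simp: Hom_def\<close>)
  thus ?thesis using that by (simp add: Hom_def null_def)
 qed
 show "zero_object C Z" unfolding zero_object_def
 proof (intro conjI ballI)
  fix X assume "X \<in> Ob C"
  hence "hzero C X Z \<in> Hom C X Z" using z by (simp add: Hom_def)
  thus "\<exists>!f. f \<in> Hom C X Z" using 1 by blast
 next
  fix X assume "X \<in> Ob C"
  hence "hzero C Z X \<in> Hom C Z X" using z by (simp add: Hom_def)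
  thus "\<exists>!f. f \<in> Hom C Z X" using 2 by blast
 qed (use z in auto)
qed

end

text \<open>The two universal properties are stated as existence of factorisations only; their
  uniqueness is contained in \<open>k\<close> being monic and \<open>c\<close> being epic.\<close>

definition ses :: "('o, 'a, 'm) preadditive_scheme => 'a => 'a => bool" where
 "ses C k c \<longleftrightarrow> monic C k & epic C c & tgt C k = src C c & null C (c \<bullet>\<^bsub>C\<^esub> k) &
  (\<forall>g \<in> Ar C. tgt C g = src C c --> null C (c \<bullet>\<^bsub>C\<^esub> g) --> factors_through C g k) &
  (\<forall>h \<in> Ar C. src C h = tgt C k --> null C (h \<bullet>\<^bsub>C\<^esub> k) --> factors_over C h c)"

context preadditive_category
begin

text \<open>Uniqueness in the universal property is traded for \<open>k\<close> being monic: if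
  \<open>k ** g\<close> is zero, both \<open>g\<close> and the zero arrow factor the zero arrow
  through \<open>k\<close>.\<close>

lemma is_kernel_iff: "is_kernel C f k \<longleftrightarrow> f \<in> Ar C & monic C k & cod k = dom f &
  null C (f ** k) &
  (\<forall>g \<in> Ar C. cod g = dom f --> null C (f ** g) --> g <~ k)" (is "?l = ?r")
proof
 assume l: ?l
 have "monic C k"
 proof (rule monicI)
  show "arr k" using l by (simp add: is_kernel_def)
  fix g assume g: "arr g" "cod g = dom k" "null C (k ** g)"
  have n: "k ** g = hzero C (dom g) (dom f)" using g l by (simp add: is_kernel_def null_def)
  have "\<exists>!u. u \<in> Hom C (dom g) (dom k) & k ** u = hzero C (dom g) (dom f)"
   using l g by (auto simp: is_kernel_def Hom_def)
  moreover have "g \<in> Hom C (dom g) (dom k) & k ** g = hzero C (dom g) (dom f)"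
   using g n by (simp add: Hom_def)
  moreover have "hzero C (dom g) (dom k) \<in> Hom C (dom g) (dom k) &
    k ** hzero C (dom g) (dom k) = hzero C (dom g) (dom f)"
   using l g by (auto simp: is_kernel_def Hom_def)
  ultimately have "g = hzero C (dom g) (dom k)" by blast
  thus "null C g" using g by (simp add: null_def)
 qed
 moreover have "g <~ k"
  if "arr g" "cod g = dom f" "null C (f ** g)" for g
 proof -
  have "g \<in> Hom C (dom g) (dom f)" "f ** g = hzero C (dom g) (cod f)"
   using that l by (simp_all add: Hom_def null_def is_kernel_def)
  thus ?thesis using l that(1) unfolding is_kernel_def factors_through_def by (meson Ob_simps(1))
 qed
 ultimately show ?r using l by (simp add: is_kernel_def null_def)
next
 assume r: ?r
 show ?l unfolding is_kernel_def
 proof (intro conjI ballI impI)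
  fix W g assume g: "g \<in> Hom C W (dom f)" "f ** g = hzero C W (cod f)"
  hence "g <~ k" using r by (auto simp: Hom_def null_def)
  then obtain u where u: "arr u" "dom u = W" "cod u = dom k" "k ** u = g"
   using g by (auto simp: Hom_def elim: factors_throughE)
  show "\<exists>!u. u \<in> Hom C W (dom k) & k ** u = g"
  proof (rule ex1I[of _ u])
   fix v assume "v \<in> Hom C W (dom k) & k ** v = g"
   thus "v = u" using u r monic_cmp_iff[of k v u] by (auto simp: Hom_def)
  qed (use u in \<open>simp add: Hom_def\<close>)
 qed (use r in \<open>auto simp: null_def\<close>)
qed

lemma is_cokernel_iff: "is_cokernel C f c \<longleftrightarrow> f \<in> Ar C & epic C c & dom c = cod f &
  null C (c ** f) &
  (\<forall>g \<in> Ar C. dom g = cod f --> null C (g ** f) --> factors_over C g c)" (is "?l = ?r")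
proof
 assume l: ?l
 have "epic C c"
 proof (rule epicI)
  show "arr c" using l by (simp add: is_cokernel_def)
  fix g assume g: "arr g" "dom g = cod c" "null C (g ** c)"
  have n: "g ** c = hzero C (cod f) (cod g)" using g l by (simp add: is_cokernel_def null_def)
  have "\<exists>!u. u \<in> Hom C (cod c) (cod g) & u ** c = hzero C (cod f) (cod g)"
   using l g by (auto simp: is_cokernel_def Hom_def)
  moreover have "g \<in> Hom C (cod c) (cod g) & g ** c = hzero C (cod f) (cod g)"
   using g n by (simp add: Hom_def)
  moreover have "hzero C (cod c) (cod g) \<in> Hom C (cod c) (cod g) &
    hzero C (cod c) (cod g) ** c = hzero C (cod f) (cod g)"
   using l g by (auto simp: is_cokernel_def Hom_def)
  ultimately have "g = hzero C (cod c) (cod g)" by blast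
  thus "null C g" using g by (simp add: null_def)
 qed
 moreover have "factors_over C g c"
  if "arr g" "dom g = cod f" "null C (g ** f)" for g
 proof -
  have "g \<in> Hom C (cod f) (cod g)" "g ** f = hzero C (dom f) (cod g)"
   using that l by (simp_all add: Hom_def null_def is_cokernel_def)
  thus ?thesis using l that(1) unfolding is_cokernel_def factors_over_def by (meson Ob_simps(2))
 qed
 ultimately show ?r using l by (simp add: is_cokernel_def null_def)
next
 assume r: ?r
 show ?l unfolding is_cokernel_def
 proof (intro conjI ballI impI)
  fix W g assume g: "g \<in> Hom C (cod f) W" "g ** f = hzero C (dom f) W"
  hence "factors_over C g c" using r by (auto simp: Hom_def null_def)
  then obtain u where u: "arr u" "dom u = cod c" "cod u = W" "u ** c = g"
   using g by (auto simp: Hom_def elim: factors_overE)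
  show "\<exists>!u. u \<in> Hom C (cod c) W & u ** c = g"
  proof (rule ex1I[of _ u])
   fix v assume "v \<in> Hom C (cod c) W & v ** c = g"
   thus "v = u" using u r epic_cmp_iff[of c v u] by (auto simp: Hom_def)
  qed (use u in \<open>simp add: Hom_def\<close>)
 qed (use r in \<open>auto simp: null_def\<close>)
qed

lemma ses_iff: "ses C k c \<longleftrightarrow> is_kernel C c k & is_cokernel C k c"
 unfolding ses_def is_kernel_iff is_cokernel_iff by auto

lemma sesD:
 assumes "ses C k c"
 shows "monic C k" "epic C c" "cod k = dom c" "null C (c ** k)"
 using assms by (simp_all add: ses_def)

lemma ses_through:
 assumes "ses C k c" "arr g" "cod g = dom c" "null C (c ** g)"
 obtains u where "arr u" "dom u = dom g" "cod u = dom k" "k ** u = g"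
 using assms unfolding ses_def by (metis factors_throughE)

lemma ses_over:
 assumes "ses C k c" "arr g" "dom g = dom c" "null C (g ** k)"
 obtains u where "arr u" "dom u = cod c" "cod u = cod g" "u ** c = g"
 using assms unfolding ses_def by (metis factors_overE)

end

section \<open>Exact sequences, images and pullbacks\<close>

context abelian_category
begin

lemma kernelE:
 assumes "arr f"
 obtains k where "monic C k" "cod k = dom f" "null C (f ** k)"
  "\<forall>g \<in> Ar C. cod g = dom f --> null C (f ** g) --> g <~ k"
 using kernel_exists[OF assms] unfolding is_kernel_iff by blast

lemma cokernelE:
 assumes "arr f"
 obtains c where "epic C c" "dom c = cod f" "null C (c ** f)"
  "\<forall>g \<in> Ar C. dom g = cod f --> null C (g ** f) --> factors_over C g c"
 using cokernel_exists[OF assms] unfolding is_cokernel_iff by blast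

text \<open>A monic \<open>m\<close> is the kernel of some \<open>g\<close>. Since \<open>g\<close>
  kills \<open>m\<close> it factors over the cokernel \<open>c\<close> of \<open>m\<close>, so
  whatever \<open>c\<close> kills is killed by \<open>g\<close> and lies in
  \<open>m\<close>.\<close>

lemma monic_ses: assumes "monic C m" obtains c where "ses C m c"
proof -
 obtain g where g: "is_kernel C g m" using monic_normal[OF assms] by blast
 have gA: "arr g" "cod m = dom g" "null C (g ** m)"
  and gf: "!!w. [|arr w; cod w = dom g; null C (g ** w)|] ==> w <~ m"
  using g unfolding is_kernel_iff by auto
 obtain c where c: "epic C c" "dom c = cod m" "null C (c ** m)"
  "\<forall>g \<in> Ar C. dom g = cod m --> null C (g ** m) --> factors_over C g c"
  using cokernelE[of m] assms by auto
 obtain u where u: "arr u" "dom u = cod c" "cod u = cod g" "u ** c = g"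
  using c(4) gA by (auto elim: factors_overE)
 have "w <~ m" if w: "arr w" "cod w = dom c" "null C (c ** w)" for w
 proof (rule gf)
  have "null C (u ** (c ** w))" by (rule null_cmp_right) (use u c w in auto)
  thus "null C (g ** w)" using u c w by (simp flip: cmp_assoc_Ar)
 qed (use w c gA in auto)
 hence "ses C m c" unfolding ses_def using c assms by auto
 thus ?thesis by (rule that)
qed

lemma epic_ses: assumes "epic C c" obtains k where "ses C k c"
proof -
 obtain g where g: "is_cokernel C g c" using epic_normal[OF assms] by blast
 have gA: "arr g" "cod g = dom c" "null C (c ** g)"
  and gf: "!!w. [|arr w; dom w = cod g; null C (w ** g)|] ==> factors_over C w c"
  using g unfolding is_cokernel_iff by auto
 obtain k where k: "monic C k" "cod k = dom c" "null C (c ** k)"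
  "\<forall>g \<in> Ar C. cod g = dom c --> null C (c ** g) --> g <~ k"
  using kernelE[of c] assms by auto
 obtain u where u: "arr u" "dom u = dom g" "cod u = dom k" "k ** u = g"
  using k(4) gA by (auto elim: factors_throughE)
 have "factors_over C w c" if w: "arr w" "dom w = cod k" "null C (w ** k)" for w
 proof (rule gf)
  have "null C ((w ** k) ** u)" by (rule null_cmp_left) (use u k w in auto)
  thus "null C (w ** g)" using u k w by simp
 qed (use w k gA in auto)
 hence "ses C k c" unfolding ses_def using k assms by auto
 thus ?thesis by (rule that)
qed

text \<open>The image is the kernel \<open>m\<close> of the cokernel \<open>c\<close> of
  \<open>f\<close>. For \<open>h\<close> killing the factor \<open>e\<close>, let \<open>n\<close>
  be the kernel of \<open>h\<close>: then \<open>f\<close> factors through \<open>m ** n\<close>, so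
  the cokernel of \<open>m ** n\<close> factors over \<open>c\<close> and kills \<open>m\<close>.
  Hence \<open>m\<close> factors through \<open>m ** n\<close>, which splits \<open>n\<close> and
  forces \<open>h\<close> to vanish.\<close>

lemma imageE:
 assumes f: "arr f"
 obtains m e where "monic C m" "epic C e" "dom e = dom f" "cod e = dom m"
  "cod m = cod f" "m ** e = f"
proof -
 obtain c where c: "epic C c" "dom c = cod f" "null C (c ** f)"
  "\<forall>g \<in> Ar C. dom g = cod f --> null C (g ** f) --> factors_over C g c"
  by (rule cokernelE[OF f])
 obtain m where m: "ses C m c" by (rule epic_ses[OF c(1)])
 note mD = sesD[OF m]
 obtain e where e: "arr e" "dom e = dom f" "cod e = dom m" "m ** e = f"
  using ses_through[OF m f] c by auto
 have "epic C e"
 proof (rule epicI)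
  fix h assume h: "arr h" "dom h = cod e" "null C (h ** e)"
  obtain n where n: "monic C n" "cod n = dom h" "null C (h ** n)"
   "\<forall>g \<in> Ar C. cod g = dom h --> null C (h ** g) --> g <~ n"
   by (rule kernelE[OF h(1)])
  obtain e' where e': "arr e'" "dom e' = dom e" "cod e' = dom n" "n ** e' = e"
   using n(4) e(1-3) h by (metis factors_throughE)
  have "monic C (m ** n)" using mD n h e by (intro monic_cmp) auto
  then obtain d where d: "ses C (m ** n) d" by (rule monic_ses)
  note dD = sesD[OF d]
  have ty: "arr m" "arr n" "arr d" "dom d = cod m" "cod n = dom m"
   using mD dD n h e by auto
  have "null C ((d ** (m ** n)) ** e')" by (rule null_cmp_left) (use ty dD e' in auto)
  hence "null C (d ** f)" using ty e e' by simp
  then obtain d' where d': "arr d'" "dom d' = cod c" "d' ** c = d"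
   using c(4) ty mD c by (auto elim: factors_overE)
  have "null C (d' ** (c ** m))" by (rule null_cmp_right) (use d' mD c in auto)
  hence "null C (d ** m)" using d' mD c by (simp flip: cmp_assoc_Ar)
  then obtain v where v: "arr v" "dom v = dom m" "cod v = dom (m ** n)" "(m ** n) ** v = m"
   using ses_through[OF d, of m] ty by auto
  have "m ** (n ** v) = m ** ident C (dom m)" using v ty by auto
  hence nv: "n ** v = ident C (dom m)"
   using v ty mD by (subst (asm) monic_cmp_iff) auto
  have "null C ((h ** n) ** v)" by (rule null_cmp_left) (use n h v ty in auto)
  thus "null C h" using n h v ty nv e by simp
 qed (rule e)
 thus ?thesis using that[of m e] mD e c by auto
qed

text \<open>The cokernel of an epic \<open>f\<close> is zero, so it kills the identity, which
  therefore factors through the monic \<open>f\<close>.\<close>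

lemma iso_arrow_iff: "iso_arrow C f \<longleftrightarrow> monic C f & epic C f"
proof
 assume f: "monic C f & epic C f"
 then obtain c where c: "ses C f c" using monic_ses by blast
 have "null C c" by (rule epicD[of f c]) (use f sesD[OF c] in auto)
 hence "null C (c ** ident C (cod f))" by (rule null_cmp_left) (use sesD[OF c] in auto)
 then obtain u where u: "arr u" "dom u = cod f" "cod u = dom f" "f ** u = ident C (cod f)"
  using ses_through[OF c, of "ident C (cod f)"] sesD[OF c] f by auto
 have "f ** (u ** f) = f ** ident C (dom f)" using u f by (simp add: cmp_reduce[OF u(4)])
 hence "u ** f = ident C (dom f)" using u f by (subst (asm) monic_cmp_iff) auto
 thus "iso_arrow C f" using u f by (intro iso_arrowI) auto
qed (auto intro: iso_arrow_monic iso_arrow_epic)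

lemma not_epicE:
 assumes "arr f" "~ epic C f"
 obtains d where "arr d" "dom d = cod f" "null C (d ** f)" "~ null C d"
 using assms epicI by blast

lemma biproductE:
 assumes "X \<in> Ob C" "Y \<in> Ob C"
 obtains B i1 i2 p1 p2 where "B \<in> Ob C" "arr i1" "dom i1 = X" "cod i1 = B"
  "arr i2" "dom i2 = Y" "cod i2 = B" "arr p1" "dom p1 = B" "cod p1 = X"
  "arr p2" "dom p2 = B" "cod p2 = Y"
  "p1 ** i1 = ident C X" "p2 ** i2 = ident C Y" "p1 ** i2 = hzero C Y X" "p2 ** i1 = hzero C X Y"
  "(i1 ** p1) \<boxplus> (i2 ** p2) = ident C B"
proof -
 obtain B i1 i2 p1 p2 where "is_biproduct C X Y B i1 i2 p1 p2"
  using biproduct_exists[OF assms] by blast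
 thus ?thesis
  by (intro that[of B i1 i2 p1 p2]) (auto simp: is_biproduct_def Hom_def)
qed

text \<open>This replaces the choice of a preimage of an element. The pullback is the kernel of the
  difference \<open>\<phi>\<close> of \<open>f ** p1\<close> and \<open>g ** p2\<close> on the
  biproduct, and \<open>\<phi>\<close> is epic because it restricts to \<open>f\<close>. If
  \<open>h\<close> kills \<open>p2 ** k\<close>, then \<open>h ** p2\<close> is
  \<open>u ** \<phi>\<close> for some \<open>u\<close>; restricting to the first summand gives
  \<open>u ** f\<close> zero, so \<open>u\<close> is zero, and restricting to the second summand
  gives that \<open>h\<close> is zero.\<close>

lemma pullback_epic:
 assumes f: "epic C f" and g: "arr g" "cod g = cod f"
 obtains a b where "arr a" "epic C b" "dom a = dom b" "cod a = dom f" "cod b = dom g"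
  "f ** a = g ** b"
proof -
 have fA: "arr f" using f by simp
 obtain B i1 i2 p1 p2 where B: "B \<in> Ob C" "arr i1" "dom i1 = dom f" "cod i1 = B"
  "arr i2" "dom i2 = dom g" "cod i2 = B" "arr p1" "dom p1 = B" "cod p1 = dom f"
  "arr p2" "dom p2 = B" "cod p2 = dom g"
  "p1 ** i1 = ident C (dom f)" "p2 ** i2 = ident C (dom g)"
  "p1 ** i2 = hzero C (dom g) (dom f)" "p2 ** i1 = hzero C (dom f) (dom g)"
  "(i1 ** p1) \<boxplus> (i2 ** p2) = ident C B"
  using biproductE[of "dom f" "dom g"] fA g(1) by (metis Ob_simps(1))
 define \<phi> where "\<phi> = (f ** p1) \<boxplus> hneg C (g ** p2)"
 have \<phi>: "arr \<phi>" "dom \<phi> = B" "cod \<phi> = cod f" using B fA g by (simp_all add: \<phi>_def)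
 have \<phi>1: "\<phi> ** i1 = f" unfolding \<phi>_def using B fA g
  by simp
 have "epic C \<phi>" using epic_left_factor[of \<phi> i1] \<phi>1 f \<phi> B by simp
 then obtain k where k: "ses C k \<phi>" by (rule epic_ses)
 note kD = sesD[OF k]
 have kA: "arr k" "cod k = B" using kD \<phi> by auto
 have "null C (\<phi> ** k)" by (rule kD)
 hence eq: "f ** (p1 ** k) = g ** (p2 ** k)"
  unfolding \<phi>_def using B fA g kA null_diff_iff[of "f ** (p1 ** k)" "g ** (p2 ** k)"] by simp
 have "epic C (p2 ** k)"
 proof (rule epicI)
  fix h assume h: "arr h" "dom h = cod (p2 ** k)" "null C (h ** (p2 ** k))"
  have h': "dom h = dom g" using h B kA by simp
  have "null C ((h ** p2) ** k)" using h h' B kA by simp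
  then obtain u where u: "arr u" "dom u = cod \<phi>" "cod u = cod (h ** p2)" "u ** \<phi> = h ** p2"
   using ses_over[OF k, of "h ** p2"] h h' B \<phi> by auto
  have tu: "dom u = cod f" "cod u = cod h" using u(1-3) h(1) h' B \<phi> by auto
  have "u ** f = u ** (\<phi> ** i1)" using \<phi>1 by simp
  also have "... = (h ** p2) ** i1" using u \<phi> B by (simp flip: cmp_assoc_Ar)
  also have "... = hzero C (dom f) (cod h)" using h(1) h' B g fA by simp
  finally have "null C (u ** f)" using u(1) h(1) tu fA by (simp add: null_def)
  hence nu: "null C u" using u(1) tu by (auto intro: epicD[OF f])
  have "null C (u ** \<phi>)" by (rule null_cmp_left[OF nu]) (use u(1,2) \<phi> in auto)
  hence n: "null C (h ** p2)" unfolding u(4) .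
  have "null C ((h ** p2) ** i2)" by (rule null_cmp_left[OF n]) (use h(1) h' B in auto)
  thus "null C h" using h(1) h' B by simp
 qed (use B kA in auto)
 thus ?thesis using that[of "p1 ** k" "p2 ** k"] eq B kA by auto
qed

end

section \<open>Subobjects\<close>

context category
begin

lemma subobject_self: "monic C m ==> m \<in> subobject C m"
 by (simp add: subobject_def)

lemma subobject_eq_iff:
 assumes "monic C m" "monic C n" "cod m = cod n"
 shows "subobject C m = subobject C n \<longleftrightarrow> m <~ n & n <~ m"
proof
 assume eq: "subobject C m = subobject C n"
 have "n \<in> subobject C m"
  unfolding eq by (rule subobject_self[OF assms(2)])
 thus "m <~ n & n <~ m" unfolding subobject_def by blast
next
 assume "m <~ n & n <~ m"
 thus "subobject C m = subobject C n"
  unfolding subobject_def using assms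
  by (intro Collect_cong) (auto intro: factors_through_trans)
qed

lemma le_Sub_iff:
 assumes "monic C m" "monic C n" "cod m = X" "cod n = X"
 shows "subobject C m \<sqsubseteq>\<^bsub>Sub C X\<^esub> subobject C n \<longleftrightarrow> m <~ n"
proof
 assume "subobject C m \<sqsubseteq>\<^bsub>Sub C X\<^esub> subobject C n"
 then obtain m' n' where mn: "m' \<in> subobject C m" "n' \<in> subobject C n" "m' <~ n'"
  by (auto simp: Sub_def)
 hence "m <~ m'" "n' <~ n" "arr n'"
  by (simp_all add: subobject_def)
 thus "m <~ n"
  using mn(3) assms by (metis factors_through_trans monic_Ar)
next
 assume "m <~ n"
 thus "subobject C m \<sqsubseteq>\<^bsub>Sub C X\<^esub> subobject C n"
  using subobject_self[OF assms(1)] subobject_self[OF assms(2)] by (auto simp: Sub_def)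
qed

lemma carrier_SubE:
 assumes "A \<in> carrier (Sub C X)"
 obtains m where "monic C m" "cod m = X" "A = subobject C m"
 using assms by (auto simp: Sub_def)

lemma subobject_carrier: "[|monic C m; cod m = X|] ==> subobject C m \<in> carrier (Sub C X)"
 by (auto simp: Sub_def)

lemma eq_Sub [simp]: "eq (Sub C X) = (=)"
 by (simp add: Sub_def)

lemma partial_order_Sub: "partial_order (Sub C X)"
proof
 fix A assume "A \<in> carrier (Sub C X)"
 thus "A \<sqsubseteq>\<^bsub>Sub C X\<^esub> A" by (elim carrier_SubE) (simp add: le_Sub_iff)
next
 fix A B assume "A \<sqsubseteq>\<^bsub>Sub C X\<^esub> B" "B \<sqsubseteq>\<^bsub>Sub C X\<^esub> A" "A \<in> carrier (Sub C X)" "B \<in> carrier (Sub C X)"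
 thus "A .=\<^bsub>Sub C X\<^esub> B"
  by (elim carrier_SubE) (simp add: le_Sub_iff subobject_eq_iff)
next
 fix A B D assume le: "A \<sqsubseteq>\<^bsub>Sub C X\<^esub> B" "B \<sqsubseteq>\<^bsub>Sub C X\<^esub> D"
  and "A \<in> carrier (Sub C X)" "B \<in> carrier (Sub C X)" "D \<in> carrier (Sub C X)"
 then obtain a b d where m: "monic C a" "monic C b" "monic C d" "cod a = X" "cod b = X" "cod d = X"
  and e: "A = subobject C a" "B = subobject C b" "D = subobject C d"
  by (metis carrier_SubE)
 show "A \<sqsubseteq>\<^bsub>Sub C X\<^esub> D"
  using le m unfolding e by (simp add: le_Sub_iff) (metis factors_through_trans monic_Ar)
qed simp_all

end

section \<open>Chain conditions\<close>

context length_category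
begin

text \<open>The hypothesis says that exactly one of the two inclusions holds for each pair of
  indices; this covers strictly ascending and strictly descending sequences at once.\<close>

lemma no_infinite_sequence:
 fixes f :: "nat => 'a"
 assumes X: "X \<in> Ob C" and f: "!!i. monic C (f i)" "!!i. cod (f i) = X"
  and le: "!!i j. i < j ==> (f i <~ f j) ~= (f j <~ f i)"
 shows False
proof -
 have ne: "subobject C (f i) ~= subobject C (f j)" if "i < j" for i j
  using le[OF that] by (simp add: subobject_eq_iff f)
 have "inj (\<lambda>i. subobject C (f i))"
  by (rule injI) (metis ne linorder_neqE_nat)
 hence "infinite (range (\<lambda>i. subobject C (f i)))" by (simp add: finite_image_iff)
 moreover have "finite (range (\<lambda>i. subobject C (f i)))"
 proof (rule finite_chains[OF X])
  show "range (\<lambda>i. subobject C (f i)) \<subseteq> carrier (Sub C X)"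
   using f by (auto intro: subobject_carrier)
 next
  fix A B assume "A \<in> range (\<lambda>i. subobject C (f i))" "B \<in> range (\<lambda>i. subobject C (f i))"
  then obtain i j where ij: "A = subobject C (f i)" "B = subobject C (f j)" by auto
  have "f i <~ f j \<or> f j <~ f i"
   using le[of i j] le[of j i] f(1) by (cases i j rule: linorder_cases) auto
  thus "A \<sqsubseteq>\<^bsub>Sub C X\<^esub> B \<or> B \<sqsubseteq>\<^bsub>Sub C X\<^esub> A"
   unfolding ij using f by (simp add: le_Sub_iff)
 qed
 ultimately show False by simp
qed

lemma minimal_monic:
 assumes X: "X \<in> Ob C" and S: "S ~= {}" "!!m. m \<in> S ==> monic C m & cod m = X"
 shows "\<exists>m \<in> S. \<forall>n \<in> S. n <~ m --> m <~ n"
proof (rule ccontr)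
 assume "~ ?thesis"
 hence *: "\<forall>m\<in>S. \<exists>n\<in>S. n <~ m & ~ m <~ n"
  by blast
 obtain m0 where "m0 \<in> S" using S by blast
 hence "\<exists>f. \<forall>i. f i \<in> S & (f (Suc i) <~ f i & ~ f i <~ f (Suc i))"
  using * by (intro dependent_nat_choice) auto
 then obtain f where f: "!!i. f i \<in> S" "!!i. f (Suc i) <~ f i"
  "!!i. ~ f i <~ f (Suc i)" by blast
 have fA: "arr (f i)" for i using S(2)[OF f(1)] by auto
 have le: "f j <~ f i" if "i \<le> j" for i j
  using that
 proof (induction rule: dec_induct)
  case base
  show ?case using fA by simp
 next
  case (step n)
  show ?case by (rule factors_through_trans[OF f(2) step(3)]) (use fA in simp)
 qed
 have lt: "~ f i <~ f j" if "i < j" for i j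
  using f(3)[of i] le[of "Suc i" j] that fA factors_through_trans[of "f i" "f j" "f (Suc i)"] by auto
 show False
  by (rule no_infinite_sequence[OF X, of f]) (use le lt S(2)[OF f(1)] in auto)
qed

lemma maximal_monic:
 assumes X: "X \<in> Ob C" and S: "S ~= {}" "!!m. m \<in> S ==> monic C m & cod m = X"
 shows "\<exists>m \<in> S. \<forall>n \<in> S. m <~ n --> n <~ m"
proof (rule ccontr)
 assume "~ ?thesis"
 hence *: "\<forall>m\<in>S. \<exists>n\<in>S. m <~ n & ~ n <~ m"
  by blast
 obtain m0 where "m0 \<in> S" using S by blast
 hence "\<exists>f. \<forall>i. f i \<in> S & (f i <~ f (Suc i) & ~ f (Suc i) <~ f i)"
  using * by (intro dependent_nat_choice) auto
 then obtain f where f: "!!i. f i \<in> S" "!!i. f i <~ f (Suc i)"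
  "!!i. ~ f (Suc i) <~ f i" by blast
 have fA: "arr (f i)" for i using S(2)[OF f(1)] by auto
 have le: "f i <~ f j" if "i \<le> j" for i j
  using that
 proof (induction rule: dec_induct)
  case base
  show ?case using fA by simp
 next
  case (step n)
  show ?case by (rule factors_through_trans[OF step(3) f(2)]) (use fA in simp)
 qed
 have lt: "~ f j <~ f i" if "i < j" for i j
  using f(3)[of i] le[of "Suc i" j] that fA factors_through_trans[of "f (Suc i)" "f j" "f i"] by auto
 show False
  by (rule no_infinite_sequence[OF X, of f]) (use le lt S(2)[OF f(1)] in auto)
qed

end

section \<open>Intersections, sums and simple objects\<close>

context abelian_category
begin

text \<open>This turns inclusion of subobjects into the vanishing of a composite, which epimorphisms
  reflect and sums respect. Most inclusions below are proved through it.\<close>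

lemma ses_null_iff:
 assumes "ses C k c" "arr g" "cod g = dom c"
 shows "null C (c ** g) \<longleftrightarrow> g <~ k"
proof
 assume "g <~ k"
 then obtain u where u: "arr u" "dom u = dom g" "cod u = dom k" "k ** u = g"
  by (rule factors_throughE)
 have "null C ((c ** k) ** u)"
  by (rule null_cmp_left) (use sesD[OF assms(1)] u in auto)
 thus "null C (c ** g)" using sesD[OF assms(1)] u by simp
qed (use assms in \<open>auto simp: ses_def\<close>)

lemma epic_factor_cancel:
 assumes m: "monic C m" and p: "epic C p" and g: "arr g" "dom g = cod p" "cod g = cod m"
  and gp: "g ** p <~ m"
 shows "g <~ m"
proof -
 obtain c where c: "ses C m c" using monic_ses[OF m] .
 have "null C (c ** (g ** p))" using gp sesD[OF c] g p by (subst ses_null_iff[OF c]) auto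
 hence "null C ((c ** g) ** p)" using sesD[OF c] g p by simp
 hence "null C (c ** g)" by (rule epicD[OF p, rotated 2]) (use sesD[OF c] g in auto)
 thus ?thesis using sesD[OF c] g by (subst (asm) ses_null_iff[OF c]) auto
qed

text \<open>With \<open>c\<close> the cokernel of \<open>n\<close>, the part of \<open>m\<close>
  lying in \<open>n\<close> is the kernel of \<open>c ** m\<close>.\<close>

lemma intersectionE:
 assumes m: "monic C m" and n: "monic C n" "cod n = cod m"
 obtains w where "monic C w" "cod w = cod m" "w <~ m" "w <~ n"
  "\<forall>v \<in> Ar C. v <~ m --> v <~ n --> v <~ w"
proof -
 obtain c where c: "ses C n c" using monic_ses[OF n(1)] .
 note cD = sesD[OF c]
 have cm: "arr (c ** m)" "dom (c ** m) = dom m" "arr c" "dom c = cod m"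
  using cD m n by auto
 obtain k where k: "monic C k" "cod k = dom (c ** m)" "null C ((c ** m) ** k)"
  "\<forall>g \<in> Ar C. cod g = dom (c ** m) --> null C ((c ** m) ** g) --> g <~ k"
  using kernelE[OF cm(1)] by auto
 have kt: "arr k" "cod k = dom m" using k cm by auto
 show ?thesis
 proof (rule that[of "m ** k"])
  show "monic C (m ** k)" using m k kt by (intro monic_cmp)
  show "cod (m ** k) = cod m" "m ** k <~ m"
   using m kt by (auto intro: factors_through_cmp)
  have "null C (c ** (m ** k))" using k(3) m kt cm by simp
  thus "m ** k <~ n"
   using m kt cm by (subst (asm) ses_null_iff[OF c]) auto
  show "\<forall>v \<in> Ar C. v <~ m --> v <~ n --> v <~ m ** k"
  proof (intro ballI impI)
   fix v assume v: "arr v" "v <~ m" "v <~ n"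
   obtain u where u: "arr u" "dom u = dom v" "cod u = dom m" "m ** u = v"
    using v(2) by (rule factors_throughE)
   have "cod v = dom c" using u m cm by auto
   hence "null C (c ** v)" using v by (subst ses_null_iff[OF c]) auto
   hence "null C ((c ** m) ** u)" using u m cm by simp
   hence "u <~ k" using k(4) u cm by auto
   then obtain w where w: "arr w" "dom w = dom u" "cod w = dom k" "k ** w = u"
    by (rule factors_throughE)
   show "v <~ m ** k"
    using w u(1-3) kt m by (intro factors_throughI[of w]) (auto simp: u(4))
  qed
 qed
qed

text \<open>The arrow \<open>e\<close> is the map from the biproduct with components
  \<open>a\<close> and \<open>b\<close>. Arrows through \<open>e\<close> itself split as sums;
  arrows through its image would first have to be lifted, which is why the image is not taken
  here.\<close>

lemma sumE:
 assumes a: "arr a" and b: "arr b" "cod b = cod a"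
 obtains e where "arr e" "cod e = cod a" "a <~ e" "b <~ e"
  "\<forall>g. g <~ e --> (\<exists>u \<in> Ar C. \<exists>v \<in> Ar C. dom u = dom g & dom v = dom g &
    cod u = dom a & cod v = dom b & g = (a ** u) \<boxplus> (b ** v))"
proof -
 obtain B i1 i2 p1 p2 where B: "B \<in> Ob C" "arr i1" "dom i1 = dom a" "cod i1 = B"
  "arr i2" "dom i2 = dom b" "cod i2 = B" "arr p1" "dom p1 = B" "cod p1 = dom a"
  "arr p2" "dom p2 = B" "cod p2 = dom b"
  "p1 ** i1 = ident C (dom a)" "p2 ** i2 = ident C (dom b)"
  "p1 ** i2 = hzero C (dom b) (dom a)" "p2 ** i1 = hzero C (dom a) (dom b)"
  by (rule biproductE[of "dom a" "dom b"]) (use a b in auto)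
 define e where "e = (a ** p1) \<boxplus> (b ** p2)"
 have e: "arr e" "dom e = B" "cod e = cod a" using B a b by (simp_all add: e_def)
 show ?thesis
 proof (rule that[of e])
  have "e ** i1 = a" "e ** i2 = b" unfolding e_def using B a b by simp_all
  thus "a <~ e" "b <~ e"
   using B e by (auto intro: factors_throughI)
  show "\<forall>g. g <~ e --> (\<exists>u \<in> Ar C. \<exists>v \<in> Ar C. dom u = dom g & dom v = dom g &
    cod u = dom a & cod v = dom b & g = (a ** u) \<boxplus> (b ** v))"
  proof (intro allI impI)
   fix g assume "g <~ e"
   then obtain u where u: "arr u" "dom u = dom g" "cod u = dom e" "e ** u = g"
    by (rule factors_throughE)
   have "g = (a ** (p1 ** u)) \<boxplus> (b ** (p2 ** u))"
    unfolding u(4)[symmetric] e_def using B(1-13) a b u(1-3) e(2) by simp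
   thus "\<exists>u \<in> Ar C. \<exists>v \<in> Ar C. dom u = dom g & dom v = dom g &
    cod u = dom a & cod v = dom b & g = (a ** u) \<boxplus> (b ** v)"
    by (intro bexI[of _ "p1 ** u"] bexI[of _ "p2 ** u"] conjI)
     (use B(1-13) a b u(1-3) e(2) in simp_all)
  qed
 qed (use e in auto)
qed

text \<open>The union is the image of the map from the biproduct. The last clause keeps the
  presentation of the union by \<open>e\<close>, because an arrow into the union splits as a sum
  only after it has been lifted along \<open>p\<close>.\<close>

lemma unionE:
 assumes m: "monic C m" and n: "monic C n" "cod n = cod m"
 obtains w where "monic C w" "cod w = cod m" "m <~ w" "n <~ w"
  "\<forall>v. monic C v --> m <~ v --> n <~ v --> w <~ v"
  "\<exists>p e. epic C p & arr e & e = w ** p & dom w = cod p &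
   (\<forall>g. g <~ e --> (\<exists>u \<in> Ar C. \<exists>v \<in> Ar C. dom u = dom g & dom v = dom g &
    cod u = dom m & cod v = dom n & g = (m ** u) \<boxplus> (n ** v)))"
proof -
 have A: "arr m" "arr n" using m n by auto
 obtain e where e: "arr e" "cod e = cod m" "m <~ e" "n <~ e"
  "\<forall>g. g <~ e --> (\<exists>u \<in> Ar C. \<exists>v \<in> Ar C. dom u = dom g & dom v = dom g &
    cod u = dom m & cod v = dom n & g = (m ** u) \<boxplus> (n ** v))"
  by (rule sumE[OF A n(2)])
 obtain w p where w: "monic C w" "epic C p" "dom p = dom e" "cod p = dom w"
  "cod w = cod e" "w ** p = e"
  by (rule imageE[OF e(1)])
 have ew: "e <~ w" using w by (intro factors_throughI[of p]) auto
 show ?thesis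
 proof (rule that[of w])
  show "m <~ w" "n <~ w"
   using e(3,4) ew w(1) by (auto intro: factors_through_trans)
  show "\<forall>v. monic C v --> m <~ v --> n <~ v --> w <~ v"
  proof (intro allI impI)
   fix v assume v: "monic C v" "m <~ v" "n <~ v"
   have tv: "cod v = cod w"
    using v(1,2) w e A by (metis factors_throughE monic_Ar tgt_cmp)
   obtain c where c: "ses C v c" using monic_ses[OF v(1)] .
   note cD = sesD[OF c]
   have cA: "arr c" "dom c = cod e" using cD tv w by auto
   obtain u1 u2 where u: "arr u1" "arr u2" "dom u1 = dom e" "dom u2 = dom e"
    "cod u1 = dom m" "cod u2 = dom n" "e = (m ** u1) \<boxplus> (n ** u2)"
    using e(5) e(1) factors_through_refl by metis
   have n1: "null C (c ** m)" "null C (c ** n)"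
    using v A n e cA by (simp_all add: ses_null_iff[OF c])
   have n2: "null C ((c ** m) ** u1)"
    by (rule null_cmp_left) (use n1 A u(1-6) cA e(2) n in auto)
   have n3: "null C ((c ** n) ** u2)"
    by (rule null_cmp_left) (use n1 A u(1-6) cA e(2) n in auto)
   have "null C ((c ** (m ** u1)) \<boxplus> (c ** (n ** u2)))"
    by (rule null_hadd) (use n2 n3 A u(1-6) cA e(2) n in auto)
   moreover have "c ** e = (c ** (m ** u1)) \<boxplus> (c ** (n ** u2))"
    using A u(1-6) cA e(2) n by (subst u(7)) simp
   ultimately have "null C (c ** e)" by simp
   hence "e <~ v"
    using ses_null_iff[OF c, of e] cA e(1) by simp
   thus "w <~ v"
    by (intro epic_factor_cancel[of v p w]) (use v w tv in auto)
  qed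
  show "\<exists>p e. epic C p & arr e & e = w ** p & dom w = cod p &
   (\<forall>g. g <~ e --> (\<exists>u \<in> Ar C. \<exists>v \<in> Ar C. dom u = dom g & dom v = dom g &
    cod u = dom m & cod v = dom n & g = (m ** u) \<boxplus> (n ** v)))"
   using e w by metis
 qed (use w e in auto)
qed

text \<open>Half of Schur's lemma: the kernel is not an isomorphism, since then \<open>c\<close>
  would vanish, so its domain is zero.\<close>

lemma simple_monic:
 assumes S: "simple_object C S" and c: "arr c" "dom c = S" "~ null C c"
 shows "monic C c"
proof -
 obtain k where k: "monic C k" "cod k = dom c" "null C (c ** k)"
  "\<forall>g \<in> Ar C. cod g = dom c --> null C (c ** g) --> g <~ k"
  by (rule kernelE[OF c(1)])
 have "~ iso_arrow C k"
  using epicD[of k c] k c by (auto simp: iso_arrow_iff)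
 hence z: "null C (ident C (dom k))"
  using S k c by (auto simp: simple_object_def zero_object_iff)
 have kA: "arr k" using k by simp
 have "null C (k ** ident C (dom k))" by (rule null_cmp_right) (use z kA in auto)
 hence kn: "null C k" using kA by simp
 show ?thesis
 by (metis monicI c(1) k(4) factors_throughE null_cmp_left kn kA)
qed

lemma monic_null_src: "monic C m ==> null C m ==> zero_object C (dom m)"
 using monicD[of m "ident C (dom m)"] by (simp add: zero_object_iff)

text \<open>For a subobject \<open>m\<close> consider its cokernel \<open>d\<close>. If
  \<open>d\<close> is zero then \<open>m\<close> is epic, hence invertible; otherwise
  \<open>d\<close> is monic by hypothesis and kills \<open>m\<close>, so \<open>m\<close> is
  zero.\<close>

lemma simple_objectI:
 assumes S: "S \<in> Ob C" "~ null C (ident C S)"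
  and c: "!!c. [|arr c; dom c = S; ~ null C c|] ==> monic C c"
 shows "simple_object C S"
 unfolding simple_object_def
proof (intro conjI allI impI)
 fix m assume m: "monic C m & cod m = S"
 then obtain d where d: "ses C m d" using monic_ses by blast
 note dD = sesD[OF d]
 show "zero_object C (dom m) \<or> iso_arrow C m"
 proof (cases "null C d")
  case True
  have "epic C m"
  proof (rule epicI)
   fix h assume h: "arr h" "dom h = cod m" "null C (h ** m)"
   obtain u where u: "arr u" "dom u = cod d" "u ** d = h"
    by (rule ses_over[OF d h(1)]) (use h dD in auto)
   have "null C (u ** d)" by (rule null_cmp_right[OF True]) (use u dD in auto)
   thus "null C h" using u by simp
  qed (use m in auto)
  thus ?thesis using m by (simp add: iso_arrow_iff)
 next
  case False
  hence "monic C d" using m dD by (intro c) auto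
  hence "null C m" by (rule monicD) (use dD m in auto)
  thus ?thesis using m monic_null_src by blast
 qed
qed (use S in \<open>auto simp: zero_object_iff\<close>)

lemma simple_epic:
 assumes S: "simple_object C S" and f: "arr f" "cod f = S" "~ null C f"
 shows "epic C f"
by (metis epicI f(1) ccontr simple_monic S f monicD)

end

context length_category
begin

text \<open>A maximal image of a family of arrows that is directed with respect to \<open>\<Phi>\<close>: the substitute
 for finite generation.\<close>

lemma noetherian:
 assumes X: "X \<in> Ob C" and Q: "Q ~= {}" "!!e. e \<in> Q ==> arr e & cod e = X"
  and dir: "!!e f. e \<in> Q ==> f \<in> \<Phi> ==> \<exists>e' \<in> Q. e <~ e' & f <~ e'"
 obtains m p where "m ** p \<in> Q" "monic C m" "epic C p" "cod p = dom m" "cod m = X"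
  "!!f. f \<in> \<Phi> ==> f <~ m"
proof -
 \<comment> \<open>The arrows in \<open>Q\<close> need not be monic, so the chain condition is
   applied to their images.\<close>
 define S where "S = {m. monic C m & cod m = X & (\<exists>p. epic C p & cod p = dom m & m ** p \<in> Q)}"
 have im: "\<exists>m \<in> S. \<exists>p. epic C p & cod p = dom m & m ** p = e" if "e \<in> Q" for e
 proof -
  have "arr e" "cod e = X" using Q that by auto
  then obtain m p where "monic C m" "epic C p" "cod p = dom m" "cod m = X" "m ** p = e"
   using imageE by metis
  thus ?thesis using that unfolding S_def by blast
 qed
 hence "S ~= {}" using Q(1) by blast
 moreover have "monic C m & cod m = X" if "m \<in> S" for m using that by (simp add: S_def)
 ultimately obtain m where m: "m \<in> S" "!!n. n \<in> S ==> m <~ n ==> n <~ m"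
  using maximal_monic[OF X, of S] by metis
 then obtain p where p: "epic C p" "cod p = dom m" "m ** p \<in> Q" and mm: "monic C m" "cod m = X"
  unfolding S_def by blast
 have "f <~ m" if f: "f \<in> \<Phi>" for f
 proof -
  obtain e' where e': "e' \<in> Q" "m ** p <~ e'" "f <~ e'"
   using dir[OF p(3) f] by blast
  obtain n p' where n: "n \<in> S" "epic C p'" "cod p' = dom n" "n ** p' = e'"
   using im[OF e'(1)] by blast
  have nm: "monic C n" "cod n = X" using n by (auto simp: S_def)
  have en: "e' <~ n" using n nm factors_through_cmp[of n p'] by auto
  have "m ** p <~ n" using e'(2) en nm factors_through_trans by auto
  hence "m <~ n"
   by (rule epic_factor_cancel[rotated 5]) (use p mm nm in auto)
  hence "n <~ m" using m(2) n by blast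
  thus ?thesis using e'(3) en nm mm factors_through_trans by (metis monic_Ar)
 qed
 thus ?thesis using that p mm by blast
qed

end

section \<open>Local objects\<close>

text \<open>An epimorphism \<open>q\<close> onto a simple object whose kernel contains every proper subobject of its
 domain; an object is local if it is the domain of such a \<open>q\<close>.\<close>

definition top_map :: "('o, 'a, 'm) preadditive_scheme => 'a => bool" where
 "top_map C q \<longleftrightarrow> epic C q & ~ null C q &
  (\<forall>g \<in> Ar C. src C g = src C q --> ~ null C g -->
    (\<forall>k \<in> Ar C. tgt C k = src C q --> null C (g \<bullet>\<^bsub>C\<^esub> k) --> null C (q \<bullet>\<^bsub>C\<^esub> k)))"

context abelian_category
begin

lemma top_mapD:
 assumes "top_map C q"
 shows "epic C q" "arr q" "~ null C q"
  "[|arr g; dom g = dom q; ~ null C g; arr k; cod k = dom q; null C (g ** k)|]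
   ==> null C (q ** k)"
 using assms by (auto simp: top_map_def)

lemma top_map_epic:
 assumes q: "top_map C q" and f: "arr f" "cod f = dom q" "~ null C (q ** f)"
 shows "epic C f"
by (metis ccontr not_epicE f(1) top_mapD(4) q f)

text \<open>Let \<open>c\<close> be a nonzero arrow out of the top and \<open>k\<close> an arrow
  killed by \<open>c\<close>. After a pullback \<open>k\<close> lifts along \<open>q\<close> to an
  arrow killed by the nonzero \<open>c ** q\<close>, hence killed by \<open>q\<close>; so
  \<open>k\<close> is zero.\<close>

lemma top_map_simple:
 assumes q: "top_map C q"
 shows "simple_object C (cod q)"
proof (rule simple_objectI)
 note qD = top_mapD[OF q]
 show "cod q \<in> Ob C" using qD by auto
 show "~ null C (ident C (cod q))"
 proof
  assume n: "null C (ident C (cod q))"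
  have "null C (ident C (cod q) ** q)" by (rule null_cmp_left[OF n]) (use qD in auto)
  thus False using qD by simp
 qed
 fix c assume c: "arr c" "dom c = cod q" "~ null C c"
 show "monic C c"
 proof (rule monicI[OF c(1)])
  fix k assume k: "arr k" "cod k = dom c" "null C (c ** k)"
  obtain a b where ab: "arr a" "epic C b" "dom a = dom b" "cod a = dom q" "cod b = dom k"
   "q ** a = k ** b"
   by (rule pullback_epic[OF qD(1), of k]) (use k c in auto)
  have "null C ((c ** k) ** b)" by (rule null_cmp_left) (use k c ab in auto)
  hence "null C ((c ** q) ** a)" using k c ab(1-5) qD(2) by (simp add: ab(6))
  moreover have "~ null C (c ** q)"
  by (metis epicD qD(1) c)
  ultimately have "null C (q ** a)"
   by (intro qD(4)[of "c ** q" a]) (use c qD(2) ab in auto)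
  hence "null C (k ** b)" using ab by simp
  thus "null C k" by (rule epicD[OF ab(2), rotated 2]) (use k ab in auto)
 qed
qed

text \<open>The definition of a top map, applied to \<open>e\<close> and its kernel, shows that
  \<open>q\<close> kills this kernel and so descends. Thus nonzero quotients of a local object are
  local with the same top.\<close>

lemma top_map_over:
 assumes q: "top_map C q" and e: "epic C e" "dom e = dom q" "~ null C e"
 obtains q' where "arr q'" "dom q' = cod e" "cod q' = cod q" "q' ** e = q" "top_map C q'"
proof -
 note qD = top_mapD[OF q]
 obtain k where k: "ses C k e" using epic_ses[OF e(1)] .
 note kD = sesD[OF k]
 have "null C (q ** k)" by (rule qD(4)[of e]) (use kD e in auto)
 then obtain q' where q': "arr q'" "dom q' = cod e" "cod q' = cod q" "q' ** e = q"
  using ses_over[OF k, of q] qD e by auto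
 have eA: "arr e" using e by simp
 have "top_map C q'"
  unfolding top_map_def
 proof (intro conjI ballI impI)
  show "epic C q'" by (rule epic_left_factor[of q' e]) (use q' qD e in auto)
  show "~ null C q'"
  by (metis null_cmp_left q' eA qD)
  fix g k assume g: "arr g" "dom g = dom q'" "~ null C g"
   and k: "arr k" "cod k = dom q'" "null C (g ** k)"
  obtain a b where ab: "arr a" "epic C b" "dom a = dom b" "cod a = dom e" "cod b = dom k"
   "e ** a = k ** b"
   by (rule pullback_epic[OF e(1), of k]) (use k q' in auto)
  have bA: "arr b" using ab by simp
  have "null C ((g ** k) ** b)" by (rule null_cmp_left) (use k g ab in auto)
  hence n1: "null C ((g ** e) ** a)" using k g ab(1-5) eA bA q'(1-3) by (simp add: ab(6))
  have n2: "~ null C (g ** e)"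
  by (metis epicD e(1) g q')
  have "null C (q ** a)"
   by (rule qD(4)[of "g ** e" a]) (use n1 n2 g eA q'(1-3) ab e in auto)
  moreover have "q' ** (e ** a) = q ** a"
   by (rule cmp_reduce[OF q'(4)]) (use q'(1-3) eA ab e in auto)
  ultimately have "null C (q' ** (e ** a))" by simp
  hence "null C ((q' ** k) ** b)" using k q'(1-3) ab(1-5) bA by (simp add: ab(6))
  thus "null C (q' ** k)" by (rule epicD[OF ab(2), rotated 2]) (use k q' ab in auto)
 qed
 thus ?thesis using that q' by blast
qed

text \<open>The arrow by which \<open>q\<close> descends along \<open>s\<close> is a nonzero
  epimorphism out of a simple object.\<close>

lemma top_map_same:
 assumes q: "top_map C q" and s: "epic C s" "dom s = dom q" "~ null C s" "simple_object C (cod s)"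
 obtains h where "iso_arrow C h" "dom h = cod s" "cod h = cod q" "h ** s = q"
by (metis top_map_over q s(1,2,3) simple_monic s(4) top_mapD iso_arrow_iff that)

end

context length_category
begin

text \<open>Choose \<open>u\<close> minimal among the subobjects of the domain that \<open>f\<close>
  still maps onto its codomain. An arrow \<open>k\<close> into it with
  \<open>q ** (f ** (u ** k))\<close> nonzero makes \<open>f ** (u ** k)\<close> epic, so the image
  of \<open>k\<close> is another candidate and by minimality all of the domain of \<open>u\<close>.
  Hence \<open>u\<close> is local with top map induced by \<open>q\<close>.\<close>

lemma top_map_cover:
 assumes f: "epic C f" and q: "top_map C q" "dom q = cod f"
 obtains u where "monic C u" "cod u = dom f" "epic C (f ** u)" "top_map C (q ** (f ** u))"
proof -
 note qD = top_mapD[OF q(1)]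
 have fA: "arr f" using f by simp
 define S where "S = {u. monic C u & cod u = dom f & epic C (f ** u)}"
 have "ident C (dom f) \<in> S" using f by (simp add: S_def)
 hence "S ~= {}" by blast
 moreover have "monic C m & cod m = dom f" if "m \<in> S" for m using that by (simp add: S_def)
 moreover have "dom f \<in> Ob C" using fA by simp
 ultimately obtain u where u: "u \<in> S" "!!n. n \<in> S ==> n <~ u ==> u <~ n"
  using minimal_monic[of "dom f" S] by metis
 have um: "monic C u" "cod u = dom f" "epic C (f ** u)" "arr u" using u by (auto simp: S_def)
 have "top_map C (q ** (f ** u))"
  unfolding top_map_def
 proof (intro conjI ballI impI)
  show "epic C (q ** (f ** u))" by (rule epic_cmp) (use um qD q fA in auto)
  show "~ null C (q ** (f ** u))"
  proof
   assume "null C (q ** (f ** u))"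
   hence "null C q" by (rule epicD[OF um(3), rotated 2]) (use qD(2) q(2) fA um in auto)
   thus False using qD(3) by simp
  qed
  fix g k assume g: "arr g" "dom g = dom (q ** (f ** u))" "~ null C g"
   and k: "arr k" "cod k = dom (q ** (f ** u))" "null C (g ** k)"
  have t: "dom (q ** (f ** u)) = dom u" using um fA qD q by simp
  show "null C ((q ** (f ** u)) ** k)"
  proof (rule ccontr)
   assume n: "~ null C ((q ** (f ** u)) ** k)"
   have ep: "epic C (f ** (u ** k))"
    by (rule top_map_epic[OF q(1)]) (use n k t um fA qD q in auto)
   obtain m e where m: "monic C m" "epic C e" "dom e = dom k" "cod e = dom m"
    "cod m = cod k" "m ** e = k" by (rule imageE[OF k(1)])
   have mA: "arr m" "arr e" using m by auto
   have "f ** (u ** k) = (f ** (u ** m)) ** e"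
    using mA m(3-5) um fA k(2) t by (simp add: m(6))
   hence "epic C (f ** (u ** m))"
    using ep by (intro epic_left_factor[of "f ** (u ** m)" e]) (use mA m um fA k t in auto)
   moreover have "monic C (u ** m)" by (rule monic_cmp) (use um m k t in auto)
   ultimately have "u ** m \<in> S" using um m mA k(2) t by (simp add: S_def)
   hence "u <~ u ** m"
    using um mA m(5) k(2) t by (intro u(2)) (auto intro: factors_through_cmp)
   then obtain v where v: "arr v" "dom v = dom u" "cod v = dom (u ** m)" "(u ** m) ** v = u"
    by (rule factors_throughE)
   have tm: "cod m = dom u" using m(5) k(2) t by simp
   have tv: "cod v = dom m" using v um mA tm by simp
   have "u ** (m ** v) = u ** ident C (dom u)" using v um mA tm tv by simp
   hence "m ** v = ident C (dom u)"
    using v(1,2) um mA tm tv by (subst (asm) monic_cmp_iff) auto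
   hence "epic C m" using epic_left_factor[of m v] v(1) tv mA um by simp
   hence "epic C k" using epic_cmp[of m e] m by simp
   hence "null C g" by (rule epicD) (use g k t in auto)
   thus False using g by simp
  qed
 qed
 thus ?thesis using that um by blast
qed

text \<open>A subobject \<open>l\<close> minimal among those on which \<open>g\<close> does not
  vanish is local; its top map is the epic part of the image factorisation of
  \<open>g ** l\<close>.\<close>

lemma local_subobject:
 assumes g: "arr g" "~ null C g"
 obtains l q where "monic C l" "cod l = dom g" "~ null C (g ** l)" "top_map C q" "dom q = dom l"
proof -
 define S where "S = {l. monic C l & cod l = dom g & ~ null C (g ** l)}"
 have "ident C (dom g) \<in> S" using g by (simp add: S_def)
 hence "S ~= {}" by blast
 moreover have "monic C m & cod m = dom g" if "m \<in> S" for m using that by (simp add: S_def)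
 moreover have "dom g \<in> Ob C" using g by simp
 ultimately obtain l where l: "l \<in> S" "!!n. n \<in> S ==> n <~ l ==> l <~ n"
  using minimal_monic[of "dom g" S] by metis
 have lm: "monic C l" "cod l = dom g" "~ null C (g ** l)" "arr l" using l by (auto simp: S_def)
 have gl: "arr (g ** l)" "dom (g ** l) = dom l" using lm g by auto
 obtain m q where m: "monic C m" "epic C q" "dom q = dom (g ** l)" "cod q = dom m"
    "cod m = cod (g ** l)" "m ** q = g ** l" by (rule imageE[OF gl(1)])
 have mA: "arr m" "arr q" "dom q = dom l" using m gl by auto
 have "top_map C q"
  unfolding top_map_def
 proof (intro conjI ballI impI)
  show "epic C q" by fact
  show "~ null C q"
  by (metis null_cmp_right mA m lm)
  fix h k assume h: "arr h" "dom h = dom q" "~ null C h"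
   and k: "arr k" "cod k = dom q" "null C (h ** k)"
  show "null C (q ** k)"
  proof (rule ccontr)
   assume n: "~ null C (q ** k)"
   have n': "~ null C (g ** (l ** k))"
   proof
    assume "null C (g ** (l ** k))"
    moreover have "g ** (l ** k) = m ** (q ** k)"
     using lm g k mA m(4) by (simp flip: cmp_assoc_Ar add: m(6))
    ultimately have "null C (m ** (q ** k))" by simp
    hence "null C (q ** k)" by (rule monicD[OF m(1), rotated 2]) (use k mA m in auto)
    thus False using n by simp
   qed
   obtain w e where w: "monic C w" "epic C e" "dom e = dom k" "cod e = dom w"
    "cod w = cod k" "w ** e = k" by (rule imageE[OF k(1)])
   have wA: "arr w" "arr e" "cod w = dom l" using w k mA by auto
   have "~ null C (g ** (l ** w))"
   proof
    assume nn: "null C (g ** (l ** w))"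
    have "null C ((g ** (l ** w)) ** e)" by (rule null_cmp_left[OF nn]) (use wA w g lm in auto)
    thus False using n' wA w(4) g lm by (simp add: w(6))
   qed
   moreover have "monic C (l ** w)" by (rule monic_cmp) (use lm w wA in auto)
   ultimately have "l ** w \<in> S" using lm wA by (simp add: S_def)
   hence "l <~ l ** w"
    using lm wA by (intro l(2)) (auto intro: factors_through_cmp)
   then obtain v where v: "arr v" "dom v = dom l" "cod v = dom (l ** w)" "(l ** w) ** v = l"
    by (rule factors_throughE)
   have tv: "cod v = dom w" using v lm wA by simp
   have "l ** (w ** v) = l ** ident C (dom l)" using v lm wA tv by simp
   hence "w ** v = ident C (dom l)"
    using v(1,2) lm wA tv by (subst (asm) monic_cmp_iff) auto
   hence "epic C w" using epic_left_factor[of w v] v(1) tv wA lm by simp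
   hence "epic C k" using epic_cmp[of w e] w by simp
   hence "null C h" by (rule epicD) (use h k in auto)
   thus False using h by simp
  qed
 qed
 thus ?thesis using that lm mA by blast
qed

end

section \<open>Cancellation rules for factorisations\<close>

context abelian_category
begin

lemma monic_null_iff:
 "[|monic C m; arr g; cod g = dom m|] ==> null C (m ** g) \<longleftrightarrow> null C g"
 by (metis monicD monic_Ar null_cmp_right)

lemma epic_null_iff:
 "[|epic C e; arr h; dom h = cod e|] ==> null C (h ** e) \<longleftrightarrow> null C h"
 by (metis epicD epic_Ar null_cmp_left)

lemma factors_through_mono:
 assumes "arr w" "arr n" "cod n = dom w" "g <~ n"
 shows "w ** g <~ w ** n"
proof -
 obtain u where "arr u" "dom u = dom g" "cod u = dom n" "n ** u = g"
  using assms(4) by (rule factors_throughE)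
 thus ?thesis using assms(1-3) by (intro factors_throughI[of u]) auto
qed

lemma factors_through_cancel:
 assumes "monic C w" "arr n" "cod n = dom w" "arr g" "cod g = dom w"
  "w ** g <~ w ** n"
 shows "g <~ n"
proof -
 have wA: "arr w" using assms(1) by simp
 obtain u where u: "arr u" "dom u = dom (w ** g)" "cod u = dom (w ** n)" "(w ** n) ** u = w ** g"
  using assms(6) by (rule factors_throughE)
 have t: "dom u = dom g" "cod u = dom n" using u assms wA by auto
 have "w ** (n ** u) = w ** g" using u(1,4) t assms(2-5) wA by simp
 hence "n ** u = g" using u(1) t assms by (subst (asm) monic_cmp_iff) auto
 thus ?thesis using u(1) t by (intro factors_throughI)
qed

text \<open>Cancelling the monic \<open>m\<close> gives a right inverse of \<open>f\<close>. This is
  the form in which two mutually contained subobjects are seen to have isomorphic domains.\<close>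

lemma factors_through_epic:
 assumes "monic C m" "arr f" "cod f = dom m" "monic C f" "m <~ m ** f"
 shows "epic C f"
proof -
 have mA: "arr m" using assms by simp
 have "ident C (dom m) <~ f"
  by (rule factors_through_cancel[OF assms(1)]) (use assms mA in auto)
 then obtain u where "arr u" "dom u = dom m" "cod u = dom f" "f ** u = ident C (dom m)"
  using mA by (auto elim: factors_throughE)
 thus ?thesis using epic_left_factor[of f u] assms mA by simp
qed

lemma epic_factors_through:
 assumes "monic C f" "epic C f" "arr g" "cod g = cod f" shows "g <~ f"
proof -
 have "iso_arrow C f" using assms iso_arrow_iff by blast
 then obtain h where h: "arr f" "arr h" "dom h = cod f" "cod h = dom f"
  "f ** h = ident C (cod f)" by (elim iso_arrowE)
 show ?thesis
  by (rule factors_throughI[of "h ** g"]) (use h assms in \<open>simp_all add: cmp_reduce[OF h(5)]\<close>)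
qed

section \<open>The lattice of subobjects\<close>

lemma least_UpperI_Sub:
 assumes m: "monic C m" "cod m = X" and n: "monic C n" "cod n = X" and w: "monic C w" "cod w = X"
  and mw: "m <~ w" and nw: "n <~ w"
  and l: "!!v. [|monic C v; cod v = X; m <~ v; n <~ v|]
   ==> w <~ v"
 shows "least (Sub C X) (subobject C w) (Upper (Sub C X) {subobject C m, subobject C n})"
 unfolding least_def
proof (intro conjI ballI)
 show "Upper (Sub C X) {subobject C m, subobject C n} \<subseteq> carrier (Sub C X)" by simp
 have car: "subobject C m \<in> carrier (Sub C X)" "subobject C n \<in> carrier (Sub C X)"
  "subobject C w \<in> carrier (Sub C X)"
  using m n w by (blast intro: subobject_carrier)+
 have "subobject C m \<sqsubseteq>\<^bsub>Sub C X\<^esub> subobject C w" "subobject C n \<sqsubseteq>\<^bsub>Sub C X\<^esub> subobject C w"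
  using mw nw le_Sub_iff[OF m(1) w(1) m(2) w(2)] le_Sub_iff[OF n(1) w(1) n(2) w(2)] by blast+
 thus "subobject C w \<in> Upper (Sub C X) {subobject C m, subobject C n}"
  using car unfolding Upper_def by blast
 fix V assume V: "V \<in> Upper (Sub C X) {subobject C m, subobject C n}"
 hence "V \<in> carrier (Sub C X)" by (simp add: Upper_def)
 then obtain v where v: "monic C v" "cod v = X" "V = subobject C v" by (rule carrier_SubE)
 have "subobject C m \<sqsubseteq>\<^bsub>Sub C X\<^esub> V" "subobject C n \<sqsubseteq>\<^bsub>Sub C X\<^esub> V"
  using V car unfolding Upper_def by blast+
 hence "m <~ v" "n <~ v"
  using le_Sub_iff[OF m(1) v(1) m(2) v(2)] le_Sub_iff[OF n(1) v(1) n(2) v(2)] v(3) by blast+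
 thus "subobject C w \<sqsubseteq>\<^bsub>Sub C X\<^esub> V"
  using l[OF v(1,2)] le_Sub_iff[OF w(1) v(1) w(2) v(2)] v(3) by blast
qed

lemma join_SubI:
 assumes "monic C m" "cod m = X" "monic C n" "cod n = X" "monic C w" "cod w = X"
  "m <~ w" "n <~ w"
  "!!v. [|monic C v; cod v = X; m <~ v; n <~ v|]
   ==> w <~ v"
 shows "subobject C m \<squnion>\<^bsub>Sub C X\<^esub> subobject C n = subobject C w"
proof -
 interpret partial_order "Sub C X" by (rule partial_order_Sub)
 have l: "least (Sub C X) (subobject C w) (Upper (Sub C X) {subobject C m, subobject C n})"
  by (rule least_UpperI_Sub) (use assms in blast)+
 show ?thesis unfolding join_def sup_def
  by (rule some_equality[of _ "subobject C w"]) (rule l, rule least_unique[OF _ l])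
qed

lemma lattice_Sub: "lattice (Sub C X)"
proof -
 interpret partial_order "Sub C X" by (rule partial_order_Sub)
 show ?thesis
 proof
  fix A B assume "A \<in> carrier (Sub C X)" "B \<in> carrier (Sub C X)"
  then obtain m n where mn: "monic C m" "cod m = X" "A = subobject C m"
   "monic C n" "cod n = X" "B = subobject C n" by (metis carrier_SubE)
  obtain w where w: "monic C w" "cod w = cod m" "m <~ w" "n <~ w"
   "\<forall>v. monic C v --> m <~ v --> n <~ v --> w <~ v"
   by (rule unionE[of m n]) (use mn in auto)
  have "least (Sub C X) (subobject C w) (Upper (Sub C X) {A, B})"
   unfolding mn(3,6) by (rule least_UpperI_Sub) (use mn w in auto)
  thus "\<exists>s. least (Sub C X) s (Upper (Sub C X) {A, B})" by blast
  obtain w where w: "monic C w" "cod w = cod m" "w <~ m" "w <~ n"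
   "\<forall>v \<in> Ar C. v <~ m --> v <~ n --> v <~ w"
   by (rule intersectionE[of m n]) (use mn in auto)
  have "greatest (Sub C X) (subobject C w) (Lower (Sub C X) {A, B})"
   unfolding greatest_def
  proof (intro conjI ballI)
   show "Lower (Sub C X) {A, B} \<subseteq> carrier (Sub C X)" by simp
   have car: "A \<in> carrier (Sub C X)" "B \<in> carrier (Sub C X)" "subobject C w \<in> carrier (Sub C X)"
    using mn w by (blast intro: subobject_carrier)+
   have tw: "cod w = X" using w mn by simp
   have "subobject C w \<sqsubseteq>\<^bsub>Sub C X\<^esub> A" "subobject C w \<sqsubseteq>\<^bsub>Sub C X\<^esub> B"
    using w(3,4) le_Sub_iff[OF w(1) mn(1) tw mn(2)] le_Sub_iff[OF w(1) mn(4) tw mn(5)] mn(3,6) by blast+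
   thus "subobject C w \<in> Lower (Sub C X) {A, B}" using car unfolding Lower_def by blast
   fix V assume V: "V \<in> Lower (Sub C X) {A, B}"
   hence "V \<in> carrier (Sub C X)" by (simp add: Lower_def)
   then obtain v where v: "monic C v" "cod v = X" "V = subobject C v" by (rule carrier_SubE)
   have "V \<sqsubseteq>\<^bsub>Sub C X\<^esub> A" "V \<sqsubseteq>\<^bsub>Sub C X\<^esub> B"
    using V car unfolding Lower_def by blast+
   hence "v <~ m" "v <~ n"
    using le_Sub_iff[OF v(1) mn(1) v(2) mn(2)] le_Sub_iff[OF v(1) mn(4) v(2) mn(5)] v(3) mn(3,6) by blast+
   thus "V \<sqsubseteq>\<^bsub>Sub C X\<^esub> subobject C w"
    using w(5) v(1,3) le_Sub_iff[OF v(1) w(1) v(2) tw] by simp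
  qed
  thus "\<exists>s. greatest (Sub C X) s (Lower (Sub C X) {A, B})" by blast
 qed
qed

lemma zero_monicE:
 assumes "X \<in> Ob C" obtains z where "monic C z" "cod z = X" "null C z"
proof -
 obtain z where z: "monic C z" "cod z = dom (ident C X)" "null C (ident C X ** z)"
  by (rule kernelE[of "ident C X"]) (use assms in auto)
 thus ?thesis using that[of z] assms by simp
qed

lemma null_factors_through:
 assumes "null C f" "arr m" "arr f" "cod f = cod m" shows "f <~ m"
 using assms by (intro factors_throughI[of "hzero C (dom f) (dom m)"]) (auto simp: null_def)

lemma bottom_Sub:
 assumes m: "monic C m" "cod m = X"
 shows "subobject C m = \<bottom>\<^bsub>Sub C X\<^esub> \<longleftrightarrow> null C m"
proof -
 interpret partial_order "Sub C X" by (rule partial_order_Sub)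
 obtain z where z: "monic C z" "cod z = X" "null C z"
  using zero_monicE[of X] m by (metis Ob_simps(2) monic_Ar)
 have l: "least (Sub C X) (subobject C z) (carrier (Sub C X))"
  unfolding least_def
 proof (intro conjI ballI)
  fix V assume "V \<in> carrier (Sub C X)"
  then obtain v where v: "monic C v" "cod v = X" "V = subobject C v" by (rule carrier_SubE)
  thus "subobject C z \<sqsubseteq>\<^bsub>Sub C X\<^esub> V"
   using z by (simp add: le_Sub_iff null_factors_through)
 qed (use z in \<open>auto intro: subobject_carrier\<close>)
 have bot: "\<bottom>\<^bsub>Sub C X\<^esub> = subobject C z"
  unfolding bottom_def by (rule some_equality[of _ "subobject C z"]) (rule l, rule least_unique[OF _ l])
 have "null C m" if le: "m <~ z"
 proof -
  obtain u where u: "arr u" "dom u = dom m" "cod u = dom z" "z ** u = m"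
   using le by (rule factors_throughE)
  have "null C (z ** u)" by (rule null_cmp_left[OF z(3)]) (use u z in auto)
  thus ?thesis using u by simp
 qed
 moreover have "m <~ z & z <~ m" if "null C m"
  using that m z null_factors_through by auto
 moreover have "cod m = cod z" using m z by simp
 ultimately show ?thesis unfolding bot using subobject_eq_iff[OF m(1) z(1)] by blast
qed

end

context length_category
begin

text \<open>For a join-irreducible \<open>m\<close>, take a maximal proper subobject
  \<open>n\<close> of its domain and let \<open>q\<close> be its cokernel. The kernel of a nonzero
  arrow lies in \<open>n\<close>, for otherwise \<open>n\<close> and this kernel would have the
  whole domain as their sum and \<open>m\<close> would be a join of two proper subobjects.
  Conversely, all proper subobjects of a local object lie in the kernel of its top map, and so do
  their joins.\<close>

lemma join_irreducible_iff:
 assumes m: "monic C m" "cod m = M"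
 shows "join_irreducible (Sub C M) (subobject C m) \<longleftrightarrow> (\<exists>q. top_map C q & dom q = dom m)"
proof
 have mA: "arr m" using m by simp
 assume ji: "join_irreducible (Sub C M) (subobject C m)"
 hence nm: "~ null C m" using bottom_Sub[OF m] by (simp add: join_irreducible_def)
 define S where "S = {n. monic C n & cod n = dom m & ~ epic C n}"
 obtain z where z: "monic C z" "cod z = dom m" "null C z"
  using zero_monicE[of "dom m"] mA by auto
 have "~ epic C z"
 proof
  assume e: "epic C z"
  have "null C (m ** z)" by (rule null_cmp_right[OF z(3)]) (use z mA in auto)
  thus False using epic_null_iff[OF e mA] z nm by simp
 qed
 hence "S ~= {}" using z by (auto simp: S_def)
 moreover have "monic C n & cod n = dom m" if "n \<in> S" for n using that by (simp add: S_def)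
 ultimately obtain n where n: "n \<in> S" "!!k. k \<in> S ==> n <~ k ==> k <~ n"
  using maximal_monic[of "dom m" S] mA by (metis Ob_simps(1))
 have nn: "monic C n" "arr n" "cod n = dom m" "~ epic C n" using n by (auto simp: S_def)
 obtain q where q: "ses C n q" using monic_ses nn by blast
 note qD = sesD[OF q]
 have qA: "arr q" "dom q = dom m" using qD nn by auto
 have "top_map C q"
  unfolding top_map_def
 proof (intro conjI ballI impI)
  show "epic C q" by (rule qD)
  show "~ null C q"
  by (metis ses_over q qD null_cmp_right qA nn epicI)
  fix g k assume g: "arr g" "dom g = dom q" "~ null C g"
   and k: "arr k" "cod k = dom q" "null C (g ** k)"
  obtain k0 where k0: "monic C k0" "cod k0 = dom g" "null C (g ** k0)"
   "\<forall>h \<in> Ar C. cod h = dom g --> null C (g ** h) --> h <~ k0"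
   by (rule kernelE[OF g(1)])
  have k0A: "arr k0" "cod k0 = dom m" using k0 g qA by auto
  have k0e: "~ epic C k0"
  proof
   assume "epic C k0"
   hence "null C g" by (rule epicD) (use g k0 in auto)
   thus False using g by simp
  qed
  obtain w where w: "monic C w" "cod w = cod n" "n <~ w" "k0 <~ w"
   "\<forall>v. monic C v --> n <~ v --> k0 <~ v --> w <~ v"
   by (rule unionE[of n k0]) (use nn k0 k0A in auto)
  have wA: "arr w" "cod w = dom m" using w nn by auto
  have "~ epic C w"
  proof
   assume we: "epic C w"
   have mon: "monic C (m ** n)" "monic C (m ** k0)"
    using m nn k0 k0A by (auto intro: monic_cmp)
   \<comment> \<open>An upper bound \<open>v\<close> of the two pieces has a cokernel
     \<open>c\<close> that kills both. The kernel \<open>K\<close> of \<open>c ** m\<close> then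
     lies above \<open>n\<close> and \<open>k0\<close>, hence above the epic \<open>w\<close>, so
     \<open>c ** m\<close> is zero.\<close>
   have "subobject C (m ** n) \<squnion>\<^bsub>Sub C M\<^esub> subobject C (m ** k0) = subobject C m"
   proof (rule join_SubI)
    show "m ** n <~ m" "m ** k0 <~ m"
     using mA nn k0A by (auto intro: factors_through_cmp)
    fix v assume v: "monic C v" "cod v = M" "m ** n <~ v"
     "m ** k0 <~ v"
    obtain c where c: "ses C v c" using monic_ses[OF v(1)] .
    note cD = sesD[OF c]
    have cA: "arr c" "dom c = cod m" using cD v m by auto
    have cm: "arr (c ** m)" "dom (c ** m) = dom m" using cA mA by auto
    have "null C (c ** (m ** n))" "null C (c ** (m ** k0))"
     using ses_null_iff[OF c, of "m ** n"] ses_null_iff[OF c, of "m ** k0"] v cA mA nn(2,3) k0A by simp_all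
    hence n1: "null C ((c ** m) ** n)" "null C ((c ** m) ** k0)"
     using cA mA nn(2,3) k0A by simp_all
    obtain K where K: "monic C K" "cod K = dom (c ** m)" "null C ((c ** m) ** K)"
     "\<forall>h \<in> Ar C. cod h = dom (c ** m) --> null C ((c ** m) ** h) --> h <~ K"
     by (rule kernelE[OF cm(1)])
    have "n <~ K" "k0 <~ K"
     using K(4) n1 cm nn k0A by auto
    hence "w <~ K" using w(5) K(1) by blast
    then obtain u where u: "arr u" "cod u = dom K" "K ** u = w" by (rule factors_throughE)
    have KA: "arr K" "cod K = dom m" using K cm by auto
    have "null C (((c ** m) ** K) ** u)" by (rule null_cmp_left[OF K(3)]) (use u KA cm in auto)
    hence "null C ((c ** m) ** w)"
     using cm u(1,2) KA unfolding u(3)[symmetric] by simp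
    hence "null C (c ** m)" using epic_null_iff[OF we cm(1)] cm wA by simp
    thus "m <~ v" using ses_null_iff[OF c mA] cA by simp
   qed (use m mA nn k0A mon in auto)
   hence "subobject C m = subobject C (m ** n) \<or> subobject C m = subobject C (m ** k0)"
    using ji mon m nn k0A mA unfolding join_irreducible_def
    by (metis subobject_carrier tgt_cmp)
   hence "m <~ m ** n \<or> m <~ m ** k0"
    using subobject_eq_iff[of m "m ** n"] subobject_eq_iff[of m "m ** k0"] m mon nn k0A mA by auto
   hence "epic C n \<or> epic C k0"
    using factors_through_epic[of m n] factors_through_epic[of m k0] m nn k0 k0A by blast
   thus False using nn k0e by blast
  qed
  hence "w \<in> S" using w wA by (simp add: S_def)
  hence "w <~ n" using n(2) w by blast
  hence k0n: "k0 <~ n" using w(4) nn factors_through_trans by blast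
  have "k <~ k0" using k0(4) k g by auto
  hence "k <~ n" using k0n nn factors_through_trans by blast
  thus "null C (q ** k)" using ses_null_iff[OF q k(1)] k by simp
 qed
 thus "\<exists>q. top_map C q & dom q = dom m" using qA by blast
next
 have mA: "arr m" using m by simp
 assume "\<exists>q. top_map C q & dom q = dom m"
 then obtain q where q: "top_map C q" "dom q = dom m" by blast
 note qD = top_mapD[OF q(1)]
 interpret L: lattice "Sub C M" by (rule lattice_Sub)
 obtain k where k: "ses C k q" using epic_ses qD by blast
 note kD = sesD[OF k]
 have kA: "arr k" "cod k = dom m" using kD q by auto
 have ke: "~ epic C k" using kD(4) qD(2,3) kD(3) epicD[of k q] by auto
 show "join_irreducible (Sub C M) (subobject C m)"
  unfolding join_irreducible_def
 proof (intro conjI ballI impI)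
  show "subobject C m \<in> carrier (Sub C M)" using m by (rule subobject_carrier)
  have "~ null C m"
  proof
   assume "null C m"
   hence "null C (ident C (dom m))"
    using monic_null_iff[OF m(1), of "ident C (dom m)"] mA by simp
   hence "null C (q ** ident C (dom m))" by (rule null_cmp_right) (use qD(2) q mA in auto)
   thus False using qD(2,3) q by simp
  qed
  thus "subobject C m ~= \<bottom>\<^bsub>Sub C M\<^esub>" using bottom_Sub[OF m] by simp
  fix Y Z assume YZ: "Y \<in> carrier (Sub C M)" "Z \<in> carrier (Sub C M)"
   and j: "subobject C m = Y \<squnion>\<^bsub>Sub C M\<^esub> Z"
  obtain y where y: "monic C y" "cod y = M" "Y = subobject C y" using YZ(1) by (rule carrier_SubE)
  obtain z where z: "monic C z" "cod z = M" "Z = subobject C z" using YZ(2) by (rule carrier_SubE)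
  have "Y \<sqsubseteq>\<^bsub>Sub C M\<^esub> subobject C m" "Z \<sqsubseteq>\<^bsub>Sub C M\<^esub> subobject C m"
   unfolding j by (rule L.join_left[OF YZ], rule L.join_right[OF YZ])
  hence le: "y <~ m" "z <~ m"
   using le_Sub_iff[OF y(1) m(1) y(2) m(2)] le_Sub_iff[OF z(1) m(1) z(2) m(2)] y(3) z(3) by simp_all
  \<comment> \<open>Subobjects strictly below \<open>m\<close> lie in the radical, which is
    represented by \<open>m ** k\<close>.\<close>
  have key: "v <~ m ** k"
   if v: "monic C v" "v <~ m" "~ m <~ v" for v
  proof -
   obtain u where u: "arr u" "dom u = dom v" "cod u = dom m" "m ** u = v"
    using v(2) by (rule factors_throughE)
   have um: "monic C u" using monic_right_factor[of m u] v u mA by simp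
   have "~ epic C u"
   proof
    assume "epic C u"
    hence "ident C (dom m) <~ u"
     using um u mA by (intro epic_factors_through) auto
    hence "m ** ident C (dom m) <~ m ** u"
     using u(1,3) mA by (intro factors_through_mono) auto
    thus False using v u mA by simp
   qed
   hence "null C (q ** u)" using top_map_epic[OF q(1), of u] u q by auto
   hence "u <~ k" using ses_null_iff[OF k u(1)] u q by simp
   hence "m ** u <~ m ** k"
    using kA mA by (intro factors_through_mono) auto
   thus ?thesis using u by simp
  qed
  show "subobject C m = Y \<or> subobject C m = Z"
  proof (rule ccontr)
   assume "~ (subobject C m = Y \<or> subobject C m = Z)"
   hence "~ m <~ y" "~ m <~ z"
    using subobject_eq_iff[of m y] subobject_eq_iff[of m z] y z m le by auto
   hence f: "y <~ m ** k" "z <~ m ** k"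
    using key y z le by auto
   have mk: "monic C (m ** k)" "cod (m ** k) = M" using m kD kA mA by (auto intro: monic_cmp)
   have "Y \<squnion>\<^bsub>Sub C M\<^esub> Z \<sqsubseteq>\<^bsub>Sub C M\<^esub> subobject C (m ** k)"
    by (rule L.join_le) (use f y z mk YZ in \<open>auto simp: le_Sub_iff intro: subobject_carrier\<close>)
   hence "m <~ m ** k" using j le_Sub_iff[OF m(1) mk(1) m(2) mk(2)] by simp
   thus False using factors_through_epic[of m k] m kA kD ke by simp
  qed
 qed
qed

text \<open>In a distributive lattice join-irreducible elements are prime. The hypothesis
  \<open>cov\<close> expresses, through arrows out of \<open>M\<close>, that \<open>m\<close> lies
  below the join of \<open>d\<close> and \<open>a\<close>; this spares the user a description of the
  join.\<close>

lemma local_prime: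
 assumes dist: "distributive_lattice (Sub C M)"
  and m: "monic C m" "cod m = M" and q: "top_map C q" "dom q = dom m"
  and d: "monic C d" "cod d = M" and a: "monic C a" "cod a = M"
  and cov: "!!h. [|arr h; dom h = M; null C (h ** d); null C (h ** a)|] ==> null C (h ** m)"
 shows "m <~ d \<or> m <~ a"
proof -
 interpret L: distributive_lattice "Sub C M" by (rule dist)
 let ?x = "subobject C m" and ?y = "subobject C d" and ?z = "subobject C a"
 have car: "?x \<in> carrier (Sub C M)" "?y \<in> carrier (Sub C M)" "?z \<in> carrier (Sub C M)"
  using m d a by (auto intro: subobject_carrier)
 have ji: "join_irreducible (Sub C M) ?x" using join_irreducible_iff[OF m] q by blast
 obtain w where w: "monic C w" "cod w = M" "?y \<squnion>\<^bsub>Sub C M\<^esub> ?z = subobject C w"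
  using L.join_closed[OF car(2,3)] by (rule carrier_SubE)
 have dw: "d <~ w" "a <~ w"
  using L.join_left[OF car(2,3)] L.join_right[OF car(2,3)] w d a by (simp_all add: le_Sub_iff)
 obtain h where h: "ses C w h" using monic_ses[OF w(1)] .
 note hD = sesD[OF h]
 have hA: "arr h" "dom h = M" using hD w by auto
 have A: "arr m" "arr d" "arr a" using m d a by auto
 have "null C (h ** d)" "null C (h ** a)"
  using ses_null_iff[OF h, of d] ses_null_iff[OF h, of a] dw A hA d a by auto
 hence "null C (h ** m)" using cov hA by blast
 hence "m <~ w" using ses_null_iff[OF h, of m] A hA m by simp
 hence "?x \<sqsubseteq>\<^bsub>Sub C M\<^esub> ?y \<squnion>\<^bsub>Sub C M\<^esub> ?z" using w m by (simp add: le_Sub_iff)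
 hence "?x = ?x \<sqinter>\<^bsub>Sub C M\<^esub> (?y \<squnion>\<^bsub>Sub C M\<^esub> ?z)"
  using L.le_iff_join[OF car(1) L.join_closed[OF car(2,3)]] by simp
 also have "... = (?x \<sqinter>\<^bsub>Sub C M\<^esub> ?y) \<squnion>\<^bsub>Sub C M\<^esub> (?x \<sqinter>\<^bsub>Sub C M\<^esub> ?z)"
  by (rule L.meet_join_distrib[OF car])
 finally have "?x = ?x \<sqinter>\<^bsub>Sub C M\<^esub> ?y \<or> ?x = ?x \<sqinter>\<^bsub>Sub C M\<^esub> ?z"
  using ji L.meet_closed[OF car(1,2)] L.meet_closed[OF car(1,3)] unfolding join_irreducible_def by blast
 hence "?x \<sqsubseteq>\<^bsub>Sub C M\<^esub> ?y \<or> ?x \<sqsubseteq>\<^bsub>Sub C M\<^esub> ?z"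
  using L.meet_right[OF car(1,2)] L.meet_right[OF car(1,3)] by metis
 thus ?thesis using m d a by (simp add: le_Sub_iff)
qed

text \<open>If two incomparable local subobjects had the same top, the diagonal of their join modulo the
 radicals would violate distributivity.\<close>

lemma local_comparable:
 assumes dist: "distributive_lattice (Sub C M)"
  and m1: "monic C m1" "cod m1 = M" and q1: "top_map C q1" "dom q1 = dom m1"
  and m2: "monic C m2" "cod m2 = M" and q2: "top_map C q2" "dom q2 = dom m2"
  and qq: "cod q1 = cod q2"
 shows "m1 <~ m2 \<or> m2 <~ m1"
proof (rule ccontr)
 assume "~ ?thesis"
 hence inc: "~ m1 <~ m2" "~ m2 <~ m1" by auto
 have A: "arr m1" "arr m2" using m1 m2 by auto
 note q1D = top_mapD[OF q1(1)] and q2D = top_mapD[OF q2(1)]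
 obtain a b where ab: "arr a" "epic C b" "dom a = dom b" "cod a = dom q1"
  "cod b = dom q2" "q1 ** a = q2 ** b"
  by (rule pullback_epic[OF q1D(1) q2D(2)]) (use qq in auto)
 have bA: "arr b" using ab by simp
 \<comment> \<open>The pair \<open>a\<close>, \<open>b\<close> runs over the elements of the two
   domains with equal images in the common top, and \<open>\<phi>\<close> adds them inside
   \<open>M\<close>. Its image \<open>d\<close> is the diagonal.\<close>
 define \<phi> where "\<phi> = (m1 ** a) \<boxplus> (m2 ** b)"
 have \<phi>: "arr \<phi>" "dom \<phi> = dom b" "cod \<phi> = M"
  using ab A m1 m2 q1 q2 bA by (simp_all add: \<phi>_def)
 obtain d e where de: "monic C d" "epic C e" "dom e = dom \<phi>" "cod e = dom d"
  "cod d = cod \<phi>" "d ** e = \<phi>" by (rule imageE[OF \<phi>(1)])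
 have deA: "arr d" "arr e" using de by auto
 \<comment> \<open>The diagonal and \<open>m1\<close> together contain \<open>m2\<close>: the
   pullback projects onto the domain of \<open>m2\<close> by the epic \<open>b\<close>, and the
   other summand of \<open>\<phi>\<close> lies in \<open>m1\<close>.\<close>
 have "m2 <~ d \<or> m2 <~ m1"
 proof (rule local_prime[OF dist m2 q2 _ _ m1])
  fix h assume h: "arr h" "dom h = M" "null C (h ** d)" "null C (h ** m1)"
  have n1: "null C ((h ** d) ** e)" by (rule null_cmp_left[OF h(3)]) (use h deA de \<phi> in auto)
  have "h ** \<phi> = (h ** d) ** e" using h(1,2) deA de \<phi> by simp
  hence n1': "null C (h ** \<phi>)" using n1 by simp
  have n2: "null C ((h ** m1) ** a)" by (rule null_cmp_left[OF h(4)]) (use h A ab m1 q1 in auto)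
  have "h ** \<phi> = ((h ** m1) ** a) \<boxplus> (h ** (m2 ** b))"
   unfolding \<phi>_def using h(1,2) A ab m1 m2 q1 q2 bA by simp
  also have "... = hzero C (dom b) (cod h) \<boxplus> (h ** (m2 ** b))"
   using n2 h(1,2) A ab m1 q1 bA by (simp add: null_def)
  also have "... = h ** (m2 ** b)" using h(1,2) A ab m2 q2 bA by simp
  also have "... = (h ** m2) ** b" using h(1,2) A ab m2 q2 bA by simp
  finally have "null C ((h ** m2) ** b)" using n1' by simp
  thus "null C (h ** m2)"
   using epic_null_iff[OF ab(2), of "h ** m2"] h(1,2) A ab m2 q2 by simp
 qed (use de \<phi> in auto)
 hence "m2 <~ d" using inc by blast
 then obtain s where s: "arr s" "dom s = dom m2" "cod s = dom d" "d ** s = m2"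
  by (rule factors_throughE)
 \<comment> \<open>Each element of \<open>m2\<close> is now, after covering by \<open>w\<close>, a
   value of \<open>\<phi>\<close>, so that \<open>m2 ** w\<close> is the sum of
   \<open>m1 ** (a ** t)\<close> and \<open>m2 ** (b ** t)\<close>.\<close>
 obtain t w where tw: "arr t" "epic C w" "dom t = dom w" "cod t = dom e"
  "cod w = dom s" "e ** t = s ** w"
  by (rule pullback_epic[OF de(2) s(1)]) (use s de in auto)
 have wA: "arr w" using tw by simp
 have tt: "cod t = dom b" using tw de \<phi> by simp
 have tyq: "dom q1 = dom m1" "dom q2 = dom m2" "cod m1 = M" "cod m2 = M" using q1 q2 m1 m2 by auto
 have wt: "cod w = dom m2" using tw s by simp
 have "\<phi> ** t = d ** (e ** t)" unfolding de(6)[symmetric] using deA de(3,4) tw(1,4) by simp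
 also have "... = d ** (s ** w)" by (simp add: tw(6))
 also have "... = m2 ** w" by (rule cmp_reduce[OF s(4)]) (use s(1-3) deA wA tw(5) in auto)
 finally have "m2 ** w = (m1 ** (a ** t)) \<boxplus> (m2 ** (b ** t))"
  unfolding \<phi>_def using A ab(1-5) bA tw(1) tt tyq by simp
 hence "(m2 ** w) \<boxplus> hneg C (m2 ** (b ** t)) = m1 ** (a ** t)"
  using hadd_hneg_cancel(1)[of "m1 ** (a ** t)" "m2 ** (b ** t)"] A ab(1-5) bA tw(1) tt tyq by simp
 hence eq: "m2 ** (w \<boxplus> hneg C (b ** t)) = m1 ** (a ** t)"
  using A ab(1-5) bA tw(1,3) tt tyq wA wt by simp
 have wbt: "arr (w \<boxplus> hneg C (b ** t))" "dom (w \<boxplus> hneg C (b ** t)) = dom w"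
  "cod (w \<boxplus> hneg C (b ** t)) = dom m2"
  using A ab(1-5) bA tw(1,3) tt tyq wA wt by simp_all
 \<comment> \<open>An arrow lying in both \<open>n\<close> and \<open>n'\<close> vanishes in the top
   of \<open>n\<close>: otherwise \<open>x\<close> would be epic and all of \<open>n\<close> would
   lie in \<open>n'\<close>.\<close>
 have kill: "null C (p ** x)"
  if n: "monic C n" "arr n'" "cod n' = cod n" "~ n <~ n'" "top_map C p" "dom p = dom n"
   and x: "arr x" "cod x = dom n" "arr y" "cod y = dom n'" "n ** x = n' ** y" "monic C n'" for n n' p x y
 proof (rule ccontr)
  assume nn: "~ null C (p ** x)"
  have xe: "epic C x" using top_map_epic[OF n(5) x(1) _ nn] n x by simp
  have "n' ** y <~ n'" using n x by (intro factors_through_cmp) auto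
  hence "n ** x <~ n'" using x by simp
  hence "n <~ n'"
   by (rule epic_factor_cancel[rotated 5]) (use n x xe in auto)
  thus False using n by simp
 qed
 have k1: "null C (q1 ** (a ** t))"
  by (rule kill[of m1 m2 q1 _ "w \<boxplus> hneg C (b ** t)"])
   (use m1 m2 A inc q1 ab(1-5) bA tw(1,3,4) tt wbt eq in auto)
 have k2: "null C (q2 ** (w \<boxplus> hneg C (b ** t)))"
  by (rule kill[of m2 m1 q2 _ "a ** t"])
   (use m1 m2 A inc q2 q1(2) ab(1-5) bA tw(1,3,4) tt wbt eq in auto)
 \<comment> \<open>By \<open>k1\<close> this common value is zero, and by \<open>k2\<close> it
   equals \<open>q2 ** w\<close>. As \<open>w\<close> is epic, \<open>q2\<close> would be
   zero.\<close>
 have q12: "q1 ** (a ** t) = q2 ** (b ** t)"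
  using ab bA tw(1) tt q1D(2) q2D(2) by (simp flip: cmp_assoc_Ar)
 have "null C ((q2 ** w) \<boxplus> hneg C (q2 ** (b ** t)))"
  using k2 q2D(2) ab(1-5) bA tw(1,3) tt wA wt tyq by simp
 hence "q2 ** w = q2 ** (b ** t)"
  using q2D(2) ab(1-5) bA tw(1,3) tt wA wt tyq by (subst (asm) null_diff_iff) auto
 hence "null C (q2 ** w)" using k1 q12 by simp
 hence "null C q2" using epic_null_iff[OF tw(2), of q2] q2D(2) wt tyq by simp
 thus False using q2D by simp
qed

section \<open>The ext-quiver\<close>

lemma iso_class_self: "X \<in> Ob C ==> X \<in> iso_class C X"
 by (auto simp: iso_class_def Hom_def intro!: exI[of _ "ident C X"])

lemma extensions_iff: "(i, p) \<in> extensions C T S \<longleftrightarrow> ses C i p & dom i = S & cod p = T"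
proof -
 have "arr i & arr p" if "is_kernel C p i"
  using that unfolding is_kernel_def by blast
 thus ?thesis unfolding extensions_def ses_iff by blast
qed

text \<open>If the zero class were the only one, the given sequence would be equivalent to that of a
  direct sum, and the projection onto the first summand would become a retraction of
  \<open>i\<close>.\<close>

lemma ext_quiverI:
 assumes S: "simple_object C S" and T: "simple_object C T" and ip: "ses C i p" "dom i = S" "cod p = T"
  and ns: "!!r. [|arr r; dom r = cod i; cod r = S|] ==> r ** i ~= ident C S"
 shows "(iso_class C S, iso_class C T) \<in> ext_quiver C"
proof -
 have ipD: "arr i" "arr p" "cod i = dom p" using sesD[OF ip(1)] by auto
 have "Ext1 C T S ~= {Ext1_zero C T S}"
 proof
  assume eq: "Ext1 C T S = {Ext1_zero C T S}"
  have ex: "(i, p) \<in> extensions C T S" using ip by (simp add: extensions_iff)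
  have "extension_rel C T S `` {(i, p)} \<in> Ext1 C T S"
   unfolding Ext1_def by (rule quotientI[OF ex])
  hence "extension_rel C T S `` {(i, p)} = Ext1_zero C T S" using eq by simp
  moreover have "((i, p), (i, p)) \<in> extension_rel C T S"
   using ex ipD by (auto simp: extension_rel_def Hom_def intro!: exI[of _ "ident C (dom p)"])
  ultimately have "(i, p) \<in> Ext1_zero C T S" by blast
  then obtain B i1 i2 p1 p2 where b: "is_biproduct C S T B i1 i2 p1 p2"
   "((i1, p2), (i, p)) \<in> extension_rel C T S" by (auto simp: Ext1_zero_def)
  have bA: "arr i1" "dom i1 = S" "cod i1 = B" "arr p1" "dom p1 = B" "cod p1 = S"
   "p1 ** i1 = ident C S"
   using b(1) by (auto simp: is_biproduct_def Hom_def)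
  obtain h where h: "dom h = cod i1" "cod h = cod i" "iso_arrow C h" "h ** i1 = i"
   using b(2) by (auto simp: extension_rel_def Hom_def)
  obtain g where g: "arr h" "arr g" "dom g = cod h" "cod g = dom h"
   "g ** h = ident C (dom h)" using h(3) by (rule iso_arrowE)
  have "(p1 ** g) ** i = p1 ** (g ** (h ** i1))" using h(1,2) g(1-4) bA(1-6) ipD by (simp add: h(4))
  also have "g ** (h ** i1) = ident C (dom h) ** i1"
   by (rule cmp_reduce[OF g(5)]) (use g h bA in auto)
  also have "p1 ** (ident C (dom h) ** i1) = ident C S" using g h(1) bA by simp
  finally show False using ns[of "p1 ** g"] g h(1,2) bA by simp
 qed
 thus ?thesis using S T unfolding ext_quiver_def by blast
qed

text \<open>The pushout of a short exact sequence with simple cokernel along an epimorphism onto a simple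
 object.\<close>

lemma ext_step:
 assumes wc: "ses C w c" and T: "simple_object C (cod c)"
  and s: "epic C s" "dom s = dom w" and S: "simple_object C (cod s)"
 shows "(\<exists>r \<in> Ar C. dom r = dom c & cod r = cod s & r ** w = s) \<or>
  (iso_class C (cod s), iso_class C (cod c)) \<in> ext_quiver C"
proof (rule disjCI)
 assume nx: "(iso_class C (cod s), iso_class C (cod c)) \<notin> ext_quiver C"
 note wD = sesD[OF wc]
 have A: "arr w" "arr c" "arr s" "cod w = dom c" using wD s by auto
 obtain k where k: "ses C k s" using epic_ses[OF s(1)] .
 note kD = sesD[OF k]
 have kA: "arr k" "cod k = dom w" using kD s by auto
 have wk: "monic C (w ** k)" by (rule monic_cmp) (use wD kD kA in auto)
 \<comment> \<open>The pushout of \<open>w\<close> along \<open>s\<close> is realised as the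
   quotient of the domain of \<open>c\<close> by the kernel of \<open>s\<close>;
   \<open>\<iota>\<close> and \<open>\<pi>\<close> are the maps induced by \<open>w\<close> and
   \<open>c\<close>.\<close>
 obtain p where p: "ses C (w ** k) p" using monic_ses[OF wk] .
 note pD = sesD[OF p]
 have pA: "arr p" "dom p = dom c" using pD A kA by auto
 have n1: "null C ((p ** w) ** k)" using pD(4) pA A kA by simp
 obtain \<iota> where \<iota>: "arr \<iota>" "dom \<iota> = cod s" "cod \<iota> = cod (p ** w)" "\<iota> ** s = p ** w"
  by (rule ses_over[OF k, of "p ** w"]) (use n1 pA A s in auto)
 have n2: "null C ((c ** w) ** k)" by (rule null_cmp_left[OF wD(4)]) (use A kA in auto)
 obtain \<pi> where \<pi>: "arr \<pi>" "dom \<pi> = cod p" "cod \<pi> = cod c" "\<pi> ** p = c"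
  by (rule ses_over[OF p, of c]) (use n2 pA A kA in auto)
 have \<iota>t: "cod \<iota> = cod p" using \<iota> pA A by simp
 have \<iota>m: "monic C \<iota>"
 proof (rule monicI[OF \<iota>(1)])
  fix g assume g: "arr g" "cod g = dom \<iota>" "null C (\<iota> ** g)"
  obtain t e where te: "arr t" "epic C e" "dom t = dom e" "cod t = dom s" "cod e = dom g"
   "s ** t = g ** e" by (rule pullback_epic[OF s(1) g(1)]) (use g \<iota> in auto)
  have eA: "arr e" using te by simp
  have "null C ((\<iota> ** g) ** e)" by (rule null_cmp_left[OF g(3)]) (use g \<iota> eA te in auto)
  moreover have "(\<iota> ** g) ** e = \<iota> ** (s ** t)" using g \<iota>(1-3) eA te by simp
  moreover have "\<iota> ** (s ** t) = (p ** w) ** t" by (rule cmp_reduce[OF \<iota>(4)]) (use A \<iota> te in auto)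
  ultimately have "null C (p ** (w ** t))" using pA A te s by simp
  hence "w ** t <~ w ** k"
   using ses_null_iff[OF p, of "w ** t"] A pA te s by simp
  hence "t <~ k"
   by (rule factors_through_cancel[rotated 5]) (use wD kA te s in auto)
  hence "null C (s ** t)" using ses_null_iff[OF k te(1)] te by simp
  hence "null C (g ** e)" using te by simp
  thus "null C g" using epic_null_iff[OF te(2) g(1)] te by simp
 qed
 obtain \<rho> where \<rho>: "ses C \<iota> \<rho>" using monic_ses[OF \<iota>m] .
 have \<pi>e: "epic C \<pi>" using epic_left_factor[of \<pi> p] \<pi> pA wD by simp
 have over: "factors_over C h \<pi>" if h: "arr h" "dom h = cod \<iota>" "null C (h ** \<iota>)" for h
 proof -
  have "null C ((h ** \<iota>) ** s)" by (rule null_cmp_left[OF h(3)]) (use h \<iota> A in auto)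
  moreover have "(h ** \<iota>) ** s = (h ** p) ** w" using h(1,2) \<iota> \<iota>t A pA by simp
  ultimately have "null C ((h ** p) ** w)" by simp
  then obtain h' where h': "arr h'" "dom h' = cod c" "cod h' = cod (h ** p)" "h' ** c = h ** p"
   using ses_over[OF wc, of "h ** p"] h pA \<iota>t by auto
  have "(h' ** \<pi>) ** p = h ** p" using h'(1-2) \<pi> pA by (simp add: h'(4))
  hence "h' ** \<pi> = h"
   using epic_cmp_iff[OF pD(2), of "h' ** \<pi>" h] h' h \<pi> pA \<iota>t by simp
  thus ?thesis using h'(1-3) \<pi> h pA \<iota>t unfolding factors_over_def Hom_def by auto
 qed
 have n3: "null C (\<pi> ** \<iota>)"
 proof -
  have "(\<pi> ** \<iota>) ** s = \<pi> ** (p ** w)" using \<pi> \<iota> \<iota>t A pA by simp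
  also have "... = c ** w" by (rule cmp_reduce[OF \<pi>(4)]) (use \<pi> pA A in auto)
  finally have "null C ((\<pi> ** \<iota>) ** s)" using wD by simp
  thus ?thesis using epic_null_iff[OF s(1), of "\<pi> ** \<iota>"] \<pi> \<iota> \<iota>t by simp
 qed
 have thr: "g <~ \<iota>" if g: "arr g" "cod g = dom \<pi>" "null C (\<pi> ** g)" for g
 proof -
  note \<rho>D = sesD[OF \<rho>]
  have "arr \<rho>" "dom \<rho> = cod \<iota>" using \<rho>D by auto
  then obtain u where u: "arr u" "dom u = cod \<pi>" "u ** \<pi> = \<rho>"
   using over[of \<rho>] \<rho>D by (auto elim: factors_overE)
  have "null C (u ** (\<pi> ** g))" by (rule null_cmp_right[OF g(3)]) (use u \<pi> g in auto)
  moreover have "u ** (\<pi> ** g) = \<rho> ** g" by (rule cmp_reduce[OF u(3)]) (use u \<pi> g in auto)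
  ultimately have "null C (\<rho> ** g)" by simp
  thus ?thesis using ses_null_iff[OF \<rho> g(1)] \<rho>D g \<pi> \<iota>t by simp
 qed
 have ses: "ses C \<iota> \<pi>" unfolding ses_def using \<iota>m \<pi>e n3 thr over \<iota>t \<pi> by auto
 \<comment> \<open>Without an arrow in the quiver the pushout sequence splits, and the retraction
   composed with \<open>p\<close> extends \<open>s\<close>.\<close>
 obtain r where r: "arr r" "dom r = cod \<iota>" "cod r = cod s" "r ** \<iota> = ident C (cod s)"
  using ext_quiverI[OF S T ses \<iota>(2) \<pi>(3)] nx by blast
 have "(r ** p) ** w = r ** (\<iota> ** s)" using r(1-3) \<iota> \<iota>t A pA by simp
 also have "... = ident C (cod s) ** s" by (rule cmp_reduce[OF r(4)]) (use r \<iota> A in auto)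
 finally have "(r ** p) ** w = s" using A by simp
 thus "\<exists>r \<in> Ar C. dom r = dom c & cod r = cod s & r ** w = s"
  using r \<iota>t pA by (intro bexI[of _ "r ** p"]) auto
qed

text \<open>Among the subobjects of the codomain of \<open>i\<close> that have a simple quotient
  reachable from the given one, take a maximal \<open>j\<close>. If it is proper, enlarge it to
  \<open>j'\<close> with \<open>j'\<close> modulo \<open>j\<close> simple. By
  \<open>ext_step\<close> the simple quotient of \<open>j\<close> extends to \<open>j'\<close>, or
  an arrow leads from it to that new simple quotient of \<open>j'\<close>. Either way
  \<open>j'\<close> contradicts maximality.\<close>

lemma simple_quotient_path:
 assumes i: "monic C i" and s: "epic C s" "dom s = dom i" "simple_object C (cod s)"
 obtains s' where "epic C s'" "dom s' = cod i" "simple_object C (cod s')"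
  "(iso_class C (cod s), iso_class C (cod s')) \<in> (ext_quiver C)\<^sup>*"
proof -
 define Y where "Y = cod i"
 have iA: "arr i" and Y: "Y \<in> Ob C" using i by (auto simp: Y_def)
 define P where "P j \<longleftrightarrow> monic C j & cod j = Y & (\<exists>s'. epic C s' & dom s' = dom j &
  simple_object C (cod s') & (iso_class C (cod s), iso_class C (cod s')) \<in> (ext_quiver C)\<^sup>*)" for j
 have "P i" unfolding P_def Y_def using i s by blast
 hence "{j. P j} ~= {}" by blast
 moreover have "monic C j & cod j = Y" if "j \<in> {j. P j}" for j using that by (simp add: P_def)
 ultimately obtain j where j: "P j" "!!n. P n ==> j <~ n ==> n <~ j"
  using maximal_monic[OF Y, of "{j. P j}"] by (metis mem_Collect_eq)
 have jm: "monic C j" "cod j = Y" "arr j" using j by (auto simp: P_def)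
 obtain s1 where s1: "epic C s1" "dom s1 = dom j" "simple_object C (cod s1)"
  "(iso_class C (cod s), iso_class C (cod s1)) \<in> (ext_quiver C)\<^sup>*"
  using j(1) unfolding P_def by blast
 show ?thesis
 proof (cases "epic C j")
  case True
  hence "iso_arrow C j" using jm by (simp add: iso_arrow_iff)
  then obtain g where g: "arr g" "dom g = cod j" "cod g = dom j" "j ** g = ident C (cod j)"
    "g ** j = ident C (dom j)" by (auto elim: iso_arrowE)
  hence "iso_arrow C g" using jm by (intro iso_arrowI[of g j]) auto
  hence "epic C g" by (simp add: iso_arrow_iff)
  hence "epic C (s1 ** g)" using s1 g by (intro epic_cmp) auto
  thus ?thesis using that[of "s1 ** g"] s1 g jm Y_def by auto
 next
  case False
  \<comment> \<open>A minimal subobject strictly above \<open>j\<close> has a simple quotient modulo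
    \<open>j\<close>.\<close>
  define S where "S = {n. monic C n & cod n = Y & j <~ n & ~ n <~ j}"
  have "~ ident C Y <~ j"
  proof
   assume "ident C Y <~ j"
   then obtain u where "arr u" "dom u = Y" "cod u = dom j" "j ** u = ident C Y"
    using Y by (auto elim: factors_throughE)
   thus False using False epic_left_factor[of j u] jm Y by simp
  qed
  moreover have "j <~ ident C Y"
   using jm Y by (intro factors_throughI[of j]) auto
  ultimately have "S ~= {}" using Y by (auto simp: S_def)
  moreover have "monic C n & cod n = Y" if "n \<in> S" for n using that by (simp add: S_def)
  ultimately obtain j' where j': "j' \<in> S" "!!n. n \<in> S ==> n <~ j' ==> j' <~ n"
   using minimal_monic[OF Y, of S] by metis
  have jm': "monic C j'" "cod j' = Y" "j <~ j'" "~ j' <~ j" "arr j'"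
   using j' by (auto simp: S_def)
  obtain w where w: "arr w" "dom w = dom j" "cod w = dom j'" "j' ** w = j"
   using jm'(3) by (rule factors_throughE)
  have wm: "monic C w" using monic_right_factor[of j' w] jm w jm' by simp
  obtain c where c: "ses C w c" using monic_ses[OF wm] .
  note cD = sesD[OF c]
  have cA: "arr c" "dom c = dom j'" using cD w by auto
  have cn: "~ null C c"
  proof
   assume n: "null C c"
   have "null C (c ** ident C (dom c))" using n cA by simp
   hence "ident C (dom c) <~ w"
    using ses_null_iff[OF c, of "ident C (dom c)"] cA jm'(5) by simp
   hence "j' ** ident C (dom c) <~ j' ** w"
    using w jm' by (intro factors_through_mono) auto
   thus False using w jm' cA by simp
  qed
  have T: "simple_object C (cod c)"
  proof (rule simple_objectI)
   show "cod c \<in> Ob C" using cA by simp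
   show "~ null C (ident C (cod c))"
   proof
    assume n: "null C (ident C (cod c))"
    have "null C (ident C (cod c) ** c)" by (rule null_cmp_left[OF n]) (use cA in auto)
    thus False using cn cA by simp
   qed
   fix d assume d: "arr d" "dom d = cod c" "~ null C d"
   have dc: "arr (d ** c)" "dom (d ** c) = dom j'" using d cA by auto
   have ndc: "~ null C (d ** c)" using epic_null_iff[OF cD(2) d(1,2)] d by simp
   obtain k0 where k0: "monic C k0" "cod k0 = dom (d ** c)" "null C ((d ** c) ** k0)"
    "\<forall>h \<in> Ar C. cod h = dom (d ** c) --> null C ((d ** c) ** h) --> h <~ k0"
    by (rule kernelE[OF dc(1)])
   have k0A: "arr k0" "cod k0 = dom j'" using k0 dc by auto
   have n: "null C (d ** (c ** w))" by (rule null_cmp_right[OF cD(4)]) (use d cA w in auto)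
   hence wk: "w <~ k0" using k0(4) w dc d cA by auto
   have jk: "j' ** w <~ j' ** k0"
    using wk k0A jm' by (intro factors_through_mono) auto
   have jkm: "monic C (j' ** k0)" using jm' k0 k0A by (intro monic_cmp) auto
   \<comment> \<open>Nothing lies strictly between \<open>j\<close> and \<open>j'\<close>, and
     \<open>k0\<close> is not epic because \<open>d ** c\<close> is nonzero.\<close>
   have "j' ** k0 <~ j"
   proof (rule ccontr)
    assume "~ j' ** k0 <~ j"
    hence "j' ** k0 \<in> S" using jk jkm jm' k0A w by (simp add: S_def)
    hence "j' <~ j' ** k0"
     using jm' k0A by (intro j'(2)) (auto intro: factors_through_cmp)
    hence "epic C k0" using factors_through_epic[of j' k0] jm' k0 k0A by simp
    hence "null C (d ** c)" by (rule epicD) (use k0 dc in auto)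
    thus False using ndc by simp
   qed
   hence "j' ** k0 <~ j' ** w" using w by simp
   hence kw: "k0 <~ w"
    by (rule factors_through_cancel[rotated 5]) (use jm' k0A w in auto)
   show "monic C d"
   proof (rule monicI[OF d(1)])
    fix g assume g: "arr g" "cod g = dom d" "null C (d ** g)"
    obtain a b where ab: "arr a" "epic C b" "dom a = dom b" "cod a = dom c" "cod b = dom g"
     "c ** a = g ** b" by (rule pullback_epic[OF cD(2) g(1)]) (use g d in auto)
    have "null C ((d ** g) ** b)" by (rule null_cmp_left[OF g(3)]) (use g d ab in auto)
    moreover have "(d ** g) ** b = (d ** c) ** a" using g(1,2) d ab cA by simp
    ultimately have "a <~ k0" using k0(4) ab dc cA by auto
    hence "a <~ w" using kw w(1) factors_through_trans by blast
    hence "null C (c ** a)" using ses_null_iff[OF c ab(1)] ab by simp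
    hence "null C (g ** b)" using ab by simp
    thus "null C g" using epic_null_iff[OF ab(2) g(1)] ab by simp
   qed
  qed
  have "P j'"
  proof -
   have "dom s1 = dom w" using s1 w by simp
   from ext_step[OF c T s1(1) this s1(3)]
   consider r where "arr r" "dom r = dom c" "cod r = cod s1" "r ** w = s1"
    | "(iso_class C (cod s1), iso_class C (cod c)) \<in> ext_quiver C" by blast
   thus "P j'"
   proof cases
    case 1
    have "epic C r" using epic_left_factor[of r w] s1(1) 1 w(1) cA w(3) by simp
    thus ?thesis unfolding P_def using 1(2,3) jm'(1,2) s1(3,4) cA(2) by (metis (no_types))
   next
    case 2
    hence "(iso_class C (cod s), iso_class C (cod c)) \<in> (ext_quiver C)\<^sup>*"
     using s1(4) by simp
    thus ?thesis unfolding P_def using jm' T cD cA by blast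
   qed
  qed
  thus ?thesis using j(2) jm' by blast
 qed
qed

text \<open>A proper subobject \<open>l\<close> lies in the radical \<open>r\<close>. A path,
  possibly trivial, leads from the given simple quotient of \<open>l\<close> to a simple quotient
  \<open>s'\<close> of the radical; a final arrow from \<open>s'\<close> to the top, coming from the
  extension of the top by \<open>r\<close>, makes the path nonempty.\<close>

lemma local_path:
 assumes q: "top_map C q" and l: "monic C l" "cod l = dom q" "~ epic C l"
  and s: "epic C s" "dom s = dom l" "simple_object C (cod s)"
 shows "(iso_class C (cod s), iso_class C (cod q)) \<in> (ext_quiver C)\<^sup>+"
proof -
 note qD = top_mapD[OF q]
 obtain r where r: "ses C r q" using epic_ses[OF qD(1)] .
 note rD = sesD[OF r]
 have rA: "arr r" "cod r = dom q" using rD by auto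
 have lA: "arr l" using l by simp
 have "null C (q ** l)" using top_map_epic[OF q lA] l by auto
 hence "l <~ r" using ses_null_iff[OF r lA] l by simp
 then obtain l' where l': "arr l'" "dom l' = dom l" "cod l' = dom r" "r ** l' = l"
  by (rule factors_throughE)
 have "monic C l'" using monic_right_factor[of r l'] l l' rA by simp
 then obtain s' where s': "epic C s'" "dom s' = cod l'" "simple_object C (cod s')"
  "(iso_class C (cod s), iso_class C (cod s')) \<in> (ext_quiver C)\<^sup>*"
  by (rule simple_quotient_path[of l' s]) (use s l' in auto)
 have sA: "arr s'" "dom s' = dom r" using s' l' by auto
 \<comment> \<open>An extension of \<open>s'\<close> to the whole local object would be a nonzero
   quotient, so \<open>q\<close> would factor over it as \<open>h\<close>; but \<open>q\<close>
   vanishes on the radical, whereas \<open>s'\<close> is epic, so \<open>h\<close> would be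
   zero.\<close>
 have "~ (\<exists>u \<in> Ar C. dom u = dom q & cod u = cod s' & u ** r = s')"
 proof
  assume "\<exists>u \<in> Ar C. dom u = dom q & cod u = cod s' & u ** r = s'"
  then obtain u where u: "arr u" "dom u = dom q" "cod u = cod s'" "u ** r = s'" by blast
  have ns: "~ null C s'"
  proof
   assume n: "null C s'"
   have "null C (ident C (cod s') ** s')" using n sA by simp
   hence "null C (ident C (cod s'))"
    using epic_null_iff[OF s'(1), of "ident C (cod s')"] sA by simp
   thus False using s'(3) sA(1) by (simp add: simple_object_def zero_object_iff)
  qed
  have ue: "epic C u" using epic_left_factor[of u r] u s' rA by simp
  have nu: "~ null C u"
  by (metis null_cmp_left u rA ns)
  obtain h where h: "arr h" "dom h = cod u" "cod h = cod q" "h ** u = q"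
   using top_map_over[OF q ue u(2) nu] by blast
  have "h ** s' = h ** (u ** r)" by (simp add: u(4))
  also have "... = q ** r" by (rule cmp_reduce[OF h(4)]) (use h u rA in auto)
  finally have "null C (h ** s')" using rD by simp
  hence n: "null C h" using epic_null_iff[OF s'(1) h(1)] h u by simp
  have "null C (h ** u)" by (rule null_cmp_left[OF n]) (use h u in auto)
  thus False using h qD by simp
 qed
 hence "(iso_class C (cod s'), iso_class C (cod q)) \<in> ext_quiver C"
  using ext_step[OF r top_map_simple[OF q] s'(1) sA(2) s'(3)] by blast
 thus ?thesis using s'(4) by (rule rtrancl_into_trancl1[rotated])
qed

text \<open>Fitting's argument. Let \<open>k\<close> be a maximal kernel of an epimorphism
  \<open>g\<close> from the object to itself. The kernel of \<open>f ** g\<close> contains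
  \<open>k\<close>, so it equals \<open>k\<close>; an arrow killed by \<open>f\<close>, lifted along
  \<open>g\<close> after a pullback, is then already killed by \<open>g\<close>.\<close>

lemma epic_endo_iso:
 assumes f: "epic C f" "dom f = cod f"
 shows "iso_arrow C f"
proof -
 let ?X = "cod f"
 have fA: "arr f" and X: "?X \<in> Ob C" using f by auto
 define S where "S = {k. \<exists>g. ses C k g & cod k = ?X & cod g = ?X}"
 obtain k where "ses C k (ident C ?X)" using epic_ses[of "ident C ?X"] X by auto
 hence "k \<in> S" using X sesD[of k "ident C ?X"] unfolding S_def by auto
 hence "S ~= {}" by blast
 moreover have "monic C k & cod k = ?X" if "k \<in> S" for k using that sesD unfolding S_def by blast
 ultimately obtain k where k: "k \<in> S" "!!n. n \<in> S ==> k <~ n ==> n <~ k"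
  using maximal_monic[OF X, of S] by metis
 then obtain g where g: "ses C k g" "cod k = ?X" "cod g = ?X" unfolding S_def by blast
 note gD = sesD[OF g(1)]
 have gA: "arr g" "dom g = ?X" "arr k" using gD g by auto
 have fg: "epic C (f ** g)" by (rule epic_cmp) (use f gD g in auto)
 then obtain n where n: "ses C n (f ** g)" using epic_ses by blast
 note nD = sesD[OF n]
 have nA: "arr n" "cod n = ?X" using nD gA g fA f by auto
 have "n \<in> S" using n nA gA g fA f unfolding S_def by auto
 moreover have "k <~ n"
 proof -
  have "null C (f ** (g ** k))" by (rule null_cmp_right[OF gD(4)]) (use fA gA f g in auto)
  hence "null C ((f ** g) ** k)" using fA gA f g by simp
  thus ?thesis using ses_null_iff[OF n gA(3)] fA gA f g by simp
 qed
 ultimately have nk: "n <~ k" using k(2) by blast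
 have "monic C f"
 proof (rule monicI[OF fA])
  fix h assume h: "arr h" "cod h = dom f" "null C (f ** h)"
  obtain a b where ab: "arr a" "epic C b" "dom a = dom b" "cod a = dom g" "cod b = dom h"
   "g ** a = h ** b" by (rule pullback_epic[OF gD(2) h(1)]) (use h g f in auto)
  have "null C ((f ** h) ** b)" by (rule null_cmp_left[OF h(3)]) (use fA h ab in auto)
  moreover have "(f ** h) ** b = (f ** g) ** a" using fA h(1,2) ab gA g f by simp
  ultimately have "a <~ n" using ses_null_iff[OF n ab(1)] ab fA gA g f by simp
  hence "a <~ k" using nk gA factors_through_trans by blast
  hence "null C (g ** a)" using ses_null_iff[OF g(1) ab(1)] ab by simp
  hence "null C (h ** b)" using ab by simp
  thus "null C h" using epic_null_iff[OF ab(2) h(1)] ab by simp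
 qed
 thus ?thesis using f by (simp add: iso_arrow_iff)
qed

end

section \<open>Radicals and powers\<close>

context length_category
begin

lemma top_Sub:
 assumes m: "monic C m" "cod m = X"
 shows "subobject C m = \<top>\<^bsub>Sub C X\<^esub> \<longleftrightarrow> epic C m"
proof -
 interpret partial_order "Sub C X" by (rule partial_order_Sub)
 have mA: "arr m" and X: "X \<in> Ob C" using m by auto
 have le: "v <~ ident C X" if "arr v" "cod v = X" for v
  using that X by (intro factors_throughI[of v]) auto
 have g: "greatest (Sub C X) (subobject C (ident C X)) (carrier (Sub C X))"
  unfolding greatest_def
 proof (intro conjI ballI)
  show "subobject C (ident C X) \<in> carrier (Sub C X)" using X by (intro subobject_carrier) auto
  fix V assume "V \<in> carrier (Sub C X)"
  then obtain v where v: "monic C v" "cod v = X" "V = subobject C v" by (rule carrier_SubE)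
  thus "V \<sqsubseteq>\<^bsub>Sub C X\<^esub> subobject C (ident C X)"
   using le_Sub_iff[of v "ident C X" X] le[of v] X by simp
 qed simp
 have top: "\<top>\<^bsub>Sub C X\<^esub> = subobject C (ident C X)"
  unfolding top_def by (rule some_equality[of _ "subobject C (ident C X)"]) (rule g, rule greatest_unique[OF _ g])
 have "epic C m" if l: "ident C X <~ m"
 proof -
  obtain u where "arr u" "cod u = dom m" "m ** u = ident C X"
   by (rule factors_throughE[OF l])
  thus ?thesis using epic_left_factor[of m u] mA X by simp
 qed
 moreover have "ident C X <~ m" if "epic C m"
  using that m X by (intro epic_factors_through) auto
 moreover have "cod m = cod (ident C X)" using m X by simp
 ultimately show ?thesis
  unfolding top using subobject_eq_iff[OF m(1) ident_monic[OF X]] le[OF mA m(2)] by blast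
qed

text \<open>Every subobject that is not epic lies below \<open>r\<close>, so \<open>r\<close> is the
  only maximal proper subobject and the intersection is over a singleton.\<close>

lemma radical_local:
 assumes q: "top_map C q" and r: "ses C r q"
 shows "radical C (dom q) = subobject C r"
proof -
 let ?L = "Sub C (dom q)"
 interpret partial_order ?L by (rule partial_order_Sub)
 note qD = top_mapD[OF q] and rD = sesD[OF r]
 have rA: "arr r" "cod r = dom q" using rD by auto
 have re: "~ epic C r" using rD(4) qD(2,3) rA epicD[of r q] by auto
 have rc: "subobject C r \<in> carrier ?L" using rD by (intro subobject_carrier) auto
 have le: "v <~ r" if v: "arr v" "cod v = dom q" "~ epic C v" for v
 proof -
  have "null C (q ** v)" using top_map_epic[OF q v(1,2)] v(3) by blast
  thus ?thesis using ses_null_iff[OF r v(1)] v(2) by simp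
 qed
 have "maximal_proper ?L A \<longleftrightarrow> A = subobject C r" for A
 proof
  assume A: "maximal_proper ?L A"
  hence "A \<in> carrier ?L" by (simp add: maximal_proper_def)
  then obtain a where a: "monic C a" "cod a = dom q" "A = subobject C a" by (rule carrier_SubE)
  have ae: "~ epic C a" using A top_Sub[OF a(1,2)] a(3) by (simp add: maximal_proper_def)
  have "a <~ r" using le a ae by simp
  hence "A \<sqsubseteq>\<^bsub>?L\<^esub> subobject C r" using le_Sub_iff[OF a(1) rD(1) a(2) rA(2)] a(3) by simp
  moreover have "subobject C r ~= \<top>\<^bsub>?L\<^esub>" using top_Sub[OF rD(1) rA(2)] re by simp
  ultimately show "A = subobject C r" using A rc unfolding maximal_proper_def by metis
 next
  assume A: "A = subobject C r"
  show "maximal_proper ?L A"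
   unfolding maximal_proper_def
  proof (intro conjI ballI impI)
   show "A \<in> carrier ?L" using rc A by simp
   show "A ~= \<top>\<^bsub>?L\<^esub>" using top_Sub[OF rD(1) rA(2)] re A by simp
   fix Y assume Y: "Y \<in> carrier ?L" "A \<sqsubseteq>\<^bsub>?L\<^esub> Y"
   obtain y where y: "monic C y" "cod y = dom q" "Y = subobject C y" using Y(1) by (rule carrier_SubE)
   have ry: "r <~ y" using Y(2) le_Sub_iff[OF rD(1) y(1) rA(2) y(2)] y(3) A by simp
   show "Y = A \<or> Y = \<top>\<^bsub>?L\<^esub>"
   proof (cases "epic C y")
    case True
    thus ?thesis using top_Sub[OF y(1,2)] y(3) by simp
   next
    case False
    hence "y <~ r" using le y by simp
    thus ?thesis using subobject_eq_iff[OF y(1) rD(1)] ry y rA A by simp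
   qed
  qed
 qed
 hence eq: "{A. maximal_proper ?L A} = {subobject C r}" by blast
 have g: "greatest ?L (subobject C r) (Lower ?L {subobject C r})"
  unfolding greatest_def
 by (simp add: conjI rc Lower_def)
 show ?thesis
  unfolding radical_def eq inf_def
  by (rule some_equality[of _ "subobject C r"]) (rule g, rule greatest_unique[OF _ g])
qed

text \<open>Otherwise \<open>\<alpha> ** r\<close> would be epic by \<open>top_map_epic\<close>, so
  \<open>\<alpha>\<close> would be epic and hence invertible; then \<open>r\<close> would be epic
  and \<open>q\<close> zero.\<close>

lemma radical_endo:
 assumes q: "top_map C q" and r: "ses C r q"
  and a: "arr \<alpha>" "dom \<alpha> = dom q" "cod \<alpha> = dom q"
 shows "null C (q ** (\<alpha> ** r))"
proof (rule ccontr)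
 note qD = top_mapD[OF q] and rD = sesD[OF r]
 have rA: "arr r" "cod r = dom q" using rD by auto
 assume "~ null C (q ** (\<alpha> ** r))"
 hence ar: "epic C (\<alpha> ** r)" using top_map_epic[OF q, of "\<alpha> ** r"] a rA by simp
 hence "epic C \<alpha>" using epic_left_factor[of \<alpha> r] a rA by simp
 hence "iso_arrow C \<alpha>" using epic_endo_iso a by simp
 then obtain b where b: "arr b" "dom b = cod \<alpha>" "cod b = dom \<alpha>" "b ** \<alpha> = ident C (dom \<alpha>)"
  "\<alpha> ** b = ident C (cod \<alpha>)"
  by (elim iso_arrowE)
 hence "iso_arrow C b" using a by (intro iso_arrowI[of b \<alpha>]) auto
 hence "epic C (b ** (\<alpha> ** r))" using epic_cmp[OF _ ar, of b] a b(1-3) rA by (simp add: iso_arrow_iff)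
 moreover have "b ** (\<alpha> ** r) = ident C (dom \<alpha>) ** r" by (rule cmp_reduce[OF b(4)]) (use a b rA in auto)
 ultimately have re: "epic C r" using rA(1,2) a(1,2) by (metis ident_cmp_Ar)
 have "null C q" by (rule epicD[OF re]) (use rD(3,4) qD(2) in simp_all)
 thus False using qD(3) by simp
qed

lemma induced_endo_eqI:
 assumes q: "epic C q" and b: "arr \<beta>" "dom \<beta> = cod q" "cod \<beta> = cod q" "\<beta> ** q = q ** \<alpha>"
 shows "induced_endo C q \<alpha> = \<beta>"
 unfolding induced_endo_def
proof (rule the_equality)
 show "\<beta> \<in> Hom C (cod q) (cod q) & \<beta> ** q = q ** \<alpha>" using b by (simp add: Hom_def)
 fix \<gamma> assume g: "\<gamma> \<in> Hom C (cod q) (cod q) & \<gamma> ** q = q ** \<alpha>"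
 hence g': "arr \<gamma>" "dom \<gamma> = cod q" "cod \<gamma> = cod q" by (simp_all add: Hom_def)
 have "\<gamma> ** q = \<beta> ** q" using g b(4) by simp
 thus "\<gamma> = \<beta>" using epic_cmp_iff[OF q g'(1) b(1)] g' b by simp
qed

end

context preadditive_category
begin

lemma null_finsum_cmp:
 assumes "finite S" and a: "a \<in> S \<rightarrow> Hom C B D" and u: "arr u" "cod u = B" and D: "D \<in> Ob C"
  and n: "!!k. k \<in> S ==> null C (a k ** u)"
 shows "null C (finsum (hom_group C B D) a S ** u)"
proof -
 have B: "B \<in> Ob C" using u by auto
 interpret G: abelian_group "hom_group C B D" by (rule hom_abelian_group[OF B D])
 show ?thesis
  using assms(1) a n
 proof (induction S rule: finite_induct)
  case empty
  thus ?case using u B D by (simp add: null_def)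
 next
  case (insert k S)
  have S: "a \<in> S \<rightarrow> carrier (hom_group C B D)" "a k \<in> carrier (hom_group C B D)"
   using insert.prems(1) by auto
  have e: "finsum (hom_group C B D) a (insert k S) = a k \<boxplus> finsum (hom_group C B D) a S"
   using G.finsum_insert[OF insert.hyps S] by simp
  have f: "finsum (hom_group C B D) a S \<in> Hom C B D"
   using G.finsum_closed[OF S(1)] by simp
  have t: "arr (a k)" "dom (a k) = B" "cod (a k) = D"
   "arr (finsum (hom_group C B D) a S)" "dom (finsum (hom_group C B D) a S) = B"
   "cod (finsum (hom_group C B D) a S) = D"
   using S(2) f by (simp_all add: Hom_def)
  have "null C (finsum (hom_group C B D) a S ** u)"
   by (rule insert.IH) (use insert.prems in auto)
  hence "null C ((a k ** u) \<boxplus> (finsum (hom_group C B D) a S ** u))"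
   by (intro null_hadd) (use insert.prems(2)[of k] t u in auto)
  thus ?case unfolding e using t u by simp
 qed
qed

text \<open>The projections are jointly monic, since \<open>u\<close> is the sum of the
  \<open>i k ** (p k ** u)\<close>.\<close>

lemma power_separates:
 assumes p: "is_power C M n B"
 obtains p where "!!k. k < n ==> p k \<in> Ar C & dom (p k) = B & cod (p k) = M"
  "!!u. [|arr u; cod u = B; !!k. k < n ==> null C (p k ** u)|] ==> null C u"
proof -
 obtain i p where ip: "!!k. k < n ==> i k \<in> Hom C M B & p k \<in> Hom C B M"
  and s: "finsum (hom_group C B B) (\<lambda>k. i k ** p k) {..<n} = ident C B" and B: "B \<in> Ob C"
  using p unfolding is_power_def by blast
 have t: "arr (i k)" "dom (i k) = M" "cod (i k) = B" "arr (p k)" "dom (p k) = B" "cod (p k) = M"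
  if "k < n" for k using ip[OF that] by (simp_all add: Hom_def)
 have "null C u" if u: "arr u" "cod u = B" and n: "!!k. k < n ==> null C (p k ** u)" for u
 proof -
  have "null C (finsum (hom_group C B B) (\<lambda>k. i k ** p k) {..<n} ** u)"
  proof (rule null_finsum_cmp[OF _ _ u B])
   show "(\<lambda>k. i k ** p k) \<in> {..<n} \<rightarrow> Hom C B B" using t by (auto simp: Hom_def)
   fix k assume "k \<in> {..<n}"
   hence k: "k < n" by simp
   have "null C (i k ** (p k ** u))" by (rule null_cmp_right[OF n[OF k]]) (use t[OF k] u in auto)
   thus "null C ((i k ** p k) ** u)" using t[OF k] u by simp
  qed simp
  thus ?thesis unfolding s using u by simp
 qed
 thus ?thesis using that[of p] t by blast
qed

end

section \<open>The generators defined by an object with (M1)--(M3)\<close>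

text \<open>By \<open>m_to_M\<close> every arrow from the domain of \<open>m x\<close> to M is an
  endomorphism followed by \<open>m x\<close>; so these arrows form a right vector space spanned by
  \<open>m x\<close>, over the endomorphism ring that \<open>m_endo\<close> makes a division ring.
  The index type is arbitrary: it serves for the join-irreducible subobjects as well as for the
  points of a given poset.\<close>

locale poset_generators = length_category C
 for C :: "('o, 'a, 'm) preadditive_scheme" (structure) +
 fixes M :: 'o and \<Omega> :: "'x set" and m :: "'x => 'a"
 assumes M_Ob: "M \<in> Ob C"
  and m_monic: "x \<in> \<Omega> ==> monic C (m x)"
  and m_tgt: "x \<in> \<Omega> ==> tgt C (m x) = M"
  and m_nonzero: "x \<in> \<Omega> ==> ~ null C (m x)"
  and m_antisym: "[|x \<in> \<Omega>; y \<in> \<Omega>; factors_through C (m x) (m y); factors_through C (m y) (m x)|] ==> x = y"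
  and m_projective: "[|x \<in> \<Omega>; epic C e; f \<in> Ar C; src C f = src C (m x); tgt C f = tgt C e|]
   ==> factors_through C f e"
  and m_generate: "[|g \<in> Ar C; ~ null C g|]
   ==> \<exists>x \<in> \<Omega>. \<exists>f \<in> Ar C. src C f = src C (m x) & tgt C f = src C g & ~ null C (g \<bullet> f)"
  and m_to_M: "[|x \<in> \<Omega>; f \<in> Ar C; src C f = src C (m x); tgt C f = M|] ==> factors_through C f (m x)"
  and m_endo: "[|x \<in> \<Omega>; \<alpha> \<in> Ar C; src C \<alpha> = src C (m x); tgt C \<alpha> = src C (m x); ~ null C \<alpha>|]
   ==> iso_arrow C \<alpha>"

locale M_conditions = length_category C
 for C :: "('o, 'a, 'm) preadditive_scheme" (structure) +
 fixes M :: 'o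
 assumes M_Ob: "M \<in> Ob C" and M1: "cond_M1 C" and M2: "cond_M2 C M" and M3: "cond_M3 C M"
begin

lemma dist: "distributive_lattice (Sub C M)"
 using M2 by (simp add: cond_M2_def)

text \<open>By \<open>local_comparable\<close> one of the two contains the other. If the inclusion
  were proper, \<open>local_path\<close> would give a closed path through the class of the common
  top.\<close>

lemma local_unique:
 assumes m1: "monic C m1" "cod m1 = M" and q1: "top_map C q1" "dom q1 = dom m1"
  and m2: "monic C m2" "cod m2 = M" and q2: "top_map C q2" "dom q2 = dom m2"
  and qq: "cod q1 = cod q2"
 shows "m1 <~ m2"
proof -
 have key: "m1 <~ m2" if m1: "monic C m1" "cod m1 = M" and q1: "top_map C q1" "dom q1 = dom m1"
  and m2: "monic C m2" "cod m2 = M" and q2: "top_map C q2" "dom q2 = dom m2"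
  and qq: "cod q1 = cod q2" and le: "m2 <~ m1" for m1 m2 q1 q2
 proof -
  obtain l where l: "arr l" "dom l = dom m2" "cod l = dom m1" "m1 ** l = m2"
   using le by (rule factors_throughE)
  have m1A: "arr m1" using m1 by simp
  have lm: "monic C l" using monic_right_factor[of m1 l] l m1A m2 by simp
  have "epic C l"
  proof (rule ccontr)
   assume "~ epic C l"
   hence "(iso_class C (cod q2), iso_class C (cod q1)) \<in> (ext_quiver C)\<^sup>+"
    by (intro local_path[OF q1(1) lm]) (use l q1 q2 top_mapD[OF q2(1)] top_map_simple[OF q2(1)] in auto)
   thus False using M1 qq by (simp add: cond_M1_def acyclic_def)
  qed
  hence "ident C (dom m1) <~ l"
   using lm l m1A by (intro epic_factors_through) auto
  hence "m1 ** ident C (dom m1) <~ m1 ** l"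
   using l m1A by (intro factors_through_mono) auto
  thus ?thesis using l m1A by simp
 qed
 show ?thesis
  using local_comparable[OF dist m1 q1 m2 q2 qq] key[OF m1 q1 m2 q2 qq] by blast
qed

text \<open>(M3) speaks of \<open>induced_endo\<close>, a definite description. It denotes an
  induced arrow because \<open>\<alpha>\<close> preserves the radical, by
  \<open>radical_endo\<close>; only then does the preimage supplied by (M3) satisfy the
  equation.\<close>

lemma lift_top_endo:
 assumes m: "monic C m" "cod m = M" and q: "top_map C q" "dom q = dom m"
  and b: "arr \<beta>" "dom \<beta> = cod q" "cod \<beta> = cod q"
 obtains \<alpha> where "arr \<alpha>" "dom \<alpha> = dom m" "cod \<alpha> = dom m" "q ** \<alpha> = \<beta> ** q"
proof -
 note qD = top_mapD[OF q(1)]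
 obtain r where r: "ses C r q" using epic_ses[OF qD(1)] .
 note rD = sesD[OF r]
 have rA: "arr r" "cod r = dom m" using rD q by auto
 have "join_irreducible (Sub C M) (subobject C m)" using join_irreducible_iff[OF m] q by blast
 moreover have "m \<in> subobject C m" using m by (intro subobject_self)
 moreover have "r \<in> radical C (dom m)" using radical_local[OF q(1) r] q rD(1) subobject_self by metis
 moreover have "is_cokernel C r q" using r by (simp add: ses_iff)
 ultimately have im: "induced_endo C q ` carrier (End_ring C (dom m)) = carrier (End_ring C (cod q))"
  using M3 unfolding cond_M3_def by blast
 have "\<beta> \<in> carrier (End_ring C (cod q))"
  unfolding End_ring_def hom_group_simps Hom_def using b by blast
 then obtain \<alpha> where a: "\<alpha> \<in> carrier (End_ring C (dom m))" "\<beta> = induced_endo C q \<alpha>"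
  unfolding im[symmetric] by blast
 have aA: "arr \<alpha>" "dom \<alpha> = dom m" "cod \<alpha> = dom m"
  using a(1) by (simp_all add: End_ring_def Hom_def)
 have "null C ((q ** \<alpha>) ** r)" using radical_endo[OF q(1) r aA(1)] aA q qD(2) rA by simp
 then obtain \<gamma> where g: "arr \<gamma>" "dom \<gamma> = cod q" "cod \<gamma> = cod (q ** \<alpha>)" "\<gamma> ** q = q ** \<alpha>"
  using ses_over[OF r, of "q ** \<alpha>"] aA q qD(2) by auto
 have gt: "cod \<gamma> = cod q" using g(3) aA q qD(2) by simp
 have "induced_endo C q \<alpha> = \<gamma>" by (rule induced_endo_eqI[OF qD(1) g(1,2) gt g(4)])
 thus ?thesis using that[OF aA] a(2) g(4) by simp
qed

text \<open>By (M2) the domain of \<open>q\<close> is a quotient of a subobject of a power of M,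
  which \<open>top_map_cover\<close> shrinks to a local one, \<open>v\<close>. The nonzero
  components of \<open>v\<close> have local images with the top of \<open>q\<close>, hence all the
  same image \<open>w\<close>. Once every component factors over one epic \<open>e\<close> onto
  \<open>w\<close>, this \<open>e\<close> is also monic, so the local cover is a subobject of M
  itself.\<close>

lemma local_cover:
 assumes q: "top_map C q"
 obtains m e where "monic C m" "cod m = M" "epic C e" "dom e = dom m" "cod e = dom q"
  "top_map C (q ** e)"
proof -
 note qD = top_mapD[OF q]
 have "dom q \<in> Ob C" using qD by simp
 then obtain n B where p: "is_power C M n B" and "subquotient C (dom q) B"
  using M2 unfolding cond_M2_def by blast
 then obtain b c where bc: "monic C b" "epic C c" "cod b = B" "dom c = dom b" "cod c = dom q"
  unfolding subquotient_def by blast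
 obtain u where u: "monic C u" "cod u = dom c" "epic C (c ** u)" "top_map C (q ** (c ** u))"
  using top_map_cover[OF bc(2) q] bc(5) by auto
 obtain p where p: "!!k. k < n ==> p k \<in> Ar C & dom (p k) = B & cod (p k) = M"
  "!!u. [|arr u; cod u = B; !!k. k < n ==> null C (p k ** u)|] ==> null C u"
  by (rule power_separates[OF p]) blast
 define v where "v = b ** u"
 define q' where "q' = q ** (c ** u)"
 have A: "arr b" "arr c" "arr u" using bc u by auto
 have v: "monic C v" "arr v" "dom v = dom u" "cod v = B"
  using bc u A unfolding v_def by (auto intro: monic_cmp)
 have q': "top_map C q'" "dom q' = dom u" "cod q' = cod q" "arr q'"
  using u A bc qD unfolding q'_def by auto
 note q'D = top_mapD[OF q'(1)]
 have comp: "arr (p k ** v)" "dom (p k ** v) = dom u" "cod (p k ** v) = M" if "k < n" for k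
  using p(1)[OF that] v by auto
 have "~ null C v"
 proof
  assume "null C v"
  hence "null C (ident C (dom u))"
   using monic_null_iff[OF v(1), of "ident C (dom u)"] v A by simp
  hence "null C (q' ** ident C (dom u))" by (rule null_cmp_right) (use q' A in auto)
  thus False using q' q'D by simp
 qed
 then obtain k0 where k0: "k0 < n" "~ null C (p k0 ** v)" using p(2)[OF v(2,4)] by blast
 \<comment> \<open>The image of a nonzero component is a nonzero quotient of a local object, so it
   is local with the same top.\<close>
 have loc: "\<exists>w e t. monic C w & cod w = M & epic C e & dom e = dom u & cod e = dom w &
   w ** e = f & arr t & dom t = dom w & cod t = cod q & t ** e = q' & top_map C t"
  if f: "arr f" "dom f = dom u" "cod f = M" "~ null C f" for f
 proof -
  obtain w e where we: "monic C w" "epic C e" "dom e = dom f" "cod e = dom w"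
   "cod w = cod f" "w ** e = f" by (rule imageE[OF f(1)])
  have "~ null C e"
  proof
   assume n: "null C e"
   have "null C (w ** e)" by (rule null_cmp_right[OF n]) (use we in auto)
   thus False using we f by simp
  qed
  then obtain t where "arr t" "dom t = cod e" "cod t = cod q'" "t ** e = q'" "top_map C t"
   using top_map_over[OF q'(1) we(2)] we q' f by auto
  thus ?thesis using we f q' by (intro exI[of _ w] exI[of _ e] exI[of _ t]) auto
 qed
 obtain w e t where w: "monic C w" "cod w = M" "epic C e" "dom e = dom u" "cod e = dom w"
   "w ** e = p k0 ** v" "arr t" "dom t = dom w" "cod t = cod q" "t ** e = q'" "top_map C t"
  using loc[OF comp[OF k0(1)] k0(2)] by blast
 have wA: "arr w" "arr e" using w by auto
 text \<open>By (M3) every component of the embedding into the power factors through the component \<open>e\<close>.\<close>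
 have fact: "\<exists>\<alpha> \<in> Ar C. dom \<alpha> = dom w & cod \<alpha> = dom w & p k ** v = w ** (\<alpha> ** e)" if k: "k < n" for k
 proof (cases "null C (p k ** v)")
  case True
  let ?\<alpha> = "hzero C (dom w) (dom w)"
  have "w ** (?\<alpha> ** e) = hzero C (dom u) M" using w(2,4,5) wA A(3) by simp
  hence "w ** (?\<alpha> ** e) = p k ** v" using True comp[OF k] by (simp add: null_def)
  thus ?thesis using wA by (intro bexI[of _ ?\<alpha>]) auto
 next
  case False
  obtain w1 e1 t1 where w1: "monic C w1" "cod w1 = M" "epic C e1" "dom e1 = dom u" "cod e1 = dom w1"
   "w1 ** e1 = p k ** v" "arr t1" "dom t1 = dom w1" "cod t1 = cod q" "t1 ** e1 = q'" "top_map C t1"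
   using loc[OF comp[OF k] False] by blast
  have "w1 <~ w"
   by (rule local_unique[OF w1(1,2,11,8) w(1,2,11,8)]) (use w w1 in auto)
  then obtain h where h: "arr h" "dom h = dom w1" "cod h = dom w" "w ** h = w1"
   by (rule factors_throughE)
  have "w <~ w1"
   by (rule local_unique[OF w(1,2,11,8) w1(1,2,11,8)]) (use w w1 in auto)
  hence "w <~ w ** h" using h by simp
  moreover have "monic C h" using monic_right_factor[of w h] h wA w1 by simp
  ultimately have he: "epic C h" using factors_through_epic[of w h] w h by simp
  define e2 where "e2 = h ** e1"
  have e1A: "arr e1" using w1(3) by simp
  have e2: "epic C e2" "arr e2" "dom e2 = dom u" "cod e2 = dom w"
   using epic_cmp[OF he w1(3)] h(1-3) w1(4,5) e1A unfolding e2_def by simp_all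
  have "w ** e2 = w1 ** e1" unfolding e2_def
   by (rule cmp_reduce[OF h(4)]) (use h(1-3) wA e1A w1(5) in simp_all)
  hence we2: "w ** e2 = p k ** v" using w1(6) by (rule trans)
  have te2: "epic C (t ** e2)" by (rule epic_cmp) (use e2(1,4) w(8) top_mapD(1)[OF w(11)] in simp_all)
  have nte2: "~ null C (t ** e2)"
   using epic_null_iff[OF e2(1), of t] w(7,8) e2(4) top_mapD(3)[OF w(11)] by simp
  \<comment> \<open>The maps \<open>e\<close> and \<open>e2\<close> onto \<open>w\<close> induce two
    top maps on the domain of \<open>u\<close>, which differ by an automorphism
    \<open>\<beta>\<close> of the top. Its lift \<open>\<alpha>\<close> to \<open>w\<close> corrects
    \<open>e\<close> so that it agrees with \<open>e2\<close> modulo the radical.\<close>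
  obtain \<beta> where \<beta>: "iso_arrow C \<beta>" "dom \<beta> = cod q'" "cod \<beta> = cod (t ** e2)" "\<beta> ** q' = t ** e2"
  proof -
   obtain b where b: "iso_arrow C b" "dom b = cod (t ** e2)" "cod b = cod q'" "b ** (t ** e2) = q'"
    by (rule top_map_same[OF q'(1) te2]) (use e2 w(7-9) q'(2-4) nte2 top_map_simple[OF w(11)] in auto)
   obtain b' where b': "arr b" "arr b'" "dom b' = cod b" "cod b' = dom b"
    "b' ** b = ident C (dom b)" "b ** b' = ident C (cod b)" using b(1) by (rule iso_arrowE)
   have "iso_arrow C b'" using b' by (intro iso_arrowI[of b' b]) auto
   moreover have "b' ** q' = t ** e2"
   proof -
    have "b' ** (b ** (t ** e2)) = ident C (dom b) ** (t ** e2)"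
     by (rule cmp_reduce[OF b'(5)]) (use b' b(2) te2 in auto)
    thus ?thesis using b(2) te2 by (simp add: b(4))
   qed
   ultimately show ?thesis using that[of b'] b b' by simp
  qed
  have \<beta>A: "arr \<beta>" "dom \<beta> = cod t" "cod \<beta> = cod t"
   using \<beta>(1-3) w(7-9) q'(3) e2 by auto
  obtain \<alpha> where \<alpha>: "arr \<alpha>" "dom \<alpha> = dom w" "cod \<alpha> = dom w" "t ** \<alpha> = \<beta> ** t"
   using lift_top_endo[OF w(1,2,11,8) \<beta>A] by blast
  define d where "d = e2 \<boxplus> hneg C (\<alpha> ** e)"
  have dA: "arr d" "dom d = dom u" "cod d = dom w"
   using e2 \<alpha>(1-3) w(4,5) wA by (simp_all add: d_def)
  have "t ** (\<alpha> ** e) = (\<beta> ** t) ** e" by (rule cmp_reduce[OF \<alpha>(4)]) (use \<alpha>(1-3) w(5,7,8) wA in auto)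
  also have "... = \<beta> ** (t ** e)" using \<beta>A w(5,7,8) wA by simp
  also have "... = \<beta> ** q'" by (simp only: w(10))
  also have "... = t ** e2" by (rule \<beta>(4))
  finally have "null C ((t ** e2) \<boxplus> hneg C (t ** (\<alpha> ** e)))"
   using e2 w(7,8) by (subst null_diff_iff) auto
  moreover have "t ** d = (t ** e2) \<boxplus> hneg C (t ** (\<alpha> ** e))"
   unfolding d_def using e2(2-4) \<alpha>(1-3) w(1-5,7-9) wA by simp
  ultimately have td: "null C (t ** d)" by simp
  \<comment> \<open>Agreement modulo the radical is equality: a nonzero \<open>w ** d\<close> would
    again have image \<open>w\<close> by \<open>local_unique\<close>, making \<open>d\<close> epic,
    while \<open>t\<close> kills \<open>d\<close>.\<close>
  have "null C d"
  proof (rule ccontr)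
   assume nd: "~ null C d"
   have wd: "arr (w ** d)" "dom (w ** d) = dom u" "cod (w ** d) = M" using wA dA w(2) by auto
   have nwd: "~ null C (w ** d)" using monic_null_iff[OF w(1), of d] nd dA by simp
   obtain w3 e3 t3 where w3: "monic C w3" "cod w3 = M" "epic C e3" "dom e3 = dom u" "cod e3 = dom w3"
    "w3 ** e3 = w ** d" "arr t3" "dom t3 = dom w3" "cod t3 = cod q" "t3 ** e3 = q'" "top_map C t3"
    using loc[OF wd nwd] by blast
   have "w <~ w3"
    by (rule local_unique[OF w(1,2,11,8) w3(1,2,11,8)]) (use w w3 in auto)
   moreover have "w3 <~ w"
    by (rule local_unique[OF w3(1,2,11,8) w(1,2,11,8)]) (use w w3 in auto)
   ultimately obtain h3 where h3: "arr h3" "dom h3 = dom w3" "cod h3 = dom w" "w ** h3 = w3"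
    and h3w: "w <~ w ** h3"
    by (metis factors_throughE)
   have "monic C h3" using monic_right_factor[of w h3] h3 wA w3(1) by simp
   hence h3e: "epic C h3" using factors_through_epic[of w h3] w(1) h3(1,3) h3w by blast
   have e3A: "arr e3" using w3(3) by simp
   have "w ** (h3 ** e3) = w3 ** e3" by (rule cmp_reduce[OF h3(4)]) (use h3(1-3) wA w3(5) e3A in auto)
   hence "w ** d = w ** (h3 ** e3)" using w3(6) by simp
   hence "d = h3 ** e3"
    using monic_cmp_iff[OF w(1), of d "h3 ** e3"] dA h3(1-3) w3(4,5) e3A by simp
   hence "epic C d" using epic_cmp[OF h3e w3(3)] h3(2) w3(5) by simp
   hence "null C t" by (rule epicD) (use td w(7,8) dA in auto)
   thus False using top_mapD[OF w(11)] by simp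
  qed
  hence "e2 = \<alpha> ** e"
   unfolding d_def using e2 \<alpha>(1-3) w(4,5) wA by (subst (asm) null_diff_iff) auto
  hence "p k ** v = w ** (\<alpha> ** e)" using we2 by simp
  thus ?thesis using \<alpha>(1-3) by blast
 qed
 \<comment> \<open>What \<open>e\<close> kills is killed by every component of the monic
   \<open>v\<close>.\<close>
 have em: "monic C e"
 proof (rule monicI[OF wA(2)])
  fix g assume g: "arr g" "cod g = dom e" "null C (e ** g)"
  have "null C (v ** g)"
  proof (rule p(2))
   fix k assume k: "k < n"
   obtain \<alpha> where \<alpha>: "arr \<alpha>" "dom \<alpha> = dom w" "cod \<alpha> = dom w" "p k ** v = w ** (\<alpha> ** e)"
    using fact[OF k] by blast
   have "null C ((w ** \<alpha>) ** (e ** g))" by (rule null_cmp_right[OF g(3)]) (use \<alpha>(1-3) w(5) wA g(1,2) in auto)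
   moreover have "p k ** (v ** g) = (w ** (\<alpha> ** e)) ** g"
    by (rule cmp_reduce[OF \<alpha>(4)]) (use p(1)[OF k] v g(1,2) w(4) in auto)
   moreover have "(w ** (\<alpha> ** e)) ** g = (w ** \<alpha>) ** (e ** g)"
    using \<alpha>(1-3) w(4,5) wA g(1,2) by simp
   ultimately show "null C (p k ** (v ** g))" by simp
  qed (use v g(1,2) w(4) in auto)
  thus "null C g" using monic_null_iff[OF v(1) g(1)] g(2) w(4) v(3) by simp
 qed
 hence "iso_arrow C e" using w(3) by (simp add: iso_arrow_iff)
 then obtain e' where e': "arr e'" "dom e' = cod e" "cod e' = dom e"
  "e' ** e = ident C (dom e)" "e ** e' = ident C (cod e)" by (elim iso_arrowE)
 have e'i: "iso_arrow C e'" using e' wA by (intro iso_arrowI[of e' e]) auto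
 define c' where "c' = (c ** u) ** e'"
 have cu: "arr (c ** u)" "dom (c ** u) = dom u" "cod (c ** u) = dom q" using A u bc by auto
 have c': "epic C c'" unfolding c'_def
  by (rule epic_cmp) (use u(3) e'(1-3) e'i w(4) cu in \<open>auto simp: iso_arrow_iff\<close>)
 have "q ** c' = q' ** e'" unfolding c'_def q'_def using cu e'(1-3) w(4) qD(2) A u(2) by simp
 also have "... = t ** (e ** e')" unfolding w(10)[symmetric] using e'(1-3) w(5,7,8) wA by simp
 also have "... = t" using e'(5) w(5,7,8) by simp
 finally have "top_map C (q ** c')" using w(11) by simp
 moreover have "dom c' = dom w" "cod c' = dom q"
  unfolding c'_def using e'(1-3) cu w(4,5) by simp_all
 ultimately show ?thesis using that[of w c'] w(1,2) c' by blast
qed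

text \<open>Shrink the domain of \<open>e\<close> to a local \<open>u\<close> over the domain of
  \<open>m\<close>, and cover \<open>u\<close> by a local subobject \<open>m'\<close> of M. It has
  the same top as \<open>m\<close>, so the two are equal by \<open>local_unique\<close>. The
  composite is then an epic endomorphism of the domain of \<open>m\<close>, hence invertible, and
  its inverse yields the section.\<close>

lemma local_split:
 assumes m: "monic C m" "cod m = M" and q: "top_map C q" "dom q = dom m"
  and e: "epic C e" "cod e = dom m"
 obtains s where "arr s" "dom s = dom m" "cod s = dom e" "e ** s = ident C (dom m)"
proof -
 have eA: "arr e" "arr m" using e m by auto
 obtain u where u: "monic C u" "cod u = dom e" "epic C (e ** u)" "top_map C (q ** (e ** u))"
  using top_map_cover[OF e(1) q(1)] e q by auto
 have uA: "arr u" and qA: "arr q" using u top_mapD[OF q(1)] by auto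
 have qs: "dom (q ** (e ** u)) = dom u" "cod (q ** (e ** u)) = cod q" using u uA eA e q qA by auto
 obtain m' e' where m': "monic C m'" "cod m' = M" "epic C e'" "dom e' = dom m'"
  "cod e' = dom u" "top_map C ((q ** (e ** u)) ** e')"
  using local_cover[OF u(4)] qs by auto
 have m'A: "arr m'" "arr e'" using m' by auto
 have ts: "dom ((q ** (e ** u)) ** e') = dom m'" "cod ((q ** (e ** u)) ** e') = cod q"
  using m' m'A u uA eA e q qA by auto
 have "m <~ m'"
  by (rule local_unique[OF m q m'(1,2,6) ts(1)]) (use ts in simp)
 then obtain v where v: "arr v" "dom v = dom m" "cod v = dom m'" "m' ** v = m"
  by (rule factors_throughE)
 have "m' <~ m"
  by (rule local_unique[OF m'(1,2,6) ts(1) m q]) (use ts in simp)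
 hence "m' <~ m' ** v" using v by simp
 moreover have "monic C v" using monic_right_factor[of m' v] v m'A m by simp
 ultimately have ve: "epic C v" using factors_through_epic[of m' v] m' v by simp
 define f where "f = (e ** u) ** (e' ** v)"
 have "epic C (e' ** v)" by (rule epic_cmp[OF m'(3) ve]) (use m'(4) v(3) in simp)
 hence "epic C f" unfolding f_def
  by (rule epic_cmp[OF u(3)]) (use m'(4,5) m'A(2) v(1,3) u(2) uA eA(1) in simp)
 moreover have "dom f = dom m" "cod f = dom m"
  unfolding f_def using m'(4,5) m'A(2) v(1-3) u(2) uA eA(1) e(2) by simp_all
 ultimately have f: "epic C f" "arr f" "dom f = dom m" "cod f = dom m" by simp_all
 hence "iso_arrow C f" by (intro epic_endo_iso) auto
 then obtain g where g: "arr g" "dom g = dom m" "cod g = dom m" "f ** g = ident C (dom m)"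
  using f by (auto elim: iso_arrowE)
 have "e ** (u ** (e' ** (v ** g))) = f ** g"
  unfolding f_def using g(1-3) m'(4,5) m'A v(1-3) u(2) uA eA e by simp
 thus ?thesis
  using that[of "u ** (e' ** (v ** g))"] g m'(4,5) m'A v(1-3) u(2) uA eA e by simp
qed

lemma poset_generators:
 fixes \<Omega> :: "'x set" and m :: "'x => 'a"
 assumes en: "enumerates_ji C M \<Omega> m"
 shows "poset_generators C M \<Omega> m"
proof
 have mx: "monic C (m x)" "cod (m x) = M" "arr (m x)" if "x \<in> \<Omega>" for x
  using en that by (auto simp: enumerates_ji_def)
 have bij: "bij_betw (\<lambda>x. subobject C (m x)) \<Omega> {N. join_irreducible (Sub C M) N}"
  using en by (simp add: enumerates_ji_def)
 have qx: "\<exists>q. top_map C q & dom q = dom (m x)" if "x \<in> \<Omega>" for x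
 proof -
  have "join_irreducible (Sub C M) (subobject C (m x))" using bij that by (auto simp: bij_betw_def)
  thus ?thesis using join_irreducible_iff[OF mx(1,2)[OF that]] by blast
 qed
 show "M \<in> Ob C" by (rule M_Ob)
 show "monic C (m x)" "cod (m x) = M" if "x \<in> \<Omega>" for x using mx[OF that] by auto
 show "~ null C (m x)" if x: "x \<in> \<Omega>" for x
 proof -
  have "join_irreducible (Sub C M) (subobject C (m x))" using bij x by (auto simp: bij_betw_def)
  thus ?thesis using bottom_Sub[OF mx(1,2)[OF x]] by (simp add: join_irreducible_def)
 qed
 show "x = y" if "x \<in> \<Omega>" "y \<in> \<Omega>" "m x <~ m y" "m y <~ m x" for x y
 proof -
  have "subobject C (m x) = subobject C (m y)"
   using subobject_eq_iff[OF mx(1)[OF that(1)] mx(1)[OF that(2)]] that mx by simp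
  thus ?thesis using bij that(1,2) by (auto simp: bij_betw_def inj_on_def)
 qed
 \<comment> \<open>A section of the pullback of \<open>e\<close> along \<open>f\<close> gives the
   lift of \<open>f\<close>.\<close>
 show "f <~ e"
  if x: "x \<in> \<Omega>" and e: "epic C e" and f: "arr f" "dom f = dom (m x)" "cod f = cod e" for x e f
 proof -
  obtain q where q: "top_map C q" "dom q = dom (m x)" using qx[OF x] by blast
  obtain a b where ab: "arr a" "epic C b" "dom a = dom b" "cod a = dom e" "cod b = dom f"
   "e ** a = f ** b" by (rule pullback_epic[OF e f(1,3)])
  obtain s where s: "arr s" "dom s = dom (m x)" "cod s = dom b" "b ** s = ident C (dom (m x))"
   using local_split[OF mx(1,2)[OF x] q ab(2)] ab f by auto
  have bA: "arr b" and eA: "arr e" using ab e by auto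
  have "e ** (a ** s) = (f ** b) ** s" by (rule cmp_reduce[OF ab(6)]) (use ab s eA in auto)
  also have "... = f" using f s ab(1-5) bA by simp
  finally show ?thesis using s ab f by (intro factors_throughI[of "a ** s"]) auto
 qed
 \<comment> \<open>The image of a nonzero arrow to M is local with the same top as
   \<open>m x\<close>, so it is the same subobject.\<close>
 have im: "\<exists>w e. monic C w & epic C e & dom e = dom f & cod e = dom w & cod w = M & w ** e = f &
   w <~ m x & m x <~ w"
  if x: "x \<in> \<Omega>" and f: "arr f" "dom f = dom (m x)" "cod f = M" "~ null C f" for x f
 proof -
  obtain q where q: "top_map C q" "dom q = dom (m x)" using qx[OF x] by blast
  obtain w e where we: "monic C w" "epic C e" "dom e = dom f" "cod e = dom w"
   "cod w = cod f" "w ** e = f" by (rule imageE[OF f(1)])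
  have "~ null C e"
  proof
   assume n: "null C e"
   have "null C (w ** e)" by (rule null_cmp_right[OF n]) (use we in auto)
   thus False using we f by simp
  qed
  then obtain t where t: "arr t" "dom t = cod e" "cod t = cod q" "t ** e = q" "top_map C t"
   using top_map_over[OF q(1) we(2)] we q f by auto
  have tw: "cod w = M" "dom t = dom w" using we f t by auto
  have "w <~ m x" "m x <~ w"
   using local_unique[OF we(1) tw(1) t(5) tw(2) mx(1,2)[OF x] q t(3)]
    local_unique[OF mx(1,2)[OF x] q we(1) tw(1) t(5) tw(2) t(3)[symmetric]] by auto
  thus ?thesis using we f by auto
 qed
 show "f <~ m x"
  if x: "x \<in> \<Omega>" and f: "arr f" "dom f = dom (m x)" "cod f = M" for x f
 proof (cases "null C f")
  case True
  thus ?thesis using null_factors_through[of f "m x"] f mx[OF x] by simp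
 next
  case False
  then obtain w e where we: "monic C w" "epic C e" "cod e = dom w" "w ** e = f" "w <~ m x"
   using im[OF x f] by blast
  have "w ** e <~ w" using we by (intro factors_through_cmp) auto
  thus ?thesis using we mx[OF x] factors_through_trans by blast
 qed
 show "iso_arrow C \<alpha>"
  if x: "x \<in> \<Omega>" and a: "arr \<alpha>" "dom \<alpha> = dom (m x)" "cod \<alpha> = dom (m x)" "~ null C \<alpha>" for x \<alpha>
 proof -
  note mm = mx[OF x]
  have "~ null C (m x ** \<alpha>)" using monic_null_iff[OF mm(1) a(1)] a by simp
  then obtain w e where we: "monic C w" "epic C e" "dom e = dom (m x ** \<alpha>)" "cod e = dom w" "w ** e = m x ** \<alpha>"
   and le: "w <~ m x" "m x <~ w"
   using im[OF x, of "m x ** \<alpha>"] a mm by auto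
  obtain h where h: "arr h" "dom h = dom w" "cod h = dom (m x)" "m x ** h = w"
   using le(1) by (rule factors_throughE)
  have "m x <~ m x ** h" using le(2) h by simp
  moreover have "monic C h" using monic_right_factor[of "m x" h] h mm we by simp
  ultimately have he: "epic C h" using factors_through_epic[of "m x" h] mm h by simp
  have weA: "arr w" "arr e" using we by auto
  have "m x ** (h ** e) = w ** e" by (rule cmp_reduce[OF h(4)]) (use h mm weA we in auto)
  hence "m x ** (h ** e) = m x ** \<alpha>" using we by simp
  hence "h ** e = \<alpha>"
   using monic_cmp_iff[OF mm(1), of "h ** e" \<alpha>] h(1-3) weA we(3,4) a mm by simp
  moreover have "epic C (h ** e)" by (rule epic_cmp[OF he we(2)]) (use h we in auto)
  ultimately show ?thesis using a by (intro epic_endo_iso) auto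
 qed
 \<comment> \<open>A nonzero arrow is nonzero on a local subobject of its domain, and
   \<open>local_cover\<close> covers this by a local, hence join-irreducible, subobject of
   M.\<close>
 show "\<exists>x \<in> \<Omega>. \<exists>f \<in> Ar C. dom f = dom (m x) & cod f = dom g & ~ null C (g ** f)"
  if g: "arr g" "~ null C g" for g
 proof -
  obtain l q where l: "monic C l" "cod l = dom g" "~ null C (g ** l)" "top_map C q" "dom q = dom l"
   by (rule local_subobject[OF g])
  obtain n e where n: "monic C n" "cod n = M" "epic C e" "dom e = dom n" "cod e = dom q"
   "top_map C (q ** e)" by (rule local_cover[OF l(4)])
  have A: "arr l" "arr n" "arr e" "arr q" using l n top_mapD by auto
  have "dom (q ** e) = dom n" using A n by simp
  hence "join_irreducible (Sub C M) (subobject C n)"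
   using join_irreducible_iff[OF n(1,2)] n(6) by blast
  hence "subobject C n \<in> (\<lambda>x. subobject C (m x)) ` \<Omega>" using bij unfolding bij_betw_def by blast
  then obtain x where x: "x \<in> \<Omega>" "subobject C (m x) = subobject C n" by force
  have le: "m x <~ n" "n <~ m x"
   using subobject_eq_iff[OF mx(1)[OF x(1)] n(1)] x mx[OF x(1)] n by auto
  obtain h where h: "arr h" "dom h = dom (m x)" "cod h = dom n" "n ** h = m x"
   using le(1) by (rule factors_throughE)
  have "n <~ n ** h" using le(2) h by simp
  moreover have "monic C h" using monic_right_factor[of n h] h A mx[OF x(1)] by simp
  ultimately have he: "epic C h" using factors_through_epic[of n h] n h by simp
  have eh: "epic C (e ** h)" by (rule epic_cmp) (use n he h in auto)
  have "~ null C ((g ** l) ** (e ** h))"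
   using epic_null_iff[OF eh, of "g ** l"] l n h A g by simp
  hence "~ null C (g ** (l ** (e ** h)))" using l n h(1-3) A g by simp
  thus ?thesis using x l n h A g by (intro bexI[of _ x] bexI[of _ "l ** (e ** h)"]) auto
 qed
qed

end

section \<open>Biproducts and split extensions\<close>

context length_category
begin

lemma is_biproductD:
 assumes "is_biproduct C X Y B i1 i2 p1 p2"
 shows "B \<in> Ob C" "arr i1" "dom i1 = X" "cod i1 = B"
  "arr i2" "dom i2 = Y" "cod i2 = B" "arr p1" "dom p1 = B" "cod p1 = X"
  "arr p2" "dom p2 = B" "cod p2 = Y"
  "p1 ** i1 = ident C X" "p2 ** i2 = ident C Y" "p1 ** i2 = hzero C Y X" "p2 ** i1 = hzero C X Y"
  "(i1 ** p1) \<boxplus> (i2 ** p2) = ident C B"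
 using assms unfolding is_biproduct_def Hom_def by blast+

lemma biproduct_ses:
 assumes b: "is_biproduct C X Y B i1 i2 p1 p2"
 shows "ses C i1 p2"
proof -
 note bD = is_biproductD[OF b]
 have XY: "X \<in> Ob C" "Y \<in> Ob C" using Ob_simps(1)[OF bD(2)] Ob_simps(1)[OF bD(5)] bD(3,6) by simp_all
 have "monic C (p1 ** i1)" "epic C (p2 ** i2)" unfolding bD(14,15) using XY by simp_all
 hence me: "monic C i1" "epic C p2"
  using monic_right_factor[of p1 i1] epic_left_factor[of p2 i2] bD(1-13) by simp_all
 have g: "g <~ i1" if g: "arr g" "cod g = dom p2" "null C (p2 ** g)" for g
 proof -
  have "g = ((i1 ** p1) \<boxplus> (i2 ** p2)) ** g" using g(1,2) bD(12) unfolding bD(18) by simp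
  also have "... = (i1 ** (p1 ** g)) \<boxplus> (i2 ** (p2 ** g))" using g(1,2) bD(1-13) by simp
  also have "... = i1 ** (p1 ** g)" using g bD(1-13) XY by (simp add: null_def)
  finally show ?thesis using factors_through_cmp[of i1 "p1 ** g"] g(1,2) bD(1-13) by simp
 qed
 have h: "factors_over C h p2" if h: "arr h" "dom h = cod i1" "null C (h ** i1)" for h
 proof -
  have "h = h ** ((i1 ** p1) \<boxplus> (i2 ** p2))" using h(1,2) bD(4) unfolding bD(18) by simp
  also have "... = ((h ** i1) ** p1) \<boxplus> (h ** (i2 ** p2))" using h(1,2) bD(1-13) by simp
  also have "... = (h ** i2) ** p2" using h bD(1-13) XY by (simp add: null_def)
  finally have "(h ** i2) ** p2 = h" by simp
  moreover have "h ** i2 \<in> Hom C (cod p2) (cod h)" using h(1,2) bD(1-13) by (simp add: Hom_def)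
  ultimately show ?thesis unfolding factors_over_def by blast
 qed
 have "null C (p2 ** i1)" unfolding bD(17) using XY by simp
 thus ?thesis unfolding ses_def using me bD(4,12) g h by simp
qed

lemma biproduct_iso:
 assumes b: "is_biproduct C X Y B i1 i2 p1 p2" and b': "is_biproduct C X Y B' i1' i2' p1' p2'"
 obtains h where "h \<in> Hom C B B'" "iso_arrow C h" "h ** i1 = i1'" "p2' ** h = p2"
proof -
 note bD = is_biproductD[OF b] and bD' = is_biproductD[OF b']
 have XY: "X \<in> Ob C" "Y \<in> Ob C" using Ob_simps(1)[OF bD(2)] Ob_simps(1)[OF bD(5)] bD(3,6) by simp_all
 define h where "h = (i1' ** p1) \<boxplus> (i2' ** p2)"
 define g where "g = (i1 ** p1') \<boxplus> (i2 ** p2')"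
 have t: "arr h" "dom h = B" "cod h = B'" "arr g" "dom g = B'" "cod g = B"
  unfolding h_def g_def using bD(1-13) bD'(1-13) by simp_all
 have hi: "h ** i1 = i1'" "h ** i2 = i2'" "g ** i1' = i1" "g ** i2' = i2"
  unfolding h_def g_def using bD(1-17) bD'(1-17) XY by simp_all
 have "g ** h = (i1 ** p1) \<boxplus> (i2 ** p2)"
  unfolding h_def using bD(1-13) bD'(1-13) t(4-6) by (simp add: cmp_reduce[OF hi(3)] cmp_reduce[OF hi(4)])
 moreover have "h ** g = (i1' ** p1') \<boxplus> (i2' ** p2')"
  unfolding g_def using bD(1-13) bD'(1-13) t(1-3) by (simp add: cmp_reduce[OF hi(1)] cmp_reduce[OF hi(2)])
 ultimately have "iso_arrow C h" using t bD(18) bD'(18) by (intro iso_arrowI[of h g]) simp_all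
 moreover have "p2' ** h = p2"
  unfolding h_def using bD(1-13) bD'(1-13) XY
  by (simp add: cmp_reduce[OF bD'(17)] cmp_reduce[OF bD'(15)])
 ultimately show ?thesis using that[of h] t hi(1) by (simp add: Hom_def)
qed

text \<open>The difference of the identity and \<open>i ** r\<close> vanishes on \<open>i\<close>,
  so it factors over \<open>p\<close>; the factor \<open>s\<close> is the section.\<close>

lemma split_biproduct:
 assumes ip: "ses C i p" and r: "arr r" "dom r = cod i" "cod r = dom i" "r ** i = ident C (dom i)"
 obtains s where "is_biproduct C (dom i) (cod p) (cod i) i s r p"
proof -
 note ipD = sesD[OF ip]
 have A: "arr i" "arr p" "dom p = cod i" using ipD by auto
 let ?d = "ident C (cod i) \<boxplus> hneg C (i ** r)"
 have d: "arr ?d" "dom ?d = cod i" "cod ?d = cod i" using A r(1-3) by simp_all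
 have "?d ** i = i \<boxplus> hneg C i" using A r by simp
 hence "null C (?d ** i)" using A by (simp add: null_def)
 then obtain s where s: "arr s" "dom s = cod p" "cod s = cod ?d" "s ** p = ?d"
  using ses_over[OF ip d(1)] d A by auto
 have st: "cod s = cod i" using s(3) d by simp
 have sum: "(i ** r) \<boxplus> (s ** p) = ident C (cod i)"
 proof -
  have "(i ** r) \<boxplus> (s ** p) = (s ** p) \<boxplus> (i ** r)"
   by (rule hadd_comm) (use s(1,2) st A r(1-3) in simp_all)
  also have "... = ident C (cod i)"
   unfolding s(4) by (rule hadd_hneg_cancel(2)) (use A r(1-3) in simp_all)
  finally show ?thesis .
 qed
 have pi: "p ** i = hzero C (dom i) (cod p)" using ipD(4) A by (simp add: null_def)
 have "p ** ((i ** r) \<boxplus> (s ** p)) = (p ** s) ** p"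
  using A r(1-3) s(1,2) st by (simp add: cmp_reduce[OF pi])
 hence "(p ** s) ** p = ident C (cod p) ** p" unfolding sum using A by simp
 hence ps: "p ** s = ident C (cod p)"
  using epic_cmp_iff[OF ipD(2), of "p ** s" "ident C (cod p)"] A s(1,2) st by simp
 have "r ** ((i ** r) \<boxplus> (s ** p)) = r \<boxplus> (r ** (s ** p))"
  using A r(1-3) s(1,2) st by (simp add: cmp_reduce[OF r(4)])
 hence "r \<boxplus> (r ** (s ** p)) = r \<boxplus> hzero C (cod i) (dom i)" unfolding sum using A r(1-3) by simp
 hence "r ** (s ** p) = hzero C (cod i) (dom i)"
  by (rule hadd_left_cancel[rotated 7]) (use A r(1-3) s(1,2) st in simp_all)
 hence "null C ((r ** s) ** p)" using A r(1-3) s(1,2) st by (simp add: null_def)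
 hence "null C (r ** s)" using epic_null_iff[OF ipD(2), of "r ** s"] A r(1-3) s(1,2) st by simp
 hence rs: "r ** s = hzero C (cod p) (dom i)" using A r(1-3) s(1,2) st by (simp add: null_def)
 have "is_biproduct C (dom i) (cod p) (cod i) i s r p"
  unfolding is_biproduct_def Hom_def using A r s(1,2) st sum ps rs pi by simp
 thus ?thesis by (rule that)
qed

text \<open>If all extensions split, each is a direct sum and any two are equivalent, so the only
  class is the zero class. This is the counterpart of \<open>ext_quiverI\<close>.\<close>

lemma ext_nonsplit:
 assumes ST: "S \<in> Ob C" "T \<in> Ob C" and ne: "Ext1 C T S ~= {Ext1_zero C T S}"
 obtains i p where "ses C i p" "dom i = S" "cod p = T"
  "!!r. [|arr r; dom r = cod i; cod r = S|] ==> r ** i ~= ident C S"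
proof (rule ccontr)
 assume n: "~ thesis"
 note wit = that
 have split: "\<exists>r \<in> Ar C. dom r = cod i & cod r = S & r ** i = ident C S"
  if ip: "ses C i p" "dom i = S" "cod p = T" for i p
  using n wit[OF ip] by blast
 have bip: "\<exists>s r. is_biproduct C S T (cod i) i s r p" if "(i, p) \<in> extensions C T S" for i p
 proof -
  have ip: "ses C i p" "dom i = S" "cod p = T" using that by (simp_all add: extensions_iff)
  obtain r where "arr r" "dom r = cod i" "cod r = S" "r ** i = ident C S"
   using split[OF ip] by blast
  thus ?thesis using split_biproduct[OF ip(1), of r] ip by metis
 qed
 have rel: "(e, e') \<in> extension_rel C T S"
  if ee: "e \<in> extensions C T S" "e' \<in> extensions C T S" for e e'
 proof -
  obtain i p i' p' where e: "e = (i, p)" "e' = (i', p')" by fastforce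
  obtain s r s' r' where b: "is_biproduct C S T (cod i) i s r p" "is_biproduct C S T (cod i') i' s' r' p'"
   using bip ee unfolding e by blast
  obtain h where "h \<in> Hom C (cod i) (cod i')" "iso_arrow C h" "h ** i = i'" "p' ** h = p"
   by (rule biproduct_iso[OF b])
  thus ?thesis using ee unfolding e extension_rel_def by blast
 qed
 have sub: "extension_rel C T S \<subseteq> extensions C T S \<times> extensions C T S"
  unfolding extension_rel_def by blast
 obtain B i1 i2 p1 p2 where b: "is_biproduct C S T B i1 i2 p1 p2" using biproduct_exists[OF ST] by blast
 have e0: "(i1, p2) \<in> extensions C T S"
  using biproduct_ses[OF b] is_biproductD[OF b] by (simp add: extensions_iff)
 have "Ext1_zero C T S = extensions C T S"
 proof
  show "Ext1_zero C T S \<subseteq> extensions C T S" unfolding Ext1_zero_def using sub by blast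
  show "extensions C T S \<subseteq> Ext1_zero C T S" unfolding Ext1_zero_def using rel[OF e0] b by blast
 qed
 moreover have "extension_rel C T S `` {e} = extensions C T S" if "e \<in> extensions C T S" for e
  using rel[OF that] sub by blast
 hence "Ext1 C T S = {extensions C T S}" unfolding Ext1_def quotient_def using e0 by blast
 ultimately show False using ne by simp
qed

lemma cmp_finsum_cmp:
 assumes "finite S" and a: "a \<in> S \<rightarrow> Hom C B D" and B: "B \<in> Ob C" "D \<in> Ob C"
  and u: "arr u" "cod u = B" and v: "arr v" "dom v = D"
 shows "v ** (finsum (hom_group C B D) a S ** u) =
  finsum (hom_group C (dom u) (cod v)) (\<lambda>k. v ** (a k ** u)) S"
proof -
 interpret G: abelian_group "hom_group C B D" by (rule hom_abelian_group[OF B])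
 interpret H: abelian_group "hom_group C (dom u) (cod v)"
  by (rule hom_abelian_group) (use u v in simp_all)
 show ?thesis
  using assms(1) a
 proof (induction S rule: finite_induct)
  case empty
  thus ?case using u v B by simp
 next
  case (insert k S)
  have S: "a \<in> S \<rightarrow> carrier (hom_group C B D)" "a k \<in> carrier (hom_group C B D)"
   using insert.prems by auto
  have t1: "arr (a k)" "dom (a k) = B" "cod (a k) = D" using S(2) by (simp_all add: Hom_def)
  have t2: "finsum (hom_group C B D) a S \<in> Hom C B D" using G.finsum_closed[OF S(1)] by simp
  hence t2: "arr (finsum (hom_group C B D) a S)" "dom (finsum (hom_group C B D) a S) = B"
   "cod (finsum (hom_group C B D) a S) = D" by (simp_all add: Hom_def)
  have S': "(\<lambda>k. v ** (a k ** u)) \<in> S \<rightarrow> carrier (hom_group C (dom u) (cod v))"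
   "v ** (a k ** u) \<in> carrier (hom_group C (dom u) (cod v))"
   using insert.prems u v by (auto simp: Hom_def Pi_iff)
  have "finsum (hom_group C B D) a (insert k S) = a k \<boxplus> finsum (hom_group C B D) a S"
   using G.finsum_insert[OF insert.hyps S] by simp
  hence "v ** (finsum (hom_group C B D) a (insert k S) ** u) =
    (v ** (a k ** u)) \<boxplus> (v ** (finsum (hom_group C B D) a S ** u))"
   using t1 t2 u v by simp
  also have "... = (v ** (a k ** u)) \<boxplus> finsum (hom_group C (dom u) (cod v)) (\<lambda>k. v ** (a k ** u)) S"
   using insert.IH insert.prems by simp
  also have "... = finsum (hom_group C (dom u) (cod v)) (\<lambda>k. v ** (a k ** u)) (insert k S)"
   using H.finsum_insert[OF insert.hyps S'] by simp
  finally show ?case .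
 qed
qed

lemma is_power_Suc:
 assumes p: "is_power C M n B" and b: "is_biproduct C B M D j1 j2 r1 r2"
 shows "is_power C M (Suc n) D"
proof -
 note bD = is_biproductD[OF b]
 have M: "M \<in> Ob C" using Ob_simps(1)[OF bD(5)] bD(6) by simp
 obtain i p where ip: "!!k. k < n ==> i k \<in> Hom C M B & p k \<in> Hom C B M"
  and o: "!!j k. j < n ==> k < n ==> p j ** i k = (if j = k then ident C M else hzero C M M)"
  and s: "finsum (hom_group C B B) (\<lambda>k. i k ** p k) {..<n} = ident C B" and B: "B \<in> Ob C"
  using p unfolding is_power_def by blast
 have t: "arr (i k)" "dom (i k) = M" "cod (i k) = B" "arr (p k)" "dom (p k) = B" "cod (p k) = M"
  if "k < n" for k using ip[OF that] by (simp_all add: Hom_def)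
 define i' where "i' k = (if k < n then j1 ** i k else j2)" for k
 define p' where "p' k = (if k < n then p k ** r1 else r2)" for k
 have H: "i' k \<in> Hom C M D & p' k \<in> Hom C D M" for k
  using t[of k] bD(1-13) by (auto simp: i'_def p'_def Hom_def)
 have O: "p' j ** i' k = (if j = k then ident C M else hzero C M M)" if "j < Suc n" "k < Suc n" for j k
 proof (cases "j < n")
  case j: True
  show ?thesis
  proof (cases "k < n")
   case True
   thus ?thesis using j o[OF j True] t[OF j] t[OF True] bD(1-13)
    by (simp add: i'_def p'_def cmp_reduce[OF bD(14)])
  next
   case False
   thus ?thesis using j t[OF j] bD(1-13) bD(16) that M by (simp add: i'_def p'_def)
  qed
 next
  case j: False
  show ?thesis
  proof (cases "k < n")
   case True
   thus ?thesis using j t[OF True] bD(1-13) that M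
    by (simp add: i'_def p'_def cmp_reduce[OF bD(17)])
  next
   case False
   thus ?thesis using j bD(15) that by (simp add: i'_def p'_def)
  qed
 qed
 interpret G: abelian_group "hom_group C D D" by (rule hom_abelian_group[OF bD(1) bD(1)])
 have car: "(\<lambda>k. i' k ** p' k) \<in> A \<rightarrow> carrier (hom_group C D D)" for A
  using H by (auto simp: Hom_def)
 have "finsum (hom_group C D D) (\<lambda>k. i' k ** p' k) {..<n} =
   finsum (hom_group C (dom r1) (cod j1)) (\<lambda>k. j1 ** ((i k ** p k) ** r1)) {..<n}"
  unfolding bD(4,9)
 proof (rule G.finsum_cong')
  show "(\<lambda>k. j1 ** ((i k ** p k) ** r1)) \<in> {..<n} \<rightarrow> carrier (hom_group C D D)"
   using t bD(1-13) by (auto simp: Hom_def)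
  fix k assume "k \<in> {..<n}"
  thus "i' k ** p' k = j1 ** ((i k ** p k) ** r1)" using t[of k] bD(1-13) by (simp add: i'_def p'_def)
 qed simp
 also have "... = j1 ** (finsum (hom_group C B B) (\<lambda>k. i k ** p k) {..<n} ** r1)"
  by (rule cmp_finsum_cmp[symmetric]) (use t B bD(1-13) in \<open>auto simp: Hom_def\<close>)
 also have "... = j1 ** r1" unfolding s using bD(1-13) by simp
 finally have e: "finsum (hom_group C D D) (\<lambda>k. i' k ** p' k) {..<n} = j1 ** r1" .
 have "finsum (hom_group C D D) (\<lambda>k. i' k ** p' k) (insert n {..<n}) =
   (i' n ** p' n) \<boxplus> finsum (hom_group C D D) (\<lambda>k. i' k ** p' k) {..<n}"
  using G.finsum_insert[of "{..<n}" n "\<lambda>k. i' k ** p' k", OF _ _ car] car[of "{n}"] by simp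
 also have "... = (j2 ** r2) \<boxplus> (j1 ** r1)" unfolding e by (simp add: i'_def p'_def)
 also have "... = ident C D" using hadd_comm[of "j2 ** r2" "j1 ** r1"] bD by simp
 finally have "finsum (hom_group C D D) (\<lambda>k. i' k ** p' k) {..<Suc n} = ident C D"
  by (simp add: lessThan_Suc)
 thus ?thesis unfolding is_power_def using H O bD(1) by blast
qed

lemma is_power_zero:
 assumes "zero_object C Z" shows "is_power C M 0 Z"
proof -
 have Z: "Z \<in> Ob C" "null C (ident C Z)" using assms by (simp_all add: zero_object_iff)
 interpret G: abelian_group "hom_group C Z Z" by (rule hom_abelian_group[OF Z(1) Z(1)])
 show ?thesis using Z G.finsum_empty by (simp add: is_power_def null_def)
qed

lemma zero_objectE: obtains Z where "zero_object C Z" "Z \<in> Ob C" "null C (ident C Z)"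
 using zero_object_exists zero_object_iff by blast

end

section \<open>Generators imply (M1)--(M3)\<close>

context poset_generators
begin

lemma m_Ar [simp]: "x \<in> \<Omega> ==> m x \<in> Ar C"
 using m_monic by auto

text \<open>Write \<open>f\<close> as \<open>m x\<close> after an endomorphism; this is nonzero,
  hence invertible, and \<open>g\<close> is its inverse.\<close>

lemma factor_iso:
 assumes x: "x \<in> \<Omega>" and f: "arr f" "dom f = dom (m x)" "cod f = M" "~ null C f"
 obtains g where "arr g" "dom g = dom (m x)" "cod g = dom (m x)" "f ** g = m x"
proof -
 obtain a where a: "arr a" "dom a = dom f" "cod a = dom (m x)" "m x ** a = f"
  using m_to_M[OF x f(1-3)] by (rule factors_throughE)
 have "~ null C a"
 proof
  assume n: "null C a"
  have "null C (m x ** a)" by (rule null_cmp_right[OF n]) (use a x in auto)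
  thus False using a f by simp
 qed
 hence "iso_arrow C a" using m_endo[OF x a(1)] a f by simp
 then obtain g where g: "arr g" "dom g = cod a" "cod g = dom a" "a ** g = ident C (cod a)"
  by (elim iso_arrowE)
 have "f ** g = m x ** (a ** g)" unfolding a(4)[symmetric] using a(1-3) g(1-3) x by simp
 also have "... = m x" using g a x by simp
 finally show ?thesis using that[of g] g a f by simp
qed

lemma m_le_of_factor:
 assumes x: "x \<in> \<Omega>" and f: "arr f" "dom f = dom (m x)" "cod f = M" "~ null C f"
  and v: "arr v" "f <~ v"
 shows "m x <~ v"
by (metis factor_iso x f factors_through_cmp v factors_through_trans)

lemma hom_le:
 assumes x: "x \<in> \<Omega>" and y: "y \<in> \<Omega>"
  and f: "arr f" "dom f = dom (m x)" "cod f = dom (m y)" "~ null C f"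
 shows "m x <~ m y"
proof (rule m_le_of_factor[OF x])
 show "~ null C (m y ** f)" using monic_null_iff[OF m_monic[OF y] f(1)] f by simp
 show "m y ** f <~ m y" using f y by (intro factors_through_cmp) auto
qed (use f y m_tgt in auto)

text \<open>If \<open>v\<close> were not below \<open>w\<close>, some generator would map to
  \<open>v\<close> without vanishing modulo \<open>w\<close>. The resulting arrow to M has the same
  image as \<open>m x\<close>, so \<open>m x\<close> lies in \<open>v\<close>, hence by hypothesis
  in \<open>w\<close>, a contradiction.\<close>

lemma sub_leI:
 assumes v: "monic C v" "cod v = M" and w: "monic C w" "cod w = M"
  and le: "!!x. x \<in> \<Omega> ==> m x <~ v ==> m x <~ w"
 shows "v <~ w"
proof -
 obtain c where c: "ses C w c" using monic_ses[OF w(1)] .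
 note cD = sesD[OF c]
 have A: "arr c" "dom c = M" "arr v" using cD w v by auto
 have "null C (c ** v)"
 proof (rule ccontr)
  assume "~ null C (c ** v)"
  then obtain x f where x: "x \<in> \<Omega>" and f: "arr f" "dom f = dom (m x)" "cod f = dom (c ** v)"
   "~ null C ((c ** v) ** f)"
   using m_generate[of "c ** v"] A v by auto
  have ft: "cod f = dom v" using f A v by simp
  have nn: "~ null C (c ** (v ** f))" using f A v ft by simp
  have vf: "~ null C (v ** f)"
  proof
   assume n: "null C (v ** f)"
   have "null C (c ** (v ** f))" by (rule null_cmp_right[OF n]) (use f A v ft in auto)
   thus False using nn by simp
  qed
  have vfA: "arr (v ** f)" "dom (v ** f) = dom (m x)" "cod (v ** f) = M"
   using f A v ft by auto
  have "v ** f <~ v" using f A ft by (intro factors_through_cmp) auto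
  hence "m x <~ v" by (rule m_le_of_factor[OF x vfA vf A(3)])
  hence "m x <~ w" by (rule le[OF x])
  hence "v ** f <~ w"
   by (rule factors_through_trans[OF m_to_M[OF x vfA]]) (use w in simp)
  hence "null C (c ** (v ** f))" using ses_null_iff[OF c vfA(1)] vfA A by simp
  thus False using nn by simp
 qed
 thus ?thesis using ses_null_iff[OF c A(3)] A v by simp
qed

text \<open>Projectivity lifts \<open>m x\<close> through the presentation of the join, which writes
  it as \<open>b ** u\<close> plus \<open>d ** v\<close>. One summand is nonzero, and a nonzero
  arrow to M has the image of \<open>m x\<close>.\<close>

lemma m_prime:
 assumes x: "x \<in> \<Omega>" and b: "monic C b" "cod b = M" and d: "monic C d" "cod d = M"
  and j: "subobject C (m x) \<sqsubseteq>\<^bsub>Sub C M\<^esub> subobject C b \<squnion>\<^bsub>Sub C M\<^esub> subobject C d"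
 shows "m x <~ b \<or> m x <~ d"
proof -
 have A: "arr b" "arr d" using b d by auto
 obtain w p e where w: "monic C w" "cod w = cod b" "b <~ w" "d <~ w"
  "\<forall>v. monic C v --> b <~ v --> d <~ v --> w <~ v"
  and p: "epic C p" "arr e" "e = w ** p" "dom w = cod p"
  and e: "\<forall>g. g <~ e --> (\<exists>u \<in> Ar C. \<exists>v \<in> Ar C. dom u = dom g & dom v = dom g &
    cod u = dom b & cod v = dom d & g = (b ** u) \<boxplus> (d ** v))"
  by (rule unionE[OF b(1) d(1)]) (use b d in auto)
 have wM: "cod w = M" and wA: "arr w" using w b by auto
 have "subobject C b \<squnion>\<^bsub>Sub C M\<^esub> subobject C d = subobject C w"
  by (rule join_SubI[OF b d w(1) wM w(3,4)]) (use w(5) in blast)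
 hence "m x <~ w"
  using j le_Sub_iff[OF m_monic[OF x] w(1) m_tgt[OF x] wM] by simp
 then obtain t where t: "arr t" "dom t = dom (m x)" "cod t = dom w" "w ** t = m x"
  by (rule factors_throughE)
 have "t <~ p" by (rule m_projective[OF x p(1) t(1,2)]) (use t p in simp)
 hence "w ** t <~ w ** p"
  using wA p by (intro factors_through_mono) auto
 hence "m x <~ e" using t p by simp
 then obtain u v where uv: "arr u" "arr v" "dom u = dom (m x)" "dom v = dom (m x)"
  "cod u = dom b" "cod v = dom d" "m x = (b ** u) \<boxplus> (d ** v)"
  using e by blast
 have t2: "arr (b ** u)" "dom (b ** u) = dom (m x)" "cod (b ** u) = M"
  using uv(1,3,5) A(1) b(2) by simp_all
 have t3: "arr (d ** v)" "dom (d ** v) = dom (m x)" "cod (d ** v) = M"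
  using uv(2,4,6) A(2) d(2) by simp_all
 show ?thesis
 by (metis t2(2,3) null_def uv(7) hadd_zero(2) t3 factors_through_cmp d uv(2,6) A uv(1,5) m_le_of_factor x t2 A(1))
qed

text \<open>Only one inclusion can fail in a general lattice. By \<open>sub_leI\<close> it may be
  tested on the \<open>m x\<close>, and these are prime.\<close>

lemma distributive: "distributive_lattice (Sub C M)"
proof -
 interpret L: lattice "Sub C M" by (rule lattice_Sub)
 show ?thesis
 proof
  fix X Y Z assume car: "X \<in> carrier (Sub C M)" "Y \<in> carrier (Sub C M)" "Z \<in> carrier (Sub C M)"
  obtain y where y: "monic C y" "cod y = M" "Y = subobject C y" using car(2) by (rule carrier_SubE)
  obtain z where z: "monic C z" "cod z = M" "Z = subobject C z" using car(3) by (rule carrier_SubE)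
  let ?l = "X \<sqinter>\<^bsub>Sub C M\<^esub> (Y \<squnion>\<^bsub>Sub C M\<^esub> Z)"
  let ?r = "(X \<sqinter>\<^bsub>Sub C M\<^esub> Y) \<squnion>\<^bsub>Sub C M\<^esub> (X \<sqinter>\<^bsub>Sub C M\<^esub> Z)"
  have car': "Y \<squnion>\<^bsub>Sub C M\<^esub> Z \<in> carrier (Sub C M)" "X \<sqinter>\<^bsub>Sub C M\<^esub> Y \<in> carrier (Sub C M)"
   "X \<sqinter>\<^bsub>Sub C M\<^esub> Z \<in> carrier (Sub C M)" using car by simp_all
  have cc: "?l \<in> carrier (Sub C M)" "?r \<in> carrier (Sub C M)" using car car' by simp_all
  obtain l where l: "monic C l" "cod l = M" "?l = subobject C l" using cc(1) by (rule carrier_SubE)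
  obtain r where r: "monic C r" "cod r = M" "?r = subobject C r" using cc(2) by (rule carrier_SubE)
  have "l <~ r"
  proof (rule sub_leI[OF l(1,2) r(1,2)])
   fix x assume x: "x \<in> \<Omega>" and xl: "m x <~ l"
   let ?x = "subobject C (m x)"
   have xc: "?x \<in> carrier (Sub C M)" using m_monic[OF x] m_tgt[OF x] by (rule subobject_carrier)
   have "?x \<sqsubseteq>\<^bsub>Sub C M\<^esub> ?l"
    unfolding l(3) using le_Sub_iff[OF m_monic[OF x] l(1) m_tgt[OF x] l(2)] xl by simp
   hence xX: "?x \<sqsubseteq>\<^bsub>Sub C M\<^esub> X" and xYZ: "?x \<sqsubseteq>\<^bsub>Sub C M\<^esub> Y \<squnion>\<^bsub>Sub C M\<^esub> Z"
    using L.le_trans[OF _ L.meet_left[OF car(1) car'(1)] xc cc(1) car(1)]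
     L.le_trans[OF _ L.meet_right[OF car(1) car'(1)] xc cc(1) car'(1)] by blast+
   have "m x <~ y \<or> m x <~ z"
    by (rule m_prime[OF x y(1,2) z(1,2)]) (use xYZ y(3) z(3) in simp)
   hence "?x \<sqsubseteq>\<^bsub>Sub C M\<^esub> Y \<or> ?x \<sqsubseteq>\<^bsub>Sub C M\<^esub> Z"
    using le_Sub_iff[OF m_monic[OF x] y(1) m_tgt[OF x] y(2)]
     le_Sub_iff[OF m_monic[OF x] z(1) m_tgt[OF x] z(2)] y(3) z(3) by simp
   hence "?x \<sqsubseteq>\<^bsub>Sub C M\<^esub> X \<sqinter>\<^bsub>Sub C M\<^esub> Y \<or> ?x \<sqsubseteq>\<^bsub>Sub C M\<^esub> X \<sqinter>\<^bsub>Sub C M\<^esub> Z"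
    using L.meet_le[OF xX _ car(1,2) xc] L.meet_le[OF xX _ car(1,3) xc] by blast
   hence "?x \<sqsubseteq>\<^bsub>Sub C M\<^esub> ?r"
    using L.le_trans[OF _ L.join_left[OF car'(2,3)] xc car'(2) cc(2)]
     L.le_trans[OF _ L.join_right[OF car'(2,3)] xc car'(3) cc(2)] by blast
   thus "m x <~ r"
    unfolding r(3) using le_Sub_iff[OF m_monic[OF x] r(1) m_tgt[OF x] r(2)] by simp
  qed
  hence lr: "?l \<sqsubseteq>\<^bsub>Sub C M\<^esub> ?r" unfolding l(3) r(3) using le_Sub_iff[OF l(1) r(1) l(2) r(2)] by simp
  have "X \<sqinter>\<^bsub>Sub C M\<^esub> Y \<sqsubseteq>\<^bsub>Sub C M\<^esub> ?l"
   by (rule L.meet_le[OF L.meet_left[OF car(1,2)] _ car(1) car'(1) car'(2)])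
    (rule L.le_trans[OF L.meet_right[OF car(1,2)] L.join_left[OF car(2,3)] car'(2) car(2) car'(1)])
  moreover have "X \<sqinter>\<^bsub>Sub C M\<^esub> Z \<sqsubseteq>\<^bsub>Sub C M\<^esub> ?l"
   by (rule L.meet_le[OF L.meet_left[OF car(1,3)] _ car(1) car'(1) car'(3)])
    (rule L.le_trans[OF L.meet_right[OF car(1,3)] L.join_right[OF car(2,3)] car'(3) car(3) car'(1)])
  ultimately have "?r \<sqsubseteq>\<^bsub>Sub C M\<^esub> ?l" by (rule L.join_le[OF _ _ car'(2,3) cc(1)])
  thus "?l = ?r" using L.le_antisym[OF lr _ cc] by simp
 qed
qed

text \<open>An arrow out of \<open>X\<close> that kills \<open>w\<close> would kill every arrow from
  a generator to \<open>X\<close>.\<close>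

lemma generated:
 assumes w: "monic C w" "cod w = X"
  and le: "!!x f. [|x \<in> \<Omega>; arr f; dom f = dom (m x); cod f = X|] ==> f <~ w"
 shows "epic C w"
proof (rule ccontr)
 have wA: "arr w" using w by simp
 assume "~ epic C w"
 then obtain d where d: "arr d" "dom d = cod w" "null C (d ** w)" "~ null C d"
  using not_epicE[OF wA] by blast
 obtain x f where x: "x \<in> \<Omega>" and f: "arr f" "dom f = dom (m x)" "cod f = dom d" "~ null C (d ** f)"
  using m_generate[OF d(1,4)] by blast
 have "f <~ w" using le[OF x f(1,2)] f(3) d w by simp
 then obtain u where u: "arr u" "cod u = dom w" "w ** u = f" by (rule factors_throughE)
 have "null C ((d ** w) ** u)" by (rule null_cmp_left[OF d(3)]) (use u d wA in auto)
 hence "null C (d ** f)" unfolding u(3)[symmetric] using u(1,2) d(1,2) wA by simp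
 thus False using f by simp
qed

lemma M2: "cond_M2 C M"
 unfolding cond_M2_def
proof (intro conjI ballI)
 show "distributive_lattice (Sub C M)" by (rule distributive)
 fix X assume X: "X \<in> Ob C"
 \<comment> \<open>Arrows to \<open>X\<close> from objects that embed in some power of M. The domain
   of a further generator embeds in M, so adding it raises the exponent by one.\<close>
 define Q where "Q = {e \<in> Ar C. cod e = X &
  (\<exists>n B u. is_power C M n B & monic C u & dom u = dom e & cod u = B)}"
 define \<Phi> where "\<Phi> = {f \<in> Ar C. cod f = X & (\<exists>x \<in> \<Omega>. dom f = dom (m x))}"
 obtain Z where Z: "zero_object C Z" "Z \<in> Ob C" by (rule zero_objectE)
 have "hzero C Z X \<in> Q"
  unfolding Q_def using X Z is_power_zero[OF Z(1)] ident_monic[OF Z(2)]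
  by (auto intro!: exI[of _ 0] exI[of _ Z] exI[of _ "ident C Z"])
 hence Q0: "Q ~= {}" by blast
 have dir: "\<exists>e' \<in> Q. e <~ e' & f <~ e'" if e: "e \<in> Q" and f: "f \<in> \<Phi>" for e f
 proof -
  obtain n B u where u: "is_power C M n B" "monic C u" "dom u = dom e" "cod u = B"
   and eA: "arr e" "cod e = X" using e unfolding Q_def by blast
  obtain x where x: "x \<in> \<Omega>" "dom f = dom (m x)" and fA: "arr f" "cod f = X"
   using f unfolding \<Phi>_def by blast
  have B: "B \<in> Ob C" using u by (simp add: is_power_def)
  have uA: "arr u" using u by simp
  obtain D i1 i2 p1 p2 where D: "is_biproduct C (dom e) (dom f) D i1 i2 p1 p2"
   using biproduct_exists[of "dom e" "dom f"] eA fA by auto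
  obtain E j1 j2 r1 r2 where E: "is_biproduct C B M E j1 j2 r1 r2"
   using biproduct_exists[OF B M_Ob] by auto
  note DD = is_biproductD[OF D] and ED = is_biproductD[OF E]
  define e' where "e' = (e ** p1) \<boxplus> (f ** p2)"
  define u' where "u' = (j1 ** (u ** p1)) \<boxplus> (j2 ** (m x ** p2))"
  have mx: "arr (m x)" "cod (m x) = M" "monic C (m x)" using x m_tgt m_monic by auto
  have e'A: "arr e'" "dom e' = D" "cod e' = X" unfolding e'_def using DD(1-13) eA fA by simp_all
  have u'A: "arr u'" "dom u' = D" "cod u' = E"
   unfolding u'_def using DD(1-13) ED(1-13) uA u(3,4) mx x(2) by simp_all
  have "e' ** i1 = e" "e' ** i2 = f" unfolding e'_def using DD(1-17) eA fA by simp_all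
  hence fac: "e <~ e'" "f <~ e'"
   using factors_throughI[of i1 e e'] factors_throughI[of i2 f e'] DD(1-13) e'A by simp_all
  have ru: "r1 ** u' = u ** p1" "r2 ** u' = m x ** p2"
   unfolding u'_def using DD(1-13) ED(1-13) uA u(3,4) mx x(2) B M_Ob
   by (simp_all add: cmp_reduce[OF ED(14)] cmp_reduce[OF ED(15)] cmp_reduce[OF ED(16)] cmp_reduce[OF ED(17)])
  have "monic C u'"
  proof (rule monicI[OF u'A(1)])
   fix g assume g: "arr g" "cod g = dom u'" "null C (u' ** g)"
   have gD: "cod g = D" using g u'A by simp
   have "null C (r1 ** (u' ** g))" "null C (r2 ** (u' ** g))"
    using null_cmp_right[OF g(3)] g(1,2) u'A ED(1-13) by simp_all
   hence "null C ((u ** p1) ** g)" "null C ((m x ** p2) ** g)"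
    using cmp_reduce[OF ru(1), of g] cmp_reduce[OF ru(2), of g] g(1) gD u'A ED(1-13) by simp_all
   hence "null C (u ** (p1 ** g))" "null C (m x ** (p2 ** g))"
    using g(1) gD DD(1-13) uA u(3) mx(1) x(2) by simp_all
   hence n: "null C (p1 ** g)" "null C (p2 ** g)"
    using monic_null_iff[OF u(2), of "p1 ** g"] monic_null_iff[OF mx(3), of "p2 ** g"]
     g(1) gD DD(1-13) u(3) x(2) by simp_all
   have n1: "null C (i1 ** (p1 ** g))" by (rule null_cmp_right[OF n(1)]) (use g(1) gD DD(1-13) in simp_all)
   have n2: "null C (i2 ** (p2 ** g))" by (rule null_cmp_right[OF n(2)]) (use g(1) gD DD(1-13) in simp_all)
   have "null C ((i1 ** (p1 ** g)) \<boxplus> (i2 ** (p2 ** g)))"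
    by (rule null_hadd[OF n1 n2]) (use g(1) gD DD(1-13) in simp_all)
   moreover have "((i1 ** p1) \<boxplus> (i2 ** p2)) ** g = (i1 ** (p1 ** g)) \<boxplus> (i2 ** (p2 ** g))"
    using g(1) gD DD(1-13) by simp
   ultimately show "null C g" using DD(18) g(1) gD by simp
  qed
  hence "e' \<in> Q" unfolding Q_def using e'A u'A is_power_Suc[OF u(1) E] by blast
  thus ?thesis using fac by blast
 qed
 obtain w p where w: "w ** p \<in> Q" "monic C w" "epic C p" "cod p = dom w" "cod w = X"
  and le: "!!f. f \<in> \<Phi> ==> f <~ w"
  using noetherian[OF X Q0 _ dir] unfolding Q_def by blast
 have "epic C w" using le by (intro generated[OF w(2,5)]) (auto simp: \<Phi>_def)
 hence ep: "epic C (w ** p)" using w by (intro epic_cmp) auto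
 obtain n B u where "is_power C M n B" "monic C u" "dom u = dom (w ** p)" "cod u = B" "cod (w ** p) = X"
  using w(1) unfolding Q_def by blast
 thus "\<exists>n B. is_power C M n B & subquotient C X B"
  using ep unfolding subquotient_def by metis
qed

text \<open>Preservation of the radical makes each induced endomorphism exist. For surjectivity,
  \<open>\<beta> ** q\<close> is lifted along \<open>q\<close>, by transport of projectivity along
  an isomorphism \<open>f\<close> with inverse \<open>t\<close> between the subobject and a
  generator.\<close>

lemma M3: "cond_M3 C M"
 unfolding cond_M3_def
proof (intro allI impI ballI)
 fix N n r q
 assume N: "join_irreducible (Sub C M) N" and n: "n \<in> N" and r: "r \<in> radical C (dom n)" and q: "is_cokernel C r q"
 have "N \<in> carrier (Sub C M)" using N by (simp add: join_irreducible_def)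
 then obtain n0 where n0: "monic C n0" "cod n0 = M" "N = subobject C n0" by (rule carrier_SubE)
 have nm: "monic C n" "cod n = M" using n n0 by (simp_all add: subobject_def)
 have "N = subobject C n" using n n0 nm subobject_eq_iff[OF n0(1) nm(1)] by (simp add: subobject_def)
 then obtain q0 where q0: "top_map C q0" "dom q0 = dom n" using N join_irreducible_iff[OF nm] by blast
 note q0D = top_mapD[OF q0(1)]
 obtain k where k: "ses C k q0" using epic_ses[OF q0D(1)] .
 note kD = sesD[OF k]
 have "r \<in> subobject C k" using r radical_local[OF q0(1) k] q0(2) by simp
 hence rk: "monic C r" "cod r = cod k" "k <~ r" "r <~ k"
  by (simp_all add: subobject_def)
 have rA: "arr r" "cod r = dom n" using rk kD q0 by auto
 have qD: "epic C q" "arr q" "dom q = dom n" "null C (q ** r)"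
  "\<forall>g \<in> Ar C. dom g = cod r --> null C (g ** r) --> factors_over C g q"
  using q rA by (auto simp: is_cokernel_iff)
 have nA: "arr n" using nm by simp
 text \<open>The subobject is isomorphic to one of the generators, hence projective with division ring
  of endomorphisms.\<close>
 obtain x f where x: "x \<in> \<Omega>" and f: "arr f" "dom f = dom (m x)" "cod f = dom q0" "~ null C (q0 ** f)"
  using m_generate[OF q0D(2,3)] by blast
 have fe: "epic C f" by (rule top_map_epic[OF q0(1) f(1,3,4)])
 have nf: "~ null C f"
 by (metis null_cmp_right f q0D(2))
 have nnf: "~ null C (n ** f)" using monic_null_iff[OF nm(1) f(1)] nf f q0 by simp
 obtain g where g: "arr g" "dom g = dom (m x)" "cod g = dom (m x)" "(n ** f) ** g = m x"
  by (rule factor_iso[OF x, of "n ** f"]) (use nnf f q0 nA nm in auto)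
 have mx: "monic C (m x)" "arr (m x)" using m_monic[OF x] by auto
 have gn: "~ null C g"
 proof
  assume nu: "null C g"
  have "null C ((n ** f) ** g)" by (rule null_cmp_right[OF nu]) (use f q0 nA g in auto)
  thus False using g(4) m_nonzero[OF x] by simp
 qed
 hence gi: "iso_arrow C g" using m_endo[OF x g(1-3)] by simp
 obtain t where t: "arr t" "dom t = cod f" "cod t = dom f" "f ** t = ident C (cod f)" "t ** f = ident C (dom f)"
 proof -
  have "monic C (f ** g)"
   using monic_right_factor[of n "f ** g"] g mx f q0 nA by simp
  hence fg: "iso_arrow C (f ** g)"
   using epic_cmp[OF fe, of g] gi g f by (simp add: iso_arrow_iff)
  obtain g' where g': "arr g'" "dom g' = cod g" "cod g' = dom g" "g ** g' = ident C (cod g)"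
   "g' ** g = ident C (dom g)"
   using gi by (rule iso_arrowE)
  have "iso_arrow C g'" using g' g(1) by (intro iso_arrowI[of g' g]) auto
  hence "iso_arrow C ((f ** g) ** g')" by (rule iso_arrow_cmp[OF _ fg]) (use f(1,2) g(1-3) g'(1-3) in simp)
  moreover have "(f ** g) ** g' = f" using f(1,2) g(1-3) g'(1-4) by simp
  ultimately have "iso_arrow C f" by simp
  thus thesis using that by (elim iso_arrowE)
 qed
 have nq: "~ null C q"
 proof
  assume nu: "null C q"
  obtain h where h: "arr h" "dom h = cod q" "h ** q = q0"
  proof -
   obtain u where u: "arr u" "cod u = dom k" "k ** u = r" using rk(4) by (rule factors_throughE)
   have "null C ((q0 ** k) ** u)" by (rule null_cmp_left[OF kD(4)]) (use u kD q0D(2) in auto)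
   hence "null C (q0 ** r)" unfolding u(3)[symmetric] using u(1,2) kD(1,3) q0D(2) by simp
   hence "factors_over C q0 q" using qD(5) q0D(2) q0(2) rA by simp
   thus thesis using that by (elim factors_overE) simp
  qed
  have "null C (h ** q)" by (rule null_cmp_right[OF nu]) (use h qD in auto)
  thus False using h q0D(3) by simp
 qed
 show "induced_endo C q ` carrier (End_ring C (dom n)) = carrier (End_ring C (cod q))"
 proof (intro equalityI subsetI)
  fix \<beta> assume "\<beta> \<in> induced_endo C q ` carrier (End_ring C (dom n))"
  then obtain \<alpha> where a: "\<alpha> \<in> carrier (End_ring C (dom n))" "\<beta> = induced_endo C q \<alpha>" by blast
  have aA: "arr \<alpha>" "dom \<alpha> = dom n" "cod \<alpha> = dom n"
   using a(1) unfolding End_ring_def hom_group_simps Hom_def by blast+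
  have "null C (q0 ** (\<alpha> ** k))" using radical_endo[OF q0(1) k aA(1)] aA q0(2) by simp
  hence "\<alpha> ** k <~ k" using ses_null_iff[OF k, of "\<alpha> ** k"] aA kD q0 by simp
  hence akr: "\<alpha> ** k <~ r" using rk rA factors_through_trans by blast
  obtain u where u: "arr u" "cod u = dom k" "k ** u = r" using rk(4) by (rule factors_throughE)
  have kA: "arr k" "cod k = dom n" using kD q0 by auto
  have "(\<alpha> ** k) ** u <~ \<alpha> ** k"
   by (rule factors_through_cmp) (use u aA kA in auto)
  hence "(\<alpha> ** k) ** u <~ r" using akr rA factors_through_trans by blast
  moreover have "(\<alpha> ** k) ** u = \<alpha> ** r" unfolding u(3)[symmetric] using u(1,2) aA kA by simp
  ultimately obtain v where v: "arr v" "cod v = dom r" "r ** v = \<alpha> ** r"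
   by (metis factors_throughE)
  have "null C ((q ** r) ** v)" by (rule null_cmp_left[OF qD(4)]) (use v qD rA in auto)
  moreover have "(q ** r) ** v = (q ** \<alpha>) ** r" using v(1,2) qD(2,3) rA aA by (simp add: v(3))
  ultimately have "factors_over C (q ** \<alpha>) q" using qD aA rA by simp
  then obtain \<gamma> where g: "arr \<gamma>" "dom \<gamma> = cod q" "cod \<gamma> = cod (q ** \<alpha>)" "\<gamma> ** q = q ** \<alpha>"
   by (rule factors_overE)
  have gt: "cod \<gamma> = cod q" using g(3) qD(2,3) aA by simp
  have "\<beta> = \<gamma>" unfolding a(2) by (rule induced_endo_eqI[OF qD(1) g(1,2) gt g(4)])
  thus "\<beta> \<in> carrier (End_ring C (cod q))"
   unfolding End_ring_def hom_group_simps Hom_def using g(1,2) gt by blast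
 next
  fix \<beta> assume "\<beta> \<in> carrier (End_ring C (cod q))"
  hence b: "arr \<beta>" "dom \<beta> = cod q" "cod \<beta> = cod q"
   unfolding End_ring_def hom_group_simps Hom_def by blast+
  have tf: "cod f = dom n" using f q0 by simp
  have "(\<beta> ** q) ** f <~ q"
   by (rule m_projective[OF x qD(1)]) (use b qD(2,3) f(1,2) tf in simp_all)
  then obtain a where a: "arr a" "dom a = dom ((\<beta> ** q) ** f)" "cod a = dom q" "q ** a = (\<beta> ** q) ** f"
   by (rule factors_throughE)
  have as: "dom a = dom f" using a(2) b qD(2,3) f(1) tf by simp
  have "q ** (a ** t) = ((\<beta> ** q) ** f) ** t"
   by (rule cmp_reduce[OF a(4)]) (use a(1,3) as qD(2,3) t(1,3) in simp_all)
  also have "... = \<beta> ** q" using b qD(2,3) f(1) tf t(1-4) by simp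
  finally have eq: "\<beta> ** q = q ** (a ** t)" by simp
  have "induced_endo C q (a ** t) = \<beta>" by (rule induced_endo_eqI[OF qD(1) b eq])
  moreover have "a ** t \<in> carrier (End_ring C (dom n))"
   unfolding End_ring_def hom_group_simps Hom_def using a(1,3) as t(1-3) tf qD(3) by simp
  ultimately show "\<beta> \<in> induced_endo C q ` carrier (End_ring C (dom n))" by blast
 qed
qed

text \<open>The cover \<open>g\<close> of the top T lifts along \<open>p\<close> to
  \<open>f'\<close>, which is epic because the extension does not split. So the cover of S, followed
  by \<open>i\<close>, lifts through \<open>f'\<close> to a nonzero arrow \<open>h\<close> from
  generator x to generator y. If x were y, \<open>h\<close> would be invertible and \<open>i\<close>
  epic.\<close>

lemma ext_less:
 assumes S: "simple_object C S" and T: "simple_object C T" and ext: "Ext1 C T S ~= {Ext1_zero C T S}"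
  and x: "x \<in> \<Omega>" "epic C f" "dom f = dom (m x)" "cod f = S"
  and y: "y \<in> \<Omega>" "epic C g" "dom g = dom (m y)" "cod g = T"
 shows "m x <~ m y & x ~= y"
proof -
 have ST: "S \<in> Ob C" "T \<in> Ob C" "~ null C (ident C S)" "~ null C (ident C T)"
  using S T by (auto simp: simple_object_def zero_object_iff)
 obtain i p where ip: "ses C i p" "dom i = S" "cod p = T"
  and ns: "!!r. [|arr r; dom r = cod i; cod r = S|] ==> r ** i ~= ident C S"
  by (rule ext_nonsplit[OF ST(1,2) ext]) blast
 note ipD = sesD[OF ip(1)]
 have A: "arr i" "arr p" "cod i = dom p" "arr f" "arr g" using ipD x y by auto
 have "g <~ p" by (rule m_projective[OF y(1) ipD(2) A(5) y(3)]) (use y ip in simp)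
 then obtain f' where f': "arr f'" "dom f' = dom g" "cod f' = dom p" "p ** f' = g"
  by (rule factors_throughE)
 text \<open>A proper image of the lift would be a complement of the kernel of the extension.\<close>
 have f'e: "epic C f'"
 proof (rule ccontr)
  assume ne: "~ epic C f'"
  obtain n e where n: "monic C n" "epic C e" "dom e = dom f'" "cod e = dom n" "cod n = cod f'" "n ** e = f'"
   by (rule imageE[OF f'(1)])
  have nA: "arr n" "arr e" "cod n = dom p" using n f' by auto
  have "p ** (n ** e) = g" using f'(4) n(6) by simp
  hence "epic C ((p ** n) ** e)" using y(2) A nA n(4) by simp
  hence pn: "epic C (p ** n)" using epic_left_factor[of "p ** n" e] A nA n(4) by simp
  obtain c where c: "ses C n c" using monic_ses[OF n(1)] .
  note cD = sesD[OF c]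
  have cA: "arr c" "dom c = dom p" using cD nA by auto
  \<comment> \<open>The subobjects \<open>i\<close> and \<open>n\<close> together generate the
    middle term, since \<open>p ** n\<close> is epic.\<close>
  have kill: "null C d" if d: "arr d" "dom d = dom p" "null C (d ** i)" "null C (d ** n)" for d
  proof -
   obtain h where h: "arr h" "dom h = cod p" "h ** p = d"
    by (rule ses_over[OF ip(1) d(1,2,3)])
   have "h ** (p ** n) = d ** n" by (rule cmp_reduce[OF h(3)]) (use h A nA in auto)
   hence "null C (h ** (p ** n))" using d by simp
   hence nh: "null C h" by (rule epicD[OF pn, rotated 2]) (use h A nA in auto)
   have "null C (h ** p)" by (rule null_cmp_left[OF nh]) (use h A in auto)
   thus ?thesis using h by simp
  qed
  have cn: "~ null C c"
  proof
   assume nu: "null C c"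
   have "ident C (dom p) <~ n"
    using ses_null_iff[OF c, of "ident C (dom p)"] nu cA A by simp
   then obtain u where u: "arr u" "cod u = dom n" "n ** u = ident C (dom p)"
    by (rule factors_throughE)
   hence "epic C n" using epic_left_factor[of n u] nA(1) A(2) by simp
   hence "epic C f'" using epic_cmp[OF _ n(2), of n] n(4,6) by simp
   thus False using ne by simp
  qed
  \<comment> \<open>Hence \<open>c ** i\<close> is nonzero on the simple object S and also epic, so
    it is invertible; its inverse after \<open>c\<close> is a retraction of
    \<open>i\<close>.\<close>
  have cin: "~ null C (c ** i)" using kill[OF cA(1,2) _ cD(4)] cn by blast
  have cim: "monic C (c ** i)" by (rule simple_monic[OF S _ _ cin]) (use cA A ip in auto)
  have "epic C (c ** i)"
  proof (rule epicI)
   fix d assume d: "arr d" "dom d = cod (c ** i)" "null C (d ** (c ** i))"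
   have dt: "dom d = cod c" using d cA A by simp
   have "null C (d ** (c ** n))" by (rule null_cmp_right[OF cD(4)]) (use d(1) dt cA nA in auto)
   hence "null C (d ** c)" using kill[of "d ** c"] d(1,3) dt cA nA A by simp
   thus "null C d" using epic_null_iff[OF cD(2) d(1) dt] by simp
  qed (use cA A in auto)
  hence "iso_arrow C (c ** i)" using cim by (simp add: iso_arrow_iff)
  then obtain v where v: "arr v" "dom v = cod (c ** i)" "cod v = dom (c ** i)"
   "v ** (c ** i) = ident C (dom (c ** i))" by (elim iso_arrowE)
  have ci: "dom (c ** i) = S" "cod (c ** i) = cod c" using cA A ip by auto
  have "(v ** c) ** i = ident C S" using v(1,2,4) ci cA A by simp
  thus False using ns[of "v ** c"] v(1-3) ci cA A by simp
 qed
 have "i ** f <~ f'"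
  by (rule m_projective[OF x(1) f'e]) (use A x ip f' in auto)
 then obtain h where h: "arr h" "dom h = dom (i ** f)" "cod h = dom f'" "f' ** h = i ** f"
  by (rule factors_throughE)
 have hs: "dom h = dom (m x)" "cod h = dom (m y)" using h A x ip f' y by auto
 have nf: "~ null C f"
 proof
  assume nu: "null C f"
  have "null C (ident C S ** f)" using nu A x by simp
  thus False using epic_null_iff[OF x(2), of "ident C S"] ST x by simp
 qed
 have ifn: "~ null C (i ** f)" using monic_null_iff[OF ipD(1) A(4)] nf x ip by simp
 have hn: "~ null C h"
 by (metis null_cmp_right h f' ifn)
 have "x ~= y"
 proof
  assume "x = y"
  hence "iso_arrow C h" using m_endo[OF x(1) h(1)] hs hn by simp
  hence "epic C (f' ** h)" using f'e h by (intro epic_cmp) (auto simp: iso_arrow_iff)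
  hence "epic C (i ** f)" using h by simp
  hence ie: "epic C i" using epic_left_factor[of i f] A x ip by simp
  have np: "null C p" by (rule epicD[OF ie]) (use ipD A in auto)
  have "null C (ident C T ** p)" using np A ip by simp
  thus False using epic_null_iff[OF ipD(2), of "ident C T"] ST ip by simp
 qed
 thus ?thesis using hom_le[OF x(1) y(1) h(1) hs hn] by simp
qed

lemma simple_cover:
 assumes S: "simple_object C S"
 obtains x f where "x \<in> \<Omega>" "epic C f" "dom f = dom (m x)" "cod f = S"
proof -
 have S': "S \<in> Ob C" "~ null C (ident C S)" using S by (auto simp: simple_object_def zero_object_iff)
 obtain x f where x: "x \<in> \<Omega>" "arr f" "dom f = dom (m x)" "cod f = dom (ident C S)" "~ null C (ident C S ** f)"
  using m_generate[of "ident C S"] S' by auto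
 thus ?thesis using that[of x f] simple_epic[OF S, of f] S' by simp
qed

text \<open>Each simple object is covered by a generator, and along an arrow of the quiver the
  covering generator grows strictly, so a closed path would contradict antisymmetry.\<close>

lemma M1: "cond_M1 C"
proof -
 define P where "P c x \<longleftrightarrow> x \<in> \<Omega> & (\<exists>f. epic C f & dom f = dom (m x) & cod f \<in> c)" for c x
 \<comment> \<open>The generator is chosen for the isomorphism class, not for a representative, so
   that the inequalities of consecutive arrows can be chained.\<close>
 define rk where "rk c = (SOME x. P c x)" for c
 have arrow: "rk c \<in> \<Omega> & rk d \<in> \<Omega> & m (rk c) <~ m (rk d) & rk c ~= rk d"
  if cd: "(c, d) \<in> ext_quiver C" for c d
 proof -
  obtain S T where ST: "c = iso_class C S" "d = iso_class C T" "simple_object C S" "simple_object C T"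
   "Ext1 C T S ~= {Ext1_zero C T S}" using cd unfolding ext_quiver_def by blast
  have P: "P (iso_class C S) (rk (iso_class C S))" if S: "simple_object C S" for S
  by (metis simple_cover S iso_class_self simple_object_def P_def rk_def someI)
  have cov: "rk (iso_class C S) \<in> \<Omega> & (\<exists>f. epic C f & dom f = dom (m (rk (iso_class C S))) & cod f = S)"
   if S: "simple_object C S" for S
  proof -
   obtain f where f: "rk (iso_class C S) \<in> \<Omega>" "epic C f" "dom f = dom (m (rk (iso_class C S)))" "cod f \<in> iso_class C S"
    using P[OF S] unfolding P_def by blast
   then obtain h where h: "arr h" "dom h = S" "cod h = cod f" "iso_arrow C h"
    by (auto simp: iso_class_def Hom_def)
   then obtain g where g: "arr g" "dom g = cod h" "cod g = dom h" "h ** g = ident C (cod h)"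
    "g ** h = ident C (dom h)" by (auto elim: iso_arrowE)
   hence "iso_arrow C g" using h by (intro iso_arrowI[of g h]) auto
   hence "epic C (g ** f)" using f(2) g h by (intro epic_cmp) (auto simp: iso_arrow_iff)
   moreover have "dom (g ** f) = dom f" "cod (g ** f) = S" using f(2) g(1-3) h(1-3) by simp_all
   ultimately show ?thesis using f(1,3) by metis
  qed
  obtain f where f: "rk c \<in> \<Omega>" "epic C f" "dom f = dom (m (rk c))" "cod f = S"
   using cov[OF ST(3)] ST(1) by blast
  obtain g where g: "rk d \<in> \<Omega>" "epic C g" "dom g = dom (m (rk d))" "cod g = T"
   using cov[OF ST(4)] ST(2) by blast
  show ?thesis using ext_less[OF ST(3,4,5) f g] f g by blast
 qed
 have "rk c \<in> \<Omega> & rk d \<in> \<Omega> & m (rk c) <~ m (rk d) & rk c ~= rk d"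
  if "(c, d) \<in> (ext_quiver C)\<^sup>+" for c d
  using that
 proof (induction rule: trancl_induct)
  case (base d)
  thus ?case by (rule arrow)
 next
  case (step d e)
  note s = arrow[OF step.hyps(2)]
  have "m (rk c) <~ m (rk e)"
   using step.IH s factors_through_trans m_Ar by blast
  moreover have "rk c ~= rk e" using step.IH s m_antisym by metis
  ultimately show ?case using step.IH s by blast
 qed
 thus ?thesis unfolding cond_M1_def acyclic_def by blast
qed

end

section \<open>Equivalences of categories\<close>

context
 fixes C :: "('o, 'a, 'm) category_scheme" and D :: "('p, 'b, 'n) category_scheme"
begin

abbreviation comp_C (infixr "\<cdot>" 70) where "g \<cdot> f \<equiv> g \<bullet>\<^bsub>C\<^esub> f"
abbreviation comp_D (infixr "**" 70) where "g ** f \<equiv> g \<bullet>\<^bsub>D\<^esub> f"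

text \<open>Choice provides the inverse functor on objects and fullness provides it on arrows. All
  its laws are checked after applying the faithful \<open>Fa\<close> and cancelling the invertible
  \<open>e\<close>.\<close>

lemma equivalent_categoriesI:
 assumes F: "cat_functor C D Fo Fa"
  and faithful: "!!X Y f g. [|f \<in> Hom C X Y; g \<in> Hom C X Y; Fa f = Fa g|] ==> f = g"
  and full: "!!X Y g. [|X \<in> Ob C; Y \<in> Ob C; g \<in> Hom D (Fo X) (Fo Y)|] ==> \<exists>f \<in> Hom C X Y. Fa f = g"
  and dense: "!!Y. Y \<in> Ob D ==> \<exists>X \<in> Ob C. \<exists>e \<in> Hom D (Fo X) Y. iso_arrow D e"
 shows "equivalent_categories C D"
proof -
 interpret F: cat_functor C D Fo Fa by (rule F)
 have "\<forall>Y \<in> Ob D. \<exists>X e e'. X \<in> Ob C & e \<in> Hom D (Fo X) Y & e' \<in> Hom D Y (Fo X) &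
   e' ** e = ident D (Fo X) & e ** e' = ident D Y"
 proof
  fix Y assume "Y \<in> Ob D"
  then obtain X e where X: "X \<in> Ob C" and e: "e \<in> Hom D (Fo X) Y" "iso_arrow D e" using dense by blast
  have "src D e = Fo X" "tgt D e = Y" using e(1) unfolding Hom_def by blast+
  thus "\<exists>X e e'. X \<in> Ob C & e \<in> Hom D (Fo X) Y & e' \<in> Hom D Y (Fo X) &
   e' ** e = ident D (Fo X) & e ** e' = ident D Y"
   using X e unfolding iso_arrow_def by metis
 qed
 then obtain Go e e' where G: "!!Y. Y \<in> Ob D ==> Go Y \<in> Ob C"
  and eH: "!!Y. Y \<in> Ob D ==> e Y \<in> Hom D (Fo (Go Y)) Y"
  and e'H: "!!Y. Y \<in> Ob D ==> e' Y \<in> Hom D Y (Fo (Go Y))"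
  and e'e: "!!Y. Y \<in> Ob D ==> e' Y ** e Y = ident D (Fo (Go Y))"
  and ee': "!!Y. Y \<in> Ob D ==> e Y ** e' Y = ident D Y" by metis
 define lift where "lift X Y g = (SOME f. f \<in> Hom C X Y & Fa f = g)" for X Y g
 have lift: "lift X Y g \<in> Hom C X Y" "Fa (lift X Y g) = g"
  if "X \<in> Ob C" "Y \<in> Ob C" "g \<in> Hom D (Fo X) (Fo Y)" for X Y g
  using someI_ex[of "\<lambda>f. f \<in> Hom C X Y & Fa f = g"] full[OF that] unfolding lift_def by blast+
 define Ga where "Ga g = lift (Go (src D g)) (Go (tgt D g)) (e' (tgt D g) ** (g ** e (src D g)))" for g
 define \<eta> where "\<eta> X = lift X (Go (Fo X)) (e' (Fo X))" for X
 have obD: "X \<in> Ob D & Y \<in> Ob D" if "g \<in> Hom D X Y" for g X Y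
  using that F.D.src_Ob F.D.tgt_Ob unfolding Hom_def by blast
 have Ga: "Ga g \<in> Hom C (Go X) (Go Y)" "Fa (Ga g) = e' Y ** (g ** e X)" if g: "g \<in> Hom D X Y" for g X Y
 proof -
  have o: "X \<in> Ob D" "Y \<in> Ob D" using obD[OF g] by auto
  have s: "src D g = X" "tgt D g = Y" using g unfolding Hom_def by blast+
  have h: "e' Y ** (g ** e X) \<in> Hom D (Fo (Go X)) (Fo (Go Y))"
   by (rule F.D.cmp_Hom[OF F.D.cmp_Hom[OF eH[OF o(1)] g] e'H[OF o(2)]])
  show "Ga g \<in> Hom C (Go X) (Go Y)" "Fa (Ga g) = e' Y ** (g ** e X)"
   unfolding Ga_def s by (rule lift[OF G[OF o(1)] G[OF o(2)] h])+
 qed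
 have eGa: "e Y ** Fa (Ga g) = g ** e X" if g: "g \<in> Hom D X Y" for g X Y
 proof -
  have o: "X \<in> Ob D" "Y \<in> Ob D" using obD[OF g] by auto
  have ge: "g ** e X \<in> Hom D (Fo (Go X)) Y" by (rule F.D.cmp_Hom[OF eH[OF o(1)] g])
  have "e Y ** Fa (Ga g) = (e Y ** e' Y) ** (g ** e X)"
   unfolding Ga(2)[OF g] by (rule F.D.cmp_assoc[symmetric, OF ge e'H[OF o(2)] eH[OF o(2)]])
  also have "... = g ** e X" unfolding ee'[OF o(2)] by (rule F.D.ident_cmp[OF ge])
  finally show ?thesis .
 qed
 have ecancel: "f = g" if f: "f \<in> Hom D X (Fo (Go Y))" and g: "g \<in> Hom D X (Fo (Go Y))" and Y: "Y \<in> Ob D"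
  and eq: "e Y ** f = e Y ** g" for f g X Y
 proof -
  have "(e' Y ** e Y) ** f = (e' Y ** e Y) ** g"
   using F.D.cmp_assoc[OF f eH[OF Y] e'H[OF Y]] F.D.cmp_assoc[OF g eH[OF Y] e'H[OF Y]] eq by simp
  thus ?thesis unfolding e'e[OF Y] using F.D.ident_cmp[OF f] F.D.ident_cmp[OF g] by simp
 qed
 have GF: "cat_functor D C Go Ga"
 proof (intro cat_functor.intro cat_functor_axioms.intro)
  show "category D" "category C" by unfold_locales
  fix X assume X: "X \<in> Ob D"
  show "Go X \<in> Ob C" by (rule G[OF X])
  have i: "ident D X \<in> Hom D X X" by (rule F.D.ident_Hom[OF X])
  have "e X ** Fa (Ga (ident D X)) = e X ** ident D (Fo (Go X))"
   unfolding eGa[OF i] F.D.ident_cmp[OF eH[OF X]] F.D.cmp_ident[OF eH[OF X]] ..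
  hence "Fa (Ga (ident D X)) = ident D (Fo (Go X))"
   by (rule ecancel[OF F.Fa_Hom[OF Ga(1)[OF i]] F.D.ident_Hom[OF F.Fo_Ob[OF G[OF X]]] X])
  also have "... = Fa (ident C (Go X))" by (rule F.Fa_ident[OF G[OF X], symmetric])
  finally show "Ga (ident D X) = ident C (Go X)"
   by (rule faithful[OF Ga(1)[OF i] F.C.ident_Hom[OF G[OF X]]])
 next
  fix f X Y assume f: "f \<in> Hom D X Y"
  show "Ga f \<in> Hom C (Go X) (Go Y)" by (rule Ga(1)[OF f])
  fix g Z assume g: "g \<in> Hom D Y Z"
  have o: "X \<in> Ob D" "Y \<in> Ob D" "Z \<in> Ob D" using obD[OF f] obD[OF g] by auto
  have gf: "g ** f \<in> Hom D X Z" by (rule F.D.cmp_Hom[OF f g])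
  note Ff = F.Fa_Hom[OF Ga(1)[OF f]] and Fg = F.Fa_Hom[OF Ga(1)[OF g]]
  have "e Z ** Fa (Ga (g ** f)) = g ** (f ** e X)"
   unfolding eGa[OF gf] by (rule F.D.cmp_assoc[OF eH[OF o(1)] f g])
  also have "... = (g ** e Y) ** Fa (Ga f)"
   unfolding eGa[OF f, symmetric] by (rule F.D.cmp_assoc[symmetric, OF Ff eH[OF o(2)] g])
  also have "... = e Z ** (Fa (Ga g) ** Fa (Ga f))"
   unfolding eGa[OF g, symmetric] by (rule F.D.cmp_assoc[OF Ff Fg eH[OF o(3)]])
  finally have "Fa (Ga (g ** f)) = Fa (Ga g) ** Fa (Ga f)"
   by (rule ecancel[OF F.Fa_Hom[OF Ga(1)[OF gf]] F.D.cmp_Hom[OF Ff Fg] o(3)])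
  also have "... = Fa (Ga g \<cdot> Ga f)" by (rule F.Fa_cmp[OF Ga(1)[OF f] Ga(1)[OF g], symmetric])
  finally show "Ga (g ** f) = Ga g \<cdot> Ga f"
   by (rule faithful[OF Ga(1)[OF gf] F.C.cmp_Hom[OF Ga(1)[OF f] Ga(1)[OF g]]])
 qed
 have \<eta>: "\<eta> X \<in> Hom C X (Go (Fo X))" "Fa (\<eta> X) = e' (Fo X)" "iso_arrow C (\<eta> X)" if X: "X \<in> Ob C" for X
 proof -
  note FX = F.Fo_Ob[OF X]
  note GX = G[OF FX]
  show 1: "\<eta> X \<in> Hom C X (Go (Fo X))" and 2: "Fa (\<eta> X) = e' (Fo X)"
   unfolding \<eta>_def by (rule lift[OF X GX e'H[OF FX]])+
  define \<theta> where "\<theta> = lift (Go (Fo X)) X (e (Fo X))"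
  have 3: "\<theta> \<in> Hom C (Go (Fo X)) X" and 4: "Fa \<theta> = e (Fo X)"
   unfolding \<theta>_def by (rule lift[OF GX X eH[OF FX]])+
  have "Fa (\<theta> \<cdot> \<eta> X) = Fa (ident C X)"
   unfolding F.Fa_cmp[OF 1 3] 2 4 ee'[OF FX] F.Fa_ident[OF X] ..
  hence 5: "\<theta> \<cdot> \<eta> X = ident C X" by (rule faithful[OF F.C.cmp_Hom[OF 1 3] F.C.ident_Hom[OF X]])
  have "Fa (\<eta> X \<cdot> \<theta>) = Fa (ident C (Go (Fo X)))"
   unfolding F.Fa_cmp[OF 3 1] 2 4 e'e[OF FX] F.Fa_ident[OF GX] ..
  hence 6: "\<eta> X \<cdot> \<theta> = ident C (Go (Fo X))"
   by (rule faithful[OF F.C.cmp_Hom[OF 3 1] F.C.ident_Hom[OF GX]])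
  have "\<eta> X \<in> Ar C" "src C (\<eta> X) = X" "tgt C (\<eta> X) = Go (Fo X)" using 1 unfolding Hom_def by blast+
  thus "iso_arrow C (\<eta> X)" unfolding iso_arrow_def using 3 5 6 by auto
 qed
 have n1: "natural_iso C C id id (Go \<circ> Fo) (Ga \<circ> Fa) \<eta>"
  unfolding natural_iso_def
 proof (intro conjI ballI)
  fix X assume X: "X \<in> Ob C"
  show "\<eta> X \<in> Hom C (id X) ((Go \<circ> Fo) X)" "iso_arrow C (\<eta> X)" using \<eta>[OF X] by simp_all
  fix Y f assume Y: "Y \<in> Ob C" and f: "f \<in> Hom C X Y"
  note Ff = F.Fa_Hom[OF f]
  have H: "e' (Fo Y) ** Fa f \<in> Hom D (Fo X) (Fo (Go (Fo Y)))"
   "Fa (Ga (Fa f)) ** e' (Fo X) \<in> Hom D (Fo X) (Fo (Go (Fo Y)))"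
   by (rule F.D.cmp_Hom[OF Ff e'H[OF F.Fo_Ob[OF Y]]])
    (rule F.D.cmp_Hom[OF e'H[OF F.Fo_Ob[OF X]] F.Fa_Hom[OF Ga(1)[OF Ff]]])
  have "e (Fo Y) ** (e' (Fo Y) ** Fa f) = (e (Fo Y) ** e' (Fo Y)) ** Fa f"
   by (rule F.D.cmp_assoc[symmetric, OF Ff e'H[OF F.Fo_Ob[OF Y]] eH[OF F.Fo_Ob[OF Y]]])
  also have "... = Fa f" unfolding ee'[OF F.Fo_Ob[OF Y]] by (rule F.D.ident_cmp[OF Ff])
  finally have l: "e (Fo Y) ** (e' (Fo Y) ** Fa f) = Fa f" .
  have "e (Fo Y) ** (Fa (Ga (Fa f)) ** e' (Fo X)) = (Fa f ** e (Fo X)) ** e' (Fo X)"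
   unfolding eGa[OF Ff, symmetric]
   by (rule F.D.cmp_assoc[symmetric, OF e'H[OF F.Fo_Ob[OF X]] F.Fa_Hom[OF Ga(1)[OF Ff]] eH[OF F.Fo_Ob[OF Y]]])
  also have "... = Fa f ** (e (Fo X) ** e' (Fo X))"
   by (rule F.D.cmp_assoc[OF e'H[OF F.Fo_Ob[OF X]] eH[OF F.Fo_Ob[OF X]] Ff])
  also have "... = Fa f" unfolding ee'[OF F.Fo_Ob[OF X]] by (rule F.D.cmp_ident[OF Ff])
  finally have "e' (Fo Y) ** Fa f = Fa (Ga (Fa f)) ** e' (Fo X)"
   using l by (intro ecancel[OF H F.Fo_Ob[OF Y]]) simp
  hence "Fa (\<eta> Y \<cdot> f) = Fa (Ga (Fa f) \<cdot> \<eta> X)"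
   unfolding F.Fa_cmp[OF f \<eta>(1)[OF Y]] F.Fa_cmp[OF \<eta>(1)[OF X] Ga(1)[OF Ff]] \<eta>(2)[OF X] \<eta>(2)[OF Y] .
  hence "\<eta> Y \<cdot> f = Ga (Fa f) \<cdot> \<eta> X"
   by (rule faithful[OF F.C.cmp_Hom[OF f \<eta>(1)[OF Y]] F.C.cmp_Hom[OF \<eta>(1)[OF X] Ga(1)[OF Ff]]])
  thus "\<eta> Y \<cdot> id f = (Ga \<circ> Fa) f \<cdot> \<eta> X" by simp
 qed
 have n2: "natural_iso D D (Fo \<circ> Go) (Fa \<circ> Ga) id id e"
  unfolding natural_iso_def
 proof (intro conjI ballI)
  fix X assume X: "X \<in> Ob D"
  show "e X \<in> Hom D ((Fo \<circ> Go) X) (id X)" using eH[OF X] by simp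
  have "e X \<in> Ar D" "src D (e X) = Fo (Go X)" "tgt D (e X) = X" using eH[OF X] unfolding Hom_def by blast+
  thus "iso_arrow D (e X)" unfolding iso_arrow_def using e'H[OF X] e'e[OF X] ee'[OF X] by auto
  fix Y f assume "f \<in> Hom D X Y"
  thus "e Y ** (Fa \<circ> Ga) f = id f ** e X" using eGa by simp
 qed
 show ?thesis unfolding equivalent_categories_def using F GF n1 n2 by blast
qed

text \<open>Faithfulness of both functors follows by cancelling the components of the natural
  isomorphisms. For fullness, conjugating \<open>Ga g\<close> by \<open>\<eta>\<close> gives an
  arrow \<open>f\<close> with \<open>Ga (Fa f)\<close> equal to \<open>Ga g\<close>, and
  \<open>Ga\<close> is faithful.\<close>

lemma equivalent_categoriesE:
 assumes "equivalent_categories C D"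
 obtains Fo Fa where "cat_functor C D Fo Fa"
  "!!X Y f g. [|f \<in> Hom C X Y; g \<in> Hom C X Y; Fa f = Fa g|] ==> f = g"
  "!!X Y g. [|X \<in> Ob C; Y \<in> Ob C; g \<in> Hom D (Fo X) (Fo Y)|] ==> \<exists>f \<in> Hom C X Y. Fa f = g"
  "!!Y. Y \<in> Ob D ==> \<exists>X \<in> Ob C. \<exists>e \<in> Hom D (Fo X) Y. iso_arrow D e"
proof -
 obtain Fo Fa Go Ga \<eta> \<epsilon> where F: "cat_functor C D Fo Fa" and G: "cat_functor D C Go Ga"
  and n1: "natural_iso C C id id (Go \<circ> Fo) (Ga \<circ> Fa) \<eta>"
  and n2: "natural_iso D D (Fo \<circ> Go) (Fa \<circ> Ga) id id \<epsilon>"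
  using assms unfolding equivalent_categories_def by blast
 interpret F: cat_functor C D Fo Fa by (rule F)
 interpret G: cat_functor D C Go Ga by (rule G)
 have obD: "X \<in> Ob D & Y \<in> Ob D" if "g \<in> Hom D X Y" for g X Y
  using that F.D.src_Ob F.D.tgt_Ob unfolding Hom_def by blast
 have obC: "X \<in> Ob C & Y \<in> Ob C" if "g \<in> Hom C X Y" for g X Y
  using that F.C.src_Ob F.C.tgt_Ob unfolding Hom_def by blast
 have \<eta>: "\<eta> X \<in> Hom C X (Go (Fo X))" "iso_arrow C (\<eta> X)" if "X \<in> Ob C" for X
  using n1 that unfolding natural_iso_def by auto
 have \<eta>n: "\<eta> Y \<cdot> f = Ga (Fa f) \<cdot> \<eta> X" if "f \<in> Hom C X Y" for f X Y
  using n1 that obC[OF that] unfolding natural_iso_def by auto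
 have \<epsilon>: "\<epsilon> X \<in> Hom D (Fo (Go X)) X" "iso_arrow D (\<epsilon> X)" if "X \<in> Ob D" for X
  using n2 that unfolding natural_iso_def by auto
 have \<epsilon>n: "\<epsilon> Y ** Fa (Ga f) = f ** \<epsilon> X" if "f \<in> Hom D X Y" for f X Y
  using n2 that obD[OF that] unfolding natural_iso_def by auto
 have faithful: "f = g" if f: "f \<in> Hom C X Y" and g: "g \<in> Hom C X Y" and eq: "Fa f = Fa g" for f g X Y
 proof -
  have Y: "Y \<in> Ob C" using obC[OF f] by simp
  have m: "monic C (\<eta> Y)" by (rule F.C.iso_arrow_monic[OF \<eta>(2)[OF Y]])
  have "src C (\<eta> Y) = Y" using \<eta>(1)[OF Y] unfolding Hom_def by blast
  moreover have "\<eta> Y \<cdot> f = \<eta> Y \<cdot> g" unfolding \<eta>n[OF f] \<eta>n[OF g] eq ..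
  ultimately show ?thesis using F.C.monic_cmp_iff[OF m, of f g] f g unfolding Hom_def by simp
 qed
 have faithful': "f = g" if f: "f \<in> Hom D X Y" and g: "g \<in> Hom D X Y" and eq: "Ga f = Ga g" for f g X Y
 proof -
  have X: "X \<in> Ob D" using obD[OF f] by simp
  have m: "epic D (\<epsilon> X)" by (rule F.D.iso_arrow_epic[OF \<epsilon>(2)[OF X]])
  have "tgt D (\<epsilon> X) = X" using \<epsilon>(1)[OF X] unfolding Hom_def by blast
  moreover have "f ** \<epsilon> X = g ** \<epsilon> X" unfolding \<epsilon>n[OF f, symmetric] \<epsilon>n[OF g, symmetric] eq ..
  ultimately show ?thesis using F.D.epic_cmp_iff[OF m, of f g] f g unfolding Hom_def by simp
 qed
 have full: "\<exists>f \<in> Hom C X Y. Fa f = g" if X: "X \<in> Ob C" and Y: "Y \<in> Ob C" and g: "g \<in> Hom D (Fo X) (Fo Y)" for X Y g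
 proof -
  have s: "src C (\<eta> Y) = Y" "tgt C (\<eta> Y) = Go (Fo Y)" using \<eta>(1)[OF Y] unfolding Hom_def by blast+
  obtain t where t: "t \<in> Hom C (Go (Fo Y)) Y" "\<eta> Y \<cdot> t = ident C (Go (Fo Y))"
   using \<eta>(2)[OF Y] unfolding iso_arrow_def s by blast
  have h: "Ga g \<cdot> \<eta> X \<in> Hom C X (Go (Fo Y))" by (rule F.C.cmp_Hom[OF \<eta>(1)[OF X] G.Fa_Hom[OF g]])
  define f where "f = t \<cdot> (Ga g \<cdot> \<eta> X)"
  have f: "f \<in> Hom C X Y" unfolding f_def by (rule F.C.cmp_Hom[OF h t(1)])
  have "\<eta> Y \<cdot> f = (\<eta> Y \<cdot> t) \<cdot> (Ga g \<cdot> \<eta> X)"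
   unfolding f_def by (rule F.C.cmp_assoc[symmetric, OF h t(1) \<eta>(1)[OF Y]])
  also have "... = Ga g \<cdot> \<eta> X" unfolding t(2) by (rule F.C.ident_cmp[OF h])
  finally have eq: "Ga (Fa f) \<cdot> \<eta> X = Ga g \<cdot> \<eta> X" unfolding \<eta>n[OF f] .
  have e: "epic C (\<eta> X)" by (rule F.C.iso_arrow_epic[OF \<eta>(2)[OF X]])
  have "tgt C (\<eta> X) = Go (Fo X)" using \<eta>(1)[OF X] unfolding Hom_def by blast
  hence "Ga (Fa f) = Ga g"
   using F.C.epic_cmp_iff[OF e, of "Ga (Fa f)" "Ga g"] eq G.Fa_Hom[OF g] G.Fa_Hom[OF F.Fa_Hom[OF f]]
   unfolding Hom_def by simp
  hence "Fa f = g" by (rule faithful'[OF F.Fa_Hom[OF f] g])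
  thus ?thesis using f by blast
 qed
 have dense: "\<exists>X \<in> Ob C. \<exists>e \<in> Hom D (Fo X) Y. iso_arrow D e" if "Y \<in> Ob D" for Y
  using \<epsilon>[OF that] G.Fo_Ob[OF that] by blast
 show ?thesis by (rule that[OF F faithful full dense])
qed

end

section \<open>Vector spaces over division rings\<close>

definition subspace_of :: "'k ring => ('k, 'v) rmodule => 'v set => bool" where
 "subspace_of K V W \<longleftrightarrow> W \<subseteq> carrier V & \<zero>\<^bsub>V\<^esub> \<in> W & (\<forall>v \<in> W. \<forall>w \<in> W. v \<oplus>\<^bsub>V\<^esub> w \<in> W) &
  (\<forall>v \<in> W. \<forall>a \<in> carrier K. v \<odot>\<^bsub>V\<^esub> a \<in> W)"

text \<open>Spanning is expressed through subspaces instead of linear combinations: sums then occur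
  only where a basis is extracted, and an image is seen to be everything as soon as it is a subspace
  containing \<open>B\<close>.\<close>

definition generates :: "'k ring => ('k, 'v) rmodule => 'v set => bool" where
 "generates K V B \<longleftrightarrow> finite B & B \<subseteq> carrier V & (\<forall>W. subspace_of K V W --> B \<subseteq> W --> W = carrier V)"

context right_vector_space
begin

abbreviation vadd (infixl "\<oplus>[V]" 65) where "v \<oplus>[V] w \<equiv> v \<oplus>\<^bsub>V\<^esub> w"
abbreviation vmul (infixl "\<odot>[V]" 70) where "v \<odot>[V] a \<equiv> v \<odot>\<^bsub>V\<^esub> a"
abbreviation vzero ("\<zero>[V]") where "\<zero>[V] \<equiv> \<zero>\<^bsub>V\<^esub>"
abbreviation vneg ("\<ominus>[V] _" [81] 80) where "\<ominus>[V] v \<equiv> \<ominus>\<^bsub>V\<^esub> v"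
abbreviation kadd (infixl "\<oplus>[K]" 65) where "a \<oplus>[K] b \<equiv> a \<oplus>\<^bsub>K\<^esub> b"
abbreviation kmul (infixl "\<otimes>[K]" 70) where "a \<otimes>[K] b \<equiv> a \<otimes>\<^bsub>K\<^esub> b"
abbreviation kzero ("\<zero>[K]") where "\<zero>[K] \<equiv> \<zero>\<^bsub>K\<^esub>"
abbreviation kone ("\<one>[K]") where "\<one>[K] \<equiv> \<one>\<^bsub>K\<^esub>"
abbreviation kneg ("\<ominus>[K] _" [81] 80) where "\<ominus>[K] a \<equiv> \<ominus>\<^bsub>K\<^esub> a"

lemma rsmult_zero_right [simp]: assumes v: "v \<in> carrier V" shows "v \<odot>[V] \<zero>[K] = \<zero>[V]"
proof -
 have "v \<odot>[V] \<zero>[K] = (v \<odot>[V] \<zero>[K]) \<oplus>[V] (v \<odot>[V] \<zero>[K])"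
  using rsmult_add_right[OF v, of "\<zero>[K]" "\<zero>[K]"] by simp
 thus ?thesis
  using v rsmult_closed[OF v K.zero_closed]
  by (metis V.a_assoc V.r_neg V.r_zero V.a_inv_closed)
qed

lemma rsmult_zero_left [simp]: assumes a: "a \<in> carrier K" shows "\<zero>[V] \<odot>[V] a = \<zero>[V]"
proof -
 have "\<zero>[V] \<odot>[V] a = (\<zero>[V] \<odot>[V] a) \<oplus>[V] (\<zero>[V] \<odot>[V] a)"
  using rsmult_add_left[of "\<zero>[V]" "\<zero>[V]" a] a by simp
 thus ?thesis
  using rsmult_closed[OF V.zero_closed a]
  by (metis V.a_assoc V.r_neg V.r_zero V.a_inv_closed)
qed

lemma rsmult_minus_right:
 assumes v: "v \<in> carrier V" and a: "a \<in> carrier K" shows "v \<odot>[V] (\<ominus>[K] a) = \<ominus>[V] (v \<odot>[V] a)"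
proof -
 have "(v \<odot>[V] (\<ominus>[K] a)) \<oplus>[V] (v \<odot>[V] a) = \<zero>[V]"
  using rsmult_add_right[OF v, of "\<ominus>[K] a" a] a v by (simp add: K.l_neg)
 thus ?thesis
  using V.minus_equality[of "v \<odot>[V] (\<ominus>[K] a)" "v \<odot>[V] a"] v a rsmult_closed by simp
qed

lemma skew_inverse:
 assumes a: "a \<in> carrier K" "a ~= \<zero>[K]"
 obtains b where "b \<in> carrier K" "a \<otimes>[K] b = \<one>[K]" "b \<otimes>[K] a = \<one>[K]"
proof -
 have "a \<in> Units K" using a K.skew_field_Units by blast
 thus ?thesis using that unfolding Units_def by blast
qed

lemma subspace_neg:
 assumes W: "subspace_of K V W" "w \<in> W" shows "\<ominus>[V] w \<in> W"
proof -
 have w: "w \<in> carrier V" using W unfolding subspace_of_def by blast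
 have "w \<odot>[V] (\<ominus>[K] \<one>[K]) \<in> W" using W unfolding subspace_of_def by (meson K.a_inv_closed K.one_closed)
 thus ?thesis using rsmult_minus_right[OF w K.one_closed] rsmult_one[OF w] by simp
qed

lemma subspace_finsum:
 assumes W: "subspace_of K V W" and "finite B" "B \<subseteq> W" "c \<in> B \<rightarrow> carrier K"
 shows "finsum V (\<lambda>b. b \<odot>[V] c b) B \<in> W"
 using assms(2-4)
proof (induction B rule: finite_induct)
 case empty
 thus ?case using W unfolding subspace_of_def by simp
next
 case (insert b B)
 have W': "W \<subseteq> carrier V" using W unfolding subspace_of_def by blast
 have "finsum V (\<lambda>b. b \<odot>[V] c b) (insert b B) = (b \<odot>[V] c b) \<oplus>[V] finsum V (\<lambda>b. b \<odot>[V] c b) B"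
  using insert.prems W' insert.hyps by (intro V.finsum_insert) (auto intro!: rsmult_closed)
 moreover have "finsum V (\<lambda>b. b \<odot>[V] c b) B \<in> W" using insert by auto
 moreover have "b \<odot>[V] c b \<in> W" using insert.prems W unfolding subspace_of_def by auto
 ultimately show ?case using W unfolding subspace_of_def by simp
qed

lemma subspace_span:
 assumes B: "finite B" "B \<subseteq> carrier V"
 shows "subspace_of K V {finsum V (\<lambda>b. b \<odot>[V] c b) B | c. c \<in> B \<rightarrow> carrier K}" (is "subspace_of K V ?S")
  and "B \<subseteq> {finsum V (\<lambda>b. b \<odot>[V] c b) B | c. c \<in> B \<rightarrow> carrier K}"
proof -
 have cl: "(\<lambda>b. b \<odot>[V] c b) \<in> B \<rightarrow> carrier V" if "c \<in> B \<rightarrow> carrier K" for c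
 proof (rule Pi_I)
  fix b assume b: "b \<in> B"
  show "b \<odot>[V] c b \<in> carrier V"
   by (rule rsmult_closed[OF subsetD[OF B(2) b] funcset_mem[OF that b]])
 qed
 have memI: "finsum V (\<lambda>b. b \<odot>[V] c b) B \<in> ?S" if "c \<in> B \<rightarrow> carrier K" for c
  using that by (intro CollectI exI[of _ c] conjI refl)
 show "subspace_of K V ?S"
  unfolding subspace_of_def
 proof (intro conjI ballI)
  show "?S \<subseteq> carrier V"
  proof
   fix v assume "v \<in> ?S"
   then obtain c where c: "c \<in> B \<rightarrow> carrier K" "v = finsum V (\<lambda>b. b \<odot>[V] c b) B" by blast
   show "v \<in> carrier V" unfolding c(2) by (rule V.finsum_closed[OF cl[OF c(1)]])
  qed
  have "finsum V (\<lambda>b. b \<odot>[V] \<zero>[K]) B = finsum V (\<lambda>b. \<zero>[V]) B"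
   by (rule V.finsum_cong') (use B in auto)
  hence z: "finsum V (\<lambda>b. b \<odot>[V] \<zero>[K]) B = \<zero>[V]" unfolding V.finsum_zero .
  show "\<zero>[V] \<in> ?S" using memI[of "\<lambda>_. \<zero>[K]"] K.zero_closed unfolding z by blast
 next
  fix v w assume "v \<in> ?S" "w \<in> ?S"
  then obtain c d where cd: "c \<in> B \<rightarrow> carrier K" "d \<in> B \<rightarrow> carrier K"
   "v = finsum V (\<lambda>b. b \<odot>[V] c b) B" "w = finsum V (\<lambda>b. b \<odot>[V] d b) B" by blast
  have "finsum V (\<lambda>b. b \<odot>[V] (c b \<oplus>[K] d b)) B = finsum V (\<lambda>b. (b \<odot>[V] c b) \<oplus>[V] (b \<odot>[V] d b)) B"
  proof (rule V.finsum_cong')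
   show "(\<lambda>b. (b \<odot>[V] c b) \<oplus>[V] (b \<odot>[V] d b)) \<in> B \<rightarrow> carrier V"
    using cl[OF cd(1)] cl[OF cd(2)] by (auto simp: Pi_iff)
   show "b \<odot>[V] (c b \<oplus>[K] d b) = (b \<odot>[V] c b) \<oplus>[V] (b \<odot>[V] d b)" if "b \<in> B" for b
    using that B cd by (intro rsmult_add_right) auto
  qed simp
  also have "... = v \<oplus>[V] w" unfolding cd(3,4) by (rule V.finsum_addf[OF cl[OF cd(1)] cl[OF cd(2)]])
  finally have "v \<oplus>[V] w = finsum V (\<lambda>b. b \<odot>[V] (c b \<oplus>[K] d b)) B" by simp
  moreover have "(\<lambda>b. c b \<oplus>[K] d b) \<in> B \<rightarrow> carrier K" using cd by auto
  ultimately show "v \<oplus>[V] w \<in> ?S" using memI[of "\<lambda>b. c b \<oplus>[K] d b"] by simp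
 next
  fix v a assume "v \<in> ?S" and a: "a \<in> carrier K"
  then obtain c where c: "c \<in> B \<rightarrow> carrier K" "v = finsum V (\<lambda>b. b \<odot>[V] c b) B" by blast
  have "finsum V (\<lambda>b. b \<odot>[V] c b) A \<odot>[V] a = finsum V (\<lambda>b. b \<odot>[V] (c b \<otimes>[K] a)) A"
   if "finite A" "A \<subseteq> B" for A
   using that
  proof (induction A rule: finite_induct)
   case empty
   thus ?case using a by simp
  next
   case (insert b A)
   have A: "(\<lambda>b. b \<odot>[V] c b) \<in> A \<rightarrow> carrier V" "b \<odot>[V] c b \<in> carrier V"
    "(\<lambda>b. b \<odot>[V] (c b \<otimes>[K] a)) \<in> A \<rightarrow> carrier V" "b \<odot>[V] (c b \<otimes>[K] a) \<in> carrier V"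
    using insert.prems B c a by (auto intro!: rsmult_closed)
   have "finsum V (\<lambda>b. b \<odot>[V] c b) (insert b A) \<odot>[V] a =
     ((b \<odot>[V] c b) \<oplus>[V] finsum V (\<lambda>b. b \<odot>[V] c b) A) \<odot>[V] a"
    using V.finsum_insert[OF insert.hyps A(1,2)] by simp
   also have "... = ((b \<odot>[V] c b) \<odot>[V] a) \<oplus>[V] (finsum V (\<lambda>b. b \<odot>[V] c b) A \<odot>[V] a)"
    by (rule rsmult_add_left[OF A(2) V.finsum_closed[OF A(1)] a])
   also have "(b \<odot>[V] c b) \<odot>[V] a = b \<odot>[V] (c b \<otimes>[K] a)"
    by (rule rsmult_assoc[symmetric]) (use insert.prems B c a in auto)
   also have "finsum V (\<lambda>b. b \<odot>[V] c b) A \<odot>[V] a = finsum V (\<lambda>b. b \<odot>[V] (c b \<otimes>[K] a)) A"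
    using insert by auto
   also have "b \<odot>[V] (c b \<otimes>[K] a) \<oplus>[V] finsum V (\<lambda>b. b \<odot>[V] (c b \<otimes>[K] a)) A =
     finsum V (\<lambda>b. b \<odot>[V] (c b \<otimes>[K] a)) (insert b A)"
    using V.finsum_insert[OF insert.hyps A(3,4)] by simp
   finally show ?case .
  qed
  hence "v \<odot>[V] a = finsum V (\<lambda>b. b \<odot>[V] (c b \<otimes>[K] a)) B" unfolding c(2) using B by blast
  moreover have "(\<lambda>b. c b \<otimes>[K] a) \<in> B \<rightarrow> carrier K" using c a by auto
  ultimately show "v \<odot>[V] a \<in> ?S" using memI[of "\<lambda>b. c b \<otimes>[K] a"] by simp
 qed
 show "B \<subseteq> ?S"
 proof
  fix b assume b: "b \<in> B"
  define c where "c b' = (if b' = b then \<one>[K] else \<zero>[K])" for b'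
  have c: "c \<in> B \<rightarrow> carrier K" unfolding c_def by auto
  have "finsum V (\<lambda>b'. b' \<odot>[V] c b') B = finsum V (\<lambda>b'. if b = b' then b' else \<zero>[V]) B"
   by (rule V.finsum_cong') (use B in \<open>auto simp: c_def rsmult_one\<close>)
  also have "... = b" by (rule V.finsum_singleton[OF b B(1)]) (use B in auto)
  finally show "b \<in> ?S" using memI[OF c] by simp
 qed
qed

text \<open>By induction on the finite set \<open>B\<close>. Either coordinates are unique and
  \<open>B\<close> is a basis, or two coordinate families of one vector differ at some
  \<open>b\<close>, and then \<open>b\<close> lies in the span of the rest.\<close>

lemma generates_finite_dimensional:
 assumes "generates K V B" shows "finite_dimensional K V"
proof -
 have "finite B" using assms unfolding generates_def by blast
 thus ?thesis using assms
 proof (induction B rule: finite_psubset_induct)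
  case (psubset B)
  have B: "finite B" "B \<subseteq> carrier V" using psubset.prems unfolding generates_def by blast+
  let ?lc = "\<lambda>c. finsum V (\<lambda>b. b \<odot>[V] c b) B"
  have span: "{?lc c | c. c \<in> B \<rightarrow> carrier K} = carrier V"
   using psubset.prems subspace_span[OF B] unfolding generates_def by blast
  have ex: "\<exists>c. c \<in> B \<rightarrow>\<^sub>E carrier K & v = ?lc c" if v: "v \<in> carrier V" for v
  proof -
   obtain c where c: "c \<in> B \<rightarrow> carrier K" "v = ?lc c" using v span by blast
   have "?lc (restrict c B) = ?lc c"
    by (rule V.finsum_cong') (use c(1) B in \<open>auto intro!: rsmult_closed\<close>)
   thus ?thesis using c by (intro exI[of _ "restrict c B"]) auto
  qed
  show ?case
  proof (cases "\<forall>c d. c \<in> B \<rightarrow>\<^sub>E carrier K --> d \<in> B \<rightarrow>\<^sub>E carrier K --> ?lc c = ?lc d --> c = d")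
   case True
   have "\<exists>!c. c \<in> B \<rightarrow>\<^sub>E carrier K & v = ?lc c" if v: "v \<in> carrier V" for v
    using ex[OF v] True by metis
   hence "is_basis K V B" unfolding is_basis_def using B by blast
   thus ?thesis unfolding finite_dimensional_def by blast
  next
   case False
   then obtain c d where cd: "c \<in> B \<rightarrow>\<^sub>E carrier K" "d \<in> B \<rightarrow>\<^sub>E carrier K" "?lc c = ?lc d" "c ~= d" by blast
   then obtain b where b: "b \<in> B" "c b ~= d b" using PiE_ext[OF cd(1,2)] by blast
   have bV: "b \<in> carrier V" and ck: "c b \<in> carrier K" "d b \<in> carrier K" using b B cd by auto
   have "generates K V (B - {b})"
    unfolding generates_def
   proof (intro conjI allI impI)
    fix W assume W: "subspace_of K V W" "B - {b} \<subseteq> W"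
    have WV: "W \<subseteq> carrier V" using W unfolding subspace_of_def by blast
    let ?rc = "\<lambda>c. finsum V (\<lambda>b. b \<odot>[V] c b) (B - {b})"
    have r: "?rc c \<in> W" "?rc d \<in> W"
     using cd by (intro subspace_finsum[OF W(1) _ W(2)]; use B in auto)+
    have split: "?lc c = (b \<odot>[V] c b) \<oplus>[V] ?rc c" if "c \<in> B \<rightarrow>\<^sub>E carrier K" for c
    proof -
     have "finsum V (\<lambda>b. b \<odot>[V] c b) (insert b (B - {b})) = (b \<odot>[V] c b) \<oplus>[V] ?rc c"
      by (rule V.finsum_insert) (use that B b in \<open>auto intro!: rsmult_closed\<close>)
     thus ?thesis using b by (simp add: insert_absorb)
    qed
    have eq: "(b \<odot>[V] c b) \<oplus>[V] ?rc c = (b \<odot>[V] d b) \<oplus>[V] ?rc d"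
     using split[OF cd(1)] split[OF cd(2)] cd(3) by simp
    \<comment> \<open>The nonzero difference of the two coordinates of \<open>b\<close>; dividing
      the relation by it puts \<open>b\<close> into every subspace containing the other
      generators.\<close>
    let ?e = "c b \<oplus>[K] (\<ominus>[K] d b)"
    have e: "?e \<in> carrier K" "?e ~= \<zero>[K]"
     using ck b(2) K.minus_equality K.minus_minus K.a_comm by (auto, metis K.add.inv_closed K.r_neg2 K.r_zero K.a_comm)
    have wV: "?rc c \<in> carrier V" "?rc d \<in> carrier V" "b \<odot>[V] c b \<in> carrier V" "b \<odot>[V] d b \<in> carrier V"
     using r WV bV ck rsmult_closed by auto
    have "b \<odot>[V] ?e = (b \<odot>[V] c b) \<oplus>[V] (\<ominus>[V] (b \<odot>[V] d b))"
     using rsmult_add_right[OF bV ck(1), of "\<ominus>[K] d b"] rsmult_minus_right[OF bV ck(2)] ck by simp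
    also have "b \<odot>[V] c b = ((b \<odot>[V] d b) \<oplus>[V] ?rc d) \<oplus>[V] (\<ominus>[V] ?rc c)"
     unfolding eq[symmetric] using wV by (simp add: V.a_assoc V.r_neg)
    also have "... \<oplus>[V] (\<ominus>[V] (b \<odot>[V] d b)) = ?rc d \<oplus>[V] (\<ominus>[V] ?rc c)"
     using wV by (simp add: V.a_assoc V.a_comm V.a_lcomm V.r_neg V.r_neg1 V.r_neg2)
    finally have "b \<odot>[V] ?e \<in> W"
     using r subspace_neg[OF W(1)] W(1) unfolding subspace_of_def by simp
    moreover obtain f where f: "f \<in> carrier K" "?e \<otimes>[K] f = \<one>[K]" by (rule skew_inverse[OF e])
    ultimately have "(b \<odot>[V] ?e) \<odot>[V] f \<in> W" using W(1) unfolding subspace_of_def by blast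
    moreover have "(b \<odot>[V] ?e) \<odot>[V] f = b"
     using rsmult_assoc[OF bV e(1) f(1)] f(2) rsmult_one[OF bV] by simp
    ultimately have "B \<subseteq> W" using W(2) by auto
    thus "W = carrier V" using psubset.prems W(1) unfolding generates_def by blast
   qed (use B in auto)
   thus ?thesis using psubset.IH[of "B - {b}"] b by blast
  qed
 qed
qed

lemma finite_dimensional_generates:
 assumes "finite_dimensional K V" obtains B where "generates K V B"
proof -
 obtain B where B: "is_basis K V B" using assms unfolding finite_dimensional_def by blast
 have "generates K V B"
  unfolding generates_def
 proof (intro conjI allI impI)
  show "finite B" "B \<subseteq> carrier V" using B unfolding is_basis_def by blast+
  fix W assume W: "subspace_of K V W" "B \<subseteq> W"
  have "v \<in> W" if v: "v \<in> carrier V" for v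
  proof -
   obtain c where c: "c \<in> B \<rightarrow>\<^sub>E carrier K" "v = finsum V (\<lambda>b. b \<odot>[V] c b) B"
    using B v unfolding is_basis_def by blast
   have "c \<in> B \<rightarrow> carrier K" using c(1) by auto
   thus ?thesis using subspace_finsum[OF W(1) \<open>finite B\<close> W(2)] c(2) by simp
  qed
  thus "W = carrier V" using W(1) unfolding subspace_of_def by blast
 qed
 thus ?thesis by (rule that)
qed

text \<open>The generators are added to \<open>W\<close> one at a time. The last subspace before the
  whole space is reached is \<open>W'\<close>, and the generator that completes it is
  \<open>b\<close>.\<close>

lemma hyperplane:
 assumes "generates K V B" and W: "subspace_of K V W" "W ~= carrier V"
 obtains W' b where "subspace_of K V W'" "W \<subseteq> W'" "b \<in> carrier V" "b \<notin> W'"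
  "!!v. v \<in> carrier V ==> \<exists>w \<in> W'. \<exists>a \<in> carrier K. v = w \<oplus>[V] (b \<odot>[V] a)"
proof -
 have "\<exists>W' b. subspace_of K V W' & W \<subseteq> W' & b \<in> carrier V & b \<notin> W' &
  (\<forall>v \<in> carrier V. \<exists>w \<in> W'. \<exists>a \<in> carrier K. v = w \<oplus>[V] (b \<odot>[V] a))"
  if "finite B" "B \<subseteq> carrier V" "subspace_of K V W" "W ~= carrier V"
   "!!U. subspace_of K V U ==> B \<subseteq> U ==> W \<subseteq> U ==> U = carrier V" for B W
  using that
 proof (induction B arbitrary: W rule: finite_induct)
  case empty
  thus ?case by blast
 next
  case (insert b B)
  note W = insert.prems(2)
  have WV: "W \<subseteq> carrier V" using W unfolding subspace_of_def by blast
  have b: "b \<in> carrier V" using insert.prems by blast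
  define W1 where "W1 = {w \<oplus>[V] (b \<odot>[V] a) | w a. w \<in> W & a \<in> carrier K}"
  have W0: "\<zero>[V] \<in> W" using W unfolding subspace_of_def by blast
  have W1: "subspace_of K V W1"
   unfolding subspace_of_def
  proof (intro conjI ballI)
   show "W1 \<subseteq> carrier V" unfolding W1_def using WV b rsmult_closed by auto
   have "\<zero>[V] = \<zero>[V] \<oplus>[V] (b \<odot>[V] \<zero>[K])" using b by simp
   thus "\<zero>[V] \<in> W1" unfolding W1_def using W0 by blast
  next
   fix v w assume "v \<in> W1" "w \<in> W1"
   then obtain v' a w' a' where vw: "v' \<in> W" "w' \<in> W" "a \<in> carrier K" "a' \<in> carrier K"
    "v = v' \<oplus>[V] (b \<odot>[V] a)" "w = w' \<oplus>[V] (b \<odot>[V] a')" unfolding W1_def by blast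
   have "v' \<in> carrier V" "w' \<in> carrier V" "b \<odot>[V] a \<in> carrier V" "b \<odot>[V] a' \<in> carrier V"
    using vw WV b rsmult_closed by auto
   hence "v \<oplus>[V] w = (v' \<oplus>[V] w') \<oplus>[V] (b \<odot>[V] (a \<oplus>[K] a'))"
    using rsmult_add_right[OF b vw(3,4)] unfolding vw(5,6) by (simp add: V.a_assoc V.a_lcomm)
   moreover have "v' \<oplus>[V] w' \<in> W" using vw W unfolding subspace_of_def by blast
   ultimately show "v \<oplus>[V] w \<in> W1" unfolding W1_def using vw(3,4) by blast
  next
   fix v a' assume "v \<in> W1" and a': "a' \<in> carrier K"
   then obtain v' a where v: "v' \<in> W" "a \<in> carrier K" "v = v' \<oplus>[V] (b \<odot>[V] a)" unfolding W1_def by blast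
   have "v \<odot>[V] a' = (v' \<odot>[V] a') \<oplus>[V] (b \<odot>[V] (a \<otimes>[K] a'))"
    using rsmult_add_left[of v' "b \<odot>[V] a" a'] rsmult_assoc[OF b v(2) a'] v WV b a' rsmult_closed by auto
   moreover have "v' \<odot>[V] a' \<in> W" using v a' W unfolding subspace_of_def by blast
   ultimately show "v \<odot>[V] a' \<in> W1" unfolding W1_def using v(2) a' by blast
  qed
  have WW1: "W \<subseteq> W1"
  proof
   fix w assume w: "w \<in> W"
   hence "w = w \<oplus>[V] (b \<odot>[V] \<zero>[K])" using b WV by auto
   thus "w \<in> W1" unfolding W1_def using w by blast
  qed
  have bW1: "b \<in> W1"
  proof -
   have "b = \<zero>[V] \<oplus>[V] (b \<odot>[V] \<one>[K])" using b rsmult_one by simp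
   thus ?thesis unfolding W1_def using W0 by blast
  qed
  show ?case
  proof (cases "W1 = carrier V")
   case True
   have "b \<notin> W"
   proof
    assume "b \<in> W"
    hence "W1 \<subseteq> W" unfolding W1_def using W unfolding subspace_of_def by blast
    thus False using True insert.prems(3) WV by blast
   qed
   moreover have "\<forall>v \<in> carrier V. \<exists>w \<in> W. \<exists>a \<in> carrier K. v = w \<oplus>[V] (b \<odot>[V] a)"
    unfolding True[symmetric] unfolding W1_def by blast
   ultimately show ?thesis using W b by (intro exI[of _ W] exI[of _ b] conjI subset_refl)
  next
   case False
   have "\<exists>W' b. subspace_of K V W' & W1 \<subseteq> W' & b \<in> carrier V & b \<notin> W' &
    (\<forall>v \<in> carrier V. \<exists>w \<in> W'. \<exists>a \<in> carrier K. v = w \<oplus>[V] (b \<odot>[V] a))"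
   proof (rule insert.IH[OF _ W1 False])
    show "B \<subseteq> carrier V" using insert.prems(1) by blast
    fix U assume U: "subspace_of K V U" "B \<subseteq> U" "W1 \<subseteq> U"
    show "U = carrier V" by (rule insert.prems(4)[OF U(1)]) (use U WW1 bW1 in blast)+
   qed
   then obtain W' b' where "subspace_of K V W'" "W1 \<subseteq> W'" "b' \<in> carrier V" "b' \<notin> W'"
    "\<forall>v \<in> carrier V. \<exists>w \<in> W'. \<exists>a \<in> carrier K. v = w \<oplus>[V] (b' \<odot>[V] a)" by (elim exE conjE)
   thus ?thesis using WW1 by (intro exI[of _ W'] exI[of _ b'] conjI subset_trans[OF WW1])
  qed
 qed
 from this[of B W]
 have "\<exists>W' b. subspace_of K V W' & W \<subseteq> W' & b \<in> carrier V & b \<notin> W' &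
  (\<forall>v \<in> carrier V. \<exists>w \<in> W'. \<exists>a \<in> carrier K. v = w \<oplus>[V] (b \<odot>[V] a))"
  using assms unfolding generates_def by (elim conjE) simp
 then obtain W' b where "subspace_of K V W'" "W \<subseteq> W'" "b \<in> carrier V" "b \<notin> W'"
  "\<forall>v \<in> carrier V. \<exists>w \<in> W'. \<exists>a \<in> carrier K. v = w \<oplus>[V] (b \<odot>[V] a)" by (elim exE conjE)
 thus ?thesis using that[of W' b] by simp
qed

end

lemmas smult_closed = right_vector_space.rsmult_closed
 and smult_zero = right_vector_space.rsmult_zero_right
 and zero_smult = right_vector_space.rsmult_zero_left
 and smult_add = right_vector_space.rsmult_add_right
 and add_smult = right_vector_space.rsmult_add_left
 and smult_assoc = right_vector_space.rsmult_assoc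
 and smult_one = right_vector_space.rsmult_one

section \<open>Morphisms of representations\<close>

abbreviation "elems R x \<equiv> carrier (rspace R x)"

lemma Hom_Rep_iff:
 "\<phi> \<in> Hom (Rep_category P K \<kappa>) A B \<longleftrightarrow>
  (\<exists>f \<in> rep_hom P K A B. \<phi> = (A, f, B)) & is_pfd_rep P K \<kappa> A & is_pfd_rep P K \<kappa> B"
 by (auto simp: Hom_def Rep_category_def)

lemma Ob_Rep_iff: "A \<in> Ob (Rep_category P K \<kappa>) \<longleftrightarrow> is_pfd_rep P K \<kappa> A"
 by (simp add: Rep_category_def)

lemma cmp_Rep:
 "cmp (Rep_category P K \<kappa>) (B', g, D) (A, f, B) =
  (A, (\<lambda>x \<in> carrier P. compose (carrier (rspace A x)) (g x) (f x)), D)"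
 by (simp add: Rep_category_def)

lemma ident_Rep:
 "ident (Rep_category P K \<kappa>) A = (A, (\<lambda>x \<in> carrier P. \<lambda>v \<in> carrier (rspace A x). v), A)"
 by (simp add: Rep_category_def)

lemma rep_homD:
 assumes "f \<in> rep_hom P K A B"
 shows "f \<in> extensional (carrier P)"
  "x \<in> carrier P ==> f x \<in> extensional (carrier (rspace A x))"
  "[|x \<in> carrier P; v \<in> carrier (rspace A x)|] ==> f x v \<in> carrier (rspace B x)"
  "[|x \<in> carrier P; v \<in> carrier (rspace A x); w \<in> carrier (rspace A x)|]
   ==> f x (v \<oplus>\<^bsub>rspace A x\<^esub> w) = f x v \<oplus>\<^bsub>rspace B x\<^esub> f x w"
  "[|x \<in> carrier P; v \<in> carrier (rspace A x); a \<in> carrier (K x)|]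
   ==> f x (v \<odot>\<^bsub>rspace A x\<^esub> a) = f x v \<odot>\<^bsub>rspace B x\<^esub> a"
  "[|x \<in> carrier P; y \<in> carrier P; x \<sqsubseteq>\<^bsub>P\<^esub> y; v \<in> carrier (rspace A y)|]
   ==> f x (rmap A x y v) = rmap B x y (f y v)"
proof -
 have f: "f \<in> extensional (carrier P)"
  "!!x. x \<in> carrier P ==> f x \<in> linear_maps (K x) (rspace A x) (rspace B x) \<inter> extensional (carrier (rspace A x))"
  "!!x y v. [|x \<in> carrier P; y \<in> carrier P; x \<sqsubseteq>\<^bsub>P\<^esub> y; v \<in> carrier (rspace A y)|]
   ==> f x (rmap A x y v) = rmap B x y (f y v)"
  using assms unfolding rep_hom_def by (auto simp: PiE_iff)
 show "f \<in> extensional (carrier P)" by (rule f(1))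
 show "x \<in> carrier P ==> f x \<in> extensional (carrier (rspace A x))" using f(2) by blast
 show "[|x \<in> carrier P; v \<in> carrier (rspace A x)|] ==> f x v \<in> carrier (rspace B x)"
  using f(2) unfolding linear_maps_def by blast
 show "[|x \<in> carrier P; v \<in> carrier (rspace A x); w \<in> carrier (rspace A x)|]
   ==> f x (v \<oplus>\<^bsub>rspace A x\<^esub> w) = f x v \<oplus>\<^bsub>rspace B x\<^esub> f x w"
  using f(2) unfolding linear_maps_def by blast
 show "[|x \<in> carrier P; v \<in> carrier (rspace A x); a \<in> carrier (K x)|]
   ==> f x (v \<odot>\<^bsub>rspace A x\<^esub> a) = f x v \<odot>\<^bsub>rspace B x\<^esub> a"
  using f(2) unfolding linear_maps_def by blast
 show "[|x \<in> carrier P; y \<in> carrier P; x \<sqsubseteq>\<^bsub>P\<^esub> y; v \<in> carrier (rspace A y)|]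
   ==> f x (rmap A x y v) = rmap B x y (f y v)" by (rule f(3))
qed

lemma rep_homI:
 assumes "f \<in> extensional (carrier P)"
  and "!!x. x \<in> carrier P ==> f x \<in> extensional (carrier (rspace A x))"
  and "!!x v. [|x \<in> carrier P; v \<in> carrier (rspace A x)|] ==> f x v \<in> carrier (rspace B x)"
  and "!!x v w. [|x \<in> carrier P; v \<in> carrier (rspace A x); w \<in> carrier (rspace A x)|]
   ==> f x (v \<oplus>\<^bsub>rspace A x\<^esub> w) = f x v \<oplus>\<^bsub>rspace B x\<^esub> f x w"
  and "!!x v a. [|x \<in> carrier P; v \<in> carrier (rspace A x); a \<in> carrier (K x)|]
   ==> f x (v \<odot>\<^bsub>rspace A x\<^esub> a) = f x v \<odot>\<^bsub>rspace B x\<^esub> a"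
  and "!!x y v. [|x \<in> carrier P; y \<in> carrier P; x \<sqsubseteq>\<^bsub>P\<^esub> y; v \<in> carrier (rspace A y)|]
   ==> f x (rmap A x y v) = rmap B x y (f y v)"
 shows "f \<in> rep_hom P K A B"
by (simp add: linear_maps_def assms(2-5) rep_hom_def assms(1,6) PiE_iff)

lemma rep_hom_eqI:
 assumes "f \<in> rep_hom P K A B" "g \<in> rep_hom P K A B"
  "!!x v. [|x \<in> carrier P; v \<in> carrier (rspace A x)|] ==> f x v = g x v"
 shows "f = g"
by (metis extensionalityI rep_homD(1) assms(1) assms(2) rep_homD(2) assms(3))

lemma pfd_repD:
 assumes "is_pfd_rep P K \<kappa> A"
 shows "x \<in> carrier P ==> right_vector_space (K x) (rspace A x)"
  "x \<in> carrier P ==> finite_dimensional (K x) (rspace A x)"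
  "[|x \<in> carrier P; v \<in> carrier (rspace A x)|] ==> rmap A x x v = v"
  "[|x \<in> carrier P; y \<in> carrier P; z \<in> carrier P; x \<sqsubseteq>\<^bsub>P\<^esub> y; y \<sqsubseteq>\<^bsub>P\<^esub> z; v \<in> carrier (rspace A z)|]
   ==> rmap A x z v = rmap A x y (rmap A y z v)"
  "[|x \<in> carrier P; y \<in> carrier P; x \<sqsubseteq>\<^bsub>P\<^esub> y; v \<in> carrier (rspace A y); w \<in> carrier (rspace A y)|]
   ==> rmap A x y (v \<oplus>\<^bsub>rspace A y\<^esub> w) = rmap A x y v \<oplus>\<^bsub>rspace A x\<^esub> rmap A x y w"
  "[|x \<in> carrier P; y \<in> carrier P; x \<sqsubseteq>\<^bsub>P\<^esub> y; v \<in> carrier (rspace A y); a \<in> carrier (K y)|]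
   ==> rmap A x y (v \<odot>\<^bsub>rspace A y\<^esub> a) = rmap A x y v \<odot>\<^bsub>rspace A x\<^esub> \<kappa> x y a"
proof -
 have lin: "rmap A x y \<in> linear_maps (K y) (rspace A y) (restrict_scalars (\<kappa> x y) (rspace A x))"
  if "x \<in> carrier P" "y \<in> carrier P" "x \<sqsubseteq>\<^bsub>P\<^esub> y" for x y
  using assms that unfolding is_pfd_rep_def by blast
 show "x \<in> carrier P ==> right_vector_space (K x) (rspace A x)"
  "x \<in> carrier P ==> finite_dimensional (K x) (rspace A x)"
  "[|x \<in> carrier P; v \<in> carrier (rspace A x)|] ==> rmap A x x v = v"
  "[|x \<in> carrier P; y \<in> carrier P; z \<in> carrier P; x \<sqsubseteq>\<^bsub>P\<^esub> y; y \<sqsubseteq>\<^bsub>P\<^esub> z; v \<in> carrier (rspace A z)|]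
   ==> rmap A x z v = rmap A x y (rmap A y z v)"
  using assms unfolding is_pfd_rep_def by blast+
 show "[|x \<in> carrier P; y \<in> carrier P; x \<sqsubseteq>\<^bsub>P\<^esub> y; v \<in> carrier (rspace A y); w \<in> carrier (rspace A y)|]
   ==> rmap A x y (v \<oplus>\<^bsub>rspace A y\<^esub> w) = rmap A x y v \<oplus>\<^bsub>rspace A x\<^esub> rmap A x y w"
  using lin[of x y] unfolding linear_maps_def restrict_scalars_def by auto
 show "[|x \<in> carrier P; y \<in> carrier P; x \<sqsubseteq>\<^bsub>P\<^esub> y; v \<in> carrier (rspace A y); a \<in> carrier (K y)|]
   ==> rmap A x y (v \<odot>\<^bsub>rspace A y\<^esub> a) = rmap A x y v \<odot>\<^bsub>rspace A x\<^esub> \<kappa> x y a"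
  using lin[of x y] unfolding linear_maps_def restrict_scalars_def by auto
qed

lemma pfd_repI:
 assumes "!!x. x \<in> carrier P ==> right_vector_space (K x) (rspace A x)"
  and "!!x. x \<in> carrier P ==> finite_dimensional (K x) (rspace A x)"
  and "!!x v. [|x \<in> carrier P; v \<in> carrier (rspace A x)|] ==> rmap A x x v = v"
  and "!!x y z v. [|x \<in> carrier P; y \<in> carrier P; z \<in> carrier P; x \<sqsubseteq>\<^bsub>P\<^esub> y; y \<sqsubseteq>\<^bsub>P\<^esub> z; v \<in> carrier (rspace A z)|]
   ==> rmap A x z v = rmap A x y (rmap A y z v)"
  and "!!x y v. [|x \<in> carrier P; y \<in> carrier P; x \<sqsubseteq>\<^bsub>P\<^esub> y; v \<in> carrier (rspace A y)|]
   ==> rmap A x y v \<in> carrier (rspace A x)"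
  and "!!x y v w. [|x \<in> carrier P; y \<in> carrier P; x \<sqsubseteq>\<^bsub>P\<^esub> y; v \<in> carrier (rspace A y); w \<in> carrier (rspace A y)|]
   ==> rmap A x y (v \<oplus>\<^bsub>rspace A y\<^esub> w) = rmap A x y v \<oplus>\<^bsub>rspace A x\<^esub> rmap A x y w"
  and "!!x y v a. [|x \<in> carrier P; y \<in> carrier P; x \<sqsubseteq>\<^bsub>P\<^esub> y; v \<in> carrier (rspace A y); a \<in> carrier (K y)|]
   ==> rmap A x y (v \<odot>\<^bsub>rspace A y\<^esub> a) = rmap A x y v \<odot>\<^bsub>rspace A x\<^esub> \<kappa> x y a"
 shows "is_pfd_rep P K \<kappa> A"
by (simp add: assms(5-7) linear_maps_def restrict_scalars_def is_pfd_rep_def assms(1-4))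

lemma rep_iso:
 assumes f: "f \<in> rep_hom P K A B" and A: "is_pfd_rep P K \<kappa> A" and B: "is_pfd_rep P K \<kappa> B"
  and bij: "!!x. x \<in> carrier P ==> bij_betw (f x) (carrier (rspace A x)) (carrier (rspace B x))"
 shows "iso_arrow (Rep_category P K \<kappa>) (A, f, B)"
proof -
 define g where "g = (\<lambda>x \<in> carrier P. \<lambda>w \<in> carrier (rspace B x). inv_into (carrier (rspace A x)) (f x) w)"
 have gc: "g x w \<in> carrier (rspace A x)" and fg: "f x (g x w) = w"
  if "x \<in> carrier P" "w \<in> carrier (rspace B x)" for x w
  using bij_betw_inv_into[OF bij[OF that(1)]] bij_betw_inv_into_right[OF bij[OF that(1)] that(2)] that
  unfolding g_def bij_betw_def by auto
 have gf: "g x (f x v) = v" if "x \<in> carrier P" "v \<in> carrier (rspace A x)" for x v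
 proof -
  have "g x (f x v) = inv_into (carrier (rspace A x)) (f x) (f x v)"
   unfolding g_def using that(1) rep_homD(3)[OF f that] by (simp only: restrict_apply')
  thus ?thesis using bij_betw_inv_into_left[OF bij[OF that(1)] that(2)] by (rule trans)
 qed
 have inj: "v = w" if "x \<in> carrier P" "v \<in> carrier (rspace A x)" "w \<in> carrier (rspace A x)" "f x v = f x w" for x v w
  using gf[OF that(1,2)] gf[OF that(1,3)] unfolding that(4) by (rule trans[OF sym])
 have g: "g \<in> rep_hom P K B A"
 proof (rule rep_homI)
  show "g \<in> extensional (carrier P)" unfolding g_def by simp
  fix x assume x: "x \<in> carrier P"
  show "g x \<in> extensional (carrier (rspace B x))" unfolding g_def using x by simp
  interpret VA: right_vector_space "K x" "rspace A x" by (rule pfd_repD(1)[OF A x])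
  interpret VB: right_vector_space "K x" "rspace B x" by (rule pfd_repD(1)[OF B x])
  fix v assume v: "v \<in> carrier (rspace B x)"
  show "g x v \<in> carrier (rspace A x)" by (rule gc[OF x v])
  show "g x (v \<oplus>\<^bsub>rspace B x\<^esub> w) = g x v \<oplus>\<^bsub>rspace A x\<^esub> g x w" if w: "w \<in> carrier (rspace B x)" for w
   by (rule inj[OF x]) (use rep_homD(4)[OF f x gc[OF x v] gc[OF x w]] fg x v w gc in simp_all)
  show "g x (v \<odot>\<^bsub>rspace B x\<^esub> a) = g x v \<odot>\<^bsub>rspace A x\<^esub> a" if a: "a \<in> carrier (K x)" for a
   by (rule inj[OF x]) (use rep_homD(5)[OF f x gc[OF x v] a] fg x v a gc VA.rsmult_closed VB.rsmult_closed in simp_all)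
 next
  fix x y v assume xy: "x \<in> carrier P" "y \<in> carrier P" "x \<sqsubseteq>\<^bsub>P\<^esub> y" and v: "v \<in> carrier (rspace B y)"
  have c: "rmap B x y v \<in> carrier (rspace B x)" by (rule rmap_closed[OF B xy v])
  have c': "rmap A x y (g y v) \<in> carrier (rspace A x)" by (rule rmap_closed[OF A xy gc[OF xy(2) v]])
  show "g x (rmap B x y v) = rmap A x y (g y v)"
   by (rule inj[OF xy(1) gc[OF xy(1) c] c'])
    (use rep_homD(6)[OF f xy gc[OF xy(2) v]] fg[OF xy(1) c] fg[OF xy(2) v] in simp)
 qed
 have "(\<lambda>x \<in> carrier P. compose (carrier (rspace A x)) (g x) (f x)) = (\<lambda>x \<in> carrier P. \<lambda>v \<in> carrier (rspace A x). v)"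
  using gf by (intro restrict_ext) (auto simp: compose_def)
 moreover have "(\<lambda>x \<in> carrier P. compose (carrier (rspace B x)) (f x) (g x)) = (\<lambda>x \<in> carrier P. \<lambda>v \<in> carrier (rspace B x). v)"
  using fg by (intro restrict_ext) (auto simp: compose_def)
 moreover have "(A, f, B) \<in> Hom (Rep_category P K \<kappa>) A B" "(B, g, A) \<in> Hom (Rep_category P K \<kappa>) B A"
  unfolding Hom_Rep_iff using f g A B by blast+
 ultimately show ?thesis
  unfolding iso_arrow_def by (auto simp: cmp_Rep ident_Rep Hom_def intro!: bexI[of _ "(B, g, A)"])
qed

section \<open>The division rings of a poset of generators\<close>

text \<open>An injection of \<open>'k\<close> into the type of vectors of \<open>pfd_Rep\<close>;
  evaluation at 0 inverts it.\<close>

definition const_seq :: "'a => nat => 'a" where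
 "const_seq a = (\<lambda>_. a)"

lemma const_seq_0 [simp]: "const_seq a 0 = a" and const_seq_inject [simp]: "const_seq a = const_seq b \<longleftrightarrow> a = b"
 by (auto simp: const_seq_def fun_eq_iff)

context poset_generators
begin

abbreviation "P \<equiv> ji_poset C M \<Omega> m"
abbreviation "K \<equiv> ji_ring C m"
abbreviation "\<kappa> \<equiv> ji_kappa C m"
abbreviation "\<iota> \<equiv> ji_incl C m"
abbreviation "N x \<equiv> dom (m x)"

lemma carrier_P [simp]: "carrier P = \<Omega>"
 by (simp add: ji_poset_def)

lemma le_P: "x \<in> \<Omega> ==> y \<in> \<Omega> ==> x \<sqsubseteq>\<^bsub>P\<^esub> y \<longleftrightarrow> m x <~ m y"
 using le_Sub_iff[of "m x" "m y" M] m_monic m_tgt by (simp add: ji_poset_def)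

lemma K_simps [simp]:
 "carrier (K x) = Hom C (N x) (N x)" "mult (K x) = cmp C" "add (K x) = hadd C"
 "zero (K x) = hzero C (N x) (N x)" "one (K x) = ident C (N x)"
 by (simp_all add: ji_ring_def End_ring_def)

lemma N_Ob [simp]: "x \<in> \<Omega> ==> N x \<in> Ob C"
 by simp

lemma incl_eqI:
 assumes "x \<in> \<Omega>" "y \<in> \<Omega>" "arr i" "dom i = N x" "cod i = N y" "m y ** i = m x"
 shows "\<iota> x y = i"
 unfolding ji_incl_def
proof (rule the_equality)
 show "i \<in> Hom C (N x) (N y) & m y ** i = m x" using assms by (simp add: Hom_def)
 fix j assume j: "j \<in> Hom C (N x) (N y) & m y ** j = m x"
 thus "j = i" using monic_cmp_iff[OF m_monic[OF assms(2)], of j i] assms by (simp add: Hom_def)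
qed

lemma incl:
 assumes "x \<in> \<Omega>" "y \<in> \<Omega>" "m x <~ m y"
 shows "arr (\<iota> x y)" "dom (\<iota> x y) = N x" "cod (\<iota> x y) = N y" "m y ** \<iota> x y = m x"
proof -
 obtain i where i: "arr i" "dom i = N x" "cod i = N y" "m y ** i = m x"
  using assms(3) by (rule factors_throughE)
 thus "arr (\<iota> x y)" "dom (\<iota> x y) = N x" "cod (\<iota> x y) = N y" "m y ** \<iota> x y = m x"
  using incl_eqI[OF assms(1,2) i] by simp_all
qed

lemma incl_monic:
 assumes "x \<in> \<Omega>" "y \<in> \<Omega>" "m x <~ m y" shows "monic C (\<iota> x y)"
 using monic_right_factor[of "m y" "\<iota> x y"] incl[OF assms] m_monic[OF assms(1)] assms by simp

lemma incl_refl [simp]: "x \<in> \<Omega> ==> \<iota> x x = ident C (N x)"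
 by (rule incl_eqI) auto

lemma incl_trans:
 assumes "x \<in> \<Omega>" "y \<in> \<Omega>" "z \<in> \<Omega>" "m x <~ m y" "m y <~ m z"
 shows "\<iota> y z ** \<iota> x y = \<iota> x z"
proof -
 note xy = incl[OF assms(1,2,4)] and yz = incl[OF assms(2,3,5)]
 have "m z ** (\<iota> y z ** \<iota> x y) = m y ** \<iota> x y"
  by (rule cmp_reduce[OF yz(4)]) (use xy(1-3) yz(1-3) assms in simp_all)
 hence "m z ** (\<iota> y z ** \<iota> x y) = m x" using xy(4) by simp
 thus ?thesis using incl_eqI[OF assms(1,3), of "\<iota> y z ** \<iota> x y"] xy(1-3) yz(1-3) by simp
qed

text \<open>By \<open>m_to_M\<close> the arrow \<open>m y ** f\<close> factors through
  \<open>m x\<close>; cancelling \<open>m y\<close> leaves the inclusion. So arrows between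
  comparable generators are given by scalars, which every naturality argument below relies
  on.\<close>

lemma hom_through_incl:
 assumes x: "x \<in> \<Omega>" and y: "y \<in> \<Omega>" and xy: "m x <~ m y"
  and f: "arr f" "dom f = N x" "cod f = N y"
 obtains \<alpha> where "arr \<alpha>" "dom \<alpha> = N x" "cod \<alpha> = N x" "f = \<iota> x y ** \<alpha>"
proof -
 note i = incl[OF x y xy]
 have "m y ** f <~ m x"
  by (rule m_to_M[OF x]) (use f y m_tgt in simp_all)
 then obtain a where a: "arr a" "dom a = dom (m y ** f)" "cod a = N x" "m x ** a = m y ** f"
  by (rule factors_throughE)
 have as: "dom a = N x" using a(2) f y by simp
 have "m y ** (\<iota> x y ** a) = m x ** a" by (rule cmp_reduce[OF i(4)]) (use i(1-3) a(1,3) y in simp_all)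
 hence "m y ** f = m y ** (\<iota> x y ** a)" using a(4) by simp
 hence "f = \<iota> x y ** a"
  using monic_cmp_iff[OF m_monic[OF y], of f "\<iota> x y ** a"] f i(1-3) a(1,3) as by simp
 thus ?thesis using that a(1,3) as by blast
qed

text \<open>The composite \<open>\<alpha> ** \<iota> x y\<close> is again an arrow between the two
  generators, so it is the inclusion after a scalar, which is unique because the inclusion is
  monic.\<close>

lemma kappa_ex1:
 assumes x: "x \<in> \<Omega>" and y: "y \<in> \<Omega>" and xy: "m x <~ m y"
  and a: "\<alpha> \<in> carrier (K y)"
 shows "\<exists>!\<beta>. \<beta> \<in> carrier (K x) & \<iota> x y ** \<beta> = \<alpha> ** \<iota> x y"
proof -
 note i = incl[OF x y xy]
 have aA: "arr \<alpha>" "dom \<alpha> = N y" "cod \<alpha> = N y" using a by (simp_all add: Hom_def)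
 obtain b where b: "arr b" "dom b = N x" "cod b = N x" "\<alpha> ** \<iota> x y = \<iota> x y ** b"
  by (rule hom_through_incl[OF x y xy, of "\<alpha> ** \<iota> x y"]) (use aA i(1-3) in simp_all)
 show ?thesis
 proof (rule ex1I[of _ b])
  show "b \<in> carrier (K x) & \<iota> x y ** b = \<alpha> ** \<iota> x y" using b by (simp add: Hom_def)
  fix c assume c: "c \<in> carrier (K x) & \<iota> x y ** c = \<alpha> ** \<iota> x y"
  hence cA: "arr c" "dom c = N x" "cod c = N x" by (simp_all add: Hom_def)
  have "\<iota> x y ** c = \<iota> x y ** b" using c b(4) by simp
  thus "c = b" using monic_cmp_iff[OF incl_monic[OF x y xy] cA(1) b(1)] cA b i(1-3) by simp
 qed
qed

lemma kappa:
 assumes x: "x \<in> \<Omega>" and y: "y \<in> \<Omega>" and xy: "m x <~ m y"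
  and a: "arr \<alpha>" "dom \<alpha> = N y" "cod \<alpha> = N y"
 shows "arr (\<kappa> x y \<alpha>)" "dom (\<kappa> x y \<alpha>) = N x" "cod (\<kappa> x y \<alpha>) = N x"
  "\<iota> x y ** \<kappa> x y \<alpha> = \<alpha> ** \<iota> x y"
proof -
 have ak: "\<alpha> \<in> carrier (K y)" using a by (simp add: Hom_def)
 have "\<kappa> x y \<alpha> \<in> carrier (K x) & \<iota> x y ** \<kappa> x y \<alpha> = \<alpha> ** \<iota> x y"
  unfolding ji_kappa_def by (rule theI'[OF kappa_ex1[OF x y xy ak]])
 thus "arr (\<kappa> x y \<alpha>)" "dom (\<kappa> x y \<alpha>) = N x" "cod (\<kappa> x y \<alpha>) = N x"
  "\<iota> x y ** \<kappa> x y \<alpha> = \<alpha> ** \<iota> x y" by (simp_all add: Hom_def)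
qed

lemma kappa_eqI:
 assumes x: "x \<in> \<Omega>" and y: "y \<in> \<Omega>" and xy: "m x <~ m y"
  and a: "arr \<alpha>" "dom \<alpha> = N y" "cod \<alpha> = N y"
  and b: "arr \<beta>" "dom \<beta> = N x" "cod \<beta> = N x" "\<iota> x y ** \<beta> = \<alpha> ** \<iota> x y"
 shows "\<kappa> x y \<alpha> = \<beta>"
by (metis incl x y xy kappa a b(4) monic_cmp_iff incl_monic b(1) b(1-3))

lemma skew_field_K:
 assumes x: "x \<in> \<Omega>" shows "skew_field (K x)"
proof -
 have N: "N x \<in> Ob C" using x by simp
 have eq: "K x = hom_group C (N x) (N x)" by (simp add: ji_ring_def End_ring_def)
 have "ring (K x)"
 proof (rule ringI)
  show "abelian_group (K x)" unfolding eq by (rule hom_abelian_group[OF N N])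
  show "Group.monoid (K x)"
  proof (rule monoidI)
   fix a b c assume "a \<in> carrier (K x)" "b \<in> carrier (K x)" "c \<in> carrier (K x)"
   hence t: "arr a" "dom a = N x" "cod a = N x" "arr b" "dom b = N x" "cod b = N x"
    "arr c" "dom c = N x" "cod c = N x" by (simp_all add: Hom_def)
   show "a \<otimes>\<^bsub>K x\<^esub> b \<in> carrier (K x)" using t by (simp add: Hom_def)
   show "a \<otimes>\<^bsub>K x\<^esub> b \<otimes>\<^bsub>K x\<^esub> c = a \<otimes>\<^bsub>K x\<^esub> (b \<otimes>\<^bsub>K x\<^esub> c)" using t by simp
   show "\<one>\<^bsub>K x\<^esub> \<otimes>\<^bsub>K x\<^esub> a = a" "a \<otimes>\<^bsub>K x\<^esub> \<one>\<^bsub>K x\<^esub> = a" using t by simp_all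
  qed (use N in \<open>simp add: Hom_def\<close>)
  fix a b c assume "a \<in> carrier (K x)" "b \<in> carrier (K x)" "c \<in> carrier (K x)"
  hence t: "arr a" "dom a = N x" "cod a = N x" "arr b" "dom b = N x" "cod b = N x"
   "arr c" "dom c = N x" "cod c = N x" by (simp_all add: Hom_def)
  show "(a \<oplus>\<^bsub>K x\<^esub> b) \<otimes>\<^bsub>K x\<^esub> c = a \<otimes>\<^bsub>K x\<^esub> c \<oplus>\<^bsub>K x\<^esub> b \<otimes>\<^bsub>K x\<^esub> c" using t by simp
  show "c \<otimes>\<^bsub>K x\<^esub> (a \<oplus>\<^bsub>K x\<^esub> b) = c \<otimes>\<^bsub>K x\<^esub> a \<oplus>\<^bsub>K x\<^esub> c \<otimes>\<^bsub>K x\<^esub> b" using t by simp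
 qed
 then interpret R: ring "K x" .
 show ?thesis
 proof
  have "a \<in> Units (K x)" if a: "a \<in> carrier (K x)" "a ~= hzero C (N x) (N x)" for a
  proof -
   have t: "arr a" "dom a = N x" "cod a = N x" using a by (simp_all add: Hom_def)
   have "~ null C a" using a(2) t by (simp add: null_def)
   hence "iso_arrow C a" by (rule m_endo[OF x t])
   then obtain b where "arr b" "dom b = N x" "cod b = N x" "b ** a = ident C (N x)" "a ** b = ident C (N x)"
    using t by (auto elim: iso_arrowE)
   thus ?thesis using a unfolding Units_def by (auto simp: Hom_def)
  qed
  moreover have "a ~= hzero C (N x) (N x)" if a: "a \<in> Units (K x)" for a
  proof
   assume z: "a = hzero C (N x) (N x)"
   obtain b where b: "arr b" "dom b = N x" "cod b = N x" "b ** a = ident C (N x)"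
    using a unfolding Units_def by (auto simp: Hom_def)
   have "null C (ident C (N x))" using b N unfolding z by (simp add: null_def)
   hence "null C (m x ** ident C (N x))" by (rule null_cmp_right) (use x N in simp_all)
   thus False using m_nonzero[OF x] x by simp
  qed
  ultimately show "Units (K x) = carrier (K x) - {\<zero>\<^bsub>K x\<^esub>}" unfolding Units_def by auto
 qed
qed

lemma kappa_ring_hom:
 assumes x: "x \<in> \<Omega>" and y: "y \<in> \<Omega>" and xy: "m x <~ m y"
 shows "\<kappa> x y \<in> ring_hom (K y) (K x)"
proof -
 note i = incl[OF x y xy]
 show ?thesis
 proof (rule ring_hom_memI)
  fix a assume "a \<in> carrier (K y)"
  hence a: "arr a" "dom a = N y" "cod a = N y" by (simp_all add: Hom_def)
  note ka = kappa[OF x y xy a]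
  show "\<kappa> x y a \<in> carrier (K x)" using ka by (simp add: Hom_def)
  fix b assume "b \<in> carrier (K y)"
  hence b: "arr b" "dom b = N y" "cod b = N y" by (simp_all add: Hom_def)
  note kb = kappa[OF x y xy b]
  have "\<iota> x y ** (\<kappa> x y a ** \<kappa> x y b) = (a ** \<iota> x y) ** \<kappa> x y b"
   by (rule cmp_reduce[OF ka(4)]) (use ka(1-3) kb(1-3) i(1-3) in simp_all)
  also have "... = a ** (\<iota> x y ** \<kappa> x y b)" using a kb(1-3) i(1-3) by simp
  also have "... = (a ** b) ** \<iota> x y" unfolding kb(4) using a b i(1-3) by simp
  finally have "\<kappa> x y (a ** b) = \<kappa> x y a ** \<kappa> x y b"
   by (intro kappa_eqI[OF x y xy]) (use a b ka(1-3) kb(1-3) in simp_all)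
  thus "\<kappa> x y (a \<otimes>\<^bsub>K y\<^esub> b) = \<kappa> x y a \<otimes>\<^bsub>K x\<^esub> \<kappa> x y b" by simp
  have "\<iota> x y ** (\<kappa> x y a \<boxplus> \<kappa> x y b) = (\<iota> x y ** \<kappa> x y a) \<boxplus> (\<iota> x y ** \<kappa> x y b)"
   by (rule cmp_hadd_Ar) (use ka(1-3) kb(1-3) i(1-3) in simp_all)
  also have "... = (a \<boxplus> b) ** \<iota> x y" unfolding ka(4) kb(4) using a b i(1-3) by simp
  finally have "\<kappa> x y (a \<boxplus> b) = \<kappa> x y a \<boxplus> \<kappa> x y b"
   by (intro kappa_eqI[OF x y xy]) (use a b ka(1-3) kb(1-3) in simp_all)
  thus "\<kappa> x y (a \<oplus>\<^bsub>K y\<^esub> b) = \<kappa> x y a \<oplus>\<^bsub>K x\<^esub> \<kappa> x y b" by simp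
 next
  have "\<kappa> x y (ident C (N y)) = ident C (N x)"
   by (rule kappa_eqI[OF x y xy]) (use x y i(1-3) in simp_all)
  thus "\<kappa> x y \<one>\<^bsub>K y\<^esub> = \<one>\<^bsub>K x\<^esub>" by simp
 qed
qed

lemma partial_order_P: "partial_order P"
proof
 fix x y z
 show "x \<in> carrier P ==> x \<sqsubseteq>\<^bsub>P\<^esub> x" using le_P by simp
 show "x .=\<^bsub>P\<^esub> y" if "x \<sqsubseteq>\<^bsub>P\<^esub> y" "y \<sqsubseteq>\<^bsub>P\<^esub> x" "x \<in> carrier P" "y \<in> carrier P"
  using that le_P m_antisym by (simp add: ji_poset_def)
 show "x \<sqsubseteq>\<^bsub>P\<^esub> z" if "x \<sqsubseteq>\<^bsub>P\<^esub> y" "y \<sqsubseteq>\<^bsub>P\<^esub> z" "x \<in> carrier P" "y \<in> carrier P" "z \<in> carrier P"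
  using that le_P factors_through_trans[of "m x" "m y" "m z"] by simp
qed (simp_all add: ji_poset_def)

lemma division_ring_family: "division_ring_family P K \<kappa>"
proof (intro division_ring_family.intro division_ring_family_axioms.intro)
 show "partial_order P" by (rule partial_order_P)
 fix x y assume "x \<in> carrier P" hence x: "x \<in> \<Omega>" by simp
 show "skew_field (K x)" by (rule skew_field_K[OF x])
 assume "y \<in> carrier P" hence y: "y \<in> \<Omega>" by simp
 assume "x \<sqsubseteq>\<^bsub>P\<^esub> y" hence xy: "m x <~ m y" using le_P x y by simp
 show "\<kappa> x y \<in> ring_hom (K y) (K x)" by (rule kappa_ring_hom[OF x y xy])
 fix z a assume "z \<in> carrier P" "y \<sqsubseteq>\<^bsub>P\<^esub> z" "a \<in> carrier (K z)"
 hence z: "z \<in> \<Omega>" and yz: "m y <~ m z"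
  and a: "arr a" "dom a = N z" "cod a = N z" using le_P y by (simp_all add: Hom_def)
 have xz: "m x <~ m z" using factors_through_trans[OF xy yz] z by simp
 note kb = kappa[OF y z yz a]
 note kc = kappa[OF x y xy kb(1-3)]
 note ixy = incl[OF x y xy] and iyz = incl[OF y z yz]
 have "\<iota> x z ** \<kappa> x y (\<kappa> y z a) = \<iota> y z ** (\<iota> x y ** \<kappa> x y (\<kappa> y z a))"
  unfolding incl_trans[OF x y z xy yz, symmetric] using kc(1-3) ixy(1-3) iyz(1-3) by simp
 also have "... = (\<iota> y z ** \<kappa> y z a) ** \<iota> x y" unfolding kc(4) using kb(1-3) ixy(1-3) iyz(1-3) by simp
 also have "... = a ** (\<iota> y z ** \<iota> x y)" unfolding kb(4) using a ixy(1-3) iyz(1-3) by simp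
 also have "... = a ** \<iota> x z" by (simp only: incl_trans[OF x y z xy yz])
 finally have "\<kappa> x z a = \<kappa> x y (\<kappa> y z a)" by (rule kappa_eqI[OF x z xz a kc(1-3)])
 thus "\<kappa> x y (\<kappa> y z a) = \<kappa> x z a" by simp
qed

end

section \<open>The functor to representations\<close>

text \<open>The arrows \<open>f\<close> in \<open>Hom (M\<^sub>x, X)\<close> are encoded as constant sequences, the elements of the
 representations in \<open>pfd_Rep\<close> being sequences.\<close>

definition hom_rep ::
  "('o, 'a, 'm) preadditive_scheme => ('x => 'a) => 'o => ('x, 'a, nat => 'a) rep" where
 "hom_rep C m X = \<lparr>
  rspace = (\<lambda>x. \<lparr>carrier = const_seq ` Hom C (src C (m x)) X, mult = (\<lambda>v w. v),
   one = const_seq (hzero C (src C (m x)) X), zero = const_seq (hzero C (src C (m x)) X),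
   add = (\<lambda>v w. const_seq (v 0 \<boxplus>\<^bsub>C\<^esub> w 0)), rsmult = (\<lambda>v a. const_seq (v 0 \<bullet>\<^bsub>C\<^esub> a))\<rparr>),
  rmap = (\<lambda>x y v. const_seq (v 0 \<bullet>\<^bsub>C\<^esub> ji_incl C m x y))\<rparr>"

context poset_generators
begin

abbreviation "F \<equiv> hom_rep C m"

lemma F_simps [simp]:
 "carrier (rspace (F X) x) = const_seq ` Hom C (N x) X"
 "zero (rspace (F X) x) = const_seq (hzero C (N x) X)"
 "add (rspace (F X) x) v w = const_seq (v 0 \<boxplus> w 0)"
 "rsmult (rspace (F X) x) v a = const_seq (v 0 ** a)"
 "rmap (F X) x y v = const_seq (v 0 ** \<iota> x y)"
 by (simp_all add: hom_rep_def)

lemma F_elemE: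
 assumes "v \<in> carrier (rspace (F X) x)"
 obtains f where "arr f" "dom f = N x" "cod f = X" "v = const_seq f"
 using assms by (auto simp: Hom_def)

lemma F_elemI: "[|arr f; dom f = N x; cod f = X|] ==> const_seq f \<in> carrier (rspace (F X) x)"
 by (simp add: Hom_def)

lemma F_vector_space:
 assumes X: "X \<in> Ob C" and x: "x \<in> \<Omega>"
 shows "right_vector_space (K x) (rspace (F X) x)"
proof -
 let ?V = "rspace (F X) x"
 have N: "N x \<in> Ob C" using x by simp
 interpret K: skew_field "K x" by (rule skew_field_K[OF x])
 have "abelian_group ?V"
 proof (rule abelian_groupI)
  fix u v w assume "u \<in> carrier ?V" "v \<in> carrier ?V" "w \<in> carrier ?V"
  then obtain f g h where f: "arr f" "dom f = N x" "cod f = X" "u = const_seq f"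
   and g: "arr g" "dom g = N x" "cod g = X" "v = const_seq g"
   and h: "arr h" "dom h = N x" "cod h = X" "w = const_seq h"
   by (metis F_elemE)
  show "u \<oplus>\<^bsub>?V\<^esub> v \<in> carrier ?V" unfolding f(4) g(4) F_simps(3) const_seq_0
   by (rule F_elemI) (use f(1-3) g(1-3) in simp_all)
  show "u \<oplus>\<^bsub>?V\<^esub> v \<oplus>\<^bsub>?V\<^esub> w = u \<oplus>\<^bsub>?V\<^esub> (v \<oplus>\<^bsub>?V\<^esub> w)"
   unfolding f(4) g(4) h(4) F_simps(3) const_seq_0 const_seq_inject
   by (rule hadd_assoc) (use f(1-3) g(1-3) h(1-3) in simp_all)
  show "u \<oplus>\<^bsub>?V\<^esub> v = v \<oplus>\<^bsub>?V\<^esub> u"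
   unfolding f(4) g(4) F_simps(3) const_seq_0 const_seq_inject
   by (rule hadd_comm) (use f(1-3) g(1-3) in simp_all)
  show "\<zero>\<^bsub>?V\<^esub> \<oplus>\<^bsub>?V\<^esub> u = u"
   unfolding f(4) F_simps(2,3) const_seq_0 const_seq_inject by (rule hadd_zero(2)[OF f(1-3)])
  have "const_seq (hneg C f) \<oplus>\<^bsub>?V\<^esub> u = \<zero>\<^bsub>?V\<^esub>"
   unfolding f(4) F_simps(2,3) const_seq_0 const_seq_inject using f(1-3) by simp
  moreover have "const_seq (hneg C f) \<in> carrier ?V" by (rule F_elemI) (use f(1-3) in simp_all)
  ultimately show "\<exists>y \<in> carrier ?V. y \<oplus>\<^bsub>?V\<^esub> u = \<zero>\<^bsub>?V\<^esub>" by blast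
 next
  show "\<zero>\<^bsub>?V\<^esub> \<in> carrier ?V" unfolding F_simps(2) by (rule F_elemI) (use N X in simp_all)
 qed
 then interpret V: abelian_group ?V .
 show ?thesis
 proof
  fix v a assume "v \<in> carrier ?V" and a0: "a \<in> carrier (K x)"
  then obtain f where f: "arr f" "dom f = N x" "cod f = X" "v = const_seq f" by (metis F_elemE)
  have a: "arr a" "dom a = N x" "cod a = N x" using a0 by (simp_all add: Hom_def)
  show "v \<odot>\<^bsub>?V\<^esub> a \<in> carrier ?V" unfolding f(4) F_simps(4) const_seq_0
   by (rule F_elemI) (use f(1-3) a in simp_all)
  show "(v \<oplus>\<^bsub>?V\<^esub> w) \<odot>\<^bsub>?V\<^esub> a = (v \<odot>\<^bsub>?V\<^esub> a) \<oplus>\<^bsub>?V\<^esub> (w \<odot>\<^bsub>?V\<^esub> a)" if w: "w \<in> carrier ?V" for w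
  by (metis w F_elemE f(4) F_simps(3,4) const_seq_0 hadd_cmp_Ar f(1-3) a)
  fix b assume b0: "b \<in> carrier (K x)"
  have b: "arr b" "dom b = N x" "cod b = N x" using b0 by (simp_all add: Hom_def)
  show "v \<odot>\<^bsub>?V\<^esub> (a \<oplus>\<^bsub>K x\<^esub> b) = (v \<odot>\<^bsub>?V\<^esub> a) \<oplus>\<^bsub>?V\<^esub> (v \<odot>\<^bsub>?V\<^esub> b)"
   unfolding f(4) F_simps(3,4) const_seq_0 const_seq_inject K_simps
   by (rule cmp_hadd_Ar) (use f(1-3) a b in simp_all)
  show "v \<odot>\<^bsub>?V\<^esub> (a \<otimes>\<^bsub>K x\<^esub> b) = (v \<odot>\<^bsub>?V\<^esub> a) \<odot>\<^bsub>?V\<^esub> b"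
   unfolding f(4) F_simps(3,4) const_seq_0 const_seq_inject K_simps
   by (rule cmp_assoc_Ar[symmetric]) (use f(1-3) a b in simp_all)
 next
  fix v assume "v \<in> carrier ?V"
  then obtain f where f: "arr f" "dom f = N x" "cod f = X" "v = const_seq f" by (metis F_elemE)
  show "v \<odot>\<^bsub>?V\<^esub> \<one>\<^bsub>K x\<^esub> = v"
   unfolding f(4) F_simps(3,4) const_seq_0 const_seq_inject K_simps by (rule cmp_ident_Ar[OF f(1,2)])
 qed
qed

text \<open>An arrow from a generator into the image \<open>w\<close> of \<open>w ** p\<close>
  already factors through \<open>w ** p\<close>, by projectivity.\<close>

lemma lift_through:
 assumes x: "x \<in> \<Omega>" and f: "arr f" "dom f = N x" "f <~ w"
  and w: "arr w" and p: "epic C p" "cod p = dom w"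
 obtains s where "arr s" "dom s = N x" "cod s = dom p" "f = (w ** p) ** s"
proof -
 have pA: "arr p" using p by simp
 obtain t where t: "arr t" "dom t = dom f" "cod t = dom w" "w ** t = f"
  using f(3) by (rule factors_throughE)
 have "t <~ p" by (rule m_projective[OF x p(1) t(1)]) (use t(2,3) f(2) p(2) in simp_all)
 then obtain s where s: "arr s" "dom s = dom t" "cod s = dom p" "p ** s = t"
  by (rule factors_throughE)
 have "(w ** p) ** s = w ** (p ** s)" using s(1,3) pA p(2) w by simp
 hence "f = (w ** p) ** s" unfolding s(4) t(4) by simp
 thus ?thesis using that[of s] s(1-3) t(2) f(2) by simp
qed

text \<open>By \<open>noetherian\<close> some \<open>e\<close> with finitely many generators for the
  arrows through it has an image containing all arrows from the generator to \<open>X\<close>;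
  projectivity lifts these arrows to \<open>e\<close> itself.\<close>

lemma F_finite_dimensional:
 assumes X: "X \<in> Ob C" and x: "x \<in> \<Omega>"
 shows "finite_dimensional (K x) (rspace (F X) x)"
proof -
 let ?V = "rspace (F X) x"
 have N: "N x \<in> Ob C" using x by simp
 \<comment> \<open>The set \<open>B\<close> spans the arrows that factor through \<open>e\<close>.
   Adding an arrow \<open>f\<close> to \<open>e\<close> adds the single vector \<open>f\<close>,
   because arrows from the generator to its own domain are scalars.\<close>
 define good where "good e B \<longleftrightarrow> finite B & B \<subseteq> carrier ?V &
  (\<forall>W. subspace_of (K x) ?V W --> B \<subseteq> W -->
   (\<forall>g \<in> Ar C. dom g = N x --> cod g = dom e --> const_seq (e ** g) \<in> W))" for e B
 define Q where "Q = {e \<in> Ar C. cod e = X & (\<exists>B. good e B)}"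
 have QD: "arr e" "cod e = X" "\<exists>B. good e B" if "e \<in> Q" for e using that by (simp_all add: Q_def)
 have QI: "e \<in> Q" if "arr e" "cod e = X" "good e B" for e B unfolding Q_def using that by (metis (mono_tags, lifting) mem_Collect_eq)
 have zero: "const_seq g \<in> W" if "subspace_of (K x) ?V W" "null C g" "dom g = N x" "cod g = X" for W g
  using that unfolding subspace_of_def null_def by simp
 have "hzero C X X \<in> Q"
 proof -
  have "const_seq (hzero C X X ** g) \<in> W"
   if "subspace_of (K x) ?V W" "arr g" "dom g = N x" "cod g = X" for W g
   by (rule zero[OF that(1)]) (use that X N in \<open>simp_all add: null_cmp_left\<close>)
  hence "good (hzero C X X) {}" unfolding good_def by (simp add: X)
  thus ?thesis by (rule QI[rotated 2]) (use X in simp_all)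
 qed
 hence Q0: "Q ~= {}" by (metis empty_iff)
 have dir: "\<exists>e' \<in> Q. e <~ e' & f <~ e'"
  if e: "e \<in> Q" and f: "f \<in> Hom C (N x) X" for e f
 proof -
  note eA = QD(1,2)[OF e]
  obtain B where "good e B" using QD(3)[OF e] by (rule exE)
  hence B: "finite B" "B \<subseteq> carrier ?V"
   "!!W g. [|subspace_of (K x) ?V W; B \<subseteq> W; arr g; dom g = N x; cod g = dom e|] ==> const_seq (e ** g) \<in> W"
   by (simp_all only: good_def)
  have fA: "arr f" "dom f = N x" "cod f = X" using f by (simp_all add: Hom_def)
  obtain e' where e': "arr e'" "cod e' = cod e" "e <~ e'" "f <~ e'"
   "\<forall>g. g <~ e' --> (\<exists>u \<in> Ar C. \<exists>v \<in> Ar C. dom u = dom g & dom v = dom g &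
    cod u = dom e & cod v = dom f & g = (e ** u) \<boxplus> (f ** v))"
   by (rule sumE[OF eA(1) fA(1)]) (use eA fA in simp)
  have "const_seq (e' ** g) \<in> W"
   if W: "subspace_of (K x) ?V W" "insert (const_seq f) B \<subseteq> W" and g: "arr g" "dom g = N x" "cod g = dom e'" for W g
  proof -
   have "e' ** g <~ e'" by (rule factors_through_cmp[OF e'(1) g(1,3)])
   then obtain u v where uv: "arr u" "arr v" "dom u = dom (e' ** g)" "dom v = dom (e' ** g)"
    "cod u = dom e" "cod v = dom f" "e' ** g = (e ** u) \<boxplus> (f ** v)" using e'(5) by blast
   have s: "dom u = N x" "dom v = N x" using uv(3,4) e'(1) g by simp_all
   have 1: "const_seq (e ** u) \<in> W" by (rule B(3)[OF W(1) _ uv(1) s(1) uv(5)]) (use W(2) in blast)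
   have "v \<in> carrier (K x)" using uv(2,6) s(2) fA(2) by (simp add: Hom_def)
   hence "const_seq f \<odot>\<^bsub>?V\<^esub> v \<in> W" using W unfolding subspace_of_def by blast
   hence "const_seq (e ** u) \<oplus>\<^bsub>?V\<^esub> (const_seq f \<odot>\<^bsub>?V\<^esub> v) \<in> W"
    using W(1) 1 unfolding subspace_of_def by blast
   thus ?thesis unfolding uv(7) F_simps const_seq_0 .
  qed
  moreover have "const_seq f \<in> carrier ?V" by (rule F_elemI[OF fA])
  ultimately have "good e' (insert (const_seq f) B)" unfolding good_def using B(1,2)
   by (simp only: finite_insert insert_subset) simp
  hence "e' \<in> Q" using QI[OF e'(1)] e'(2) eA(2) by (simp only:)
  thus ?thesis using e'(3,4) by (rule_tac bexI[of _ e']) simp_all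
 qed
 obtain w p where w: "w ** p \<in> Q" "monic C w" "epic C p" "cod p = dom w" "cod w = X"
  and le: "!!f. f \<in> Hom C (N x) X ==> f <~ w"
  by (rule noetherian[OF X Q0 conjI[OF QD(1,2)] dir]) (assumption | rule that)+
 obtain B where "good (w ** p) B" using QD(3)[OF w(1)] by (rule exE)
 hence B: "finite B" "B \<subseteq> carrier ?V"
   "!!W g. [|subspace_of (K x) ?V W; B \<subseteq> W; arr g; dom g = N x; cod g = dom (w ** p)|] ==> const_seq ((w ** p) ** g) \<in> W"
  by (simp_all only: good_def)
 have wA: "arr w" "arr p" using w by auto
 have "generates (K x) ?V B"
  unfolding generates_def
 proof (intro conjI allI impI)
  fix W assume W: "subspace_of (K x) ?V W" "B \<subseteq> W"
  have "v \<in> W" if v: "v \<in> carrier ?V" for v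
  proof -
   obtain f where f: "arr f" "dom f = N x" "cod f = X" "v = const_seq f" using v by (rule F_elemE)
   have "f <~ w" using le f by (simp add: Hom_def)
   then obtain s where s: "arr s" "dom s = N x" "cod s = dom p" "f = (w ** p) ** s"
    by (rule lift_through[OF x f(1,2) _ wA(1) w(3,4)])
   have "dom (w ** p) = dom p" using wA w(4) by simp
   thus ?thesis unfolding f(4) s(4) using B(3)[OF W s(1,2)] s(3) by simp
  qed
  thus "W = carrier ?V" using W(1) unfolding subspace_of_def by blast
 qed (use B in auto)
 thus ?thesis by (rule right_vector_space.generates_finite_dimensional[OF F_vector_space[OF X x]])
qed

lemma F_pfd:
 assumes X: "X \<in> Ob C" shows "is_pfd_rep P K \<kappa> (F X)"
proof (rule pfd_repI)
 fix x assume "x \<in> carrier P" hence x: "x \<in> \<Omega>" by simp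
 show "right_vector_space (K x) (rspace (F X) x)" by (rule F_vector_space[OF X x])
 show "finite_dimensional (K x) (rspace (F X) x)" by (rule F_finite_dimensional[OF X x])
 show "rmap (F X) x x v = v" if v: "v \<in> carrier (rspace (F X) x)" for v
 by (metis v F_elemE F_simps const_seq_0 incl_refl x cmp_ident_Ar)
 fix y assume "y \<in> carrier P" "x \<sqsubseteq>\<^bsub>P\<^esub> y"
 hence y: "y \<in> \<Omega>" and xy: "m x <~ m y" using x le_P by simp_all
 note i = incl[OF x y xy]
 show "rmap (F X) x z v = rmap (F X) x y (rmap (F X) y z v)"
  if "z \<in> carrier P" "y \<sqsubseteq>\<^bsub>P\<^esub> z" and v: "v \<in> carrier (rspace (F X) z)" for z v
 proof -
  have z: "z \<in> \<Omega>" and yz: "m y <~ m z" using that(1,2) y le_P by simp_all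
  obtain f where f: "arr f" "dom f = N z" "cod f = X" "v = const_seq f" using v by (rule F_elemE)
  note j = incl[OF y z yz]
  have "f ** (\<iota> y z ** \<iota> x y) = (f ** \<iota> y z) ** \<iota> x y" using f(1-3) i(1-3) j(1-3) by simp
  thus ?thesis unfolding f(4) F_simps const_seq_0 const_seq_inject incl_trans[OF x y z xy yz] .
 qed
 fix v assume v: "v \<in> carrier (rspace (F X) y)"
 obtain f where f: "arr f" "dom f = N y" "cod f = X" "v = const_seq f" using v by (rule F_elemE)
 show "rmap (F X) x y v \<in> carrier (rspace (F X) x)"
  unfolding f(4) F_simps(5) const_seq_0 by (rule F_elemI) (use f(1-3) i(1-3) in simp_all)
 show "rmap (F X) x y (v \<oplus>\<^bsub>rspace (F X) y\<^esub> w) = rmap (F X) x y v \<oplus>\<^bsub>rspace (F X) x\<^esub> rmap (F X) x y w"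
  if w: "w \<in> carrier (rspace (F X) y)" for w
 by (metis w F_elemE f(4) F_simps const_seq_0 hadd_cmp_Ar f(1-3) i(1-3))
 show "rmap (F X) x y (v \<odot>\<^bsub>rspace (F X) y\<^esub> a) = rmap (F X) x y v \<odot>\<^bsub>rspace (F X) x\<^esub> \<kappa> x y a"
  if a: "a \<in> carrier (K y)" for a
 proof -
  have aA: "arr a" "dom a = N y" "cod a = N y" using a by (simp_all add: Hom_def)
  note k = kappa[OF x y xy aA]
  have "(f ** a) ** \<iota> x y = f ** (a ** \<iota> x y)" using f(1-3) i(1-3) aA by simp
  also have "... = f ** (\<iota> x y ** \<kappa> x y a)" by (simp only: k(4))
  also have "... = (f ** \<iota> x y) ** \<kappa> x y a" using f(1-3) i(1-3) k(1-3) by simp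
  finally show ?thesis unfolding f(4) F_simps const_seq_0 const_seq_inject .
 qed
qed

definition Farr :: "'a => ('x, 'a, nat => 'a) rep_arrow" where
 "Farr f = (F (dom f), (\<lambda>x \<in> \<Omega>. \<lambda>v \<in> carrier (rspace (F (dom f)) x). const_seq (f ** v 0)), F (cod f))"

lemma Farr_rep_hom:
 assumes f: "arr f" "dom f = X" "cod f = Y"
 shows "(\<lambda>x \<in> \<Omega>. \<lambda>v \<in> carrier (rspace (F X) x). const_seq (f ** v 0)) \<in> rep_hom P K (F X) (F Y)" (is "?f \<in> _")
proof -
 have X: "X \<in> Ob C" using f by auto
 have ev: "?f x v = const_seq (f ** v 0)" if "x \<in> \<Omega>" "v \<in> carrier (rspace (F X) x)" for x v
  using that by (simp only: restrict_apply')
 note pfd = F_pfd[OF X]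
 show ?thesis
 proof (rule rep_homI)
  show "?f \<in> extensional (carrier P)" by simp
  fix x assume "x \<in> carrier P" hence x: "x \<in> \<Omega>" by simp
  interpret V: right_vector_space "K x" "rspace (F X) x" by (rule F_vector_space[OF X x])
  show "?f x \<in> extensional (carrier (rspace (F X) x))" using x by (simp only: restrict_apply' restrict_extensional)
  fix v assume v: "v \<in> carrier (rspace (F X) x)"
  obtain g where g: "arr g" "dom g = N x" "cod g = X" "v = const_seq g" using v by (rule F_elemE)
  show "?f x v \<in> carrier (rspace (F Y) x)"
   unfolding ev[OF x v] unfolding g(4) const_seq_0 by (rule F_elemI) (use f g(1-3) in simp_all)
  show "?f x (v \<oplus>\<^bsub>rspace (F X) x\<^esub> w) = ?f x v \<oplus>\<^bsub>rspace (F Y) x\<^esub> ?f x w" if w: "w \<in> carrier (rspace (F X) x)" for w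
  proof -
   obtain h where h: "arr h" "dom h = N x" "cod h = X" "w = const_seq h" using w by (rule F_elemE)
   show ?thesis
    unfolding ev[OF x v] ev[OF x w] ev[OF x V.V.a_closed[OF v w]]
    unfolding g(4) h(4) F_simps const_seq_0 const_seq_inject
    by (rule cmp_hadd_Ar) (use f g(1-3) h(1-3) in simp_all)
  qed
  show "?f x (v \<odot>\<^bsub>rspace (F X) x\<^esub> a) = ?f x v \<odot>\<^bsub>rspace (F Y) x\<^esub> a" if a: "a \<in> carrier (K x)" for a
  proof -
   have aA: "arr a" "dom a = N x" "cod a = N x" using a by (simp_all add: Hom_def)
   show ?thesis
    unfolding ev[OF x v] ev[OF x V.rsmult_closed[OF v a]]
    unfolding g(4) F_simps const_seq_0 const_seq_inject
    by (rule cmp_assoc_Ar[symmetric]) (use f g(1-3) aA in simp_all)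
  qed
 next
  fix x y v assume xy0: "x \<in> carrier P" "y \<in> carrier P" "x \<sqsubseteq>\<^bsub>P\<^esub> y" and v: "v \<in> carrier (rspace (F X) y)"
  have x: "x \<in> \<Omega>" and y: "y \<in> \<Omega>" and xy: "m x <~ m y" using xy0 le_P by simp_all
  note i = incl[OF x y xy]
  obtain g where g: "arr g" "dom g = N y" "cod g = X" "v = const_seq g" using v by (rule F_elemE)
  show "?f x (rmap (F X) x y v) = rmap (F Y) x y (?f y v)"
   unfolding ev[OF y v] ev[OF x rmap_closed[OF pfd xy0 v]]
   unfolding g(4) F_simps const_seq_0 const_seq_inject
   by (rule cmp_assoc_Ar[symmetric]) (use f g(1-3) i(1-3) in simp_all)
 qed
qed

lemma Farr_eq:
 assumes "f \<in> Hom C X Y"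
 shows "Farr f = (F X, (\<lambda>x \<in> \<Omega>. \<lambda>v \<in> carrier (rspace (F X) x). const_seq (f ** v 0)), F Y)"
proof -
 have "dom f = X" "cod f = Y" using assms unfolding Hom_def by blast+
 thus ?thesis unfolding Farr_def by (simp only:)
qed

lemma F_functor: "cat_functor C (pfd_Rep P K \<kappa>) F Farr"
proof -
 interpret R: category "Rep_category P K \<kappa> :: (('x, 'a, nat => 'a) rep, ('x, 'a, nat => 'a) rep_arrow) category"
  by (rule category_Rep)
 show ?thesis unfolding pfd_Rep_def
 proof (intro cat_functor.intro cat_functor_axioms.intro)
  show "category C" by unfold_locales
  show "category (Rep_category P K \<kappa> :: (('x, 'a, nat => 'a) rep, ('x, 'a, nat => 'a) rep_arrow) category)"
   by (rule category_Rep)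
  fix X assume X: "X \<in> Ob C"
  show "F X \<in> Ob (Rep_category P K \<kappa>)" unfolding Ob_Rep_iff by (rule F_pfd[OF X])
  have i: "ident C X \<in> Hom C X X" by (rule ident_Hom[OF X])
  have "const_seq (ident C X ** v 0) = v" if v: "v \<in> carrier (rspace (F X) x)" for x v
  by (metis v F_elemE const_seq_0 ident_cmp_Ar)
  hence "(\<lambda>x \<in> \<Omega>. \<lambda>v \<in> carrier (rspace (F X) x). const_seq (ident C X ** v 0)) = (\<lambda>x \<in> \<Omega>. \<lambda>v \<in> carrier (rspace (F X) x). v)"
   by (intro restrict_ext) blast
  thus "Farr (ident C X) = ident (Rep_category P K \<kappa>) (F X)"
   unfolding Farr_eq[OF i] ident_Rep carrier_P by simp
 next
  fix f X Y assume f: "f \<in> Hom C X Y"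
  have fA: "arr f" "dom f = X" "cod f = Y" using f by (simp_all add: Hom_def)
  have XY: "X \<in> Ob C" "Y \<in> Ob C" using fA by auto
  show "Farr f \<in> Hom (Rep_category P K \<kappa>) (F X) (F Y)"
   unfolding Farr_eq[OF f] Hom_Rep_iff using Farr_rep_hom[OF fA] F_pfd[OF XY(1)] F_pfd[OF XY(2)] by blast
  fix g Z assume g: "g \<in> Hom C Y Z"
  have gA: "arr g" "dom g = Y" "cod g = Z" using g by (simp_all add: Hom_def)
  have "(\<lambda>v \<in> carrier (rspace (F X) x). const_seq ((g ** f) ** v 0)) =
    compose (carrier (rspace (F X) x)) (\<lambda>v \<in> carrier (rspace (F Y) x). const_seq (g ** v 0))
     (\<lambda>v \<in> carrier (rspace (F X) x). const_seq (f ** v 0))" for x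
   unfolding compose_def
  proof (rule restrict_ext)
   fix v assume v: "v \<in> carrier (rspace (F X) x)"
   obtain h where h: "arr h" "dom h = N x" "cod h = X" "v = const_seq h" using v by (rule F_elemE)
   have "const_seq (f ** v 0) \<in> carrier (rspace (F Y) x)"
    unfolding h(4) const_seq_0 by (rule F_elemI) (use fA h(1-3) in simp_all)
   hence "(\<lambda>v \<in> carrier (rspace (F Y) x). const_seq (g ** v 0)) ((\<lambda>v \<in> carrier (rspace (F X) x). const_seq (f ** v 0)) v) =
     const_seq (g ** (f ** v 0))" using v by (simp only: restrict_apply' const_seq_0)
   also have "g ** (f ** v 0) = (g ** f) ** v 0"
    unfolding h(4) const_seq_0 by (rule cmp_assoc_Ar[symmetric]) (use fA gA h(1-3) in simp_all)
   finally show "const_seq ((g ** f) ** v 0) = (\<lambda>v \<in> carrier (rspace (F Y) x). const_seq (g ** v 0)) ((\<lambda>v \<in> carrier (rspace (F X) x). const_seq (f ** v 0)) v)"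
    by simp
  qed
  thus "Farr (g ** f) = cmp (Rep_category P K \<kappa>) (Farr g) (Farr f)"
   unfolding Farr_eq[OF f] Farr_eq[OF g] Farr_eq[OF cmp_Hom[OF f g]] cmp_Rep carrier_P prod.inject
   by (intro conjI refl restrict_ext) (simp only: restrict_apply')
 qed
qed

lemma F_faithful:
 assumes f: "f \<in> Hom C X Y" and g: "g \<in> Hom C X Y" and eq: "Farr f = Farr g"
 shows "f = g"
proof (rule ccontr)
 have fA: "arr f" "dom f = X" "cod f = Y" "arr g" "dom g = X" "cod g = Y"
  using f g by (simp_all add: Hom_def)
 assume "f ~= g"
 hence nn: "~ null C (f \<boxplus> hneg C g)" using null_diff_iff[of f g] fA by simp
 have d: "arr (f \<boxplus> hneg C g)" "dom (f \<boxplus> hneg C g) = X" using fA by simp_all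
 obtain x h where x: "x \<in> \<Omega>" and h: "arr h" "dom h = N x" "cod h = dom (f \<boxplus> hneg C g)"
  "~ null C ((f \<boxplus> hneg C g) ** h)" using m_generate[OF d(1) nn] by blast
 have ht: "cod h = X" using h(3) d(2) by simp
 have v: "const_seq h \<in> carrier (rspace (F X) x)" by (rule F_elemI[OF h(1,2) ht])
 have "(\<lambda>x \<in> \<Omega>. \<lambda>v \<in> carrier (rspace (F X) x). const_seq (f ** v 0)) x (const_seq h) =
   (\<lambda>x \<in> \<Omega>. \<lambda>v \<in> carrier (rspace (F X) x). const_seq (g ** v 0)) x (const_seq h)"
  using eq unfolding Farr_eq[OF f] Farr_eq[OF g] prod.inject by (simp only:)
 hence "f ** h = g ** h" using x v by (simp only: restrict_apply' const_seq_0 const_seq_inject)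
 hence "null C ((f ** h) \<boxplus> hneg C (g ** h))"
  using null_diff_iff[of "f ** h" "g ** h"] fA h(1,2) ht by simp
 thus False using h(4) fA h(1,2) ht by simp
qed

text \<open>The arrow is first constructed on a cover. Among the arrows \<open>e\<close> into
  \<open>X\<close> along which \<open>\<theta>\<close> is induced by some \<open>h\<close> there is
  an epic one, and its \<open>h\<close> descends along \<open>e\<close> to the required
  arrow.\<close>

lemma F_full:
 assumes X: "X \<in> Ob C" and Y: "Y \<in> Ob C" and \<theta>: "\<theta> \<in> rep_hom P K (F X) (F Y)"
 shows "\<exists>f \<in> Hom C X Y. Farr f = (F X, \<theta>, F Y)"
proof -
 define \<tau> where "\<tau> x f = \<theta> x (const_seq f) 0" for x f
 have \<tau>: "arr (\<tau> x f)" "dom (\<tau> x f) = N x" "cod (\<tau> x f) = Y" "\<theta> x (const_seq f) = const_seq (\<tau> x f)"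
  if x: "x \<in> \<Omega>" and f: "arr f" "dom f = N x" "cod f = X" for x f
 proof -
  have "\<theta> x (const_seq f) \<in> carrier (rspace (F Y) x)"
   using rep_homD(3)[OF \<theta>, of x] x F_elemI[OF f] by simp
  then obtain g where g: "arr g" "dom g = N x" "cod g = Y" "\<theta> x (const_seq f) = const_seq g" by (rule F_elemE)
  thus "arr (\<tau> x f)" "dom (\<tau> x f) = N x" "cod (\<tau> x f) = Y" "\<theta> x (const_seq f) = const_seq (\<tau> x f)"
   using g(1-3) unfolding \<tau>_def g(4) const_seq_0 by simp_all
 qed
 have \<tau>_add: "\<tau> x (f \<boxplus> g) = \<tau> x f \<boxplus> \<tau> x g"
  if x: "x \<in> \<Omega>" and f: "arr f" "dom f = N x" "cod f = X" and g: "arr g" "dom g = N x" "cod g = X" for x f g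
 proof -
  have "x \<in> carrier P" using x by simp
  from rep_homD(4)[OF \<theta> this F_elemI[OF f] F_elemI[OF g]]
  have "\<theta> x (const_seq (f \<boxplus> g)) = const_seq (\<tau> x f \<boxplus> \<tau> x g)"
   unfolding F_simps(3) const_seq_0 \<tau>(4)[OF x f] \<tau>(4)[OF x g] .
  thus ?thesis unfolding \<tau>_def[of x "f \<boxplus> g"] by simp
 qed
 have \<tau>_zero: "null C (\<tau> x f)" if x: "x \<in> \<Omega>" and f: "arr f" "dom f = N x" "cod f = X" "null C f" for x f
 proof -
  have "f \<boxplus> f = f" using f by (simp add: null_def)
  hence "\<tau> x f = \<tau> x f \<boxplus> \<tau> x f" using \<tau>_add[OF x f(1-3) f(1-3)] by simp
  thus ?thesis using hadd_self_zero[of "\<tau> x f"] \<tau>(1)[OF x f(1-3)] unfolding null_def by simp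
 qed
 \<comment> \<open>A morphism of representations respects scalars and inclusions only; as every
   nonzero arrow between generators is an inclusion after a scalar, it respects all of them.\<close>
 have \<tau>_cmp: "\<tau> x (f ** a) = \<tau> y f ** a"
  if x: "x \<in> \<Omega>" and y: "y \<in> \<Omega>" and f: "arr f" "dom f = N y" "cod f = X"
   and a: "arr a" "dom a = N x" "cod a = N y" for x y f a
 proof (cases "null C a")
  case True
  have "null C (f ** a)" by (rule null_cmp_right[OF True]) (use f a in simp_all)
  hence "null C (\<tau> x (f ** a))" by (intro \<tau>_zero[OF x]) (use f a in simp_all)
  moreover have "null C (\<tau> y f ** a)" by (rule null_cmp_right[OF True]) (use \<tau>[OF y f] a in simp_all)
  ultimately show ?thesis
   by (rule null_eqI) (use \<tau>(1-3)[OF y f] \<tau>(2,3)[OF x, of "f ** a"] f a in simp_all)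
 next
  case False
  have xy: "m x <~ m y" by (rule hom_le[OF x y a False])
  note i = incl[OF x y xy]
  obtain \<alpha> where \<alpha>: "arr \<alpha>" "dom \<alpha> = N x" "cod \<alpha> = N x" "a = \<iota> x y ** \<alpha>"
   by (rule hom_through_incl[OF x y xy a])
  have xP: "x \<in> carrier P" "y \<in> carrier P" "x \<sqsubseteq>\<^bsub>P\<^esub> y" using x y xy le_P by simp_all
  have fi: "arr (f ** \<iota> x y)" "dom (f ** \<iota> x y) = N x" "cod (f ** \<iota> x y) = X" using f i(1-3) by simp_all
  have aK: "\<alpha> \<in> carrier (K x)" using \<alpha>(1-3) by (simp add: Hom_def)
  from rep_homD(6)[OF \<theta> xP F_elemI[OF f]]
  have 1: "\<tau> x (f ** \<iota> x y) = \<tau> y f ** \<iota> x y"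
   unfolding F_simps(5) const_seq_0 \<tau>(4)[OF y f] \<tau>(4)[OF x fi] const_seq_inject .
  from rep_homD(5)[OF \<theta> xP(1) F_elemI[OF fi] aK]
  have "\<theta> x (const_seq ((f ** \<iota> x y) ** \<alpha>)) = const_seq (\<tau> x (f ** \<iota> x y) ** \<alpha>)"
   unfolding F_simps(4) const_seq_0 \<tau>(4)[OF x fi] .
  hence "\<tau> x ((f ** \<iota> x y) ** \<alpha>) = (\<tau> y f ** \<iota> x y) ** \<alpha>" unfolding \<tau>_def[of x "(f ** \<iota> x y) ** \<alpha>"] 1 by simp
  moreover have "(f ** \<iota> x y) ** \<alpha> = f ** a" unfolding \<alpha>(4) using f i(1-3) \<alpha>(1-3) by simp
  moreover have "(\<tau> y f ** \<iota> x y) ** \<alpha> = \<tau> y f ** a" unfolding \<alpha>(4) using \<tau>(1-3)[OF y f] i(1-3) \<alpha>(1-3) by simp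
  ultimately show ?thesis by simp
 qed
 \<comment> \<open>For a sum of \<open>e\<close> and an arrow \<open>f\<close> from generator y, the
   new \<open>h\<close> has the components \<open>h\<close> and \<open>\<tau> y f\<close>, so
   \<open>Q\<close> is closed under adding generators.\<close>
 define Q where "Q = {e \<in> Ar C. cod e = X & (\<exists>h \<in> Ar C. dom h = dom e & cod h = Y &
  (\<forall>x \<in> \<Omega>. \<forall>g \<in> Ar C. dom g = N x --> cod g = dom e --> \<tau> x (e ** g) = h ** g))}"
 define \<Phi> where "\<Phi> = {f \<in> Ar C. cod f = X & (\<exists>x \<in> \<Omega>. dom f = N x)}"
 have "hzero C X X \<in> Q"
 proof -
  have "\<tau> x (hzero C X X ** g) = hzero C X Y ** g" if x: "x \<in> \<Omega>" and g: "arr g" "dom g = N x" "cod g = X" for x g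
  by (simp add: null_eqI X g N_Ob x null_cmp_left \<tau>_zero Y \<tau>(2,3))
  thus ?thesis unfolding Q_def using X Y by (intro CollectI conjI bexI[of _ "hzero C X Y"]) simp_all
 qed
 hence Q0: "Q ~= {}" by (metis empty_iff)
 have dir: "\<exists>e' \<in> Q. e <~ e' & f <~ e'" if e: "e \<in> Q" and f: "f \<in> \<Phi>" for e f
 proof -
  obtain h where eA: "arr e" "cod e = X" and h: "arr h" "dom h = dom e" "cod h = Y"
   "!!x g. [|x \<in> \<Omega>; arr g; dom g = N x; cod g = dom e|] ==> \<tau> x (e ** g) = h ** g"
   using e unfolding Q_def by blast
  obtain y where y: "y \<in> \<Omega>" and fA: "arr f" "dom f = N y" "cod f = X"
   using f unfolding \<Phi>_def by blast
  have oe: "dom e \<in> Ob C" using eA by simp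
  obtain D i1 i2 p1 p2 where D: "is_biproduct C (dom e) (N y) D i1 i2 p1 p2"
   using biproduct_exists[OF oe N_Ob[OF y]] by blast
  note DD = is_biproductD[OF D]
  note t = \<tau>[OF y fA]
  define e' where "e' = (e ** p1) \<boxplus> (f ** p2)"
  define h' where "h' = (h ** p1) \<boxplus> (\<tau> y f ** p2)"
  have e'A: "arr e'" "dom e' = D" "cod e' = X" unfolding e'_def using DD(1-13) eA fA by simp_all
  have h'A: "arr h'" "dom h' = D" "cod h' = Y" unfolding h'_def using DD(1-13) h(1-3) t(1-3) by simp_all
  have "e' ** i1 = e" "e' ** i2 = f" unfolding e'_def using DD(1-17) eA fA oe N_Ob[OF y] X by simp_all
  hence fac: "e <~ e'" "f <~ e'"
   using factors_throughI[of i1 e e'] factors_throughI[of i2 f e'] DD(1-13) e'A fA by simp_all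
  have "\<tau> x (e' ** g) = h' ** g" if x: "x \<in> \<Omega>" and g: "arr g" "dom g = N x" "cod g = D" for x g
  proof -
   have g1: "arr (p1 ** g)" "dom (p1 ** g) = N x" "cod (p1 ** g) = dom e"
    and g2: "arr (p2 ** g)" "dom (p2 ** g) = N x" "cod (p2 ** g) = N y"
    using g DD(1-13) by simp_all
   have eg: "arr (e ** (p1 ** g))" "dom (e ** (p1 ** g)) = N x" "cod (e ** (p1 ** g)) = X"
    using g1 eA by simp_all
   have fg: "arr (f ** (p2 ** g))" "dom (f ** (p2 ** g)) = N x" "cod (f ** (p2 ** g)) = X"
    using g2 fA by simp_all
   have "e' ** g = (e ** (p1 ** g)) \<boxplus> (f ** (p2 ** g))"
    unfolding e'_def using DD(1-13) eA fA g by simp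
   hence "\<tau> x (e' ** g) = \<tau> x (e ** (p1 ** g)) \<boxplus> \<tau> x (f ** (p2 ** g))"
    using \<tau>_add[OF x eg fg] by simp
   also have "... = (h ** (p1 ** g)) \<boxplus> (\<tau> y f ** (p2 ** g))"
    unfolding h(4)[OF x g1] \<tau>_cmp[OF x y fA g2] ..
   also have "... = h' ** g" unfolding h'_def using DD(1-13) h(1-3) t(1-3) g by simp
   finally show ?thesis .
  qed
  hence "e' \<in> Q" unfolding Q_def using e'A h'A by (intro CollectI conjI bexI[of _ h']) simp_all
  thus ?thesis using fac by blast
 qed
 obtain w p where w: "w ** p \<in> Q" "monic C w" "epic C p" "cod p = dom w" "cod w = X"
  and le: "!!f. f \<in> \<Phi> ==> f <~ w"
  using noetherian[OF X Q0 _ dir] unfolding Q_def by blast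
 have we: "epic C w" by (rule generated[OF w(2,5)]) (rule le, auto simp: \<Phi>_def)
 define e where "e = w ** p"
 have e: "epic C e" unfolding e_def by (rule epic_cmp[OF we w(3,4)])
 obtain h where eA: "arr e" "cod e = X" and h: "arr h" "dom h = dom e" "cod h = Y"
  "!!x g. [|x \<in> \<Omega>; arr g; dom g = N x; cod g = dom e|] ==> \<tau> x (e ** g) = h ** g"
  using w(1) unfolding Q_def e_def by blast
 obtain k where k: "ses C k e" using epic_ses[OF e] .
 note kD = sesD[OF k]
 have kA: "arr k" "cod k = dom e" using kD by auto
 \<comment> \<open>A generator that detects \<open>h ** k\<close> through \<open>g\<close> would
   give an arrow \<open>e ** (k ** g)\<close>, which is zero, but whose value under
   \<open>\<tau>\<close> is the nonzero \<open>h ** (k ** g)\<close>.\<close>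
 have "null C (h ** k)"
 proof (rule ccontr)
  assume nn: "~ null C (h ** k)"
  have hk: "arr (h ** k)" "dom (h ** k) = dom k" using h(1,2) kA by simp_all
  obtain x g where x: "x \<in> \<Omega>" and g: "arr g" "dom g = N x" "cod g = dom (h ** k)" "~ null C ((h ** k) ** g)"
   using m_generate[OF hk(1) nn] by blast
  have gt: "cod g = dom k" using g(3) hk(2) by simp
  have kg: "arr (k ** g)" "dom (k ** g) = N x" "cod (k ** g) = dom e" using kA g(1,2) gt by simp_all
  have "null C ((e ** k) ** g)" by (rule null_cmp_left[OF kD(4)]) (use eA kA g(1) gt in simp_all)
  hence n: "null C (e ** (k ** g))" using eA kA g(1) gt by simp
  have "null C (\<tau> x (e ** (k ** g)))" by (rule \<tau>_zero[OF x _ _ _ n]) (use kg eA in simp_all)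
  hence "null C (h ** (k ** g))" unfolding h(4)[OF x kg] .
  thus False using g(4) h(1,2) kA g(1) gt by simp
 qed
 then obtain f where f: "arr f" "dom f = cod e" "cod f = cod h" "f ** e = h"
  by (rule ses_over[OF k h(1,2)])
 have fX: "dom f = X" "cod f = Y" using f(2,3) eA h(3) by simp_all
 have fH: "f \<in> Hom C X Y" using f(1) fX by (simp add: Hom_def)
 have "(\<lambda>x \<in> \<Omega>. \<lambda>v \<in> carrier (rspace (F X) x). const_seq (f ** v 0)) = \<theta>"
 proof (rule rep_hom_eqI[OF Farr_rep_hom[OF f(1) fX] \<theta>])
  fix x v assume "x \<in> carrier P" and v: "v \<in> carrier (rspace (F X) x)"
  hence x: "x \<in> \<Omega>" by simp
  obtain g where g: "arr g" "dom g = N x" "cod g = X" "v = const_seq g" using v by (rule F_elemE)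
  have "g <~ e" by (rule m_projective[OF x e g(1,2)]) (use g(3) eA in simp)
  then obtain s where s: "arr s" "dom s = dom g" "cod s = dom e" "e ** s = g" by (rule factors_throughE)
  have sN: "dom s = N x" using s(2) g(2) by simp
  have "\<tau> x (e ** s) = h ** s" by (rule h(4)[OF x s(1) sN s(3)])
  also have "... = f ** (e ** s)" unfolding f(4)[symmetric] using f(1,2) s(1,3) eA by simp
  finally have "\<tau> x g = f ** g" unfolding s(4) .
  hence "\<theta> x v = const_seq (f ** v 0)" unfolding g(4) const_seq_0 \<tau>(4)[OF x g(1-3)] by simp
  thus "(\<lambda>x \<in> \<Omega>. \<lambda>v \<in> carrier (rspace (F X) x). const_seq (f ** v 0)) x v = \<theta> x v"
   using x v by (simp only: restrict_apply')
 qed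
 hence "Farr f = (F X, \<theta>, F Y)" unfolding Farr_eq[OF fH] by simp
 thus ?thesis using fH by blast
qed

end

section \<open>Density\<close>

lemma rmap_zero:
 assumes R: "is_pfd_rep P K \<kappa> R" and xy: "x \<in> carrier P" "y \<in> carrier P" "x \<sqsubseteq>\<^bsub>P\<^esub> y"
 shows "rmap R x y \<zero>\<^bsub>rspace R y\<^esub> = \<zero>\<^bsub>rspace R x\<^esub>"
proof -
 have z: "\<zero>\<^bsub>rspace R y\<^esub> \<in> carrier (rspace R y)"
  "\<zero>\<^bsub>rspace R y\<^esub> \<oplus>\<^bsub>rspace R y\<^esub> \<zero>\<^bsub>rspace R y\<^esub> = \<zero>\<^bsub>rspace R y\<^esub>"
 proof -
  interpret V: right_vector_space "K y" "rspace R y" by (rule pfd_repD(1)[OF R xy(2)])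
  show "\<zero>\<^bsub>rspace R y\<^esub> \<in> carrier (rspace R y)" by (rule V.V.zero_closed)
  thus "\<zero>\<^bsub>rspace R y\<^esub> \<oplus>\<^bsub>rspace R y\<^esub> \<zero>\<^bsub>rspace R y\<^esub> = \<zero>\<^bsub>rspace R y\<^esub>" by (rule V.V.l_zero)
 qed
 have c: "rmap R x y \<zero>\<^bsub>rspace R y\<^esub> \<in> carrier (rspace R x)" by (rule rmap_closed[OF R xy z(1)])
 have e: "rmap R x y \<zero>\<^bsub>rspace R y\<^esub> = rmap R x y \<zero>\<^bsub>rspace R y\<^esub> \<oplus>\<^bsub>rspace R x\<^esub> rmap R x y \<zero>\<^bsub>rspace R y\<^esub>"
  using pfd_repD(5)[OF R xy z(1) z(1)] unfolding z(2) .
 interpret V: abelian_group "rspace R x" using pfd_repD(1)[OF R xy(1)] by (simp add: right_vector_space_def)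
 show ?thesis using V.add.r_cancel_one[OF c c] e by simp
qed

context poset_generators
begin

text \<open>The sum of all \<open>m x\<close> over \<open>\<Psi>\<close> is reached by finitely many
  of them. Each \<open>m x\<close> then lifts to this finite sum with a nonzero component, which is
  an arrow between generators and so puts x below one of the finitely many.\<close>

lemma finite_covering:
 assumes S: "\<Psi> \<subseteq> \<Omega>"
 obtains G where "finite G" "G \<subseteq> \<Psi>" "!!x. x \<in> \<Psi> ==> \<exists>y \<in> G. m x <~ m y"
proof -
 define good where "good e G \<longleftrightarrow> finite G & G \<subseteq> \<Psi> & (\<forall>x \<in> \<Omega>. \<forall>g \<in> Ar C.
  dom g = N x --> cod g = dom e --> ~ null C (e ** g) --> (\<exists>y \<in> G. m x <~ m y))" for e G
 define Q where "Q = {e \<in> Ar C. cod e = M & (\<exists>G. good e G)}"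
 have QD: "arr e" "cod e = M" "\<exists>G. good e G" if "e \<in> Q" for e using that by (simp_all add: Q_def)
 have QI: "e \<in> Q" if "arr e" "cod e = M" "good e G" for e G unfolding Q_def using that by (metis (mono_tags, lifting) mem_Collect_eq)
 have "hzero C M M \<in> Q"
 proof -
  have "null C (hzero C M M ** g)" if "arr g" "cod g = M" for g
   by (rule null_cmp_left) (use that M_Ob in simp_all)
  hence "good (hzero C M M) {}" unfolding good_def by (simp add: M_Ob)
  thus ?thesis by (rule QI[rotated 2]) (use M_Ob in simp_all)
 qed
 hence Q0: "Q ~= {}" by (metis empty_iff)
 have dir: "\<exists>e' \<in> Q. e <~ e' & f <~ e'" if e: "e \<in> Q" and f: "f \<in> m ` \<Psi>" for e f
 proof -
  note eA = QD(1,2)[OF e]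
  obtain G where "good e G" using QD(3)[OF e] by (rule exE)
  hence G: "finite G" "G \<subseteq> \<Psi>"
   "!!x g. [|x \<in> \<Omega>; arr g; dom g = N x; cod g = dom e; ~ null C (e ** g)|]
    ==> \<exists>y \<in> G. m x <~ m y"
   by (simp_all only: good_def) metis
  obtain z where z: "z \<in> \<Psi>" "f = m z" using f by blast
  have zO: "z \<in> \<Omega>" using z S by blast
  have fA: "arr f" "cod f = M" "dom f = N z" using z zO m_tgt by simp_all
  obtain e' where e': "arr e'" "cod e' = cod e" "e <~ e'" "f <~ e'"
   "\<forall>g. g <~ e' --> (\<exists>u \<in> Ar C. \<exists>v \<in> Ar C. dom u = dom g & dom v = dom g &
    cod u = dom e & cod v = dom f & g = (e ** u) \<boxplus> (f ** v))"
   by (rule sumE[OF eA(1) fA(1)]) (use eA fA in simp)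
  have "\<exists>y \<in> insert z G. m x <~ m y"
   if x: "x \<in> \<Omega>" and g: "arr g" "dom g = N x" "cod g = dom e'" "~ null C (e' ** g)" for x g
  proof -
   have "e' ** g <~ e'" by (rule factors_through_cmp[OF e'(1) g(1,3)])
   then obtain u v where uv: "arr u" "arr v" "dom u = dom (e' ** g)" "dom v = dom (e' ** g)"
    "cod u = dom e" "cod v = dom f" "e' ** g = (e ** u) \<boxplus> (f ** v)" using e'(5) by blast
   have s: "dom u = N x" "dom v = N x" using uv(3,4) e'(1) g(1-3) by simp_all
   show ?thesis
   proof (cases "null C (e ** u)")
    case True
    have "~ null C (f ** v)"
    proof
     assume n: "null C (f ** v)"
     have "null C ((e ** u) \<boxplus> (f ** v))"
      by (rule null_hadd[OF True n]) (use uv(1,2,5,6) s eA fA in simp_all)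
     thus False using g(4) uv(7) by simp
    qed
    hence "~ null C v" using null_cmp_right[of v f] uv(2,6) fA by auto
    hence "m x <~ m z" using hom_le[OF x zO uv(2) s(2)] uv(6) fA by simp
    thus ?thesis by blast
   next
    case False
    thus ?thesis using G(3)[OF x uv(1) s(1) uv(5)] by blast
   qed
  qed
  hence "good e' (insert z G)" unfolding good_def using G(1,2) z(1)
   by (simp only: finite_insert insert_subset) simp
  hence "e' \<in> Q" using QI[OF e'(1)] e'(2) eA(2) by (simp only:)
  thus ?thesis using e'(3,4) by (rule_tac bexI[of _ e']) simp_all
 qed
 obtain w p where w: "w ** p \<in> Q" "monic C w" "epic C p" "cod p = dom w" "cod w = M"
  and le: "!!f. f \<in> m ` \<Psi> ==> f <~ w"
  by (rule noetherian[OF M_Ob Q0 conjI[OF QD(1,2)] dir]) (assumption | rule that)+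
 obtain G where "good (w ** p) G" using QD(3)[OF w(1)] by (rule exE)
 hence G: "finite G" "G \<subseteq> \<Psi>"
   "!!x g. [|x \<in> \<Omega>; arr g; dom g = N x; cod g = dom (w ** p); ~ null C ((w ** p) ** g)|]
    ==> \<exists>y \<in> G. m x <~ m y"
  by (simp_all only: good_def) metis
 have wA: "arr w" "arr p" using w by auto
 have "\<exists>y \<in> G. m x <~ m y" if x: "x \<in> \<Psi>" for x
 proof -
  have xO: "x \<in> \<Omega>" using x S by blast
  have "m x <~ w" using le x by blast
  then obtain s where s: "arr s" "dom s = N x" "cod s = dom p" "m x = (w ** p) ** s"
   by (rule lift_through[OF xO m_Ar[OF xO] refl _ wA(1) w(3,4)])
  have t: "cod s = dom (w ** p)" using s(3) wA w(4) by simp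
  show ?thesis by (rule G(3)[OF xO s(1,2) t]) (use m_nonzero[OF xO] s(4) in simp)
 qed
 thus ?thesis using that G(1,2) by blast
qed

text \<open>If some down-set were infinite, take y with \<open>m y\<close> minimal among such. The
  points strictly below y are covered by finitely many, whose down-sets are finite, a contradiction.
  The whole of \<open>\<Omega>\<close> is in turn covered by finitely many down-sets.\<close>

lemma finite_\<Omega>: "finite \<Omega>"
proof -
 define dn where "dn x = {y \<in> \<Omega>. m y <~ m x}" for x
 have "finite (dn x)" if "x \<in> \<Omega>" for x
 proof (rule ccontr)
  assume inf: "infinite (dn x)"
  define S where "S = {m y | y. y \<in> \<Omega> & infinite (dn y)}"
  have "S ~= {}" using that inf unfolding S_def by blast
  moreover have "monic C n & cod n = M" if "n \<in> S" for n using that m_monic m_tgt unfolding S_def by blast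
  ultimately obtain n where n: "n \<in> S" "!!k. k \<in> S ==> k <~ n ==> n <~ k"
   using minimal_monic[OF M_Ob, of S] by metis
  obtain y where y: "y \<in> \<Omega>" "infinite (dn y)" "n = m y" using n(1) unfolding S_def by blast
  obtain G where G: "finite G" "G \<subseteq> dn y - {y}" "!!x. x \<in> dn y - {y} ==> \<exists>z \<in> G. m x <~ m z"
   by (rule finite_covering[of "dn y - {y}"]) (auto simp: dn_def)
  have "finite (dn z)" if z: "z \<in> G" for z
  proof (rule ccontr)
   have zO: "z \<in> \<Omega>" "m z <~ m y" "z ~= y" using z G(2) unfolding dn_def by blast+
   assume "infinite (dn z)"
   hence "m z \<in> S" using zO(1) unfolding S_def by blast
   hence "m y <~ m z" using n(2) zO(2) y(3) by blast
   thus False using m_antisym[OF zO(1) y(1)] zO(2,3) by blast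
  qed
  hence "finite (insert y (\<Union>z \<in> G. dn z))" using G(1) by blast
  moreover have "dn y \<subseteq> insert y (\<Union>z \<in> G. dn z)"
  proof
   fix x assume x: "x \<in> dn y"
   show "x \<in> insert y (\<Union>z \<in> G. dn z)"
   proof (cases "x = y")
    case False
    thus ?thesis using G(3)[of x] x unfolding dn_def by blast
   qed simp
  qed
  ultimately show False using y(2) finite_subset by blast
 qed
 moreover obtain G where G: "finite G" "G \<subseteq> \<Omega>" "!!x. x \<in> \<Omega> ==> \<exists>y \<in> G. m x <~ m y"
  by (rule finite_covering[of \<Omega>]) auto
 ultimately have "finite (\<Union>y \<in> G. dn y)" by blast
 moreover have "\<Omega> \<subseteq> (\<Union>y \<in> G. dn y)"
 proof
  fix x assume "x \<in> \<Omega>"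
  thus "x \<in> (\<Union>y \<in> G. dn y)" using G(3)[of x] unfolding dn_def by blast
 qed
 ultimately show ?thesis using finite_subset by blast
qed

text \<open>A morphism from the representation of \<open>D\<close> to \<open>R\<close>, without the
  encoding by sequences and without extensionality, so that it can be built up by sums.\<close>

definition nat_map :: "('x, 'a, 'v) rep => 'o => ('x => 'a => 'v) => bool" where
 "nat_map R D \<Theta> \<longleftrightarrow> D \<in> Ob C & (\<forall>x \<in> \<Omega>. \<forall>g \<in> Hom C (N x) D. \<Theta> x g \<in> carrier (rspace R x) &
  (\<forall>h \<in> Hom C (N x) D. \<Theta> x (g \<boxplus> h) = \<Theta> x g \<oplus>\<^bsub>rspace R x\<^esub> \<Theta> x h) &
  (\<forall>a \<in> carrier (K x). \<Theta> x (g ** a) = \<Theta> x g \<odot>\<^bsub>rspace R x\<^esub> a) &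
  (\<forall>y \<in> \<Omega>. m y <~ m x --> \<Theta> y (g ** \<iota> y x) = rmap R y x (\<Theta> x g)))"

lemma nat_mapD:
 assumes "nat_map R D \<Theta>"
 shows "D \<in> Ob C"
  "[|x \<in> \<Omega>; arr g; dom g = N x; cod g = D|] ==> \<Theta> x g \<in> carrier (rspace R x)"
  "[|x \<in> \<Omega>; arr g; dom g = N x; cod g = D; arr h; dom h = N x; cod h = D|]
   ==> \<Theta> x (g \<boxplus> h) = \<Theta> x g \<oplus>\<^bsub>rspace R x\<^esub> \<Theta> x h"
  "[|x \<in> \<Omega>; arr g; dom g = N x; cod g = D; arr a; dom a = N x; cod a = N x|]
   ==> \<Theta> x (g ** a) = \<Theta> x g \<odot>\<^bsub>rspace R x\<^esub> a"
  "[|x \<in> \<Omega>; arr g; dom g = N x; cod g = D; y \<in> \<Omega>; m y <~ m x|]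
   ==> \<Theta> y (g ** \<iota> y x) = rmap R y x (\<Theta> x g)"
 using assms unfolding nat_map_def K_simps Hom_def by blast+

lemma nat_mapI:
 assumes "D \<in> Ob C"
  "!!x g. [|x \<in> \<Omega>; arr g; dom g = N x; cod g = D|] ==> \<Theta> x g \<in> carrier (rspace R x)"
  "!!x g h. [|x \<in> \<Omega>; arr g; dom g = N x; cod g = D; arr h; dom h = N x; cod h = D|]
   ==> \<Theta> x (g \<boxplus> h) = \<Theta> x g \<oplus>\<^bsub>rspace R x\<^esub> \<Theta> x h"
  "!!x g a. [|x \<in> \<Omega>; arr g; dom g = N x; cod g = D; arr a; dom a = N x; cod a = N x|]
   ==> \<Theta> x (g ** a) = \<Theta> x g \<odot>\<^bsub>rspace R x\<^esub> a"
  "!!x g y. [|x \<in> \<Omega>; arr g; dom g = N x; cod g = D; y \<in> \<Omega>; m y <~ m x|]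
   ==> \<Theta> y (g ** \<iota> y x) = rmap R y x (\<Theta> x g)"
 shows "nat_map R D \<Theta>"
 using assms unfolding nat_map_def K_simps Hom_def by simp

context
 fixes R :: "('x, 'a, nat => 'a) rep"
 assumes R: "is_pfd_rep P K \<kappa> R"
begin

abbreviation "E x \<equiv> carrier (rspace R x)"
abbreviation R_add ("_ \<oplus>[_] _" [65, 0, 66] 65) where "v \<oplus>[x] w \<equiv> v \<oplus>\<^bsub>rspace R x\<^esub> w"
abbreviation R_mul ("_ \<odot>[_] _" [70, 0, 71] 70) where "v \<odot>[x] a \<equiv> v \<odot>\<^bsub>rspace R x\<^esub> a"
abbreviation R_zero ("\<zero>[_]") where "\<zero>[x] \<equiv> \<zero>\<^bsub>rspace R x\<^esub>"

lemma R_vector_space: "x \<in> \<Omega> ==> right_vector_space (K x) (rspace R x)"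
 using pfd_repD(1)[OF R] by simp

lemma R_abelian_group: "x \<in> \<Omega> ==> abelian_group (rspace R x)"
 using R_vector_space unfolding right_vector_space_def by blast

lemma R_le: "[|x \<in> \<Omega>; y \<in> \<Omega>; m x <~ m y|] ==> x \<in> carrier P & y \<in> carrier P & x \<sqsubseteq>\<^bsub>P\<^esub> y"
 using le_P by simp

lemma nat_map_null:
 assumes \<Theta>: "nat_map R D \<Theta>" and x: "x \<in> \<Omega>" and g: "arr g" "dom g = N x" "cod g = D" "null C g"
 shows "\<Theta> x g = \<zero>[x]"
proof -
 have "g \<boxplus> g = g" using g by (simp add: null_def)
 hence e: "\<Theta> x g = \<Theta> x g \<oplus>[x] \<Theta> x g" using nat_mapD(3)[OF \<Theta> x g(1-3) g(1-3)] by simp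
 have c: "\<Theta> x g \<in> E x" by (rule nat_mapD(2)[OF \<Theta> x g(1-3)])
 interpret V: abelian_group "rspace R x" by (rule R_abelian_group[OF x])
 show ?thesis using V.add.r_cancel_one[OF c c] e by simp
qed

text \<open>Arrows between generators are inclusions after scalars, so the kernel of
  \<open>\<Theta>\<close> is closed under composition with all of them. This lets kernel elements be
  collected in one subobject.\<close>

lemma nat_map_kernel:
 assumes \<Theta>: "nat_map R D \<Theta>" and x: "x \<in> \<Omega>" and y: "y \<in> \<Omega>"
  and f: "arr f" "dom f = N y" "cod f = D" "\<Theta> y f = \<zero>[y]"
  and a: "arr a" "dom a = N x" "cod a = N y"
 shows "\<Theta> x (f ** a) = \<zero>[x]"
proof (cases "null C a")
 case True
 have "null C (f ** a)" by (rule null_cmp_right[OF True]) (use f(1-3) a in simp_all)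
 thus ?thesis by (intro nat_map_null[OF \<Theta> x]) (use f(1-3) a in simp_all)
next
 case False
 have xy: "m x <~ m y" by (rule hom_le[OF x y a False])
 note i = incl[OF x y xy]
 obtain \<alpha> where \<alpha>: "arr \<alpha>" "dom \<alpha> = N x" "cod \<alpha> = N x" "a = \<iota> x y ** \<alpha>"
  by (rule hom_through_incl[OF x y xy a])
 have fi: "arr (f ** \<iota> x y)" "dom (f ** \<iota> x y) = N x" "cod (f ** \<iota> x y) = D" using f(1-3) i(1-3) by simp_all
 have "\<Theta> x (f ** \<iota> x y) = rmap R x y (\<Theta> y f)" by (rule nat_mapD(5)[OF \<Theta> y f(1-3) x xy])
 also have "... = \<zero>[x]" unfolding f(4) using rmap_zero[OF R] R_le[OF x y xy] by blast
 finally have z: "\<Theta> x (f ** \<iota> x y) = \<zero>[x]" .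
 have "f ** a = (f ** \<iota> x y) ** \<alpha>" unfolding \<alpha>(4) using f(1-3) i(1-3) \<alpha>(1-3) by simp
 hence "\<Theta> x (f ** a) = \<zero>[x] \<odot>[x] \<alpha>"
  using nat_mapD(4)[OF \<Theta> x fi \<alpha>(1-3)] z by simp
 also have "... = \<zero>[x]"
  by (rule zero_smult[OF R_vector_space[OF x]]) (use \<alpha>(1-3) in \<open>simp add: Hom_def\<close>)
 finally show ?thesis .
qed

text \<open>An arrow to \<open>N y\<close> from a generator x below y is the inclusion after a
  unique scalar \<open>cf x a\<close>; it is sent to the restriction of \<open>v\<close> to x times
  this scalar. From other points only the zero arrow exists.\<close>

lemma yoneda:
 assumes y: "y \<in> \<Omega>" and v: "v \<in> E y"
 obtains \<Theta> where "nat_map R (N y) \<Theta>" "\<Theta> y (ident C (N y)) = v"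
proof -
 define cf where "cf x a = (THE \<alpha>. \<alpha> \<in> Ar C & dom \<alpha> = N x & cod \<alpha> = N x & a = \<iota> x y ** \<alpha>)" for x a
 have cf_eq: "cf x a = \<alpha>" if x: "x \<in> \<Omega>" "m x <~ m y"
  and \<alpha>: "arr \<alpha>" "dom \<alpha> = N x" "cod \<alpha> = N x" "a = \<iota> x y ** \<alpha>" for x a \<alpha>
  unfolding cf_def
 proof (rule the_equality)
  show "arr \<alpha> & dom \<alpha> = N x & cod \<alpha> = N x & a = \<iota> x y ** \<alpha>" using \<alpha> by blast
  fix \<beta> assume b: "arr \<beta> & dom \<beta> = N x & cod \<beta> = N x & a = \<iota> x y ** \<beta>"
  hence "\<iota> x y ** \<beta> = \<iota> x y ** \<alpha>" using \<alpha>(4) by simp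
  thus "\<beta> = \<alpha>"
   using monic_cmp_iff[OF incl_monic[OF x(1) y x(2)], of \<beta> \<alpha>] b \<alpha>(1-3) incl(2)[OF x(1) y x(2)] by simp
 qed
 have cf: "arr (cf x a)" "dom (cf x a) = N x" "cod (cf x a) = N x" "\<iota> x y ** cf x a = a"
  if x: "x \<in> \<Omega>" "m x <~ m y" and a: "arr a" "dom a = N x" "cod a = N y" for x a
 proof -
  obtain \<alpha> where \<alpha>: "arr \<alpha>" "dom \<alpha> = N x" "cod \<alpha> = N x" "a = \<iota> x y ** \<alpha>"
   by (rule hom_through_incl[OF x(1) y x(2) a])
  have e: "cf x a = \<alpha>" by (rule cf_eq[OF x \<alpha>])
  show "arr (cf x a)" "dom (cf x a) = N x" "cod (cf x a) = N x" "\<iota> x y ** cf x a = a"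
   unfolding e using \<alpha> by simp_all
 qed
 define \<Theta> where "\<Theta> x a = (if m x <~ m y then rmap R x y v \<odot>[x] cf x a else \<zero>[x])" for x a
 have rv: "rmap R x y v \<in> E x" if x: "x \<in> \<Omega>" "m x <~ m y" for x
  using rmap_closed[OF R _ _ _ v] R_le[OF x(1) y x(2)] by blast
 have "nat_map R (N y) \<Theta>"
 proof (rule nat_mapI)
  show "N y \<in> Ob C" using y by simp
  fix x g assume x: "x \<in> \<Omega>" and g: "arr g" "dom g = N x" "cod g = N y"
  note VS = R_vector_space[OF x]
  show "\<Theta> x g \<in> E x"
  proof (cases "m x <~ m y")
   case True
   have "cf x g \<in> carrier (K x)" using cf[OF x True g] by (simp add: Hom_def)
   thus ?thesis unfolding \<Theta>_def using True smult_closed[OF VS rv[OF x True]] by simp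
  next
   case False
   thus ?thesis unfolding \<Theta>_def
    using abelian_monoid.zero_closed[OF abelian_group.axioms(1)[OF R_abelian_group[OF x]]] by simp
  qed
  show "\<Theta> x (g \<boxplus> h) = \<Theta> x g \<oplus>[x] \<Theta> x h" if h: "arr h" "dom h = N x" "cod h = N y" for h
  proof (cases "m x <~ m y")
   case True
   note i = incl[OF x y True] and cg = cf[OF x True g] and ch = cf[OF x True h]
   have "g \<boxplus> h = \<iota> x y ** (cf x g \<boxplus> cf x h)"
    using cmp_hadd_Ar[of "cf x g" "cf x h" "\<iota> x y"] cg ch i(1-3) by simp
   hence "cf x (g \<boxplus> h) = cf x g \<boxplus> cf x h"
    by (rule cf_eq[OF x True, rotated 3]) (use cg(1-3) ch(1-3) in simp_all)
   moreover have "rmap R x y v \<odot>[x] (cf x g \<oplus>\<^bsub>K x\<^esub> cf x h) =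
     (rmap R x y v \<odot>[x] cf x g) \<oplus>[x] (rmap R x y v \<odot>[x] cf x h)"
    by (rule smult_add[OF VS rv[OF x True]])
     (use cg(1-3) ch(1-3) in \<open>simp_all add: Hom_def\<close>)
   ultimately show ?thesis unfolding \<Theta>_def using True by simp
  next
   case False
   thus ?thesis unfolding \<Theta>_def
    using abelian_monoid.l_zero[OF abelian_group.axioms(1)[OF R_abelian_group[OF x]]]
     abelian_monoid.zero_closed[OF abelian_group.axioms(1)[OF R_abelian_group[OF x]]] by simp
  qed
  show "\<Theta> x (g ** a) = \<Theta> x g \<odot>[x] a" if a: "arr a" "dom a = N x" "cod a = N x" for a
  proof (cases "m x <~ m y")
   case True
   note i = incl[OF x y True] and cg = cf[OF x True g]
   have "\<iota> x y ** (cf x g ** a) = g ** a"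
    by (rule cmp_reduce[OF cg(4)]) (use cg(1-3) i(1-3) a in simp_all)
   hence "cf x (g ** a) = cf x g ** a"
    by (intro cf_eq[OF x True]) (use cg(1-3) a in simp_all)
   moreover have "rmap R x y v \<odot>[x] (cf x g \<otimes>\<^bsub>K x\<^esub> a) = (rmap R x y v \<odot>[x] cf x g) \<odot>[x] a"
    by (rule smult_assoc[OF VS rv[OF x True]])
     (use cg(1-3) a in \<open>simp_all add: Hom_def\<close>)
   ultimately show ?thesis unfolding \<Theta>_def using True by simp
  next
   case False
   have "a \<in> carrier (K x)" using a by (simp add: Hom_def)
   thus ?thesis unfolding \<Theta>_def using False zero_smult[OF VS] by simp
  qed
  show "\<Theta> z (g ** \<iota> z x) = rmap R z x (\<Theta> x g)" if z: "z \<in> \<Omega>" "m z <~ m x" for z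
  proof (cases "m x <~ m y")
   case True
   have zy: "m z <~ m y" using factors_through_trans[OF z(2) True] y by simp
   note i = incl[OF x y True] and cg = cf[OF x True g] and j = incl[OF z(1) x z(2)]
   note k = kappa[OF z(1) x z(2) cg(1-3)]
   have "g ** \<iota> z x = \<iota> x y ** (cf x g ** \<iota> z x)"
    using cmp_reduce[OF cg(4), of "\<iota> z x"] cg(1-3) i(1-3) j(1-3) by simp
   also have "... = \<iota> x y ** (\<iota> z x ** \<kappa> z x (cf x g))" by (simp only: k(4))
   also have "... = \<iota> z y ** \<kappa> z x (cf x g)"
    by (rule cmp_reduce[OF incl_trans[OF z(1) x y z(2) True]]) (use i(1-3) j(1-3) k(1-3) in simp_all)
   finally have "cf z (g ** \<iota> z x) = \<kappa> z x (cf x g)" by (rule cf_eq[OF z(1) zy k(1-3)])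
   hence "\<Theta> z (g ** \<iota> z x) = rmap R z y v \<odot>[z] \<kappa> z x (cf x g)" unfolding \<Theta>_def using zy by simp
   also have "rmap R z y v = rmap R z x (rmap R x y v)"
    using pfd_repD(4)[OF R _ _ _ _ _ v, of z x] R_le[OF z(1) x z(2)] R_le[OF x y True] by blast
   also have "rmap R z x (rmap R x y v) \<odot>[z] \<kappa> z x (cf x g) = rmap R z x (rmap R x y v \<odot>[x] cf x g)"
   proof -
    have "cf x g \<in> carrier (K x)" using cg(1-3) by (simp add: Hom_def)
    thus ?thesis using pfd_repD(6)[OF R _ _ _ rv[OF x True], of z "cf x g"] R_le[OF z(1) x z(2)] by simp
   qed
   finally show ?thesis unfolding \<Theta>_def using True by simp
  next
   case False
   \<comment> \<open>No nonzero arrow leads from x to y, although the smaller z may still lie below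
     y.\<close>
   have ng: "null C g" using hom_le[OF x y g] False by blast
   have gz: "arr (g ** \<iota> z x)" "dom (g ** \<iota> z x) = N z" "cod (g ** \<iota> z x) = N y"
    using g incl(1-3)[OF z(1) x z(2)] by simp_all
   have n: "null C (g ** \<iota> z x)" by (rule null_cmp_left[OF ng]) (use g incl(1-3)[OF z(1) x z(2)] in simp_all)
   have "\<Theta> z (g ** \<iota> z x) = \<zero>[z]"
   proof (cases "m z <~ m y")
    case True
    note i = incl[OF z(1) y True]
    have "g ** \<iota> z x = \<iota> z y ** hzero C (N z) (N z)" using n gz i(1-3) z(1) by (simp add: null_def)
    hence "cf z (g ** \<iota> z x) = hzero C (N z) (N z)" by (rule cf_eq[OF z(1) True, rotated 3]) (use z(1) in simp_all)
    moreover have "rmap R z y v \<odot>[z] \<zero>\<^bsub>K z\<^esub> = \<zero>[z]"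
     by (rule smult_zero[OF R_vector_space[OF z(1)] rv[OF z(1) True]])
    ultimately show ?thesis unfolding \<Theta>_def using True by simp
   next
    case False
    thus ?thesis unfolding \<Theta>_def by simp
   qed
   moreover have "rmap R z x (\<Theta> x g) = \<zero>[z]"
    unfolding \<Theta>_def using False rmap_zero[OF R] R_le[OF z(1) x z(2)] by simp
   ultimately show ?thesis by simp
  qed
 qed
 moreover have "\<Theta> y (ident C (N y)) = v"
 proof -
  have yy: "m y <~ m y" using y by simp
  have "cf y (ident C (N y)) = ident C (N y)" by (rule cf_eq[OF y yy]) (use y in simp_all)
  moreover have "rmap R y y v = v" using pfd_repD(3)[OF R _ v] y by simp
  moreover have "v \<odot>[y] \<one>\<^bsub>K y\<^esub> = v" by (rule smult_one[OF R_vector_space[OF y] v])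
  ultimately show ?thesis unfolding \<Theta>_def using yy by simp
 qed
 ultimately show ?thesis by (rule that)
qed

lemma nat_map_sum:
 assumes 1: "nat_map R D1 \<Theta>1" and 2: "nat_map R D2 \<Theta>2"
 obtains D \<Theta> where "nat_map R D \<Theta>"
  "!!x g. [|x \<in> \<Omega>; arr g; dom g = N x; cod g = D1|] ==> \<exists>g' \<in> Hom C (N x) D. \<Theta> x g' = \<Theta>1 x g"
  "!!x g. [|x \<in> \<Omega>; arr g; dom g = N x; cod g = D2|] ==> \<exists>g' \<in> Hom C (N x) D. \<Theta> x g' = \<Theta>2 x g"
proof -
 obtain D i1 i2 p1 p2 where D: "is_biproduct C D1 D2 D i1 i2 p1 p2"
  using biproduct_exists nat_mapD(1)[OF 1] nat_mapD(1)[OF 2] by blast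
 note DD = is_biproductD[OF D]
 define \<Theta> where "\<Theta> x g = \<Theta>1 x (p1 ** g) \<oplus>[x] \<Theta>2 x (p2 ** g)" for x g
 have pg: "arr (p1 ** g)" "dom (p1 ** g) = N x" "cod (p1 ** g) = D1"
  "arr (p2 ** g)" "dom (p2 ** g) = N x" "cod (p2 ** g) = D2"
  if "arr g" "dom g = N x" "cod g = D" for x g
  using that DD(1-13) by simp_all
 have "nat_map R D \<Theta>"
 proof (rule nat_mapI)
  show "D \<in> Ob C" by (rule DD)
  fix x g assume x: "x \<in> \<Omega>" and g: "arr g" "dom g = N x" "cod g = D"
  note VS = R_vector_space[OF x] and p = pg[OF g]
  note AM = abelian_group.axioms(1)[OF R_abelian_group[OF x]]
  have c: "\<Theta>1 x (p1 ** g) \<in> E x" "\<Theta>2 x (p2 ** g) \<in> E x"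
   by (rule nat_mapD(2)[OF 1 x p(1-3)], rule nat_mapD(2)[OF 2 x p(4-6)])
  show "\<Theta> x g \<in> E x" unfolding \<Theta>_def by (rule abelian_monoid.a_closed[OF AM c])
  show "\<Theta> x (g \<boxplus> h) = \<Theta> x g \<oplus>[x] \<Theta> x h" if h: "arr h" "dom h = N x" "cod h = D" for h
  proof -
   note q = pg[OF h]
   have d: "\<Theta>1 x (p1 ** h) \<in> E x" "\<Theta>2 x (p2 ** h) \<in> E x"
    by (rule nat_mapD(2)[OF 1 x q(1-3)], rule nat_mapD(2)[OF 2 x q(4-6)])
   have "p1 ** (g \<boxplus> h) = (p1 ** g) \<boxplus> (p1 ** h)" "p2 ** (g \<boxplus> h) = (p2 ** g) \<boxplus> (p2 ** h)"
    using g h DD(1-13) by simp_all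
   hence "\<Theta> x (g \<boxplus> h) = (\<Theta>1 x (p1 ** g) \<oplus>[x] \<Theta>1 x (p1 ** h)) \<oplus>[x]
     (\<Theta>2 x (p2 ** g) \<oplus>[x] \<Theta>2 x (p2 ** h))"
    unfolding \<Theta>_def using nat_mapD(3)[OF 1 x p(1-3) q(1-3)] nat_mapD(3)[OF 2 x p(4-6) q(4-6)] by simp
   also have "... = \<Theta> x g \<oplus>[x] \<Theta> x h"
   proof -
    interpret A: abelian_group "rspace R x" by (rule R_abelian_group[OF x])
    show ?thesis unfolding \<Theta>_def using c d by (simp only: A.a_assoc A.a_lcomm A.a_closed)
   qed
   finally show ?thesis .
  qed
  show "\<Theta> x (g ** a) = \<Theta> x g \<odot>[x] a" if a: "arr a" "dom a = N x" "cod a = N x" for a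
  proof -
   have "p1 ** (g ** a) = (p1 ** g) ** a" "p2 ** (g ** a) = (p2 ** g) ** a" using g a DD(1-13) by simp_all
   moreover have "(\<Theta>1 x (p1 ** g) \<oplus>[x] \<Theta>2 x (p2 ** g)) \<odot>[x] a =
     (\<Theta>1 x (p1 ** g) \<odot>[x] a) \<oplus>[x] (\<Theta>2 x (p2 ** g) \<odot>[x] a)"
    by (rule add_smult[OF VS c]) (use a in \<open>simp add: Hom_def\<close>)
   ultimately show ?thesis unfolding \<Theta>_def
    using nat_mapD(4)[OF 1 x p(1-3) a] nat_mapD(4)[OF 2 x p(4-6) a] by simp
  qed
  show "\<Theta> z (g ** \<iota> z x) = rmap R z x (\<Theta> x g)" if z: "z \<in> \<Omega>" "m z <~ m x" for z
  proof -
   note i = incl[OF z(1) x z(2)]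
   have "p1 ** (g ** \<iota> z x) = (p1 ** g) ** \<iota> z x" "p2 ** (g ** \<iota> z x) = (p2 ** g) ** \<iota> z x"
    using g i(1-3) DD(1-13) by simp_all
   moreover have "rmap R z x (\<Theta>1 x (p1 ** g) \<oplus>[x] \<Theta>2 x (p2 ** g)) =
     rmap R z x (\<Theta>1 x (p1 ** g)) \<oplus>[z] rmap R z x (\<Theta>2 x (p2 ** g))"
    using pfd_repD(5)[OF R _ _ _ c] R_le[OF z(1) x z(2)] by blast
   ultimately show ?thesis unfolding \<Theta>_def
    using nat_mapD(5)[OF 1 x p(1-3) z] nat_mapD(5)[OF 2 x p(4-6) z] by simp
  qed
 qed
 moreover have "\<exists>g' \<in> Hom C (N x) D. \<Theta> x g' = \<Theta>1 x g"
  if x: "x \<in> \<Omega>" and g: "arr g" "dom g = N x" "cod g = D1" for x g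
 proof (rule bexI[of _ "i1 ** g"])
  show "i1 ** g \<in> Hom C (N x) D" using g DD(1-13) by (simp add: Hom_def)
  have D2: "D2 \<in> Ob C" by (rule nat_mapD(1)[OF 2])
  have "p1 ** (i1 ** g) = g" using cmp_reduce[OF DD(14), of g] g DD(1-13) by simp
  moreover have "p2 ** (i1 ** g) = hzero C (N x) D2" using cmp_reduce[OF DD(17), of g] g DD(1-13) D2 by simp
  moreover have "\<Theta>2 x (hzero C (N x) D2) = \<zero>[x]" by (rule nat_map_null[OF 2 x]) (use x D2 in simp_all)
  ultimately show "\<Theta> x (i1 ** g) = \<Theta>1 x g" unfolding \<Theta>_def
   using abelian_monoid.r_zero[OF abelian_group.axioms(1)[OF R_abelian_group[OF x]] nat_mapD(2)[OF 1 x g]] by simp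
 qed
 moreover have "\<exists>g' \<in> Hom C (N x) D. \<Theta> x g' = \<Theta>2 x g"
  if x: "x \<in> \<Omega>" and g: "arr g" "dom g = N x" "cod g = D2" for x g
 proof (rule bexI[of _ "i2 ** g"])
  show "i2 ** g \<in> Hom C (N x) D" using g DD(1-13) by (simp add: Hom_def)
  have D1: "D1 \<in> Ob C" by (rule nat_mapD(1)[OF 1])
  have "p2 ** (i2 ** g) = g" using cmp_reduce[OF DD(15), of g] g DD(1-13) by simp
  moreover have "p1 ** (i2 ** g) = hzero C (N x) D1" using cmp_reduce[OF DD(16), of g] g DD(1-13) D1 by simp
  moreover have "\<Theta>1 x (hzero C (N x) D1) = \<zero>[x]" by (rule nat_map_null[OF 1 x]) (use x D1 in simp_all)
  ultimately show "\<Theta> x (i2 ** g) = \<Theta>2 x g" unfolding \<Theta>_def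
   using abelian_monoid.l_zero[OF abelian_group.axioms(1)[OF R_abelian_group[OF x]] nat_mapD(2)[OF 2 x g]] by simp
 qed
 ultimately show ?thesis by (rule that)
qed

text \<open>One summand \<open>N y\<close> with its Yoneda map is added for each prescribed
  vector.\<close>

lemma nat_map_hits:
 assumes "finite S" "!!y v. (y, v) \<in> S ==> y \<in> \<Omega> & v \<in> E y"
 shows "\<exists>D \<Theta>. nat_map R D \<Theta> & (\<forall>(y, v) \<in> S. \<exists>g \<in> Hom C (N y) D. \<Theta> y g = v)"
 using assms
proof (induction S rule: finite_induct)
 case empty
 obtain Z where Z: "zero_object C Z" "Z \<in> Ob C" "null C (ident C Z)" by (rule zero_objectE)
 define \<Theta> where "\<Theta> x g = \<zero>[x]" for x and g :: 'a
 have "nat_map R Z \<Theta>"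
 proof (rule nat_mapI)
  fix x g assume x: "x \<in> \<Omega>"
  note AM = abelian_group.axioms(1)[OF R_abelian_group[OF x]]
  show "\<Theta> x g \<in> E x" unfolding \<Theta>_def by (rule abelian_monoid.zero_closed[OF AM])
  show "\<Theta> x (g \<boxplus> h) = \<Theta> x g \<oplus>[x] \<Theta> x h" for h
   unfolding \<Theta>_def using abelian_monoid.l_zero[OF AM abelian_monoid.zero_closed[OF AM]] by simp
  show "\<Theta> x (g ** a) = \<Theta> x g \<odot>[x] a" if "arr a" "dom a = N x" "cod a = N x" for a
   unfolding \<Theta>_def using zero_smult[OF R_vector_space[OF x], of a] that by (simp add: Hom_def)
  show "\<Theta> z (g ** \<iota> z x) = rmap R z x (\<Theta> x g)" if z: "z \<in> \<Omega>" "m z <~ m x" for z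
   unfolding \<Theta>_def using rmap_zero[OF R] R_le[OF z(1) x z(2)] by simp
 qed (rule Z)
 thus ?case by blast
next
 case (insert s S)
 obtain y v where s: "s = (y, v)" by fastforce
 have yv: "y \<in> \<Omega>" "v \<in> E y" using insert.prems s by blast+
 obtain D1 \<Theta>1 where 1: "nat_map R D1 \<Theta>1" "\<forall>(y, v) \<in> S. \<exists>g \<in> Hom C (N y) D1. \<Theta>1 y g = v"
  using insert.IH insert.prems by blast
 obtain \<Theta>2 where 2: "nat_map R (N y) \<Theta>2" "\<Theta>2 y (ident C (N y)) = v" by (rule yoneda[OF yv])
 obtain D \<Theta> where 3: "nat_map R D \<Theta>"
  "!!x g. [|x \<in> \<Omega>; arr g; dom g = N x; cod g = D1|] ==> \<exists>g' \<in> Hom C (N x) D. \<Theta> x g' = \<Theta>1 x g"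
  "!!x g. [|x \<in> \<Omega>; arr g; dom g = N x; cod g = N y|] ==> \<exists>g' \<in> Hom C (N x) D. \<Theta> x g' = \<Theta>2 x g"
  by (rule nat_map_sum[OF 1(1) 2(1)]) blast
 have "\<exists>g \<in> Hom C (N z) D. \<Theta> z g = w" if zw: "(z, w) \<in> insert s S" for z w
 proof (cases "(z, w) = s")
  case True
  hence "z = y" "w = v" using s by simp_all
  thus ?thesis using 3(3)[OF yv(1), of "ident C (N y)"] 2(2) yv(1) by simp
 next
  case False
  hence zS: "(z, w) \<in> S" using zw by simp
  obtain g where g: "g \<in> Hom C (N z) D1" "\<Theta>1 z g = w"
   using bspec[OF 1(2) zS, unfolded prod.case] by (rule bexE)
  have z: "z \<in> \<Omega>" using insert.prems[OF zw] by (rule conjunct1)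
  have "arr g" "dom g = N z" "cod g = D1" using g(1) by (simp_all add: Hom_def)
  from 3(2)[OF z this] show ?thesis unfolding g(2) .
 qed
 thus ?case using 3(1) by blast
qed

text \<open>A presentation of \<open>R\<close>: a finite direct sum \<open>D\<close> of generators
  maps onto \<open>R\<close> at every point, and dividing \<open>D\<close> by the subobject
  \<open>w\<close> collected from the kernel gives an object whose representation is
  \<open>R\<close>.\<close>

lemma F_dense: "\<exists>X \<in> Ob C. \<exists>e \<in> Hom (Rep_category P K \<kappa>) (F X) R. iso_arrow (Rep_category P K \<kappa>) e"
proof -
 have "\<exists>B. generates (K x) (rspace R x) B" if x: "x \<in> \<Omega>" for x
  using right_vector_space.finite_dimensional_generates[OF R_vector_space[OF x]] pfd_repD(2)[OF R] x
  by (metis carrier_P)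
 then obtain B where B: "!!x. x \<in> \<Omega> ==> generates (K x) (rspace R x) (B x)" by metis
 \<comment> \<open>Finite dimensionality is given pointwise only; a finite direct sum can hit
   generators at all points because \<open>\<Omega>\<close> is finite.\<close>
 have "finite (Sigma \<Omega> B)" by (rule finite_SigmaI[OF finite_\<Omega>]) (use B in \<open>simp add: generates_def\<close>)
 moreover have "y \<in> \<Omega> & v \<in> E y" if "(y, v) \<in> Sigma \<Omega> B" for y v
  using that B[of y] unfolding generates_def by blast
 ultimately obtain D \<Theta> where \<Theta>: "nat_map R D \<Theta>" and hit: "\<forall>(y, v) \<in> Sigma \<Omega> B. \<exists>g \<in> Hom C (N y) D. \<Theta> y g = v"
  using nat_map_hits[of "Sigma \<Omega> B"] by blast
 have D: "D \<in> Ob C" by (rule nat_mapD(1)[OF \<Theta>])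
 have surj: "\<Theta> x ` Hom C (N x) D = E x" if x: "x \<in> \<Omega>" for x
 proof -
  have "subspace_of (K x) (rspace R x) (\<Theta> x ` Hom C (N x) D)"
   unfolding subspace_of_def
  proof (intro conjI ballI)
   show "\<Theta> x ` Hom C (N x) D \<subseteq> E x"
    using nat_mapD(2)[OF \<Theta> x] unfolding Hom_def by blast
   have "\<Theta> x (hzero C (N x) D) = \<zero>[x]" by (rule nat_map_null[OF \<Theta> x]) (use x D in simp_all)
   moreover have "hzero C (N x) D \<in> Hom C (N x) D" using x D by (simp add: Hom_def)
   ultimately show "\<zero>[x] \<in> \<Theta> x ` Hom C (N x) D" by (metis imageI)
  next
   fix v w assume "v \<in> \<Theta> x ` Hom C (N x) D" "w \<in> \<Theta> x ` Hom C (N x) D"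
   then obtain g h where g: "arr g" "dom g = N x" "cod g = D" "v = \<Theta> x g"
    and h: "arr h" "dom h = N x" "cod h = D" "w = \<Theta> x h" unfolding Hom_def by blast
   have "g \<boxplus> h \<in> Hom C (N x) D" using g h by (simp add: Hom_def)
   thus "v \<oplus>[x] w \<in> \<Theta> x ` Hom C (N x) D"
    unfolding g(4) h(4) nat_mapD(3)[OF \<Theta> x g(1-3) h(1-3), symmetric] by (rule imageI)
  next
   fix v a assume "v \<in> \<Theta> x ` Hom C (N x) D" and a0: "a \<in> carrier (K x)"
   then obtain g where g: "arr g" "dom g = N x" "cod g = D" "v = \<Theta> x g" unfolding Hom_def by blast
   have a: "arr a" "dom a = N x" "cod a = N x" using a0 by (simp_all add: Hom_def)
   have "g ** a \<in> Hom C (N x) D" using g a by (simp add: Hom_def)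
   thus "v \<odot>[x] a \<in> \<Theta> x ` Hom C (N x) D"
    unfolding g(4) nat_mapD(4)[OF \<Theta> x g(1-3) a, symmetric] by (rule imageI)
  qed
  moreover have "B x \<subseteq> \<Theta> x ` Hom C (N x) D"
  proof
   fix b assume "b \<in> B x"
   hence xb: "(x, b) \<in> Sigma \<Omega> B" by (rule SigmaI[OF x])
   obtain g where g: "g \<in> Hom C (N x) D" "\<Theta> x g = b" using bspec[OF hit xb, unfolded prod.case] by (rule bexE)
   show "b \<in> \<Theta> x ` Hom C (N x) D" unfolding g(2)[symmetric] by (rule imageI[OF g(1)])
  qed
  ultimately show ?thesis using B[OF x] unfolding generates_def by blast
 qed
 define Q where "Q = {e \<in> Ar C. cod e = D & (\<forall>x \<in> \<Omega>. \<forall>g \<in> Ar C. dom g = N x --> cod g = dom e -->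
  \<Theta> x (e ** g) = \<zero>[x])}"
 define \<Phi> where "\<Phi> = {f \<in> Ar C. cod f = D & (\<exists>x \<in> \<Omega>. dom f = N x & \<Theta> x f = \<zero>[x])}"
 have "hzero C D D \<in> Q"
 proof -
  have "\<Theta> x (hzero C D D ** g) = \<zero>[x]" if x: "x \<in> \<Omega>" and g: "arr g" "dom g = N x" "cod g = D" for x g
  proof (rule nat_map_null[OF \<Theta> x])
   show "null C (hzero C D D ** g)" by (rule null_cmp_left) (use g D in simp_all)
  qed (use g D N_Ob[OF x] in simp_all)
  thus ?thesis unfolding Q_def using D by (intro CollectI conjI) simp_all
 qed
 hence Q0: "Q ~= {}" by (metis empty_iff)
 have QD: "arr e" "cod e = D" if "e \<in> Q" for e using that by (simp_all add: Q_def)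
 have dir: "\<exists>e' \<in> Q. e <~ e' & f <~ e'" if e: "e \<in> Q" and f: "f \<in> \<Phi>" for e f
 proof -
  have eA: "arr e" "cod e = D" and eQ: "!!x g. [|x \<in> \<Omega>; arr g; dom g = N x; cod g = dom e|] ==>
   \<Theta> x (e ** g) = \<zero>[x]"
   using e unfolding Q_def by blast+
  obtain y where y: "y \<in> \<Omega>" and fA: "arr f" "dom f = N y" "cod f = D" "\<Theta> y f = \<zero>[y]"
   using f unfolding \<Phi>_def by blast
  obtain e' where e': "arr e'" "cod e' = cod e" "e <~ e'" "f <~ e'"
   "\<forall>g. g <~ e' --> (\<exists>u \<in> Ar C. \<exists>v \<in> Ar C. dom u = dom g & dom v = dom g &
    cod u = dom e & cod v = dom f & g = (e ** u) \<boxplus> (f ** v))"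
   by (rule sumE[OF eA(1) fA(1)]) (use eA fA in simp)
  have "\<Theta> x (e' ** g) = \<zero>[x]"
   if x: "x \<in> \<Omega>" and g: "arr g" "dom g = N x" "cod g = dom e'" for x g
  proof -
   have "e' ** g <~ e'" by (rule factors_through_cmp[OF e'(1) g(1,3)])
   then obtain u v where uv: "arr u" "arr v" "dom u = dom (e' ** g)" "dom v = dom (e' ** g)"
    "cod u = dom e" "cod v = dom f" "e' ** g = (e ** u) \<boxplus> (f ** v)" using e'(5) by blast
   have s: "dom u = N x" "dom v = N x" using uv(3,4) e'(1) g by simp_all
   have vy: "cod v = N y" using uv(6) fA(2) by simp
   have "\<Theta> x (e' ** g) = \<Theta> x (e ** u) \<oplus>[x] \<Theta> x (f ** v)"
    unfolding uv(7) by (rule nat_mapD(3)[OF \<Theta> x]) (use uv(1,2,5,6) s eA fA(1-3) in simp_all)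
   also have "... = \<zero>[x] \<oplus>[x] \<zero>[x]"
    using eQ[OF x uv(1) s(1) uv(5)] nat_map_kernel[OF \<Theta> x y fA uv(2) s(2) vy] by simp
   also have "... = \<zero>[x]"
    using abelian_monoid.l_zero[OF abelian_group.axioms(1)[OF R_abelian_group[OF x]]
     abelian_monoid.zero_closed[OF abelian_group.axioms(1)[OF R_abelian_group[OF x]]]] .
   finally show ?thesis .
  qed
  hence "e' \<in> Q" unfolding Q_def using e'(1,2) eA(2) by (intro CollectI conjI) simp_all
  thus ?thesis using e'(3,4) by blast
 qed
 obtain w p where w: "w ** p \<in> Q" "monic C w" "epic C p" "cod p = dom w" "cod w = D"
  and le: "!!f. f \<in> \<Phi> ==> f <~ w"
  by (rule noetherian[OF D Q0 conjI[OF QD] dir]) (assumption | rule that)+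
 have wA: "arr w" "arr p" using w by auto
 obtain c where c: "ses C w c" using monic_ses[OF w(2)] .
 note cD = sesD[OF c]
 have cA: "arr c" "dom c = D" using cD w(5) by auto
 define X where "X = cod c"
 have X: "X \<in> Ob C" using cA by (simp add: X_def)
 \<comment> \<open>That \<open>w\<close> contains the kernel is its maximality. That it contains
   nothing else holds because an arrow from a generator into \<open>w\<close> lifts to
   \<open>w ** p\<close>, and \<open>\<Theta>\<close> vanishes on all arrows through that.\<close>
 have ker: "null C (c ** g) \<longleftrightarrow> \<Theta> x g = \<zero>[x]"
  if x: "x \<in> \<Omega>" and g: "arr g" "dom g = N x" "cod g = D" for x g
 proof
  assume "null C (c ** g)"
  hence "g <~ w" using ses_null_iff[OF c g(1)] g(3) cA by simp
  then obtain s where s: "arr s" "dom s = N x" "cod s = dom p" "g = (w ** p) ** s"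
   by (rule lift_through[OF x g(1,2) _ wA(1) w(3,4)])
  have "cod s = dom (w ** p)" using s(3) wA w(4) by simp
  thus "\<Theta> x g = \<zero>[x]" unfolding s(4) using w(1) x s(1,2) unfolding Q_def by blast
 next
  assume "\<Theta> x g = \<zero>[x]"
  hence "g <~ w" using x g by (intro le) (auto simp: \<Phi>_def)
  thus "null C (c ** g)" using ses_null_iff[OF c g(1)] g(3) cA by simp
 qed
 have eq: "\<Theta> x g = \<Theta> x h \<longleftrightarrow> c ** g = c ** h"
  if x: "x \<in> \<Omega>" and g: "arr g" "dom g = N x" "cod g = D" and h: "arr h" "dom h = N x" "cod h = D" for x g h
 proof -
  let ?d = "g \<boxplus> hneg C h"
  have d: "arr ?d" "dom ?d = N x" "cod ?d = D" using g h by simp_all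
  have cd: "c ** ?d = (c ** g) \<boxplus> hneg C (c ** h)" using g h cA by simp
  have 1: "null C (c ** ?d) \<longleftrightarrow> c ** g = c ** h"
   unfolding cd by (rule null_diff_iff) (use g h cA in simp_all)
  have "?d \<boxplus> h = g" by (rule hadd_hneg_cancel(2)) (use g h in simp_all)
  hence 2: "\<Theta> x g = \<Theta> x ?d \<oplus>[x] \<Theta> x h" using nat_mapD(3)[OF \<Theta> x d h] by simp
  have cc: "\<Theta> x ?d \<in> E x" "\<Theta> x h \<in> E x"
   by (rule nat_mapD(2)[OF \<Theta> x d], rule nat_mapD(2)[OF \<Theta> x h])
  have "\<Theta> x ?d = \<zero>[x] \<longleftrightarrow> \<Theta> x g = \<Theta> x h"
  proof -
   interpret A: abelian_group "rspace R x" by (rule R_abelian_group[OF x])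
   show ?thesis unfolding 2 using A.add.l_cancel_one[OF cc(2,1)] A.add.r_cancel_one[OF cc(2,1)] A.a_comm[OF cc] by simp
  qed
  thus ?thesis using ker[OF x d] 1 by simp
 qed
 have lift: "\<exists>g. g \<in> Ar C & dom g = N x & cod g = D & c ** g = f"
  if x: "x \<in> \<Omega>" and f: "arr f" "dom f = N x" "cod f = X" for x f
 by (metis m_projective x cD(2) f(1,2) f(3) X_def factors_throughE f(2) cA(2) exI)
 define L where "L x f = (SOME g. g \<in> Ar C & dom g = N x & cod g = D & c ** g = f)" for x f
 have L: "arr (L x f)" "dom (L x f) = N x" "cod (L x f) = D" "c ** L x f = f"
  if x: "x \<in> \<Omega>" and f: "arr f" "dom f = N x" "cod f = X" for x f
  using someI_ex[OF lift[OF x f]] unfolding L_def by blast+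
 \<comment> \<open>The value of \<open>\<Theta>\<close> on a chosen lift along \<open>c\<close>;
   \<open>eq\<close> makes it independent of the lift.\<close>
 define \<psi> where "\<psi> = (\<lambda>x \<in> \<Omega>. \<lambda>v \<in> carrier (rspace (F X) x). \<Theta> x (L x (v 0)))"
 have \<psi>: "\<psi> x (const_seq (c ** g)) = \<Theta> x g"
  if x: "x \<in> \<Omega>" and g: "arr g" "dom g = N x" "cod g = D" for x g
 proof -
  have cg: "arr (c ** g)" "dom (c ** g) = N x" "cod (c ** g) = X" using g cA X_def by simp_all
  have "\<psi> x (const_seq (c ** g)) = \<Theta> x (L x (c ** g))"
   unfolding \<psi>_def using x F_elemI[OF cg] by (simp only: restrict_apply' const_seq_0)
  also have "... = \<Theta> x g" using eq[OF x L(1-3)[OF x cg] g] L(4)[OF x cg] by simp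
  finally show ?thesis .
 qed
 have elem: "\<exists>g \<in> Ar C. dom g = N x & cod g = D & v = const_seq (c ** g)"
  if x: "x \<in> \<Omega>" and v: "v \<in> carrier (rspace (F X) x)" for x v
 proof -
  obtain f where f: "arr f" "dom f = N x" "cod f = X" "v = const_seq f" using v by (rule F_elemE)
  thus ?thesis using L[OF x f(1-3)] by (intro bexI[of _ "L x f"]) simp_all
 qed
 have hom: "\<psi> \<in> rep_hom P K (F X) R"
 proof (rule rep_homI)
  show "\<psi> \<in> extensional (carrier P)" unfolding \<psi>_def by simp
  fix x assume "x \<in> carrier P" hence x: "x \<in> \<Omega>" by simp
  show "\<psi> x \<in> extensional (carrier (rspace (F X) x))" unfolding \<psi>_def using x by (simp only: restrict_apply' restrict_extensional)
  fix v assume "v \<in> carrier (rspace (F X) x)"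
  then obtain g where g: "arr g" "dom g = N x" "cod g = D" "v = const_seq (c ** g)" using elem[OF x] by blast
  show "\<psi> x v \<in> E x" unfolding g(4) \<psi>[OF x g(1-3)] by (rule nat_mapD(2)[OF \<Theta> x g(1-3)])
  show "\<psi> x (v \<oplus>\<^bsub>rspace (F X) x\<^esub> w) = \<psi> x v \<oplus>[x] \<psi> x w" if ww: "w \<in> carrier (rspace (F X) x)" for w
  proof -
   obtain h where h: "arr h" "dom h = N x" "cod h = D" "w = const_seq (c ** h)" using elem[OF x ww] by blast
   have "(c ** g) \<boxplus> (c ** h) = c ** (g \<boxplus> h)" using g(1-3) h(1-3) cA by simp
   moreover have "\<psi> x (const_seq (c ** (g \<boxplus> h))) = \<Theta> x (g \<boxplus> h)" by (rule \<psi>[OF x]) (use g(1-3) h(1-3) in simp_all)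
   ultimately show ?thesis
    unfolding g(4) h(4) F_simps const_seq_0 \<psi>[OF x g(1-3)] \<psi>[OF x h(1-3)] nat_mapD(3)[OF \<Theta> x g(1-3) h(1-3), symmetric] by simp
  qed
  show "\<psi> x (v \<odot>\<^bsub>rspace (F X) x\<^esub> a) = \<psi> x v \<odot>[x] a" if a0: "a \<in> carrier (K x)" for a
  proof -
   have a: "arr a" "dom a = N x" "cod a = N x" using a0 by (simp_all add: Hom_def)
   have "(c ** g) ** a = c ** (g ** a)" using g(1-3) a cA by simp
   moreover have "\<psi> x (const_seq (c ** (g ** a))) = \<Theta> x (g ** a)" by (rule \<psi>[OF x]) (use g(1-3) a in simp_all)
   ultimately show ?thesis
    unfolding g(4) F_simps const_seq_0 \<psi>[OF x g(1-3)] nat_mapD(4)[OF \<Theta> x g(1-3) a, symmetric] by simp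
  qed
 next
  fix x y v assume xy0: "x \<in> carrier P" "y \<in> carrier P" "x \<sqsubseteq>\<^bsub>P\<^esub> y" and v: "v \<in> carrier (rspace (F X) y)"
  have x: "x \<in> \<Omega>" and y: "y \<in> \<Omega>" and xy: "m x <~ m y" using xy0 le_P by simp_all
  note i = incl[OF x y xy]
  obtain g where g: "arr g" "dom g = N y" "cod g = D" "v = const_seq (c ** g)" using elem[OF y v] by blast
  have "(c ** g) ** \<iota> x y = c ** (g ** \<iota> x y)" using g(1-3) i(1-3) cA by simp
  moreover have "\<psi> x (const_seq (c ** (g ** \<iota> x y))) = \<Theta> x (g ** \<iota> x y)" by (rule \<psi>[OF x]) (use g(1-3) i(1-3) in simp_all)
  ultimately show "\<psi> x (rmap (F X) x y v) = rmap R x y (\<psi> y v)"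
   unfolding g(4) F_simps const_seq_0 \<psi>[OF y g(1-3)] nat_mapD(5)[OF \<Theta> y g(1-3) x xy, symmetric] by simp
 qed
 have bij: "bij_betw (\<psi> x) (carrier (rspace (F X) x)) (E x)" if "x \<in> carrier P" for x
 proof -
  have x: "x \<in> \<Omega>" using that by simp
  have "inj_on (\<psi> x) (carrier (rspace (F X) x))"
  proof (rule inj_onI)
   fix v w assume vw: "v \<in> carrier (rspace (F X) x)" "w \<in> carrier (rspace (F X) x)" "\<psi> x v = \<psi> x w"
   obtain g where g: "arr g" "dom g = N x" "cod g = D" "v = const_seq (c ** g)" using elem[OF x vw(1)] by blast
   obtain h where h: "arr h" "dom h = N x" "cod h = D" "w = const_seq (c ** h)" using elem[OF x vw(2)] by blast
   have "\<Theta> x g = \<Theta> x h" using vw(3) unfolding g(4) h(4) \<psi>[OF x g(1-3)] \<psi>[OF x h(1-3)] .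
   hence "c ** g = c ** h" using eq[OF x g(1-3) h(1-3)] by simp
   thus "v = w" unfolding g(4) h(4) by (rule arg_cong)
  qed
  moreover have "\<psi> x ` carrier (rspace (F X) x) = E x"
  proof (rule equalityI)
   show "\<psi> x ` carrier (rspace (F X) x) \<subseteq> E x" using rep_homD(3)[OF hom that] by blast
   show "E x \<subseteq> \<psi> x ` carrier (rspace (F X) x)"
   proof
    fix v assume "v \<in> E x"
    then obtain g where g: "arr g" "dom g = N x" "cod g = D" "v = \<Theta> x g"
     using surj[OF x] unfolding Hom_def by blast
    have "const_seq (c ** g) \<in> carrier (rspace (F X) x)" by (rule F_elemI) (use g(1-3) cA X_def in simp_all)
    thus "v \<in> \<psi> x ` carrier (rspace (F X) x)" unfolding g(4) \<psi>[OF x g(1-3), symmetric] by (rule imageI)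
   qed
  qed
  ultimately show ?thesis unfolding bij_betw_def by blast
 qed
 have "iso_arrow (Rep_category P K \<kappa>) (F X, \<psi>, R)" by (rule rep_iso[OF hom F_pfd[OF X] R bij])
 moreover have "(F X, \<psi>, R) \<in> Hom (Rep_category P K \<kappa>) (F X) R"
  unfolding Hom_Rep_iff using hom F_pfd[OF X] R by blast
 ultimately show ?thesis using X by blast
qed

end

lemma F_equivalence: "equivalent_categories C (pfd_Rep P K \<kappa>)"
proof (rule equivalent_categoriesI[OF F_functor])
 show "f = g" if "f \<in> Hom C X Y" "g \<in> Hom C X Y" "Farr f = Farr g" for X Y f g
  by (rule F_faithful[OF that])
 show "\<exists>f \<in> Hom C X Y. Farr f = g"
  if X: "X \<in> Ob C" and Y: "Y \<in> Ob C" and g: "g \<in> Hom (pfd_Rep P K \<kappa>) (F X) (F Y)" for X Y g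
 by (metis g pfd_Rep_def Hom_Rep_iff F_full X Y)
 show "\<exists>X \<in> Ob C. \<exists>e \<in> Hom (pfd_Rep P K \<kappa>) (F X) Y. iso_arrow (pfd_Rep P K \<kappa>) e"
  if Y: "Y \<in> Ob (pfd_Rep P K \<kappa>)" for Y
 proof -
  have "is_pfd_rep P K \<kappa> Y" using Y unfolding pfd_Rep_def Ob_Rep_iff .
  thus ?thesis unfolding pfd_Rep_def by (rule F_dense)
 qed
qed

end

section \<open>Length categories equivalent to categories of representations\<close>

lemma rep_hom_zero:
 assumes f: "f \<in> rep_hom P K A B" and A: "is_pfd_rep P K \<kappa> A" and B: "is_pfd_rep P K \<kappa> B"
  and x: "x \<in> carrier P"
 shows "f x \<zero>\<^bsub>rspace A x\<^esub> = \<zero>\<^bsub>rspace B x\<^esub>"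
proof -
 note VA = pfd_repD(1)[OF A x] and VB = pfd_repD(1)[OF B x]
 have zK: "\<zero>\<^bsub>K x\<^esub> \<in> carrier (K x)"
  using VA by (simp add: right_vector_space_def skew_field_def ring.ring_simprules(2))
 have zA: "\<zero>\<^bsub>rspace A x\<^esub> \<in> carrier (rspace A x)"
  using VA by (simp add: right_vector_space_def abelian_group_def abelian_monoid.zero_closed)
 have "f x (\<zero>\<^bsub>rspace A x\<^esub> \<odot>\<^bsub>rspace A x\<^esub> \<zero>\<^bsub>K x\<^esub>) = f x \<zero>\<^bsub>rspace A x\<^esub> \<odot>\<^bsub>rspace B x\<^esub> \<zero>\<^bsub>K x\<^esub>"
  by (rule rep_homD(5)[OF f x zA zK])
 thus ?thesis
  unfolding smult_zero[OF VA zA]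
   smult_zero[OF VB rep_homD(3)[OF f x zA]] .
qed

lemma rep_iso_inverse:
 assumes e: "e \<in> Hom (Rep_category P K \<kappa>) A B" and iso: "iso_arrow (Rep_category P K \<kappa>) e"
 obtains f g where "f \<in> rep_hom P K A B" "g \<in> rep_hom P K B A"
  "!!x v. [|x \<in> carrier P; v \<in> carrier (rspace A x)|] ==> g x (f x v) = v"
  "!!x v. [|x \<in> carrier P; v \<in> carrier (rspace B x)|] ==> f x (g x v) = v"
proof -
 let ?R = "Rep_category P K \<kappa>"
 have st: "src ?R e = A" "tgt ?R e = B" using e by (simp_all add: Hom_def)
 obtain e' where e': "e' \<in> Hom ?R B A" "cmp ?R e' e = ident ?R A" "cmp ?R e e' = ident ?R B"
  using iso unfolding iso_arrow_def st by blast
 obtain f where f: "f \<in> rep_hom P K A B" "e = (A, f, B)" using e unfolding Hom_Rep_iff by blast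
 obtain g where g: "g \<in> rep_hom P K B A" "e' = (B, g, A)" using e'(1) unfolding Hom_Rep_iff by blast
 have gf: "(\<lambda>x \<in> carrier P. compose (carrier (rspace A x)) (g x) (f x)) = (\<lambda>x \<in> carrier P. \<lambda>v \<in> carrier (rspace A x). v)"
  using e'(2) unfolding f(2) g(2) cmp_Rep ident_Rep prod.inject by blast
 have fg: "(\<lambda>x \<in> carrier P. compose (carrier (rspace B x)) (f x) (g x)) = (\<lambda>x \<in> carrier P. \<lambda>v \<in> carrier (rspace B x). v)"
  using e'(3) unfolding f(2) g(2) cmp_Rep ident_Rep prod.inject by blast
 have 1: "g x (f x v) = v" if "x \<in> carrier P" "v \<in> carrier (rspace A x)" for x v
  using fun_cong[OF fun_cong[OF gf, of x], of v] that by (simp only: restrict_apply' compose_def)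
 have 2: "f x (g x v) = v" if "x \<in> carrier P" "v \<in> carrier (rspace B x)" for x v
  using fun_cong[OF fun_cong[OF fg, of x], of v] that by (simp only: restrict_apply' compose_def)
 show ?thesis by (rule that[OF f(1) g(1) 1 2])
qed

text \<open>The representation supported on a convex set \<open>U\<close>, with a one-dimensional space at each
 point of \<open>U\<close>.\<close>

definition box :: "('p => 'k ring) => ('p => 'p => 'k => 'k) => 'p set => ('p, 'k, nat => 'k) rep" where
 "box K \<kappa> U = \<lparr>
  rspace = (\<lambda>x. \<lparr>carrier = const_seq ` (if x \<in> U then carrier (K x) else {\<zero>\<^bsub>K x\<^esub>}),
   mult = (\<lambda>v w. v), one = const_seq \<zero>\<^bsub>K x\<^esub>, zero = const_seq \<zero>\<^bsub>K x\<^esub>,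
   add = (\<lambda>v w. const_seq (v 0 \<oplus>\<^bsub>K x\<^esub> w 0)), rsmult = (\<lambda>v a. const_seq (v 0 \<otimes>\<^bsub>K x\<^esub> a))\<rparr>),
  rmap = (\<lambda>x y v. const_seq (if x \<in> U then \<kappa> x y (v 0) else \<zero>\<^bsub>K x\<^esub>))\<rparr>"

lemma box_simps:
 "carrier (rspace (box K \<kappa> U) x) = const_seq ` (if x \<in> U then carrier (K x) else {\<zero>\<^bsub>K x\<^esub>})"
 "zero (rspace (box K \<kappa> U) x) = const_seq \<zero>\<^bsub>K x\<^esub>"
 "add (rspace (box K \<kappa> U) x) v w = const_seq (v 0 \<oplus>\<^bsub>K x\<^esub> w 0)"
 "rsmult (rspace (box K \<kappa> U) x) v a = const_seq (v 0 \<otimes>\<^bsub>K x\<^esub> a)"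
 "rmap (box K \<kappa> U) x y v = const_seq (if x \<in> U then \<kappa> x y (v 0) else \<zero>\<^bsub>K x\<^esub>)"
 by (simp_all add: box_def)

lemma skew_field_one_not_zero: "skew_field K ==> \<one>\<^bsub>K\<^esub> ~= \<zero>\<^bsub>K\<^esub>"
proof -
 assume "skew_field K"
 then interpret K: skew_field K .
 have "\<one>\<^bsub>K\<^esub> \<in> Units K" by (rule K.Units_one_closed)
 thus ?thesis unfolding K.skew_field_Units by blast
qed

lemma skew_field_inverse:
 assumes "skew_field K" "a \<in> carrier K" "a ~= \<zero>\<^bsub>K\<^esub>"
 obtains b where "b \<in> carrier K" "a \<otimes>\<^bsub>K\<^esub> b = \<one>\<^bsub>K\<^esub>" "b \<otimes>\<^bsub>K\<^esub> a = \<one>\<^bsub>K\<^esub>"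
proof -
 have "a \<in> Units K" unfolding skew_field.skew_field_Units[OF assms(1)] using assms(2,3) by blast
 thus ?thesis using that unfolding Units_def by blast
qed

section \<open>Box representations of convex sets\<close>

context division_ring_family
begin

abbreviation "pts \<equiv> carrier P"
abbreviation P_le (infix "\<lesssim>" 50) where "x \<lesssim> y \<equiv> x \<sqsubseteq>\<^bsub>P\<^esub> y"

lemma kappa_closed:
 "[|x \<in> pts; y \<in> pts; x \<lesssim> y; a \<in> carrier (K y)|] ==> \<kappa> x y a \<in> carrier (K x)"
 by (rule ring_hom_closed[OF kappa_hom])

lemma ring_K: "x \<in> pts ==> ring (K x)"
 by (rule skew_field.axioms(1)[OF skew_field_K])

lemma kappa_zero:
 "[|x \<in> pts; y \<in> pts; x \<lesssim> y|] ==> \<kappa> x y \<zero>\<^bsub>K y\<^esub> = \<zero>\<^bsub>K x\<^esub>"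
 by (rule ring_hom_zero[OF kappa_hom]) (simp_all add: ring_K)

lemma P_refl: "x \<in> pts ==> x \<lesssim> x"
 by (rule P.le_refl)

text \<open>The composition law makes \<open>\<kappa> x x\<close> idempotent, so it kills the
  difference \<open>d\<close> of \<open>\<kappa> x x a\<close> and \<open>a\<close>. A nonzero
  \<open>d\<close> would be invertible and the image of one would be zero.\<close>

lemma kappa_refl:
 assumes x: "x \<in> pts" and a: "a \<in> carrier (K x)" shows "\<kappa> x x a = a"
proof (rule ccontr)
 interpret K: skew_field "K x" by (rule skew_field_K[OF x])
 note h = kappa_hom[OF x x P_refl[OF x]]
 have c: "\<kappa> x x a \<in> carrier (K x)" by (rule ring_hom_closed[OF h a])
 assume ne: "\<kappa> x x a ~= a"
 define d where "d = \<kappa> x x a \<oplus>\<^bsub>K x\<^esub> (\<ominus>\<^bsub>K x\<^esub> a)"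
 have na: "\<ominus>\<^bsub>K x\<^esub> a \<in> carrier (K x)" by (rule K.a_inv_closed[OF a])
 have dc: "d \<in> carrier (K x)" unfolding d_def by (rule K.a_closed[OF c na])
 have "d ~= \<zero>\<^bsub>K x\<^esub>"
 proof
  assume "d = \<zero>\<^bsub>K x\<^esub>"
  hence "\<ominus>\<^bsub>K x\<^esub> (\<ominus>\<^bsub>K x\<^esub> a) = \<kappa> x x a" unfolding d_def by (rule K.minus_equality[OF _ na c])
  thus False using K.minus_minus[OF a] ne by simp
 qed
 then obtain e where e: "e \<in> carrier (K x)" "d \<otimes>\<^bsub>K x\<^esub> e = \<one>\<^bsub>K x\<^esub>"
  using skew_field_inverse[OF skew_field_K[OF x] dc] by metis
 have "\<kappa> x x (\<ominus>\<^bsub>K x\<^esub> a) \<oplus>\<^bsub>K x\<^esub> \<kappa> x x a = \<kappa> x x (\<ominus>\<^bsub>K x\<^esub> a \<oplus>\<^bsub>K x\<^esub> a)"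
  by (rule ring_hom_add[OF h na a, symmetric])
 also have "... = \<zero>\<^bsub>K x\<^esub>" unfolding K.l_neg[OF a] by (rule kappa_zero[OF x x P_refl[OF x]])
 finally have z: "\<kappa> x x (\<ominus>\<^bsub>K x\<^esub> a) \<oplus>\<^bsub>K x\<^esub> \<kappa> x x a = \<zero>\<^bsub>K x\<^esub>" .
 have "\<kappa> x x d = \<kappa> x x (\<kappa> x x a) \<oplus>\<^bsub>K x\<^esub> \<kappa> x x (\<ominus>\<^bsub>K x\<^esub> a)" unfolding d_def by (rule ring_hom_add[OF h c na])
 also have "\<kappa> x x (\<kappa> x x a) = \<kappa> x x a" by (rule kappa_cmp[OF x x x P_refl[OF x] P_refl[OF x] a])
 also have "\<kappa> x x a \<oplus>\<^bsub>K x\<^esub> \<kappa> x x (\<ominus>\<^bsub>K x\<^esub> a) = \<zero>\<^bsub>K x\<^esub>"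
  using z K.a_comm[OF c ring_hom_closed[OF h na]] by (rule trans[rotated])
 finally have d0: "\<kappa> x x d = \<zero>\<^bsub>K x\<^esub>" .
 have "\<one>\<^bsub>K x\<^esub> = \<kappa> x x (d \<otimes>\<^bsub>K x\<^esub> e)" unfolding e(2) by (rule ring_hom_one[OF h, symmetric])
 also have "... = \<kappa> x x d \<otimes>\<^bsub>K x\<^esub> \<kappa> x x e" by (rule ring_hom_mult[OF h dc e(1)])
 also have "... = \<zero>\<^bsub>K x\<^esub>" unfolding d0 by (rule K.l_null[OF ring_hom_closed[OF h e(1)]])
 finally show False using skew_field_one_not_zero[OF skew_field_K[OF x]] by blast
qed

lemma box_elem:
 assumes "x \<in> pts" "v \<in> carrier (rspace (box K \<kappa> U) x)"
 obtains a where "v = const_seq a" "a \<in> carrier (K x)" "x \<notin> U ==> a = \<zero>\<^bsub>K x\<^esub>"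
proof (cases "x \<in> U")
 case True
 thus ?thesis using assms(2) that unfolding box_simps by auto
next
 case False
 have "\<zero>\<^bsub>K x\<^esub> \<in> carrier (K x)" by (rule ring.ring_simprules(2)[OF ring_K[OF assms(1)]])
 thus ?thesis using False assms(2) that unfolding box_simps by auto
qed

lemma box_elemI:
 "[|a \<in> carrier (K x); x \<notin> U ==> a = \<zero>\<^bsub>K x\<^esub>|] ==> const_seq a \<in> carrier (rspace (box K \<kappa> U) x)"
 unfolding box_simps by (rule imageI) simp

lemma box_vector_space:
 assumes x: "x \<in> pts"
 shows "right_vector_space (K x) (rspace (box K \<kappa> U) x)"
proof -
 let ?V = "rspace (box K \<kappa> U) x"
 interpret K: skew_field "K x" by (rule skew_field_K[OF x])
 have "abelian_group ?V"
 proof (rule abelian_groupI)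
  fix u v w assume "u \<in> carrier ?V" "v \<in> carrier ?V" "w \<in> carrier ?V"
  then obtain a b c where a: "u = const_seq a" "a \<in> carrier (K x)" "x \<notin> U ==> a = \<zero>\<^bsub>K x\<^esub>"
   and b: "v = const_seq b" "b \<in> carrier (K x)" "x \<notin> U ==> b = \<zero>\<^bsub>K x\<^esub>"
   and c: "w = const_seq c" "c \<in> carrier (K x)" by (metis box_elem[OF x])
  show "u \<oplus>\<^bsub>?V\<^esub> v \<in> carrier ?V" unfolding a(1) b(1) box_simps(3) const_seq_0
   by (rule box_elemI) (use a(2,3) b(2,3) in simp_all)
  show "u \<oplus>\<^bsub>?V\<^esub> v \<oplus>\<^bsub>?V\<^esub> w = u \<oplus>\<^bsub>?V\<^esub> (v \<oplus>\<^bsub>?V\<^esub> w)"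
   unfolding a(1) b(1) c(1) box_simps(3) const_seq_0 const_seq_inject by (rule K.a_assoc[OF a(2) b(2) c(2)])
  show "u \<oplus>\<^bsub>?V\<^esub> v = v \<oplus>\<^bsub>?V\<^esub> u"
   unfolding a(1) b(1) box_simps(3) const_seq_0 const_seq_inject by (rule K.a_comm[OF a(2) b(2)])
  show "\<zero>\<^bsub>?V\<^esub> \<oplus>\<^bsub>?V\<^esub> u = u"
   unfolding a(1) box_simps(2,3) const_seq_0 const_seq_inject by (rule K.l_zero[OF a(2)])
  have "const_seq (\<ominus>\<^bsub>K x\<^esub> a) \<oplus>\<^bsub>?V\<^esub> u = \<zero>\<^bsub>?V\<^esub>"
   unfolding a(1) box_simps(2,3) const_seq_0 const_seq_inject by (rule K.l_neg[OF a(2)])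
  moreover have "const_seq (\<ominus>\<^bsub>K x\<^esub> a) \<in> carrier ?V" by (rule box_elemI) (use a(2,3) in simp_all)
  ultimately show "\<exists>y \<in> carrier ?V. y \<oplus>\<^bsub>?V\<^esub> u = \<zero>\<^bsub>?V\<^esub>" by (rule bexI)
 next
  show "\<zero>\<^bsub>?V\<^esub> \<in> carrier ?V" unfolding box_simps(2) by (rule box_elemI) simp_all
 qed
 then interpret V: abelian_group ?V .
 show ?thesis
 proof
  fix v a assume "v \<in> carrier ?V" and a: "a \<in> carrier (K x)"
  then obtain f where f: "v = const_seq f" "f \<in> carrier (K x)" "x \<notin> U ==> f = \<zero>\<^bsub>K x\<^esub>" by (metis box_elem[OF x])
  show "v \<odot>\<^bsub>?V\<^esub> a \<in> carrier ?V" unfolding f(1) box_simps(4) const_seq_0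
   by (rule box_elemI) (use f(2,3) a in simp_all)
  show "(v \<oplus>\<^bsub>?V\<^esub> w) \<odot>\<^bsub>?V\<^esub> a = (v \<odot>\<^bsub>?V\<^esub> a) \<oplus>\<^bsub>?V\<^esub> (w \<odot>\<^bsub>?V\<^esub> a)" if w: "w \<in> carrier ?V" for w
  proof -
   obtain g where g: "w = const_seq g" "g \<in> carrier (K x)" using w by (metis box_elem[OF x])
   show ?thesis unfolding f(1) g(1) box_simps(3,4) const_seq_0 const_seq_inject
    by (rule K.l_distr[OF f(2) g(2) a])
  qed
  fix b assume b: "b \<in> carrier (K x)"
  show "v \<odot>\<^bsub>?V\<^esub> (a \<oplus>\<^bsub>K x\<^esub> b) = (v \<odot>\<^bsub>?V\<^esub> a) \<oplus>\<^bsub>?V\<^esub> (v \<odot>\<^bsub>?V\<^esub> b)"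
   unfolding f(1) box_simps(3,4) const_seq_0 const_seq_inject by (rule K.r_distr[OF a b f(2)])
  show "v \<odot>\<^bsub>?V\<^esub> (a \<otimes>\<^bsub>K x\<^esub> b) = (v \<odot>\<^bsub>?V\<^esub> a) \<odot>\<^bsub>?V\<^esub> b"
   unfolding f(1) box_simps(4) const_seq_0 const_seq_inject by (rule K.m_assoc[OF f(2) a b, symmetric])
 next
  fix v assume "v \<in> carrier ?V"
  then obtain f where f: "v = const_seq f" "f \<in> carrier (K x)" by (metis box_elem[OF x])
  show "v \<odot>\<^bsub>?V\<^esub> \<one>\<^bsub>K x\<^esub> = v"
   unfolding f(1) box_simps(4) const_seq_0 const_seq_inject by (rule K.r_one[OF f(2)])
 qed
qed

lemma box_finite_dimensional:
 assumes x: "x \<in> pts"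
 shows "finite_dimensional (K x) (rspace (box K \<kappa> U) x)"
proof -
 let ?V = "rspace (box K \<kappa> U) x"
 interpret K: skew_field "K x" by (rule skew_field_K[OF x])
 let ?B = "if x \<in> U then {const_seq \<one>\<^bsub>K x\<^esub>} else {}"
 have "generates (K x) ?V ?B"
  unfolding generates_def
 proof (intro conjI allI impI)
  show "finite ?B" by simp
  show "?B \<subseteq> carrier ?V"
  proof (cases "x \<in> U")
   case True
   thus ?thesis using box_elemI[OF K.one_closed, of U] by simp
  qed simp
  fix W assume W: "subspace_of (K x) ?V W" and B: "?B \<subseteq> W"
  have "v \<in> W" if v: "v \<in> carrier ?V" for v
  proof -
   obtain a where a: "v = const_seq a" "a \<in> carrier (K x)" "x \<notin> U ==> a = \<zero>\<^bsub>K x\<^esub>" by (metis box_elem[OF x v])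
   show ?thesis
   proof (cases "x \<in> U")
    case True
    hence "const_seq \<one>\<^bsub>K x\<^esub> \<in> W" using B by simp
    hence "const_seq \<one>\<^bsub>K x\<^esub> \<odot>\<^bsub>?V\<^esub> a \<in> W" using W a(2) unfolding subspace_of_def by blast
    thus ?thesis unfolding box_simps(4) const_seq_0 K.l_one[OF a(2)] a(1) .
   next
    case False
    have "\<zero>\<^bsub>?V\<^esub> \<in> W" using W unfolding subspace_of_def by blast
    thus ?thesis unfolding a(1) a(3)[OF False] box_simps(2) .
   qed
  qed
  thus "W = carrier ?V" using W unfolding subspace_of_def by blast
 qed
 thus ?thesis by (rule right_vector_space.generates_finite_dimensional[OF box_vector_space[OF x]])
qed

lemma box_pfd:
 assumes convex: "!!x y z. [|x \<in> U; z \<in> U; y \<in> pts; x \<lesssim> y; y \<lesssim> z|] ==> y \<in> U"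
 shows "is_pfd_rep P K \<kappa> (box K \<kappa> U)"
proof (rule pfd_repI)
 let ?V = "\<lambda>x. rspace (box K \<kappa> U) x"
 fix x assume x: "x \<in> pts"
 interpret K: skew_field "K x" by (rule skew_field_K[OF x])
 show "right_vector_space (K x) (?V x)" by (rule box_vector_space[OF x])
 show "finite_dimensional (K x) (?V x)" by (rule box_finite_dimensional[OF x])
 show "rmap (box K \<kappa> U) x x v = v" if v: "v \<in> carrier (?V x)" for v
 proof -
  obtain a where a: "v = const_seq a" "a \<in> carrier (K x)" "x \<notin> U ==> a = \<zero>\<^bsub>K x\<^esub>" by (metis box_elem[OF x v])
  show ?thesis unfolding a(1) box_simps(5) const_seq_0 const_seq_inject kappa_refl[OF x a(2)] using a(3) by simp
 qed
 fix y assume y: "y \<in> pts" and xy: "x \<lesssim> y"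
 note h = kappa_hom[OF x y xy]
 show "rmap (box K \<kappa> U) x z v = rmap (box K \<kappa> U) x y (rmap (box K \<kappa> U) y z v)"
  if z: "z \<in> pts" and yz: "y \<lesssim> z" and v: "v \<in> carrier (?V z)" for z v
 proof -
  obtain a where a: "v = const_seq a" "a \<in> carrier (K z)" "z \<notin> U ==> a = \<zero>\<^bsub>K z\<^esub>" by (metis box_elem[OF z v])
  have xz: "x \<lesssim> z" by (rule P.le_trans[OF xy yz x y z])
  show ?thesis
  proof (cases "x \<in> U & y \<notin> U")
   case True
   \<comment> \<open>The composite through a point y outside \<open>U\<close> is zero, so
     functoriality needs the direct map from z to x to vanish; convexity ensures this, since z
     cannot lie in \<open>U\<close>.\<close>
   hence "z \<notin> U" using convex[of x z y] y xy yz by blast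
   hence a0: "a = \<zero>\<^bsub>K z\<^esub>" by (rule a(3))
   show ?thesis unfolding a(1) a0 box_simps(5) const_seq_0 const_seq_inject kappa_zero[OF x z xz]
    using True kappa_zero[OF x y xy] by simp
  next
   case False
   thus ?thesis unfolding a(1) box_simps(5) const_seq_0 const_seq_inject
    using kappa_cmp[OF x y z xy yz a(2)] by auto
  qed
 qed
 fix v assume v: "v \<in> carrier (?V y)"
 obtain a where a: "v = const_seq a" "a \<in> carrier (K y)" by (rule box_elem[OF y v])
 show "rmap (box K \<kappa> U) x y v \<in> carrier (?V x)"
  unfolding a(1) box_simps(5) const_seq_0
  by (rule box_elemI) (use ring_hom_closed[OF h a(2)] in auto)
 show "rmap (box K \<kappa> U) x y (v \<oplus>\<^bsub>?V y\<^esub> w) = rmap (box K \<kappa> U) x y v \<oplus>\<^bsub>?V x\<^esub> rmap (box K \<kappa> U) x y w"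
  if w: "w \<in> carrier (?V y)" for w
 proof -
  obtain b where b: "w = const_seq b" "b \<in> carrier (K y)" by (rule box_elem[OF y w])
  show ?thesis unfolding a(1) b(1) box_simps(3,5) const_seq_0 const_seq_inject
   using ring_hom_add[OF h a(2) b(2)] by simp
 qed
 show "rmap (box K \<kappa> U) x y (v \<odot>\<^bsub>?V y\<^esub> b) = rmap (box K \<kappa> U) x y v \<odot>\<^bsub>?V x\<^esub> \<kappa> x y b"
  if b: "b \<in> carrier (K y)" for b
  unfolding a(1) box_simps(4,5) const_seq_0 const_seq_inject
  using ring_hom_mult[OF h a(2) b] ring_hom_closed[OF h b] by simp
qed

end

text \<open>Of the equivalence only a full, faithful and dense functor is kept. Through it objects
  of C have vectors and arrows of C act on them.\<close>

locale rep_equivalence = length_category C + D: division_ring_family P K \<kappa>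
 for C :: "('o, 'a, 'm) preadditive_scheme" (structure)
  and P :: "'p gorder" and K :: "'p => 'k ring" and \<kappa> +
 fixes Fo :: "'o => ('p, 'k, nat => 'k) rep" and Fa :: "'a => ('p, 'k, nat => 'k) rep_arrow"
 assumes is_functor: "cat_functor C (pfd_Rep P K \<kappa>) Fo Fa"
  and faithful: "[|f \<in> Hom C X Y; g \<in> Hom C X Y; Fa f = Fa g|] ==> f = g"
  and full: "[|X \<in> Ob C; Y \<in> Ob C; h \<in> Hom (pfd_Rep P K \<kappa>) (Fo X) (Fo Y)|] ==> \<exists>f \<in> Hom C X Y. Fa f = h"
  and dense: "R \<in> Ob (pfd_Rep P K \<kappa>) ==> \<exists>X \<in> Ob C. \<exists>e \<in> Hom (pfd_Rep P K \<kappa>) (Fo X) R. iso_arrow (pfd_Rep P K \<kappa>) e"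
begin

abbreviation "V X x \<equiv> rspace (Fo X) x"
abbreviation "pts \<equiv> carrier P"
abbreviation "E X x \<equiv> carrier (V X x)"
abbreviation V_add ("_ \<oplus>[_,_] _" [65, 0, 0, 66] 65) where "v \<oplus>[X,x] w \<equiv> v \<oplus>\<^bsub>V X x\<^esub> w"
abbreviation V_mul ("_ \<odot>[_,_] _" [70, 0, 0, 71] 70) where "v \<odot>[X,x] a \<equiv> v \<odot>\<^bsub>V X x\<^esub> a"
abbreviation V_zero' ("\<zero>[_,_]") where "\<zero>[X,x] \<equiv> \<zero>\<^bsub>V X x\<^esub>"

definition act :: "'a => 'p => (nat => 'k) => nat => 'k" where
 "act f = fst (snd (Fa f))"

lemma Fo_pfd: "X \<in> Ob C ==> is_pfd_rep P K \<kappa> (Fo X)"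
 using cat_functor.Fo_Ob[OF is_functor] unfolding pfd_Rep_def Ob_Rep_iff .

lemma V_vector_space: "X \<in> Ob C ==> x \<in> pts ==> right_vector_space (K x) (V X x)"
 by (rule pfd_repD(1)[OF Fo_pfd])

lemma V_zero: "X \<in> Ob C ==> x \<in> pts ==> \<zero>[X,x] \<in> E X x"
 using V_vector_space[of X x] by (simp add: right_vector_space_def abelian_group_def abelian_monoid.zero_closed)

lemma act_hom:
 assumes f: "arr f" "dom f = X" "cod f = Y"
 shows "act f \<in> rep_hom P K (Fo X) (Fo Y)" and Fa_eq: "Fa f = (Fo X, act f, Fo Y)"
proof -
 have "f \<in> Hom C X Y" using f by (simp add: Hom_def)
 hence "Fa f \<in> Hom (Rep_category P K \<kappa>) (Fo X) (Fo Y)"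
  using cat_functor.Fa_Hom[OF is_functor] unfolding pfd_Rep_def by blast
 then obtain \<theta> where t: "\<theta> \<in> rep_hom P K (Fo X) (Fo Y)" "Fa f = (Fo X, \<theta>, Fo Y)"
  unfolding Hom_Rep_iff by blast
 show "act f \<in> rep_hom P K (Fo X) (Fo Y)" "Fa f = (Fo X, act f, Fo Y)"
  unfolding act_def t(2) fst_conv snd_conv by (rule t(1), rule refl)
qed

lemma act_closed:
 "[|arr f; dom f = X; cod f = Y; x \<in> pts; v \<in> E X x|] ==> act f x v \<in> E Y x"
 by (rule rep_homD(3)[OF act_hom(1)])

lemma act_smult:
 "[|arr f; dom f = X; cod f = Y; x \<in> pts; v \<in> E X x; a \<in> carrier (K x)|]
  ==> act f x (v \<odot>[X,x] a) = act f x v \<odot>[Y,x] a"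
 by (rule rep_homD(5)[OF act_hom(1)])

lemma act_add:
 "[|arr f; dom f = X; cod f = Y; x \<in> pts; v \<in> E X x; w \<in> E X x|]
  ==> act f x (v \<oplus>[X,x] w) = act f x v \<oplus>[Y,x] act f x w"
 by (rule rep_homD(4)[OF act_hom(1)])

lemma act_rmap:
 "[|arr f; dom f = X; cod f = Y; x \<in> pts; y \<in> pts; x \<lesssim> y; v \<in> E X y|]
  ==> act f x (rmap (Fo X) x y v) = rmap (Fo Y) x y (act f y v)"
 by (rule rep_homD(6)[OF act_hom(1)])

lemma act_zero:
 assumes f: "arr f" "dom f = X" "cod f = Y" and x: "x \<in> pts"
 shows "act f x \<zero>[X,x] = \<zero>[Y,x]"
proof -
 have "X \<in> Ob C" "Y \<in> Ob C" using f by auto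
 thus ?thesis using rep_hom_zero[OF act_hom(1)[OF f] Fo_pfd Fo_pfd x] by blast
qed

lemma act_ident:
 assumes X: "X \<in> Ob C" and x: "x \<in> pts" and v: "v \<in> E X x"
 shows "act (ident C X) x v = v"
proof -
 have "Fa (ident C X) = ident (Rep_category P K \<kappa>) (Fo X)"
  using cat_functor.Fa_ident[OF is_functor X] unfolding pfd_Rep_def .
 hence "act (ident C X) = (\<lambda>x \<in> pts. \<lambda>v \<in> E X x. v)"
  unfolding act_def ident_Rep by (simp only: fst_conv snd_conv)
 thus ?thesis using x v by (simp only: restrict_apply')
qed

lemma act_cmp:
 assumes f: "arr f" "dom f = X" "cod f = Y" and g: "arr g" "dom g = Y"
  and x: "x \<in> pts" and v: "v \<in> E X x"
 shows "act (g ** f) x v = act g x (act f x v)"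
proof -
 have "f \<in> Hom C X Y" "g \<in> Hom C Y (cod g)" using f g by (simp_all add: Hom_def)
 hence "Fa (g ** f) = cmp (Rep_category P K \<kappa>) (Fa g) (Fa f)"
  using cat_functor.Fa_cmp[OF is_functor] unfolding pfd_Rep_def by blast
 also have "... = (Fo X, (\<lambda>x \<in> pts. compose (E X x) (act g x) (act f x)), Fo (cod g))"
  unfolding Fa_eq[OF f] Fa_eq[OF g refl] cmp_Rep ..
 finally have "act (g ** f) = (\<lambda>x \<in> pts. compose (E X x) (act g x) (act f x))"
  unfolding act_def[of "g ** f"] by (simp only: fst_conv snd_conv)
 thus ?thesis using x v by (simp only: restrict_apply' compose_def)
qed

lemma act_eqI:
 assumes f: "arr f" "dom f = X" "cod f = Y" and g: "arr g" "dom g = X" "cod g = Y"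
  and eq: "!!x v. [|x \<in> pts; v \<in> E X x|] ==> act f x v = act g x v"
 shows "f = g"
proof -
 have "act f = act g" by (rule rep_hom_eqI[OF act_hom(1)[OF f] act_hom(1)[OF g] eq])
 hence e: "Fa f = Fa g" unfolding Fa_eq[OF f] Fa_eq[OF g] by (simp only:)
 have "f \<in> Hom C X Y" "g \<in> Hom C X Y" using f g by (simp_all add: Hom_def)
 thus ?thesis using e by (rule faithful)
qed

lemma act_full:
 assumes X: "X \<in> Ob C" and Y: "Y \<in> Ob C" and \<theta>: "\<theta> \<in> rep_hom P K (Fo X) (Fo Y)"
 obtains f where "arr f" "dom f = X" "cod f = Y" "act f = \<theta>"
proof -
 have "(Fo X, \<theta>, Fo Y) \<in> Hom (pfd_Rep P K \<kappa>) (Fo X) (Fo Y)"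
  unfolding pfd_Rep_def Hom_Rep_iff using \<theta> Fo_pfd[OF X] Fo_pfd[OF Y] by blast
 then obtain f where f: "f \<in> Hom C X Y" "Fa f = (Fo X, \<theta>, Fo Y)" using full[OF X Y] by blast
 have "arr f" "dom f = X" "cod f = Y" using f(1) by (simp_all add: Hom_def)
 moreover have "act f = \<theta>" unfolding act_def f(2) by (simp only: fst_conv snd_conv)
 ultimately show ?thesis by (rule that)
qed

text \<open>\<open>X\<close> corresponds to the box representation of \<open>U\<close>, with basis vector \<open>u y\<close> at \<open>y\<close>.\<close>

definition is_model :: "'o => ('p => nat => 'k) => 'p set => bool" where
 "is_model X u U \<longleftrightarrow> X \<in> Ob C & U \<subseteq> carrier P &
  (\<forall>y \<in> U. u y \<in> E X y) &
  (\<forall>y \<in> U. \<forall>w \<in> E X y. \<exists>a \<in> carrier (K y). w = u y \<odot>[X,y] a) &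
  (\<forall>y \<in> U. \<forall>a \<in> carrier (K y). u y \<odot>[X,y] a = \<zero>[X,y] --> a = \<zero>\<^bsub>K y\<^esub>) &
  (\<forall>y \<in> pts. y \<notin> U --> (\<forall>w \<in> E X y. w = \<zero>[X,y])) &
  (\<forall>z \<in> U. \<forall>y \<in> U. z \<lesssim> y --> rmap (Fo X) z y (u y) = u z)"

lemma is_modelD:
 assumes "is_model X u U"
 shows "X \<in> Ob C" "U \<subseteq> carrier P" "y \<in> U ==> y \<in> pts" "y \<in> U ==> u y \<in> E X y"
  "[|y \<in> U; w \<in> E X y|] ==> \<exists>a \<in> carrier (K y). w = u y \<odot>[X,y] a"
  "[|y \<in> U; a \<in> carrier (K y); u y \<odot>[X,y] a = \<zero>[X,y]|] ==> a = \<zero>\<^bsub>K y\<^esub>"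
  "[|y \<in> pts; y \<notin> U; w \<in> E X y|] ==> w = \<zero>[X,y]"
  "[|z \<in> U; y \<in> U; z \<lesssim> y|] ==> rmap (Fo X) z y (u y) = u z"
 using assms unfolding is_model_def by blast+

text \<open>Density gives an object isomorphic to the box representation, and the basis vectors are
  the images of the units under the isomorphism.\<close>

lemma model_exists:
 assumes U: "U \<subseteq> carrier P"
  and convex: "!!x y z. [|x \<in> U; z \<in> U; y \<in> pts; x \<lesssim> y; y \<lesssim> z|] ==> y \<in> U"
 shows "\<exists>X u. is_model X u U"
proof -
 let ?B = "box K \<kappa> U"
 have B: "is_pfd_rep P K \<kappa> ?B" by (rule D.box_pfd[OF convex])
 then obtain X e where X: "X \<in> Ob C" and e: "e \<in> Hom (Rep_category P K \<kappa>) (Fo X) ?B"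
  "iso_arrow (Rep_category P K \<kappa>) e"
  using dense[of ?B] unfolding pfd_Rep_def Ob_Rep_iff by blast
 obtain f g where f: "f \<in> rep_hom P K (Fo X) ?B" and g: "g \<in> rep_hom P K ?B (Fo X)"
  and gf: "!!x v. [|x \<in> pts; v \<in> E X x|] ==> g x (f x v) = v"
  and fg: "!!x v. [|x \<in> pts; v \<in> carrier (rspace ?B x)|] ==> f x (g x v) = v"
  by (rule rep_iso_inverse[OF e]) blast
 define u where "u y = g y (const_seq \<one>\<^bsub>K y\<^esub>)" for y
 have one: "\<one>\<^bsub>K y\<^esub> \<in> carrier (K y)" if "y \<in> pts" for y
  by (rule ring.ring_simprules(6)[OF D.ring_K[OF that]])
 have oneB: "const_seq \<one>\<^bsub>K y\<^esub> \<in> carrier (rspace ?B y)" if "y \<in> U" for y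
  by (rule D.box_elemI[OF one]) (use that U in blast)+
 have mult: "u y \<odot>[X,y] a = g y (const_seq a)" if y: "y \<in> U" and a: "a \<in> carrier (K y)" for y a
 proof -
  have yP: "y \<in> pts" using y U by blast
  have "g y (const_seq \<one>\<^bsub>K y\<^esub> \<odot>\<^bsub>rspace ?B y\<^esub> a) = u y \<odot>[X,y] a"
   unfolding u_def by (rule rep_homD(5)[OF g yP oneB[OF y] a])
  thus ?thesis unfolding box_simps(4) const_seq_0 ring.ring_simprules(12)[OF D.ring_K[OF yP] a] by (rule sym)
 qed
 have g0: "g y (const_seq \<zero>\<^bsub>K y\<^esub>) = \<zero>[X,y]" if "y \<in> pts" for y
  using rep_hom_zero[OF g B Fo_pfd[OF X] that] unfolding box_simps(2) .
 have f0: "f y \<zero>[X,y] = const_seq \<zero>\<^bsub>K y\<^esub>" if "y \<in> pts" for y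
  using rep_hom_zero[OF f Fo_pfd[OF X] B that] unfolding box_simps(2) .
 have "is_model X u U"
  unfolding is_model_def
 proof (intro conjI ballI impI)
  show "X \<in> Ob C" by (rule X)
  show "U \<subseteq> carrier P" by (rule U)
  fix y assume y: "y \<in> U"
  have yP: "y \<in> pts" using y U by blast
  show "u y \<in> E X y" unfolding u_def by (rule rep_homD(3)[OF g yP oneB[OF y]])
  show "\<exists>a \<in> carrier (K y). w = u y \<odot>[X,y] a" if w: "w \<in> E X y" for w
  proof -
   obtain a where a: "f y w = const_seq a" "a \<in> carrier (K y)"
    using rep_homD(3)[OF f yP w] by (rule D.box_elem[OF yP])
   have "w = u y \<odot>[X,y] a" using gf[OF yP w] unfolding a(1) mult[OF y a(2)] by (rule sym)
   thus ?thesis using a(2) by (rule bexI)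
  qed
  show "a = \<zero>\<^bsub>K y\<^esub>" if a: "a \<in> carrier (K y)" and z: "u y \<odot>[X,y] a = \<zero>[X,y]" for a
  proof -
   have "const_seq a \<in> carrier (rspace ?B y)" by (rule D.box_elemI[OF a]) (use y in blast)
   from fg[OF yP this] have "const_seq \<zero>\<^bsub>K y\<^esub> = const_seq a"
    unfolding mult[OF y a, symmetric] z f0[OF yP] .
   thus ?thesis unfolding const_seq_inject by (rule sym)
  qed
  show "rmap (Fo X) y z (u z) = u y" if z: "z \<in> U" and yz: "y \<lesssim> z" for z
  proof -
   have zP: "z \<in> pts" using z U by blast
   have "g y (rmap ?B y z (const_seq \<one>\<^bsub>K z\<^esub>)) = rmap (Fo X) y z (u z)"
    unfolding u_def by (rule rep_homD(6)[OF g yP zP yz oneB[OF z]])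
   thus ?thesis
    unfolding box_simps(5) const_seq_0 if_P[OF y] ring_hom_one[OF D.kappa_hom[OF yP zP yz]] u_def by (rule sym)
  qed
 next
  fix y w assume y: "y \<in> pts" "y \<notin> U" and w: "w \<in> E X y"
  have "f y w \<in> carrier (rspace ?B y)" by (rule rep_homD(3)[OF f y(1) w])
  hence "f y w = const_seq \<zero>\<^bsub>K y\<^esub>" using y(2) unfolding box_simps(1) by simp
  thus "w = \<zero>[X,y]" using gf[OF y(1) w] g0[OF y(1)] by simp
 qed
 thus ?thesis by blast
qed

text \<open>The functor is not assumed to be additive. A zero arrow factors through any object, in
  particular through one that models the empty set, where all vectors are zero.\<close>

lemma act_null:
 assumes f: "arr f" "dom f = X" "cod f = Y" "null C f" and x: "x \<in> pts" and v: "v \<in> E X x"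
 shows "act f x v = \<zero>[Y,x]"
proof -
 have XY: "X \<in> Ob C" "Y \<in> Ob C" using f by auto
 obtain Z w where m: "is_model Z w {}" using model_exists[of "{}"] by blast
 note Z = is_modelD(1)[OF m]
 have z1: "arr (hzero C X Z)" "dom (hzero C X Z) = X" "cod (hzero C X Z) = Z"
  and z2: "arr (hzero C Z Y)" "dom (hzero C Z Y) = Z" "cod (hzero C Z Y) = Y" using XY Z by simp_all
 have "null C (hzero C Z Y)" using z2 by (simp add: null_def)
 hence "null C (hzero C Z Y ** hzero C X Z)" by (rule null_cmp_left[OF _ z1(1) z2(1)]) (use z1(3) z2(2) in simp)
 hence "f = hzero C Z Y ** hzero C X Z"
  by (rule null_eqI[OF f(4)]) (use f z1 z2 in simp_all)
 hence "act f x v = act (hzero C Z Y) x (act (hzero C X Z) x v)"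
  using act_cmp[OF z1 z2(1,2) x v] by simp
 also have "act (hzero C X Z) x v = \<zero>[Z,x]" by (rule is_modelD(7)[OF m x _ act_closed[OF z1 x v]]) simp
 also have "act (hzero C Z Y) x \<zero>[Z,x] = \<zero>[Y,x]" by (rule act_zero[OF z2 x])
 finally show ?thesis .
qed

lemma null_actI:
 assumes f: "arr f" "dom f = X" "cod f = Y"
  and eq: "!!x v. [|x \<in> pts; v \<in> E X x|] ==> act f x v = \<zero>[Y,x]"
 shows "null C f"
proof -
 have XY: "X \<in> Ob C" "Y \<in> Ob C" using f by auto
 have z: "arr (hzero C X Y)" "dom (hzero C X Y) = X" "cod (hzero C X Y) = Y" "null C (hzero C X Y)"
  using XY by (simp_all add: null_def)
 have "f = hzero C X Y"
  by (rule act_eqI[OF f z(1-3)]) (simp only: eq act_null[OF z])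
 thus ?thesis using z(4) by simp
qed

text \<open>The model of a principal down-set is generated by its vector at x: the basis vectors
  below are its restrictions.\<close>

lemma model_eqI:
 assumes X: "is_model X u {y \<in> pts. y \<lesssim> x}" and x: "x \<in> pts"
  and f: "arr f" "dom f = X" "cod f = Y" and g: "arr g" "dom g = X" "cod g = Y"
  and eq: "act f x (u x) = act g x (u x)"
 shows "f = g"
proof (rule act_eqI[OF f g])
 let ?U = "{y \<in> pts. y \<lesssim> x}"
 note m = is_modelD[OF X]
 have xU: "x \<in> ?U" using x D.P_refl[OF x] by blast
 fix y v assume y: "y \<in> pts" and v: "v \<in> E X y"
 show "act f y v = act g y v"
 proof (cases "y \<in> ?U")
  case True
  hence yx: "y \<lesssim> x" by blast
  obtain a where a: "a \<in> carrier (K y)" "v = u y \<odot>[X,y] a" using m(5)[OF True v] by (rule bexE)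
  have r: "u y = rmap (Fo X) y x (u x)" by (rule m(8)[OF True xU yx, symmetric])
  have "act f y (u y) = act g y (u y)"
   unfolding r act_rmap[OF f y x yx m(4)[OF xU]] act_rmap[OF g y x yx m(4)[OF xU]] eq ..
  thus ?thesis
   unfolding a(2) act_smult[OF f y m(4)[OF True] a(1)] act_smult[OF g y m(4)[OF True] a(1)] by simp
 next
  case False
  have "v = \<zero>[X,y]" by (rule m(7)[OF y False v])
  thus ?thesis using act_zero[OF f y] act_zero[OF g y] by simp
 qed
qed

text \<open>The Yoneda lemma for representations: the basis vector at y times a is sent to the
  restriction of \<open>v\<close> to y times a, and zero is taken outside the down-set.\<close>

lemma model_lift:
 assumes X: "is_model X u {y \<in> pts. y \<lesssim> x}" and x: "x \<in> pts"
  and Y: "Y \<in> Ob C" and v: "v \<in> E Y x"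
 obtains f where "arr f" "dom f = X" "cod f = Y" "act f x (u x) = v"
proof -
 let ?U = "{y \<in> pts. y \<lesssim> x}"
 note m = is_modelD[OF X]
 have xU: "x \<in> ?U" using x D.P_refl[OF x] by blast
 have rv: "rmap (Fo Y) y x v \<in> E Y y" if "y \<in> ?U" for y
  using rmap_closed[OF Fo_pfd[OF Y] _ x _ v] that by blast
 define c where "c y w = (SOME a. a \<in> carrier (K y) & w = u y \<odot>[X,y] a)" for y w
 have c: "c y w \<in> carrier (K y)" "w = u y \<odot>[X,y] c y w" if "y \<in> ?U" "w \<in> E X y" for y w
 proof -
  have "\<exists>a. a \<in> carrier (K y) & w = u y \<odot>[X,y] a" using m(5)[OF that] by blast
  from someI_ex[OF this] show "c y w \<in> carrier (K y)" "w = u y \<odot>[X,y] c y w" unfolding c_def by blast+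
 qed
 have c_eq: "c y (u y \<odot>[X,y] a) = a" if y: "y \<in> ?U" and a: "a \<in> carrier (K y)" for y a
 proof -
  interpret VX: right_vector_space "K y" "V X y" by (rule V_vector_space[OF m(1) m(3)[OF y]])
  note uy = m(4)[OF y]
  have w: "u y \<odot>[X,y] a \<in> E X y" by (rule VX.rsmult_closed[OF uy a])
  define b where "b = c y (u y \<odot>[X,y] a)"
  have b: "b \<in> carrier (K y)" "u y \<odot>[X,y] a = u y \<odot>[X,y] b" unfolding b_def using c[OF y w] by blast+
  have na: "\<ominus>\<^bsub>K y\<^esub> a \<in> carrier (K y)" by (rule VX.K.a_inv_closed[OF a])
  have "u y \<odot>[X,y] (b \<oplus>\<^bsub>K y\<^esub> \<ominus>\<^bsub>K y\<^esub> a) = (u y \<odot>[X,y] b) \<oplus>[X,y] (u y \<odot>[X,y] (\<ominus>\<^bsub>K y\<^esub> a))"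
   by (rule VX.rsmult_add_right[OF uy b(1) na])
  also have "... = u y \<odot>[X,y] (a \<oplus>\<^bsub>K y\<^esub> \<ominus>\<^bsub>K y\<^esub> a)"
   unfolding b(2)[symmetric] by (rule VX.rsmult_add_right[OF uy a na, symmetric])
  also have "... = \<zero>[X,y]" unfolding VX.K.r_neg[OF a] by (rule VX.rsmult_zero_right[OF uy])
  finally have "b \<oplus>\<^bsub>K y\<^esub> \<ominus>\<^bsub>K y\<^esub> a = \<zero>\<^bsub>K y\<^esub>" by (rule m(6)[OF y VX.K.a_closed[OF b(1) na]])
  hence "\<ominus>\<^bsub>K y\<^esub> (\<ominus>\<^bsub>K y\<^esub> a) = b" by (rule VX.K.minus_equality[OF _ na b(1)])
  thus ?thesis using VX.K.minus_minus[OF a] unfolding b_def by (rule trans[OF sym])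
 qed
 define \<theta> where "\<theta> = (\<lambda>y \<in> pts. \<lambda>w \<in> E X y.
  if y \<in> ?U then rmap (Fo Y) y x v \<odot>[Y,y] c y w else \<zero>[Y,y])"
 have ev0: "\<theta> y w = (if y \<in> ?U then rmap (Fo Y) y x v \<odot>[Y,y] c y w else \<zero>[Y,y])"
  if "y \<in> pts" "w \<in> E X y" for y w
  unfolding \<theta>_def using that by (simp only: restrict_apply')
 have ev: "\<theta> y (u y \<odot>[X,y] a) = rmap (Fo Y) y x v \<odot>[Y,y] a" if y: "y \<in> ?U" and a: "a \<in> carrier (K y)" for y a
  unfolding ev0[OF m(3)[OF y] smult_closed[OF V_vector_space[OF m(1) m(3)[OF y]] m(4)[OF y] a]]
   if_P[OF y] c_eq[OF y a] ..
 have evz: "\<theta> y w = \<zero>[Y,y]" if y: "y \<in> pts" "y \<notin> ?U" and w: "w \<in> E X y" for y w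
  unfolding ev0[OF y(1) w] if_not_P[OF y(2)] ..
 have "\<theta> \<in> rep_hom P K (Fo X) (Fo Y)"
 proof (rule rep_homI)
  show "\<theta> \<in> extensional (carrier P)" unfolding \<theta>_def by simp
  fix y assume y: "y \<in> pts"
  note VX = V_vector_space[OF m(1) y] and VY = V_vector_space[OF Y y]
  show "\<theta> y \<in> extensional (E X y)" unfolding \<theta>_def using y by (simp only: restrict_apply' restrict_extensional)
  have AX: "abelian_monoid (V X y)" using VX by (simp add: right_vector_space_def abelian_group_def)
  have AY: "abelian_monoid (V Y y)" using VY by (simp add: right_vector_space_def abelian_group_def)
  fix w assume w: "w \<in> E X y"
  show "\<theta> y w \<in> E Y y"
  proof (cases "y \<in> ?U")
   case True
   show ?thesis unfolding ev0[OF y w] if_P[OF True]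
    by (rule smult_closed[OF VY rv[OF True] c(1)[OF True w]])
  next
   case False
   show ?thesis unfolding evz[OF y False w] by (rule V_zero[OF Y y])
  qed
  show "\<theta> y (w \<oplus>[X,y] w') = \<theta> y w \<oplus>[Y,y] \<theta> y w'" if w': "w' \<in> E X y" for w'
  proof (cases "y \<in> ?U")
   case True
   obtain a where a: "a \<in> carrier (K y)" "w = u y \<odot>[X,y] a" using m(5)[OF True w] by (rule bexE)
   obtain b where b: "b \<in> carrier (K y)" "w' = u y \<odot>[X,y] b" using m(5)[OF True w'] by (rule bexE)
   have ab: "a \<oplus>\<^bsub>K y\<^esub> b \<in> carrier (K y)" by (rule ring.ring_simprules(1)[OF D.ring_K[OF y] a(1) b(1)])
   show ?thesis
    unfolding a(2) b(2) smult_add[OF VX m(4)[OF True] a(1) b(1), symmetric]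
     ev[OF True a(1)] ev[OF True b(1)] ev[OF True ab]
    by (rule smult_add[OF VY rv[OF True] a(1) b(1)])
  next
   case False
   show ?thesis unfolding evz[OF y False w] evz[OF y False w'] evz[OF y False abelian_monoid.a_closed[OF AX w w']]
    by (rule abelian_monoid.l_zero[OF AY V_zero[OF Y y], symmetric])
  qed
  show "\<theta> y (w \<odot>[X,y] b) = \<theta> y w \<odot>[Y,y] b" if b: "b \<in> carrier (K y)" for b
  proof (cases "y \<in> ?U")
   case True
   obtain a where a: "a \<in> carrier (K y)" "w = u y \<odot>[X,y] a" using m(5)[OF True w] by (rule bexE)
   have ab: "a \<otimes>\<^bsub>K y\<^esub> b \<in> carrier (K y)" by (rule ring.ring_simprules(5)[OF D.ring_K[OF y] a(1) b])
   show ?thesis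
    unfolding a(2) smult_assoc[OF VX m(4)[OF True] a(1) b, symmetric]
     ev[OF True a(1)] ev[OF True ab]
    by (rule smult_assoc[OF VY rv[OF True] a(1) b])
  next
   case False
   show ?thesis
    unfolding evz[OF y False w] evz[OF y False smult_closed[OF VX w b]]
    by (rule zero_smult[OF VY b, symmetric])
  qed
 next
  fix z y w assume zy: "z \<in> pts" "y \<in> pts" "z \<lesssim> y" and w: "w \<in> E X y"
  show "\<theta> z (rmap (Fo X) z y w) = rmap (Fo Y) z y (\<theta> y w)"
  proof (cases "y \<in> ?U")
   case True
   hence yx: "y \<lesssim> x" by blast
   have zU: "z \<in> ?U" using D.P.le_trans[OF zy(3) yx zy(1,2) x] zy(1) by blast
   obtain a where a: "a \<in> carrier (K y)" "w = u y \<odot>[X,y] a" using m(5)[OF True w] by (rule bexE)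
   have k: "\<kappa> z y a \<in> carrier (K z)" by (rule D.kappa_closed[OF zy a(1)])
   have "rmap (Fo X) z y w = rmap (Fo X) z y (u y) \<odot>[X,z] \<kappa> z y a"
    unfolding a(2) by (rule pfd_repD(6)[OF Fo_pfd[OF m(1)] zy m(4)[OF True] a(1)])
   hence 1: "rmap (Fo X) z y w = u z \<odot>[X,z] \<kappa> z y a" unfolding m(8)[OF zU True zy(3)] .
   have 2: "rmap (Fo Y) z x v = rmap (Fo Y) z y (rmap (Fo Y) y x v)"
    by (rule pfd_repD(4)[OF Fo_pfd[OF Y] zy(1,2) x zy(3) yx v])
   show ?thesis unfolding 1 ev[OF zU k] unfolding a(2) ev[OF True a(1)] 2
    by (rule pfd_repD(6)[OF Fo_pfd[OF Y] zy rv[OF True] a(1), symmetric])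
  next
   case False
   have "w = \<zero>[X,y]" by (rule m(7)[OF zy(2) False w])
   hence r: "rmap (Fo X) z y w = \<zero>[X,z]" using rmap_zero[OF Fo_pfd[OF m(1)] zy] by simp
   have t: "\<theta> z \<zero>[X,z] = \<zero>[Y,z]"
   proof (cases "z \<in> ?U")
    case True
    have zK: "\<zero>\<^bsub>K z\<^esub> \<in> carrier (K z)" by (rule ring.ring_simprules(2)[OF D.ring_K[OF zy(1)]])
    show ?thesis
     using ev[OF True zK]
     unfolding smult_zero[OF V_vector_space[OF m(1) zy(1)] m(4)[OF True]]
      smult_zero[OF V_vector_space[OF Y zy(1)] rv[OF True]] .
   next
    case False
    show ?thesis by (rule evz[OF zy(1) False V_zero[OF m(1) zy(1)]])
   qed
   show ?thesis unfolding r t evz[OF zy(2) False w] by (rule rmap_zero[OF Fo_pfd[OF Y] zy, symmetric])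
  qed
 qed
 then obtain f where f: "arr f" "dom f = X" "cod f = Y" "act f = \<theta>" by (rule act_full[OF m(1) Y])
 have oneK: "\<one>\<^bsub>K x\<^esub> \<in> carrier (K x)" by (rule ring.ring_simprules(6)[OF D.ring_K[OF x]])
 have "\<theta> x (u x) = v"
  using ev[OF xU oneK]
  unfolding smult_one[OF V_vector_space[OF m(1) x] m(4)[OF xU]]
   pfd_repD(3)[OF Fo_pfd[OF Y] x v] smult_one[OF V_vector_space[OF Y x] v] .
 thus ?thesis using that[OF f(1-3)] unfolding f(4) by blast
qed

end

text \<open>Take a hyperplane above \<open>W\<close> and a complementary vector \<open>b\<close>;
  the functional reads off the coefficient of \<open>b\<close>, which is unique because a nonzero
  multiple of \<open>b\<close> never lies in the hyperplane.\<close>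

lemma (in right_vector_space) functional:
 assumes "generates K V B" and W: "subspace_of K V W" "W ~= carrier V"
 obtains l b where "!!v. v \<in> carrier V ==> l v \<in> carrier K"
  "!!v w. [|v \<in> carrier V; w \<in> carrier V|] ==> l (v \<oplus>[V] w) = l v \<oplus>[K] l w"
  "!!v a. [|v \<in> carrier V; a \<in> carrier K|] ==> l (v \<odot>[V] a) = l v \<otimes>[K] a"
  "!!w. w \<in> W ==> l w = \<zero>[K]" "b \<in> carrier V" "l b ~= \<zero>[K]"
proof -
 obtain W' b where W': "subspace_of K V W'" "W \<subseteq> W'" and b: "b \<in> carrier V" "b \<notin> W'"
  and dec: "!!v. v \<in> carrier V ==> \<exists>w \<in> W'. \<exists>a \<in> carrier K. v = w \<oplus>[V] (b \<odot>[V] a)"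
  using hyperplane[OF assms] by metis
 have W'D: "w \<in> carrier V" if "w \<in> W'" for w using W'(1) that unfolding subspace_of_def by blast
 have W'_add: "v \<oplus>[V] w \<in> W'" if "v \<in> W'" "w \<in> W'" for v w using W'(1) that unfolding subspace_of_def by blast
 have W'_mult: "w \<odot>[V] a \<in> W'" if "w \<in> W'" "a \<in> carrier K" for w a using W'(1) that unfolding subspace_of_def by blast
 have uniq: "a = a'" if w: "w \<in> W'" and w': "w' \<in> W'" and a: "a \<in> carrier K" and a': "a' \<in> carrier K"
  and eq: "w \<oplus>[V] (b \<odot>[V] a) = w' \<oplus>[V] (b \<odot>[V] a')" for w w' a a'
 proof (rule ccontr)
  assume ne: "a ~= a'"
  define p where "p = b \<odot>[V] a"
  define p' where "p' = b \<odot>[V] a'"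
  have p: "p \<in> carrier V" "p' \<in> carrier V" unfolding p_def p'_def by (rule rsmult_closed[OF b(1) a], rule rsmult_closed[OF b(1) a'])
  have c: "w \<in> carrier V" "w' \<in> carrier V" "\<ominus>[V] w \<in> carrier V" "\<ominus>[V] p' \<in> carrier V"
   using W'D[OF w] W'D[OF w'] p by simp_all
  define d where "d = a \<oplus>[K] (\<ominus>[K] a')"
  have na: "\<ominus>[K] a' \<in> carrier K" using a' by simp
  have d: "d \<in> carrier K" unfolding d_def by (rule K.a_closed[OF a na])
  have "d ~= \<zero>[K]"
  proof
   assume "d = \<zero>[K]"
   hence "\<ominus>[K] (\<ominus>[K] a') = a" unfolding d_def by (rule K.minus_equality[OF _ na a])
   thus False using K.minus_minus[OF a'] ne by simp
  qed
  then obtain e where e: "e \<in> carrier K" "d \<otimes>[K] e = \<one>[K]" using skew_inverse[OF d] by metis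
  have "\<ominus>[V] w \<oplus>[V] (w \<oplus>[V] p) = p" by (rule V.r_neg1[OF c(1) p(1)])
  hence pe: "p = \<ominus>[V] w \<oplus>[V] (w' \<oplus>[V] p')" using eq unfolding p_def p'_def by simp
  have "b \<odot>[V] d = p \<oplus>[V] \<ominus>[V] p'"
   unfolding d_def rsmult_add_right[OF b(1) a na] rsmult_minus_right[OF b(1) a'] p_def p'_def ..
  also have "... = \<ominus>[V] w \<oplus>[V] ((w' \<oplus>[V] p') \<oplus>[V] \<ominus>[V] p')"
   unfolding pe by (rule V.a_assoc[OF c(3) V.a_closed[OF c(2) p(2)] c(4)])
  also have "(w' \<oplus>[V] p') \<oplus>[V] \<ominus>[V] p' = w'"
   unfolding V.a_assoc[OF c(2) p(2) c(4)] V.r_neg[OF p(2)] by (rule V.r_zero[OF c(2)])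
  finally have "b \<odot>[V] d \<in> W'" using W'_add[OF subspace_neg[OF W'(1) w] w'] by simp
  hence "(b \<odot>[V] d) \<odot>[V] e \<in> W'" by (rule W'_mult[OF _ e(1)])
  thus False unfolding rsmult_assoc[OF b(1) d e(1), symmetric] e(2) rsmult_one[OF b(1)] using b(2) by blast
 qed
 define l where "l v = (SOME a. a \<in> carrier K & (\<exists>w \<in> W'. v = w \<oplus>[V] (b \<odot>[V] a)))" for v
 have l_spec: "l v \<in> carrier K & (\<exists>w \<in> W'. v = w \<oplus>[V] (b \<odot>[V] l v))" if v: "v \<in> carrier V" for v
 proof -
  have "\<exists>a. a \<in> carrier K & (\<exists>w \<in> W'. v = w \<oplus>[V] (b \<odot>[V] a))" using dec[OF v] by blast
  thus ?thesis unfolding l_def by (rule someI_ex)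
 qed
 have l_eq: "l (w \<oplus>[V] (b \<odot>[V] a)) = a" if w: "w \<in> W'" and a: "a \<in> carrier K" for w a
 proof -
  define v where "v = w \<oplus>[V] (b \<odot>[V] a)"
  have "v \<in> carrier V" unfolding v_def by (rule V.a_closed[OF W'D[OF w] rsmult_closed[OF b(1) a]])
  from l_spec[OF this] obtain w' where w': "l v \<in> carrier K" "w' \<in> W'" "v = w' \<oplus>[V] (b \<odot>[V] l v)" by blast
  have "w' \<oplus>[V] (b \<odot>[V] l v) = w \<oplus>[V] (b \<odot>[V] a)" using w'(3) unfolding v_def[symmetric] by (rule sym)
  hence "l v = a" by (rule uniq[OF w'(2) w w'(1) a])
  thus ?thesis unfolding v_def .
 qed
 show ?thesis
 proof (rule that)
  fix v assume v: "v \<in> carrier V"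
  show "l v \<in> carrier K" using l_spec[OF v] by (rule conjunct1)
  obtain w a where w: "w \<in> W'" "a \<in> carrier K" "v = w \<oplus>[V] (b \<odot>[V] a)" using dec[OF v] by blast
  note ba = rsmult_closed[OF b(1) w(2)]
  show "l (v \<oplus>[V] v') = l v \<oplus>[K] l v'" if v': "v' \<in> carrier V" for v'
  proof -
   obtain w' a' where w': "w' \<in> W'" "a' \<in> carrier K" "v' = w' \<oplus>[V] (b \<odot>[V] a')" using dec[OF v'] by blast
   note ba' = rsmult_closed[OF b(1) w'(2)]
   have "v \<oplus>[V] v' = (w \<oplus>[V] w') \<oplus>[V] ((b \<odot>[V] a) \<oplus>[V] (b \<odot>[V] a'))"
    unfolding w(3) w'(3) using W'D[OF w(1)] W'D[OF w'(1)] ba ba'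
    by (simp only: V.a_assoc V.a_lcomm V.a_closed)
   also have "... = (w \<oplus>[V] w') \<oplus>[V] (b \<odot>[V] (a \<oplus>[K] a'))"
    unfolding rsmult_add_right[OF b(1) w(2) w'(2)] ..
   finally have "l (v \<oplus>[V] v') = a \<oplus>[K] a'"
    using l_eq[OF W'_add[OF w(1) w'(1)] K.a_closed[OF w(2) w'(2)]] by simp
   thus ?thesis unfolding w(3) w'(3) l_eq[OF w(1,2)] l_eq[OF w'(1,2)] .
  qed
  show "l (v \<odot>[V] c) = l v \<otimes>[K] c" if c: "c \<in> carrier K" for c
  proof -
   have "v \<odot>[V] c = (w \<odot>[V] c) \<oplus>[V] (b \<odot>[V] (a \<otimes>[K] c))"
    unfolding w(3) rsmult_add_left[OF W'D[OF w(1)] ba c] rsmult_assoc[OF b(1) w(2) c] ..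
   hence "l (v \<odot>[V] c) = a \<otimes>[K] c"
    using l_eq[OF W'_mult[OF w(1) c] K.m_closed[OF w(2) c]] by simp
   thus ?thesis unfolding w(3) l_eq[OF w(1,2)] .
  qed
 next
  fix w assume "w \<in> W"
  hence w: "w \<in> W'" using W'(2) by blast
  have "w \<oplus>[V] (b \<odot>[V] \<zero>[K]) = w" unfolding rsmult_zero_right[OF b(1)] by (rule V.r_zero[OF W'D[OF w]])
  thus "l w = \<zero>[K]" using l_eq[OF w K.zero_closed] by simp
 next
  show "b \<in> carrier V" by (rule b(1))
  have z: "\<zero>[V] \<in> W'" using W'(1) unfolding subspace_of_def by blast
  have "\<zero>[V] \<oplus>[V] (b \<odot>[V] \<one>[K]) = b" unfolding rsmult_one[OF b(1)] by (rule V.l_zero[OF b(1)])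
  hence "l b = \<one>[K]" using l_eq[OF z K.one_closed] by simp
  thus "l b ~= \<zero>[K]" using skew_field_one_not_zero[OF K.skew_field_axioms] by simp
 qed
qed

text \<open>The vector \<open>\<epsilon> y\<close> is the basis of M at y, and \<open>N x\<close>
  models the principal down-set of x. The arrow \<open>m x\<close> is the one sending the generating
  vector of \<open>N x\<close> to \<open>\<epsilon> x\<close>; it sends basis vectors to basis
  vectors, so it is injective on vectors.\<close>

locale rep_equivalence_models = rep_equivalence C P K \<kappa> Fo Fa
 for C :: "('o, 'a, 'm) preadditive_scheme" (structure)
  and P :: "'p gorder" and K :: "'p => 'k ring" and \<kappa> Fo Fa +
 fixes M :: 'o and \<epsilon> :: "'p => nat => 'k" and N :: "'p => 'o" and u :: "'p => 'p => nat => 'k" and m :: "'p => 'a"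
 assumes M_model: "is_model M \<epsilon> (carrier P)"
  and N_model: "x \<in> carrier P ==> is_model (N x) (u x) {y \<in> carrier P. y \<sqsubseteq>\<^bsub>P\<^esub> x}"
  and m: "x \<in> carrier P ==> m x \<in> Ar C & src C (m x) = N x & tgt C (m x) = M & act (m x) x (u x x) = \<epsilon> x"
begin

lemma mA:
 assumes "x \<in> pts"
 shows "arr (m x)" "dom (m x) = N x" "cod (m x) = M" "act (m x) x (u x x) = \<epsilon> x"
 using m[OF assms] by blast+

lemma below_self: "x \<in> pts ==> x \<in> {y \<in> pts. y \<lesssim> x}"
 using D.P_refl by blast

lemma u_closed: "x \<in> pts ==> u x x \<in> E (N x) x"
 by (rule is_modelD(4)[OF N_model below_self])

lemma m_act:
 assumes x: "x \<in> pts" and y: "y \<in> pts" "y \<lesssim> x" and a: "a \<in> carrier (K y)"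
 shows "act (m x) y (u x y \<odot>[(N x),y] a) = \<epsilon> y \<odot>[M,y] a"
proof -
 have yU: "y \<in> {y \<in> pts. y \<lesssim> x}" using y by blast
 note n = is_modelD[OF N_model[OF x]]
 have r: "u x y = rmap (Fo (N x)) y x (u x x)" by (rule n(8)[OF yU below_self[OF x] y(2), symmetric])
 have "act (m x) y (u x y) = rmap (Fo M) y x (\<epsilon> x)"
  unfolding r act_rmap[OF mA(1-3)[OF x] y(1) x y(2) u_closed[OF x]] mA(4)[OF x] ..
 also have "... = \<epsilon> y" by (rule is_modelD(8)[OF M_model y(1) x y(2)])
 finally have "act (m x) y (u x y) = \<epsilon> y" .
 thus ?thesis unfolding act_smult[OF mA(1-3)[OF x] y(1) n(4)[OF yU] a] by simp
qed

lemma m_act_zero: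
 assumes x: "x \<in> pts" and y: "y \<in> pts" and v: "v \<in> E (N x) y"
  and z: "act (m x) y v = \<zero>[M,y]"
 shows "v = \<zero>[(N x),y]"
proof (cases "y \<in> {y \<in> pts. y \<lesssim> x}")
 case True
 note n = is_modelD[OF N_model[OF x]]
 have yx: "y \<lesssim> x" using True by blast
 obtain a where a: "a \<in> carrier (K y)" "v = u x y \<odot>[(N x),y] a" using n(5)[OF True v] by (rule bexE)
 have "\<epsilon> y \<odot>[M,y] a = \<zero>[M,y]" using z unfolding a(2) m_act[OF x y yx a(1)] .
 hence a0: "a = \<zero>\<^bsub>K y\<^esub>" by (rule is_modelD(6)[OF M_model y a(1)])
 show ?thesis unfolding a(2) a0 by (rule smult_zero[OF V_vector_space[OF n(1) y] n(4)[OF True]])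
next
 case False
 thus ?thesis by (rule is_modelD(7)[OF N_model[OF x] y _ v])
qed

lemma m_monic:
 assumes x: "x \<in> pts" shows "monic C (m x)"
proof (rule monicI[OF mA(1)[OF x]])
 fix g assume g: "arr g" "cod g = dom (m x)" and n: "null C (m x ** g)"
 have gt: "cod g = N x" using g(2) mA(2)[OF x] by simp
 have mg: "arr (m x ** g)" "dom (m x ** g) = dom g" "cod (m x ** g) = M"
  using g mA(1-3)[OF x] by simp_all
 show "null C g"
 by (metis null_actI g(1) gt act_cmp mA(1,2) x act_null mg n m_act_zero act_closed)
qed

lemma m_nonzero:
 assumes x: "x \<in> pts" shows "\<epsilon> x ~= \<zero>[M,x]"
proof
 assume z: "\<epsilon> x = \<zero>[M,x]"
 have one: "\<one>\<^bsub>K x\<^esub> \<in> carrier (K x)" by (rule ring.ring_simprules(6)[OF D.ring_K[OF x]])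
 have "\<epsilon> x \<odot>[M,x] \<one>\<^bsub>K x\<^esub> = \<zero>[M,x]"
  unfolding smult_one[OF V_vector_space[OF is_modelD(1)[OF M_model] x] is_modelD(4)[OF M_model x]] by (rule z)
 hence "\<one>\<^bsub>K x\<^esub> = \<zero>\<^bsub>K x\<^esub>" by (rule is_modelD(6)[OF M_model x one])
 thus False using skew_field_one_not_zero[OF D.skew_field_K[OF x]] by blast
qed

text \<open>If x is not below y, the model \<open>N y\<close> has only zero at x, whereas
  \<open>m x\<close> takes the nonzero value \<open>\<epsilon> x\<close> there.\<close>

lemma m_le_iff:
 assumes x: "x \<in> pts" and y: "y \<in> pts"
 shows "m x <~ m y \<longleftrightarrow> x \<lesssim> y"
proof
 assume "m x <~ m y"
 then obtain i where i: "arr i" "dom i = dom (m x)" "cod i = dom (m y)" "m y ** i = m x"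
  by (rule factors_throughE)
 have i2: "dom i = N x" "cod i = N y" using i(2,3) mA(2)[OF x] mA(2)[OF y] by simp_all
 show "x \<lesssim> y"
 proof (rule ccontr)
  assume "~ x \<lesssim> y"
  hence "x \<notin> {z \<in> pts. z \<lesssim> y}" by blast
  hence z: "act i x (u x x) = \<zero>[(N y),x]"
   by (rule is_modelD(7)[OF N_model[OF y] x _ act_closed[OF i(1) i2 x u_closed[OF x]]])
  have "\<epsilon> x = act (m y ** i) x (u x x)" unfolding i(4) mA(4)[OF x] ..
  also have "... = act (m y) x (act i x (u x x))" by (rule act_cmp[OF i(1) i2 mA(1,2)[OF y] x u_closed[OF x]])
  also have "... = \<zero>[M,x]" unfolding z by (rule act_zero[OF mA(1-3)[OF y] x])
  finally show False using m_nonzero[OF x] by blast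
 qed
next
 assume xy: "x \<lesssim> y"
 have xU: "x \<in> {z \<in> pts. z \<lesssim> y}" using x xy by blast
 note n = is_modelD[OF N_model[OF y]]
 obtain i where i: "arr i" "dom i = N x" "cod i = N y" "act i x (u x x) = u y x"
  by (rule model_lift[OF N_model[OF x] x n(1) n(4)[OF xU]])
 have one: "\<one>\<^bsub>K x\<^esub> \<in> carrier (K x)" by (rule ring.ring_simprules(6)[OF D.ring_K[OF x]])
 have "act (m y ** i) x (u x x) = act (m y) x (u y x)"
  unfolding act_cmp[OF i(1-3) mA(1,2)[OF y] x u_closed[OF x]] i(4) ..
 also have "... = \<epsilon> x"
  using m_act[OF y x xy one]
  unfolding smult_one[OF V_vector_space[OF n(1) x] n(4)[OF xU]]
   smult_one[OF V_vector_space[OF is_modelD(1)[OF M_model] x] is_modelD(4)[OF M_model x]] .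
 also have "... = act (m x) x (u x x)" by (rule mA(4)[OF x, symmetric])
 finally have e: "act (m y ** i) x (u x x) = act (m x) x (u x x)" .
 have "m y ** i = m x"
  by (rule model_eqI[OF N_model[OF x] x _ _ _ mA(1-3)[OF x] e]) (use i(1-3) mA(1-3)[OF y] in simp_all)
 thus "m x <~ m y"
  by (intro factors_throughI[of i]) (use i(1-3) mA(2)[OF x] mA(2)[OF y] in simp_all)
qed

lemma epic_act_surj:
 assumes e: "epic C e" and st: "dom e = X" "cod e = Y" and x: "x \<in> pts" and v: "v \<in> E Y x"
 shows "\<exists>w \<in> E X x. act e x w = v"
proof (rule ccontr)
 have eA: "arr e" using e unfolding epic_def by blast
 note E = eA st
 have XY: "X \<in> Ob C" "Y \<in> Ob C" using E by auto
 \<comment> \<open>The poset carries no chain condition of its own; a maximal point of failure is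
   found by maximality among the subobjects \<open>m x\<close> of M.\<close>
 define B where "B = {x \<in> pts. \<exists>v \<in> E Y x. \<forall>w \<in> E X x. act e x w ~= v}"
 assume "~ ?thesis"
 hence "x \<in> B" unfolding B_def using x v by blast
 hence "m ` B ~= {}" by blast
 moreover have "monic C k & cod k = M" if "k \<in> m ` B" for k
  using that m_monic mA(3) unfolding B_def by blast
 ultimately obtain k where k: "k \<in> m ` B" "\<forall>n \<in> m ` B. k <~ n --> n <~ k"
  using maximal_monic[OF is_modelD(1)[OF M_model], of "m ` B"] by metis
 obtain z where z: "z \<in> B" "k = m z" using k(1) by blast
 have zP: "z \<in> pts" using z(1) unfolding B_def by blast
 have above: "\<exists>w \<in> E X y. act e y w = t"
  if y: "y \<in> pts" "z \<lesssim> y" "y ~= z" and t: "t \<in> E Y y" for y t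
 proof (rule ccontr)
  assume "~ ?thesis"
  hence "y \<in> B" unfolding B_def using y(1) t by blast
  hence "k <~ m y --> m y <~ k" using k(2) by blast
  hence "y \<lesssim> z" using m_le_iff[OF zP y(1)] m_le_iff[OF y(1) zP] y(2) unfolding z(2) by blast
  thus False using D.P.le_antisym[OF y(2) _ zP y(1)] y(3) by blast
 qed
 note VX = V_vector_space[OF XY(1) zP] and VY = V_vector_space[OF XY(2) zP]
 define I where "I = act e z ` E X z"
 have AX: "abelian_monoid (V X z)" using VX by (simp add: right_vector_space_def abelian_group_def)
 have sub: "subspace_of (K z) (V Y z) I"
  unfolding subspace_of_def
 proof (intro conjI ballI)
  show "I \<subseteq> E Y z" unfolding I_def using act_closed[OF E zP] by blast
  show "\<zero>[Y,z] \<in> I" unfolding I_def act_zero[OF E zP, symmetric] by (rule imageI[OF V_zero[OF XY(1) zP]])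
  fix p assume "p \<in> I"
  then obtain p' where p: "p' \<in> E X z" "p = act e z p'" unfolding I_def by blast
  show "p \<oplus>[Y,z] q \<in> I" if "q \<in> I" for q
  proof -
   obtain q' where q: "q' \<in> E X z" "q = act e z q'" using \<open>q \<in> I\<close> unfolding I_def by blast
   show ?thesis unfolding p(2) q(2) I_def act_add[OF E zP p(1) q(1), symmetric]
    by (rule imageI[OF abelian_monoid.a_closed[OF AX p(1) q(1)]])
  qed
  show "p \<odot>[Y,z] a \<in> I" if a: "a \<in> carrier (K z)" for a
   unfolding p(2) I_def act_smult[OF E zP p(1) a, symmetric]
   by (rule imageI[OF smult_closed[OF VX p(1) a]])
 qed
 obtain t where t: "t \<in> E Y z" "\<forall>w \<in> E X z. act e z w ~= t"
  using z(1) unfolding B_def by blast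
 have "t \<notin> I" unfolding I_def image_iff using t(2) by metis
 hence ne: "I ~= E Y z" using t(1) by metis
 obtain G where G: "generates (K z) (V Y z) G"
  by (rule right_vector_space.finite_dimensional_generates[OF VY pfd_repD(2)[OF Fo_pfd[OF XY(2)] zP]])
 \<comment> \<open>A functional at z that vanishes on the image of \<open>e\<close> but not
   everywhere becomes the only nonzero component of a map to the one-point model.\<close>
 obtain l b where l: "!!v. v \<in> E Y z ==> l v \<in> carrier (K z)"
  "!!v w. [|v \<in> E Y z; w \<in> E Y z|] ==> l (v \<oplus>[Y,z] w) = l v \<oplus>\<^bsub>K z\<^esub> l w"
  "!!v a. [|v \<in> E Y z; a \<in> carrier (K z)|] ==> l (v \<odot>[Y,z] a) = l v \<otimes>\<^bsub>K z\<^esub> a"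
  "!!w. w \<in> I ==> l w = \<zero>\<^bsub>K z\<^esub>" and b: "b \<in> E Y z" "l b ~= \<zero>\<^bsub>K z\<^esub>"
  by (rule right_vector_space.functional[OF VY G sub ne]) (assumption | rule that)+
 have "\<exists>S s. is_model S s {z}"
 proof (rule model_exists)
  show "{z} \<subseteq> carrier P" using zP by blast
  show "y \<in> {z}" if h: "x \<in> {z}" "x' \<in> {z}" "y \<in> pts" "x \<lesssim> y" "y \<lesssim> x'" for x y x'
   using D.P.le_antisym[of y z] h zP by simp
 qed
 then obtain S s where S: "is_model S s {z}" by blast
 note sD = is_modelD[OF S]
 have sz: "s z \<in> E S z" by (rule sD(4)) simp
 note VS = V_vector_space[OF sD(1) zP]
 define \<theta> where "\<theta> = (\<lambda>y \<in> pts. \<lambda>w \<in> E Y y. if y = z then s z \<odot>[S,z] l w else \<zero>[S,y])"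
 have ev: "\<theta> z w = s z \<odot>[S,z] l w" if "w \<in> E Y z" for w
  unfolding \<theta>_def using that zP by (simp only: restrict_apply' if_True simp_thms)
 have ev0: "\<theta> y w = \<zero>[S,y]" if "y \<in> pts" "y ~= z" "w \<in> E Y y" for y w
  unfolding \<theta>_def using that by (simp only: restrict_apply' if_False)
 have evI: "\<theta> z w = \<zero>[S,z]" if w: "w \<in> E Y z" "w \<in> I" for w
  unfolding ev[OF w(1)] l(4)[OF w(2)] by (rule smult_zero[OF VS sz])
 have "\<theta> \<in> rep_hom P K (Fo Y) (Fo S)"
 proof (rule rep_homI)
  show "\<theta> \<in> extensional (carrier P)" unfolding \<theta>_def by simp
  fix y assume y: "y \<in> pts"
  note VYy = V_vector_space[OF XY(2) y] and VSy = V_vector_space[OF sD(1) y]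
  have AY: "abelian_monoid (V Y y)" using VYy by (simp add: right_vector_space_def abelian_group_def)
  have AS: "abelian_monoid (V S y)" using VSy by (simp add: right_vector_space_def abelian_group_def)
  show "\<theta> y \<in> extensional (E Y y)" unfolding \<theta>_def using y by (simp only: restrict_apply' restrict_extensional)
  fix w assume w: "w \<in> E Y y"
  show "\<theta> y w \<in> E S y"
  proof (cases "y = z")
   case True
   have wz: "w \<in> E Y z" using w unfolding True .
   show ?thesis unfolding True ev[OF wz] by (rule smult_closed[OF VS sz l(1)[OF wz]])
  next
   case False
   show ?thesis unfolding ev0[OF y False w] by (rule V_zero[OF sD(1) y])
  qed
  show "\<theta> y (w \<oplus>[Y,y] w') = \<theta> y w \<oplus>[S,y] \<theta> y w'" if w': "w' \<in> E Y y" for w'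
  proof (cases "y = z")
   case True
   have c: "w \<in> E Y z" "w' \<in> E Y z" "w \<oplus>[Y,z] w' \<in> E Y z"
    using w w' abelian_monoid.a_closed[OF AY w w'] unfolding True by blast+
   show ?thesis unfolding True ev[OF c(1)] ev[OF c(2)] ev[OF c(3)] l(2)[OF c(1,2)]
    by (rule smult_add[OF VS sz l(1)[OF c(1)] l(1)[OF c(2)]])
  next
   case False
   show ?thesis unfolding ev0[OF y False w] ev0[OF y False w'] ev0[OF y False abelian_monoid.a_closed[OF AY w w']]
    by (rule abelian_monoid.l_zero[OF AS V_zero[OF sD(1) y], symmetric])
  qed
  show "\<theta> y (w \<odot>[Y,y] a) = \<theta> y w \<odot>[S,y] a" if a: "a \<in> carrier (K y)" for a
  proof (cases "y = z")
   case True
   have c: "w \<in> E Y z" "w \<odot>[Y,z] a \<in> E Y z" "a \<in> carrier (K z)"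
    using w a smult_closed[OF VYy w a] unfolding True by blast+
   show ?thesis unfolding True ev[OF c(1)] ev[OF c(2)] l(3)[OF c(1,3)]
    by (rule smult_assoc[OF VS sz l(1)[OF c(1)] c(3)])
  next
   case False
   show ?thesis unfolding ev0[OF y False w] ev0[OF y False smult_closed[OF VYy w a]]
    by (rule zero_smult[OF VSy a, symmetric])
  qed
 next
  fix x y w assume xy: "x \<in> pts" "y \<in> pts" "x \<lesssim> y" and w: "w \<in> E Y y"
  have rw: "rmap (Fo Y) x y w \<in> E Y x" by (rule rmap_closed[OF Fo_pfd[OF XY(2)] xy w])
  note R0 = rmap_zero[OF Fo_pfd[OF sD(1)] xy]
  show "\<theta> x (rmap (Fo Y) x y w) = rmap (Fo S) x y (\<theta> y w)"
  proof (cases "x = z")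
   case xz: True
   show ?thesis
   proof (cases "y = z")
    case True
    have wz: "w \<in> E Y z" using w unfolding True .
    have "s z \<odot>[S,z] l w \<in> E S z" by (rule smult_closed[OF VS sz l(1)[OF wz]])
    thus ?thesis
     unfolding xz True pfd_repD(3)[OF Fo_pfd[OF XY(2)] zP wz] ev[OF wz]
     by (rule pfd_repD(3)[OF Fo_pfd[OF sD(1)] zP, symmetric])
   next
    case False
    \<comment> \<open>Maximality of z enters here: a vector at a larger point comes from the domain
      of \<open>e\<close>, so its restriction to z lies in the image, where the functional
      vanishes.\<close>
    obtain w' where w': "w' \<in> E X y" "act e y w' = w" using above[OF xy(2) _ False w] xy(3) unfolding xz by blast
    have "rmap (Fo Y) x y w = act e x (rmap (Fo X) x y w')" unfolding act_rmap[OF E xy w'(1)] w'(2) ..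
    hence "rmap (Fo Y) x y w \<in> I"
     unfolding I_def xz[symmetric] using rmap_closed[OF Fo_pfd[OF XY(1)] xy w'(1)] by blast
    hence "\<theta> x (rmap (Fo Y) x y w) = \<zero>[S,x]" using evI rw unfolding xz by blast
    thus ?thesis unfolding ev0[OF xy(2) False w] R0 .
   qed
  next
   case False
   have "rmap (Fo S) x y (\<theta> y w) = \<zero>[S,x]"
   proof (cases "y = z")
    case True
    have wz: "w \<in> E Y z" using w unfolding True .
    have "\<theta> y w \<in> E S y" unfolding True ev[OF wz] by (rule smult_closed[OF VS sz l(1)[OF wz]])
    hence "rmap (Fo S) x y (\<theta> y w) \<in> E S x" by (rule rmap_closed[OF Fo_pfd[OF sD(1)] xy])
    thus ?thesis by (intro sD(7)[OF xy(1)]) (use False in simp)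
   next
    case False
    show ?thesis unfolding ev0[OF xy(2) False w] by (rule R0)
   qed
   thus ?thesis unfolding ev0[OF xy(1) False rw] by (rule sym)
  qed
 qed
 then obtain h where h: "arr h" "dom h = Y" "cod h = S" "act h = \<theta>" by (rule act_full[OF XY(2) sD(1)])
 have he: "arr (h ** e)" "dom (h ** e) = X" "cod (h ** e) = S" using h(1-3) E by simp_all
 have "null C (h ** e)"
 proof (rule null_actI[OF he])
  fix y w assume y: "y \<in> pts" and w: "w \<in> E X y"
  note c = act_closed[OF E y w]
  have "act (h ** e) y w = \<theta> y (act e y w)" unfolding act_cmp[OF E h(1,2) y w] h(4) ..
  also have "... = \<zero>[S,y]"
  proof (cases "y = z")
   case True
   have "act e z w \<in> I" unfolding I_def using w unfolding True by (rule imageI)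
   thus ?thesis using evI c unfolding True by blast
  next
   case False
   thus ?thesis by (rule ev0[OF y _ c])
  qed
  finally show "act (h ** e) y w = \<zero>[S,y]" .
 qed
 hence "null C h" by (rule epicD[OF e h(1), rotated 1]) (use h(2) st in simp)
 hence "act h z b = \<zero>[S,z]" by (rule act_null[OF h(1-3) _ zP b(1)])
 hence "s z \<odot>[S,z] l b = \<zero>[S,z]" unfolding h(4) ev[OF b(1)] .
 hence "l b = \<zero>\<^bsub>K z\<^esub>" by (intro sD(6)[OF _ l(1)[OF b(1)]]) simp_all
 thus False using b(2) by blast
qed

lemma generators: "poset_generators C M (carrier P) m"
proof
 show "M \<in> Ob C" by (rule is_modelD(1)[OF M_model])
 fix x assume x: "x \<in> pts"
 note n = is_modelD[OF N_model[OF x]] and mx = mA[OF x]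
 show "monic C (m x)" by (rule m_monic[OF x])
 show "cod (m x) = M" by (rule mx(3))
 show "~ null C (m x)"
 by (metis act_null mx(1-3) x u_closed m_nonzero mx(4))
 show "x = y" if "y \<in> pts" "m x <~ m y" "m y <~ m x" for y
  using D.P.le_antisym[OF _ _ x that(1)] m_le_iff[OF x that(1)] m_le_iff[OF that(1) x] that(2,3) by blast
 show "f <~ e" if e: "epic C e" and f: "arr f" "dom f = dom (m x)" "cod f = cod e" for e f
 proof -
  have eA: "arr e" using e unfolding epic_def by blast
  have fN: "dom f = N x" using f(2) mx(2) by simp
  obtain w where w: "w \<in> E (dom e) x" "act e x w = act f x (u x x)"
   using epic_act_surj[OF e refl refl x act_closed[OF f(1) fN f(3) x u_closed[OF x]]] by (rule bexE)
  have "dom e \<in> Ob C" using eA by simp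
  then obtain g where g: "arr g" "dom g = N x" "cod g = dom e" "act g x (u x x) = w"
   using model_lift[OF N_model[OF x] x _ w(1)] by metis
  have "act (e ** g) x (u x x) = act f x (u x x)"
   unfolding act_cmp[OF g(1-3) eA refl x u_closed[OF x]] g(4) by (rule w(2))
  hence "e ** g = f"
   by (rule model_eqI[OF N_model[OF x] x _ _ _ f(1) fN f(3), rotated 3]) (use g(1-3) eA in simp_all)
  thus ?thesis by (intro factors_throughI[of g]) (use g(1-3) fN in simp_all)
 qed
 show "f <~ m x" if f: "arr f" "dom f = dom (m x)" "cod f = M" for f
 proof -
  have fN: "dom f = N x" using f(2) mx(2) by simp
  obtain a where a: "a \<in> carrier (K x)" "act f x (u x x) = \<epsilon> x \<odot>[M,x] a"
   using is_modelD(5)[OF M_model x act_closed[OF f(1) fN f(3) x u_closed[OF x]]] by (rule bexE)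
  have ua: "u x x \<odot>[(N x),x] a \<in> E (N x) x"
   by (rule smult_closed[OF V_vector_space[OF n(1) x] u_closed[OF x] a(1)])
  obtain g where g: "arr g" "dom g = N x" "cod g = N x" "act g x (u x x) = u x x \<odot>[(N x),x] a"
   by (rule model_lift[OF N_model[OF x] x n(1) ua])
  have "act (m x ** g) x (u x x) = act f x (u x x)"
   unfolding act_cmp[OF g(1-3) mx(1,2) x u_closed[OF x]] g(4) m_act[OF x x D.P_refl[OF x] a(1)] a(2) ..
  hence "m x ** g = f"
   by (rule model_eqI[OF N_model[OF x] x _ _ _ f(1) fN f(3), rotated 3]) (use g(1-3) mx(1-3) in simp_all)
  thus ?thesis by (intro factors_throughI[of g]) (use g(1-3) fN mx(2) in simp_all)
 qed
 show "iso_arrow C \<alpha>" if al: "arr \<alpha>" "dom \<alpha> = dom (m x)" "cod \<alpha> = dom (m x)" "~ null C \<alpha>" for \<alpha>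
 proof -
  have aN: "dom \<alpha> = N x" "cod \<alpha> = N x" using al(2,3) mx(2) by simp_all
  note VN = V_vector_space[OF n(1) x] and ux = u_closed[OF x]
  have lift: "\<exists>g. g \<in> Ar C & dom g = N x & cod g = N x & act g x (u x x) = u x x \<odot>[(N x),x] a"
   if a: "a \<in> carrier (K x)" for a
   using model_lift[OF N_model[OF x] x n(1) smult_closed[OF VN ux a]] by metis
  have coef: "\<exists>a \<in> carrier (K x). act g x (u x x) = u x x \<odot>[(N x),x] a"
   if g: "arr g" "dom g = N x" "cod g = N x" for g
   by (rule n(5)[OF below_self[OF x] act_closed[OF g x ux]])
  \<comment> \<open>Endomorphisms of \<open>N x\<close> are determined by the scalar multiplying the
    generating vector, and composition multiplies these scalars in the same order.\<close>
  have inv: "g ** h = ident C (N x)"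
   if g: "arr g" "dom g = N x" "cod g = N x" "act g x (u x x) = u x x \<odot>[(N x),x] a"
    and h: "arr h" "dom h = N x" "cod h = N x" "act h x (u x x) = u x x \<odot>[(N x),x] b"
    and ab: "a \<in> carrier (K x)" "b \<in> carrier (K x)" "a \<otimes>\<^bsub>K x\<^esub> b = \<one>\<^bsub>K x\<^esub>" for g h a b
  proof -
   have "act (g ** h) x (u x x) = act g x (u x x) \<odot>[(N x),x] b"
    unfolding act_cmp[OF h(1-3) g(1,2) x ux] h(4) by (rule act_smult[OF g(1-3) x ux ab(2)])
   also have "... = u x x"
    unfolding g(4) smult_assoc[OF VN ux ab(1,2), symmetric] ab(3)
    by (rule smult_one[OF VN ux])
   also have "... = act (ident C (N x)) x (u x x)" by (rule act_ident[OF n(1) x ux, symmetric])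
   finally have e: "act (g ** h) x (u x x) = act (ident C (N x)) x (u x x)" .
   show ?thesis
    by (rule model_eqI[OF N_model[OF x] x _ _ _ _ _ _ e]) (use g(1-3) h(1-3) n(1) in simp_all)
  qed
  obtain a where a: "a \<in> carrier (K x)" "act \<alpha> x (u x x) = u x x \<odot>[(N x),x] a"
   using coef[OF al(1) aN] by (rule bexE)
  have "a ~= \<zero>\<^bsub>K x\<^esub>"
  proof
   assume a0: "a = \<zero>\<^bsub>K x\<^esub>"
   define o' where "o' = hzero C (N x) (N x)"
   have o': "arr o'" "dom o' = N x" "cod o' = N x" "null C o'" unfolding o'_def using n(1) by (simp_all add: null_def)
   have "act \<alpha> x (u x x) = \<zero>[(N x),x]"
    unfolding a(2) a0 by (rule smult_zero[OF VN ux])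
   also have "... = act o' x (u x x)" by (rule act_null[OF o' x ux, symmetric])
   finally have "\<alpha> = o'" by (rule model_eqI[OF N_model[OF x] x al(1) aN o'(1-3)])
   thus False using al(4) o'(4) by simp
  qed
  then obtain b where b: "b \<in> carrier (K x)" "a \<otimes>\<^bsub>K x\<^esub> b = \<one>\<^bsub>K x\<^esub>" "b \<otimes>\<^bsub>K x\<^esub> a = \<one>\<^bsub>K x\<^esub>"
   by (rule skew_field_inverse[OF D.skew_field_K[OF x] a(1)])
  obtain \<beta> where be: "arr \<beta>" "dom \<beta> = N x" "cod \<beta> = N x" "act \<beta> x (u x x) = u x x \<odot>[(N x),x] b"
   using lift[OF b(1)] by blast
  have 1: "\<alpha> ** \<beta> = ident C (N x)" by (rule inv[OF al(1) aN a(2) be a(1) b(1,2)])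
  have 2: "\<beta> ** \<alpha> = ident C (N x)" by (rule inv[OF be al(1) aN a(2) b(1) a(1) b(3)])
  show ?thesis unfolding iso_arrow_def aN using al(1) be(1-3) 1 2 by (auto simp: Hom_def)
 qed
next
 fix g assume g: "arr g" and nn: "~ null C g"
 have "\<exists>x \<in> pts. \<exists>v \<in> E (dom g) x. act g x v ~= \<zero>[(cod g),x]"
  using null_actI[OF g refl refl] nn by metis
 then obtain x v where x: "x \<in> pts" and v: "v \<in> E (dom g) x" "act g x v ~= \<zero>[(cod g),x]" by blast
 have "dom g \<in> Ob C" using g by simp
 then obtain f where f: "arr f" "dom f = N x" "cod f = dom g" "act f x (u x x) = v"
  using model_lift[OF N_model[OF x] x _ v(1)] by metis
 have gf: "arr (g ** f)" "dom (g ** f) = N x" "cod (g ** f) = cod g" using f(1-3) g by simp_all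
 have "~ null C (g ** f)"
 by (metis act_null gf x u_closed v(2) act_cmp f(1-3) g f(4))
 thus "\<exists>x \<in> pts. \<exists>f \<in> Ar C. dom f = dom (m x) & cod f = dom g & ~ null C (g ** f)"
  using x f(1-3) mA(2)[OF x] by (intro bexI[of _ x] bexI[of _ f]) simp_all
qed

end

lemma (in rep_equivalence) conditions: "\<exists>M \<in> Ob C. cond_M1 C & cond_M2 C M & cond_M3 C M"
proof -
 have "\<exists>X w. is_model X w (carrier P)" by (rule model_exists) blast+
 then obtain M \<epsilon> where M: "is_model M \<epsilon> (carrier P)" by blast
 have "\<exists>X w. is_model X w {y \<in> pts. y \<lesssim> x}" if x: "x \<in> pts" for x
 proof (rule model_exists)
  show "y \<in> {y \<in> pts. y \<lesssim> x}"
   if h: "x' \<in> {y \<in> pts. y \<lesssim> x}" "z \<in> {y \<in> pts. y \<lesssim> x}" "y \<in> pts" "x' \<lesssim> y" "y \<lesssim> z" for x' y z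
   using D.P.le_trans[OF h(5) _ h(3) _ x] h(2,3) by blast
 qed blast
 then obtain N u where N: "!!x. x \<in> pts ==> is_model (N x) (u x) {y \<in> pts. y \<lesssim> x}" by metis
 have "\<exists>f. f \<in> Ar C & dom f = N x & cod f = M & act f x (u x x) = \<epsilon> x" if x: "x \<in> pts" for x
  using model_lift[OF N[OF x] x is_modelD(1)[OF M] is_modelD(4)[OF M x]] by metis
 then obtain m where m: "!!x. x \<in> pts ==>
   m x \<in> Ar C & dom (m x) = N x & cod (m x) = M & act (m x) x (u x x) = \<epsilon> x" by metis
 have "rep_equivalence_models C P K \<kappa> Fo Fa M \<epsilon> N u m" by unfold_locales (rule M, rule N, assumption, rule m, assumption)
 hence g: "poset_generators C M (carrier P) m" by (rule rep_equivalence_models.generators)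
 show ?thesis
  using poset_generators.M1[OF g] poset_generators.M2[OF g] poset_generators.M3[OF g] is_modelD(1)[OF M] by blast
qed

lemma conditions_of_equivalence:
 assumes "length_category C" and "division_ring_family P K \<kappa>" and "equivalent_categories C (pfd_Rep P K \<kappa>)"
 shows "\<exists>M \<in> Ob C. cond_M1 C & cond_M2 C M & cond_M3 C M"
proof -
 obtain Fo Fa where F: "cat_functor C (pfd_Rep P K \<kappa>) Fo Fa"
  "!!X Y f g. [|f \<in> Hom C X Y; g \<in> Hom C X Y; Fa f = Fa g|] ==> f = g"
  "!!X Y g. [|X \<in> Ob C; Y \<in> Ob C; g \<in> Hom (pfd_Rep P K \<kappa>) (Fo X) (Fo Y)|] ==> \<exists>f \<in> Hom C X Y. Fa f = g"
  "!!Y. Y \<in> Ob (pfd_Rep P K \<kappa>) ==> \<exists>X \<in> Ob C. \<exists>e \<in> Hom (pfd_Rep P K \<kappa>) (Fo X) Y. iso_arrow (pfd_Rep P K \<kappa>) e"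
  by (rule equivalent_categoriesE[OF assms(3)]) (assumption | rule that)+
 have "rep_equivalence C P K \<kappa> Fo Fa"
  by (intro rep_equivalence.intro rep_equivalence_axioms.intro assms(1,2) F)
 thus ?thesis by (rule rep_equivalence.conditions)
qed

lemma equivalence_of_conditions:
 assumes "length_category C" "M \<in> Ob C" "cond_M1 C" "cond_M2 C M" "cond_M3 C M" "enumerates_ji C M \<Omega> m"
 shows "poset_generators C M \<Omega> m"
proof -
 have "M_conditions C M" by (intro M_conditions.intro M_conditions_axioms.intro assms(1-5))
 thus ?thesis using assms(6) by (rule M_conditions.poset_generators)
qed

text \<open>Types cannot be quantified existentially, so the first clause names those that the
  construction produces: join-irreducible subobjects are sets of arrows and the division rings
  consist of arrows. The second clause, with arbitrary types for points and scalars, shows that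
  nothing is lost by this choice.\<close>

theorem corollary1p3:
  fixes A :: "('o, 'a) preadditive"
  assumes "length_category A"
  shows
    "((\<exists>(P :: 'a set gorder) (K :: 'a set \<Rightarrow> 'a ring) \<kappa>.
         division_ring_family P K \<kappa> \<and> equivalent_categories A (pfd_Rep P K \<kappa>)) \<longleftrightarrow>
      (\<exists>M \<in> Ob A. cond_M1 A \<and> cond_M2 A M \<and> cond_M3 A M)) \<and>
     (\<forall>(P :: 'p gorder) (K :: 'p \<Rightarrow> 'k ring) \<kappa>.
         division_ring_family P K \<kappa> \<and> equivalent_categories A (pfd_Rep P K \<kappa>) \<longrightarrow>
         (\<exists>M \<in> Ob A. cond_M1 A \<and> cond_M2 A M \<and> cond_M3 A M)) \<and>
     (\<forall>M \<in> Ob A. \<forall>(\<Omega> :: 'x set) m.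
         cond_M1 A \<and> cond_M2 A M \<and> cond_M3 A M \<and> enumerates_ji A M \<Omega> m \<longrightarrow>
         division_ring_family (ji_poset A M \<Omega> m) (ji_ring A m) (ji_kappa A m) \<and>
         (\<forall>x \<in> \<Omega>. \<forall>y \<in> \<Omega>. x \<sqsubseteq>\<^bsub>ji_poset A M \<Omega> m\<^esub> y \<longrightarrow>
            ji_incl A m x y \<in> Hom A (src A (m x)) (src A (m y)) \<and>
            m y \<bullet>\<^bsub>A\<^esub> ji_incl A m x y = m x \<and>
            (\<forall>\<alpha> \<in> carrier (ji_ring A m y).
               \<exists>!\<beta>. \<beta> \<in> carrier (ji_ring A m x) \<and>
                 ji_incl A m x y \<bullet>\<^bsub>A\<^esub> \<beta> = \<alpha> \<bullet>\<^bsub>A\<^esub> ji_incl A m x y)) \<and>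
         equivalent_categories A (pfd_Rep (ji_poset A M \<Omega> m) (ji_ring A m) (ji_kappa A m)))"
proof (intro conjI allI ballI impI iffI)
 assume "\<exists>(P :: 'a set gorder) (K :: 'a set => 'a ring) \<kappa>.
  division_ring_family P K \<kappa> & equivalent_categories A (pfd_Rep P K \<kappa>)"
 thus "\<exists>M \<in> Ob A. cond_M1 A & cond_M2 A M & cond_M3 A M"
  using conditions_of_equivalence[OF assms] by (elim exE conjE)
next
 assume "\<exists>M \<in> Ob A. cond_M1 A & cond_M2 A M & cond_M3 A M"
 then obtain M where M: "M \<in> Ob A" "cond_M1 A" "cond_M2 A M" "cond_M3 A M" by blast
 define \<Omega> where "\<Omega> = {N. join_irreducible (Sub A M) N}"
 \<comment> \<open>The join-irreducible subobjects serve as their own indices, each with a chosen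
   representing monomorphism.\<close>
 define m where "m N = (SOME n. monic A n & tgt A n = M & subobject A n = N)" for N
 have m: "monic A (m N) & tgt A (m N) = M & subobject A (m N) = N" if "N \<in> \<Omega>" for N
 proof -
  have "N \<in> carrier (Sub A M)" using that unfolding \<Omega>_def join_irreducible_def by blast
  hence "\<exists>n. monic A n & tgt A n = M & subobject A n = N" unfolding Sub_def by auto
  thus ?thesis unfolding m_def by (rule someI_ex)
 qed
 have "bij_betw (\<lambda>x. subobject A (m x)) \<Omega> {N. join_irreducible (Sub A M) N}"
  unfolding \<Omega>_def[symmetric] by (rule bij_betw_cong[THEN iffD1, OF _ bij_betw_id]) (simp add: m)
 hence "enumerates_ji A M \<Omega> m" unfolding enumerates_ji_def using m by blast
 hence g: "poset_generators A M \<Omega> m" by (rule equivalence_of_conditions[OF assms M])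
 show "\<exists>(P :: 'a set gorder) (K :: 'a set => 'a ring) \<kappa>.
   division_ring_family P K \<kappa> & equivalent_categories A (pfd_Rep P K \<kappa>)"
  by (intro exI conjI) (rule poset_generators.division_ring_family[OF g], rule poset_generators.F_equivalence[OF g])
next
 fix P :: "'p gorder" and K :: "'p => 'k ring" and \<kappa>
 assume "division_ring_family P K \<kappa> & equivalent_categories A (pfd_Rep P K \<kappa>)"
 thus "\<exists>M \<in> Ob A. cond_M1 A & cond_M2 A M & cond_M3 A M"
  using conditions_of_equivalence[OF assms] by (elim conjE)
next
 fix M and \<Omega> :: "'x set" and m
 assume "M \<in> Ob A" and "cond_M1 A & cond_M2 A M & cond_M3 A M & enumerates_ji A M \<Omega> m"
 hence g: "poset_generators A M \<Omega> m" by (elim conjE) (rule equivalence_of_conditions[OF assms])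
 show "division_ring_family (ji_poset A M \<Omega> m) (ji_ring A m) (ji_kappa A m)"
  by (rule poset_generators.division_ring_family[OF g])
 show "equivalent_categories A (pfd_Rep (ji_poset A M \<Omega> m) (ji_ring A m) (ji_kappa A m))"
  by (rule poset_generators.F_equivalence[OF g])
 fix x y assume x: "x \<in> \<Omega>" and y: "y \<in> \<Omega>" and "x \<sqsubseteq>\<^bsub>ji_poset A M \<Omega> m\<^esub> y"
 hence xy: "factors_through A (m x) (m y)" using poset_generators.le_P[OF g x y] by simp
 note i = poset_generators.incl[OF g x y xy]
 show "ji_incl A m x y \<in> Hom A (src A (m x)) (src A (m y))" using i(1-3) by (simp add: Hom_def)
 show "m y \<bullet>\<^bsub>A\<^esub> ji_incl A m x y = m x" by (rule i(4))
 show "\<exists>!\<beta>. \<beta> \<in> carrier (ji_ring A m x) & ji_incl A m x y \<bullet>\<^bsub>A\<^esub> \<beta> = \<alpha> \<bullet>\<^bsub>A\<^esub> ji_incl A m x y"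
  if "\<alpha> \<in> carrier (ji_ring A m y)" for \<alpha>
  by (rule poset_generators.kappa_ex1[OF g x y xy that])
qed

end
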